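(* Let $(R,\Delta)$ be a Hermitian form ring with $R$ commutative, let $(I,\Omega)$ be an odd form ideal of $(R,\Delta)$ and let $H$ be a subgroup of $\mathrm{U}_{7}(R,\Delta)$ normalised by $\mathrm{EU}_{7}(I,\Omega)$. Then \[\mathrm{EU}_{7}(U(H)\ast I^{12})\leq H\leq \mathrm{CU}_{7}((R,\Delta),U(H)).\]
   Context: Form rings. Rings are associative with $1\neq 0$; $R$ is a commutative ring. A Hermitian ring $(R,\bar{\ },\lambda,\mu)$ consists of $R$, a bijection $x\mapsto\bar x$ of $R$ with $\overline{x+y}=\bar x+\bar y$, $\overline{xy}=\bar y\bar x$, $\bar 1=1$, an element $\lambda\in R$ with $\bar{\bar x}=\lambda x\bar\lambda$ for all $x\in R$ (it follows that $\bar\lambda=\lambda^{-1}$), and an element $\mu\in R$ with $\mu=\bar\mu\lambda$. A subset $A\subseteq R$ is involution invariant if $\bar x\in A$ for all $x\in A$. The Heisenberg group $\mathfrak{H}$ is $R\times R$ with group operation $(x_1,y_1)\dotplus(x_2,y_2)=(x_1+x_2,\,y_1+y_2-\bar x_1\mu x_2)$; the inverse of $\alpha$ is written $\dot{-}\alpha$, and $\alpha\,\dot{-}\,\beta:=\alpha\dotplus(\dot{-}\beta)$. For $a\in R$ put $(x,y)\circ a=(xa,\bar a y a)$; $\circ$ has higher priority than $\dotplus$ and $\dot{-}$. An $R^{\bullet}$-submodule of $\mathfrak{H}$ is a subgroup stable under all maps $\alpha\mapsto\alpha\circ a$ ($a\in R$). For $A\subseteq\mathfrak{H}$, $B\subseteq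 R$, $A\circ B$ is the subgroup of $\mathfrak{H}$ generated by all $\alpha\circ b$ ($\alpha\in A$, $b\in B$); for $A,B\subseteq \mathfrak{H}$, $A\dotplus B=\{\alpha\dotplus\beta\mid\alpha\in A,\beta\in B\}$. For a subgroup $\Omega$ of $\mathfrak{H}$, $\alpha\equiv\beta\bmod\Omega$ means $\alpha\,\dot{-}\,\beta\in\Omega$. Let $\Delta_{\min}=\{(0,x-\bar x\lambda)\mid x\in R\}$ and $\Delta_{\max}=\{(x,y)\mid \bar x\mu x+y+\bar y\lambda=0\}$. An odd form parameter is an $R^\bullet$-submodule $\Delta$ of $\mathfrak{H}$ with $\Delta_{\min}\subseteq\Delta\subseteq\Delta_{\max}$; then $(R,\Delta)$ (short for $((R,\bar{\ },\lambda,\mu),\Delta)$) is called a Hermitian form ring. Put $J(\Delta)=\{y\in R\mid\exists z\in R:(y,z)\in\Delta\}$. For an involution invariant ideal $I$ of $R$ put $\tilde I=\{x\in R\mid\overline{J(\Delta)}\mu x\subseteq I\}$, $\Omega^I_{\min}=\{(0,x-\bar x\lambda)\mid x\in I\}\dotplus\Delta\circ I$ and $\Omega^I_{\max}=\Delta\cap(\tilde I\times I)$. An odd form ideal of $(R,\Delta)$ is a pair $(I,\Omega)$ where $I$ is an involution invariant ideal and $\Omega$ is an $R^\bullet$-submodule of $\mathfrak{H}$ with $\Omega^I_{\min}\subseteq\Omega\subseteq\Omega^I_{\max}$. Put $\Delta^{1}=\Delta$, $\Delta^{-1}=\{(x,y)\mid(x,\bar y)\in\Delta\}$, $\Omega^1=\Omega$,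 $\Omega^{-1}=\{(x,y)\mid(x,\bar y)\in\Omega\}$. Product. For an odd form ideal $(J,\Sigma)$ and an involution invariant ideal $K$, $(J,\Sigma)\ast K$ is the odd form ideal $(JK,\Omega^{JK}_{\min}\dotplus\Sigma\circ K)$. Groups (for $n\in\mathbb{N}$; here $n=3$). Let $\Theta_+=\{1,\dots,n\}$, $\Theta_-=\{-n,\dots,-1\}$, $\Theta=\Theta_+\cup\{0\}\cup\Theta_-$, $\Theta_{\mathrm{hb}}=\Theta\setminus\{0\}$, $\epsilon(i)=1$ for $i\in\Theta_+$ and $\epsilon(i)=-1$ for $i\in\Theta_-$. Coordinates of $M=R^{2n+1}$ (columns) and rows/columns of $(2n+1)\times(2n+1)$ matrices are indexed by $\Theta$ in the order $1,\dots,n,0,-n,\dots,-1$. $\sigma_{ij}$ is the $(i,j)$ entry and $\sigma_{*j}$ the $j$-th column of $\sigma$; $\sigma_{\mathrm{hb}}=(\sigma_{ij})_{i,j\in\Theta_{\mathrm{hb}}}$; $e$ is the identity matrix, $e^{ij}$ a matrix unit. For $u,v\in M$ let $B(u,v)=\sum_{i=1}^n\bar u_iv_{-i}+\bar u_0\mu v_0+\sum_{i=-n}^{-1}\bar u_i\lambda v_{-i}$ and $Q(u)=(u_0,\sum_{i=1}^n\bar u_iu_{-i})\in\mathfrak{H}$. $\mathrm{U}_{2n+1}(R,\Delta)$ is the group of $\sigma\in\mathrm{GL}_{2n+1}(R)$ with $B(\sigma u,\sigma v)=B(u,v)$ and $Q(\sigma u)\equiv Q(u)\bmod\Delta$ for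 all $u,v\in M$. Elementary subgroups. For $i,j\in\Theta_{\mathrm{hb}}$, $i\neq\pm j$, $x\in R$: $T_{ij}(x)=e+xe^{ij}-\lambda^{(\epsilon(j)-1)/2}\bar x\lambda^{(1-\epsilon(i))/2}e^{-j,-i}$. For $i\in\Theta_{\mathrm{hb}}$, $(x,y)\in\Delta^{-\epsilon(i)}$: $T_i(x,y)=e+xe^{0,-i}-\lambda^{-(1+\epsilon(i))/2}\bar x\mu e^{i0}+ye^{i,-i}$. $\mathrm{EU}_{2n+1}(R,\Delta)$ is the subgroup of $\mathrm{U}_{2n+1}(R,\Delta)$ generated by all these elements. For an odd form ideal $(I,\Omega)$, $\mathrm{EU}_{2n+1}(I,\Omega)$ is the subgroup generated by all $T_{ij}(x)$ with $x\in I$ and all $T_i(x,y)$ with $(x,y)\in\Omega^{-\epsilon(i)}$. Congruence subgroups. Let $M(R,\Delta)=\{u\in M\mid u_0\in J(\Delta)\}$. $\mathrm{U}_{2n+1}((R,\Delta),(I,\Omega))$ is the group of $\sigma\in\mathrm{U}_{2n+1}(R,\Delta)$ with $\sigma_{\mathrm{hb}}\equiv e_{\mathrm{hb}}\bmod I$ and $Q(\sigma u)\equiv Q(u)\bmod\Omega$ for all $u\in M(R,\Delta)$. $\mathrm{NU}_{2n+1}((R,\Delta),(I,\Omega))$ is its normaliser in $\mathrm{U}_{2n+1}(R,\Delta)$, and $\mathrm{CU}_{2n+1}((R,\Delta),(I,\Omega))=\{\sigma\in\mathrm{NU}_{2n+1}((R,\Delta),(I,\Omega))\mid[\sigma,\mathrm{EU}_{2n+1}(R,\Delta)]\leq\mathrm{U}_{2n+1}((R,\Delta),(I,\Omega))\}$,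 where $[g,h]=ghg^{-1}h^{-1}$. Upper level. For a subgroup $H\leq\mathrm{U}_{2n+1}(R,\Delta)$, the upper level $U(H)$ is the odd form ideal $(J,\Sigma)$ where $J$ is the ideal generated by $Y\cup\bar Y$, $Y$ being the set of all elements $\sigma_{ij}$, $\sigma_{ii}-\sigma_{jj}$ and all elements of the sets $\sigma_{i0}J(\Delta)$, $\overline{J(\Delta)}\mu\sigma_{0j}$, $\overline{J(\Delta)}\mu(\sigma_{00}-\sigma_{jj})J(\Delta)$ with $\sigma\in H$, $i\neq j\in\Theta_{\mathrm{hb}}$; and $\Sigma=\Omega^J_{\min}\dotplus Z\circ R$, where $Z$ is the set of all $Q(\sigma_{*j})$ and $(Q(\sigma_{*0})\,\dot{-}\,(1,0))\circ y\dotplus(y,z)\,\dot{-}\,(y,z)\circ\sigma_{ii}$ with $\sigma\in H$, $i,j\in\Theta_{\mathrm{hb}}$, $(y,z)\in\Delta$. *)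

theory Defs
  imports
    "HOL-Analysis.Analysis"
    "HOL-Library.Numeral_Type"
    "HOL-Algebra.Generated_Groups"
    "HOL-Algebra.Group_Action"
begin

section \<open>Ideals of a commutative ring\<close>

text \<open>
  The ring is a type of class \<^class>\<open>comm_ring_1\<close>. Regarded as a module over itself, its
  submodules are its ideals, and the span of a set is the ideal generated by that set. The
  locale \<^locale>\<open>module\<close> is deliberately not interpreted globally: its simp rule \<open>scale_scale\<close>
  would loop with \<open>mult.assoc\<close>.
\<close>

lemma module_self: "module ((*) :: 'a::comm_ring_1 \<Rightarrow> 'a \<Rightarrow> 'a)"
  by standard (simp_all add: algebra_simps)

abbreviation is_ideal :: "'a::comm_ring_1 set \<Rightarrow> bool" where
  "is_ideal \<equiv> module.subspace (*)"

abbreviation ideal_generated :: "'a::comm_ring_1 set \<Rightarrow> 'a set" where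
  "ideal_generated \<equiv> module.span (*)"

definition ideal_prod :: "'a::comm_ring_1 set \<Rightarrow> 'a set \<Rightarrow> 'a set" where
  "ideal_prod I J = ideal_generated {a * b | a b. a \<in> I \<and> b \<in> J}"

primrec ideal_pow :: "'a::comm_ring_1 set \<Rightarrow> nat \<Rightarrow> 'a set" where
  "ideal_pow I 0 = UNIV"
| "ideal_pow I (Suc k) = ideal_prod I (ideal_pow I k)"


section \<open>Hermitian form rings\<close>

text \<open>
  A record of this type carries the data of a Hermitian form ring on the type \<^typ>\<open>'a\<close>: the
  map \<open>x \<mapsto> bar x\<close>, the elements \<open>lam\<close> and \<open>mu\<close>, and the odd form parameter \<open>Delta\<close>.
\<close>

record 'a form_ring =
  bar :: "'a \<Rightarrow> 'a"
  lam :: 'a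
  mu :: 'a
  Delta :: "('a \<times> 'a) set"

locale hermitian_ring =
  fixes F :: "'a::comm_ring_1 form_ring"
  assumes bij_bar: "bij (bar F)"
    and bar_add: "bar F (x + y) = bar F x + bar F y"
    and bar_mult: "bar F (x * y) = bar F y * bar F x"
    and bar_one: "bar F 1 = 1"
    and bar_bar: "bar F (bar F x) = lam F * x * bar F (lam F)"
    and mu_eq: "mu F = bar F (mu F) * lam F"
begin

lemma lam_mult_bar_lam: "lam F * bar F (lam F) = 1"
  using bar_bar[of 1] by (simp add: bar_one)

lemma bar_zero: "bar F 0 = 0"
  using bar_add[of 0 0] by simp

lemma bar_uminus: "bar F (- x) = - bar F x"
  by (rule minus_unique [symmetric]) (simp add: bar_add [symmetric] bar_zero)

end

text \<open>
  Integer powers of \<open>lam\<close>; the inverse of \<open>lam\<close> is \<open>bar lam\<close> by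
  \<open>hermitian_ring.lam_mult_bar_lam\<close>.
\<close>

definition lam_pow :: "'a::comm_ring_1 form_ring \<Rightarrow> int \<Rightarrow> 'a" where
  "lam_pow F k = (if k \<ge> 0 then lam F ^ nat k else bar F (lam F) ^ nat (- k))"

definition involution_invariant :: "'a form_ring \<Rightarrow> 'a set \<Rightarrow> bool" where
  "involution_invariant F A \<longleftrightarrow> (\<forall>x\<in>A. bar F x \<in> A)"

text \<open>
  The Heisenberg group, as a multiplicatively written group of \<^theory>\<open>HOL-Algebra.Group\<close>.
  Thus for \<open>G = heis F\<close> the sum and the difference of \<open>\<alpha>\<close> and \<open>\<beta>\<close> are \<open>\<alpha> \<otimes>\<^bsub>G\<^esub> \<beta>\<close>
  and \<open>\<alpha> \<otimes>\<^bsub>G\<^esub> inv\<^bsub>G\<^esub> \<beta>\<close>, and the elementwise sum of subsets is \<open>A <#>\<^bsub>G\<^esub> B\<close>.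
\<close>

definition heis :: "'a::comm_ring_1 form_ring \<Rightarrow> ('a \<times> 'a) monoid" where
  "heis F = \<lparr>carrier = UNIV,
     mult = (\<lambda>(x1, y1) (x2, y2). (x1 + x2, y1 + y2 - bar F x1 * mu F * x2)),
     one = (0, 0)\<rparr>"

lemma (in hermitian_ring) group_heis: "Group.group (heis F)"
proof (rule groupI)
  fix \<alpha> assume "\<alpha> \<in> carrier (heis F)"
  obtain x y where \<alpha>: "\<alpha> = (x, y)" by (cases \<alpha>)
  have "(- x, - y - bar F x * mu F * x) \<otimes>\<^bsub>heis F\<^esub> \<alpha> = \<one>\<^bsub>heis F\<^esub>"
    by (simp add: heis_def \<alpha> bar_uminus)
  then show "\<exists>\<beta>\<in>carrier (heis F). \<beta> \<otimes>\<^bsub>heis F\<^esub> \<alpha> = \<one>\<^bsub>heis F\<^esub>"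
    by (rule bexI) (simp add: heis_def)
next
  fix \<alpha> \<beta> \<gamma>
  show "\<alpha> \<otimes>\<^bsub>heis F\<^esub> \<beta> \<otimes>\<^bsub>heis F\<^esub> \<gamma> = \<alpha> \<otimes>\<^bsub>heis F\<^esub> (\<beta> \<otimes>\<^bsub>heis F\<^esub> \<gamma>)"
    by (cases \<alpha>; cases \<beta>; cases \<gamma>) (simp add: heis_def bar_add algebra_simps)
qed (simp_all add: heis_def bar_zero split: prod.split)

definition heis_act :: "'a::comm_ring_1 form_ring \<Rightarrow> 'a \<times> 'a \<Rightarrow> 'a \<Rightarrow> 'a \<times> 'a" where
  "heis_act F \<alpha> a = (fst \<alpha> * a, bar F a * snd \<alpha> * a)"

definition heis_submodule :: "'a::comm_ring_1 form_ring \<Rightarrow> ('a \<times> 'a) set \<Rightarrow> bool" where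
  "heis_submodule F \<Omega> \<longleftrightarrow> subgroup \<Omega> (heis F) \<and> (\<forall>\<alpha>\<in>\<Omega>. \<forall>a. heis_act F \<alpha> a \<in> \<Omega>)"

definition heis_circ ::
  "'a::comm_ring_1 form_ring \<Rightarrow> ('a \<times> 'a) set \<Rightarrow> 'a set \<Rightarrow> ('a \<times> 'a) set" where
  "heis_circ F A B = generate (heis F) {heis_act F \<alpha> b | \<alpha> b. \<alpha> \<in> A \<and> b \<in> B}"

definition heis_cong ::
  "'a::comm_ring_1 form_ring \<Rightarrow> ('a \<times> 'a) set \<Rightarrow> 'a \<times> 'a \<Rightarrow> 'a \<times> 'a \<Rightarrow> bool" where
  "heis_cong F \<Omega> \<alpha> \<beta> \<longleftrightarrow> \<alpha> \<otimes>\<^bsub>heis F\<^esub> inv\<^bsub>heis F\<^esub> \<beta> \<in> \<Omega>"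

definition Delta_min :: "'a::comm_ring_1 form_ring \<Rightarrow> ('a \<times> 'a) set" where
  "Delta_min F = {(0, x - bar F x * lam F) | x. True}"

definition Delta_max :: "'a::comm_ring_1 form_ring \<Rightarrow> ('a \<times> 'a) set" where
  "Delta_max F = {(x, y). bar F x * mu F * x + y + bar F y * lam F = 0}"

locale hermitian_form_ring = hermitian_ring +
  assumes Delta_submodule: "heis_submodule F (Delta F)"
    and Delta_min_subset: "Delta_min F \<subseteq> Delta F"
    and Delta_subset_max: "Delta F \<subseteq> Delta_max F"

definition J_Delta :: "'a form_ring \<Rightarrow> 'a set" where
  "J_Delta F = {y. \<exists>z. (y, z) \<in> Delta F}"

definition ideal_tilde :: "'a::comm_ring_1 form_ring \<Rightarrow> 'a set \<Rightarrow> 'a set" where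
  "ideal_tilde F I = {x. \<forall>y\<in>J_Delta F. bar F y * mu F * x \<in> I}"

definition Omega_min :: "'a::comm_ring_1 form_ring \<Rightarrow> 'a set \<Rightarrow> ('a \<times> 'a) set" where
  "Omega_min F I =
     {(0, x - bar F x * lam F) | x. x \<in> I} <#>\<^bsub>heis F\<^esub> heis_circ F (Delta F) I"

definition Omega_max :: "'a::comm_ring_1 form_ring \<Rightarrow> 'a set \<Rightarrow> ('a \<times> 'a) set" where
  "Omega_max F I = Delta F \<inter> (ideal_tilde F I \<times> I)"

text \<open>A pair \<open>(I, \<Omega>)\<close> is handled as a single object of product type.\<close>

type_synonym 'a form_ideal = "'a set \<times> ('a \<times> 'a) set"

definition odd_form_ideal :: "'a::comm_ring_1 form_ring \<Rightarrow> 'a form_ideal \<Rightarrow> bool" where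
  "odd_form_ideal F = (\<lambda>(I, \<Omega>).
     is_ideal I \<and> involution_invariant F I \<and> heis_submodule F \<Omega> \<and>
     Omega_min F I \<subseteq> \<Omega> \<and> \<Omega> \<subseteq> Omega_max F I)"

definition form_ideal_prod ::
  "'a::comm_ring_1 form_ring \<Rightarrow> 'a form_ideal \<Rightarrow> 'a set \<Rightarrow> 'a form_ideal" where
  "form_ideal_prod F = (\<lambda>(J, \<Sigma>) K.
     (ideal_prod J K, Omega_min F (ideal_prod J K) <#>\<^bsub>heis F\<^esub> heis_circ F \<Sigma> K))"

text \<open>\<open>param_pow F \<Omega> s\<close> is \<open>\<Omega>\<^sup>s\<close> for a sign \<open>s\<close>, i.e. \<open>s\<close> is \<open>1\<close> or \<open>- 1\<close>.\<close>

definition param_pow :: "'a form_ring \<Rightarrow> ('a \<times> 'a) set \<Rightarrow> int \<Rightarrow> ('a \<times> 'a) set" where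
  "param_pow F \<Omega> s = (if s = 1 then \<Omega> else {(x, y). (x, bar F y) \<in> \<Omega>})"


section \<open>Indices, matrices and the forms\<close>

text \<open>
  For an index type \<open>'n\<close> with \<open>n\<close> elements, \<open>'n theta\<close> is the index set
  \<open>{1, \<dots>, n, 0, -n, \<dots>, -1}\<close>: \<open>Pos k\<close> is the index \<open>k\<close>, \<open>Mid\<close> is \<open>0\<close> and \<open>Neg k\<close> is \<open>-k\<close>.
  The order of the indices plays no role. For \<open>n = 3\<close> the index type is the numeral
  type \<open>3\<close>, whose elements are \<open>1\<close>, \<open>2\<close> and \<open>3\<close> (with \<open>3 = 0\<close>).
\<close>

datatype 'n theta = Pos 'n | Mid | Neg 'n

lemma UNIV_theta: "UNIV = range Pos \<union> {Mid} \<union> range Neg"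
proof (rule UNIV_eq_I)
  show "i \<in> range Pos \<union> {Mid} \<union> range Neg" for i :: "'a theta"
    by (cases i) simp_all
qed

instance theta :: (finite) finite
  by standard (simp add: UNIV_theta)

instantiation theta :: (type) uminus
begin

primrec uminus_theta :: "'a theta \<Rightarrow> 'a theta" where
  "- Pos k = Neg k"
| "- Mid = Mid"
| "- Neg k = Pos k"

instance ..

end

definition theta_hb :: "'n theta set" where
  "theta_hb = range Pos \<union> range Neg"

text \<open>The value at \<open>Mid\<close> is irrelevant.\<close>

primrec eps :: "'n theta \<Rightarrow> int" where
  "eps (Pos k) = 1"
| "eps Mid = 0"
| "eps (Neg k) = - 1"

text \<open>
  Columns are elements of \<open>'a ^ 'n theta\<close>, matrices of \<open>'a ^ 'n theta ^ 'n theta\<close>; the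
  \<open>(i, j)\<close> entry of \<open>\<sigma>\<close> is \<open>\<sigma> $ i $ j\<close>.
\<close>

type_synonym ('a, 'n) tmat = "'a ^ 'n theta ^ 'n theta"

definition form_B ::
  "'a::comm_ring_1 form_ring \<Rightarrow> 'a ^ ('n::finite) theta \<Rightarrow> 'a ^ 'n theta \<Rightarrow> 'a" where
  "form_B F u v =
     (\<Sum>k\<in>UNIV. bar F (u $ Pos k) * v $ Neg k)
     + bar F (u $ Mid) * mu F * v $ Mid
     + (\<Sum>k\<in>UNIV. bar F (u $ Neg k) * lam F * v $ Pos k)"

definition form_Q ::
  "'a::comm_ring_1 form_ring \<Rightarrow> 'a ^ ('n::finite) theta \<Rightarrow> 'a \<times> 'a" where
  "form_Q F u = (u $ Mid, \<Sum>k\<in>UNIV. bar F (u $ Pos k) * u $ Neg k)"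

definition M_Delta :: "'a::comm_ring_1 form_ring \<Rightarrow> ('a ^ ('n::finite) theta) set" where
  "M_Delta F = {u. u $ Mid \<in> J_Delta F}"


section \<open>Unitary groups\<close>

definition GL :: "('a::comm_ring_1, 'n::finite) tmat monoid" where
  "GL = \<lparr>carrier = {\<sigma>. invertible \<sigma>}, mult = (**), one = mat 1\<rparr>"

definition U :: "'a::comm_ring_1 form_ring \<Rightarrow> ('a, 'n::finite) tmat monoid" where
  "U F = GL\<lparr>carrier := {\<sigma> \<in> carrier GL.
     (\<forall>u v. form_B F (\<sigma> *v u) (\<sigma> *v v) = form_B F u v) \<and>
     (\<forall>u. heis_cong F (Delta F) (form_Q F (\<sigma> *v u)) (form_Q F u))}\<rparr>"

definition munit :: "'n theta \<Rightarrow> 'n theta \<Rightarrow> 'a \<Rightarrow> ('a::comm_ring_1, 'n::finite) tmat" where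
  "munit i j x = (\<chi> k l. if k = i \<and> l = j then x else 0)"

text \<open>All divisions of integers by two are exact for \<open>i, j \<noteq> Mid\<close>.\<close>

definition T_short ::
  "'a::comm_ring_1 form_ring \<Rightarrow> 'n theta \<Rightarrow> 'n theta \<Rightarrow> 'a \<Rightarrow> ('a, 'n::finite) tmat" where
  "T_short F i j x = mat 1 + munit i j x
     - munit (- j) (- i)
         (lam_pow F ((eps j - 1) div 2) * bar F x * lam_pow F ((1 - eps i) div 2))"

definition T_long ::
  "'a::comm_ring_1 form_ring \<Rightarrow> 'n theta \<Rightarrow> 'a \<times> 'a \<Rightarrow> ('a, 'n::finite) tmat" where
  "T_long F i = (\<lambda>(x, y). mat 1 + munit Mid (- i) x
     - munit i Mid (lam_pow F (- ((1 + eps i) div 2)) * bar F x * mu F)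
     + munit i (- i) y)"

text \<open>
  \<open>EU F (I, \<Omega>)\<close> is the elementary subgroup of level \<open>(I, \<Omega>)\<close>. The full elementary
  group is the one of level \<open>(UNIV, Delta F)\<close>.
\<close>

definition EU ::
  "'a::comm_ring_1 form_ring \<Rightarrow> 'a form_ideal \<Rightarrow> ('a, 'n::finite) tmat set" where
  "EU F = (\<lambda>(I, \<Omega>). generate (U F)
     ({T_short F i j x | i j x. i \<in> theta_hb \<and> j \<in> theta_hb \<and> i \<noteq> j \<and> i \<noteq> - j \<and> x \<in> I} \<union>
      {T_long F i \<alpha> | i \<alpha>. i \<in> theta_hb \<and> \<alpha> \<in> param_pow F \<Omega> (- eps i)}))"

definition U_cong ::
  "'a::comm_ring_1 form_ring \<Rightarrow> 'a form_ideal \<Rightarrow> ('a, 'n::finite) tmat set" where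
  "U_cong F = (\<lambda>(I, \<Omega>). {\<sigma> \<in> carrier (U F).
     (\<forall>i\<in>theta_hb. \<forall>j\<in>theta_hb. \<sigma> $ i $ j - mat 1 $ i $ j \<in> I) \<and>
     (\<forall>u\<in>M_Delta F. heis_cong F \<Omega> (form_Q F (\<sigma> *v u)) (form_Q F u))})"

definition NU ::
  "'a::comm_ring_1 form_ring \<Rightarrow> 'a form_ideal \<Rightarrow> ('a, 'n::finite) tmat set" where
  "NU F I\<Omega> = normalizer (U F) (U_cong F I\<Omega>)"

definition CU ::
  "'a::comm_ring_1 form_ring \<Rightarrow> 'a form_ideal \<Rightarrow> ('a, 'n::finite) tmat set" where
  "CU F I\<Omega> = {\<sigma> \<in> NU F I\<Omega>. \<forall>\<tau>\<in>EU F (UNIV, Delta F).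
     \<sigma> \<otimes>\<^bsub>U F\<^esub> \<tau> \<otimes>\<^bsub>U F\<^esub> inv\<^bsub>U F\<^esub> \<sigma> \<otimes>\<^bsub>U F\<^esub> inv\<^bsub>U F\<^esub> \<tau> \<in> U_cong F I\<Omega>}"


section \<open>The upper level of a subgroup\<close>

definition level_Y ::
  "'a::comm_ring_1 form_ring \<Rightarrow> ('a, 'n::finite) tmat set \<Rightarrow> 'a set" where
  "level_Y F H = (\<Union>\<sigma>\<in>H. \<Union>i\<in>theta_hb. \<Union>j\<in>theta_hb - {i}.
     {\<sigma> $ i $ j, \<sigma> $ i $ i - \<sigma> $ j $ j}
     \<union> {\<sigma> $ i $ Mid * a | a. a \<in> J_Delta F}
     \<union> {bar F a * mu F * \<sigma> $ Mid $ j | a. a \<in> J_Delta F}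
     \<union> {bar F a * mu F * (\<sigma> $ Mid $ Mid - \<sigma> $ j $ j) * b | a b. a \<in> J_Delta F \<and> b \<in> J_Delta F})"

definition level_Z ::
  "'a::comm_ring_1 form_ring \<Rightarrow> ('a, 'n::finite) tmat set \<Rightarrow> ('a \<times> 'a) set" where
  "level_Z F H =
     {form_Q F (column j \<sigma>) | \<sigma> j. \<sigma> \<in> H \<and> j \<in> theta_hb} \<union>
     {heis_act F (form_Q F (column Mid \<sigma>) \<otimes>\<^bsub>heis F\<^esub> inv\<^bsub>heis F\<^esub> (1, 0)) (fst \<alpha>)
        \<otimes>\<^bsub>heis F\<^esub> \<alpha> \<otimes>\<^bsub>heis F\<^esub> inv\<^bsub>heis F\<^esub> (heis_act F \<alpha> (\<sigma> $ i $ i))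
      | \<sigma> i \<alpha>. \<sigma> \<in> H \<and> i \<in> theta_hb \<and> \<alpha> \<in> Delta F}"

definition upper_level ::
  "'a::comm_ring_1 form_ring \<Rightarrow> ('a, 'n::finite) tmat set \<Rightarrow> 'a form_ideal" where
  "upper_level F H =
     (let J = ideal_generated (level_Y F H \<union> bar F ` level_Y F H)
      in (J, Omega_min F J <#>\<^bsub>heis F\<^esub> heis_circ F (level_Z F H) UNIV))"

end

theory Submission
  imports Defs
begin

text \<open>
  All elementary generators are Eichler transvections
  \<open>transv u v z = (w \<mapsto> w + C u w v - B v w u + z C u w u)\<close> with isotropic \<open>u\<close> orthogonal to
  \<open>v\<close>, and conjugation by an isometry just moves \<open>u\<close> and \<open>v\<close>. In these terms the two inclusions
  are statements about which transvections lie in \<open>H\<close> and about how an element of \<open>H\<close> moves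
  the vectors \<open>u\<close> and \<open>v\<close>.

  Lower bound. Let \<open>N\<close> be the set of elements normalising \<open>H\<close>; it contains the elementary group of
  the smallest level over \<open>I\<close>. Let \<open>\<sigma> \<in> H\<close> and \<open>c = \<sigma>\<inverse> e\<^sub>k\<close>. Two vectors orthogonal to \<open>c\<close>,
  supported on three coordinates and built from entries of \<open>c\<close> themselves, give an element
  \<open>\<tau> \<in> N\<close> that fixes \<open>c\<close>. Then \<open>H\<close> contains the product of a transvection along \<open>\<tau>\<inverse> e\<^sub>k\<close> and one
  along \<open>e\<^sub>k\<close> (lemma \<open>parabolic\<close>), and three more commutators with elementary elements of level \<open>I\<close>
  isolate a short root transvection whose parameter is a product of two entries of \<open>c\<close>
  times five elements of \<open>I\<close> (\<open>column_products\<close>, \<open>column_products_diag\<close>). Conjugating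
  \<open>\<sigma>\<close> by elementary elements of level \<open>I\<close> yields more such products, and the equation that a row of
  \<open>\<sigma>\<inverse>\<close> times a column of \<open>\<sigma>\<close> is \<open>1\<close> then recovers single entries for one further factor
  (\<open>offdiag6\<close>).

  Let \<open>A s\<close> be the ideal of all \<open>x\<close> for which \<open>x\<close> times \<open>s\<close> factors from \<open>I\<close> is the parameter of a
  short transvection in \<open>H\<close>, in every root position. Off-diagonal entries are in \<open>A 8\<close>, the entries
  that involve the middle coordinate and the differences of diagonal entries in \<open>A 9\<close> and
  \<open>A 10\<close>, so the ideal of the upper level lies in \<open>A 10\<close> (\<open>level_J_subset\<close>). One factor more
  also gives the long transvections attached to such an \<open>x\<close> (\<open>A_I_K\<close>). For the form parameter, the
  commutator construction with a \<open>\<tau>\<close> adapted to a column shows that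
  \<open>Q (\<sigma> e\<^sub>r) \<circ> I\<^sup>1\<^sup>1\<close> consists of parameters of long transvections in \<open>H\<close> (\<open>Q_all\<close>). Applied
  to a conjugate of \<open>\<sigma>\<close> by a long transvection this gives the generators of the second kind, for
  one more factor (\<open>zeta_all\<close>). This is where the exponent \<open>12\<close> comes from.

  Upper bound. Modulo its upper level \<open>(J, \<Sigma>)\<close>, an element \<open>\<sigma>\<close> of \<open>H\<close> acts like the scalar
  \<open>s = \<sigma>\<^sub>i\<^sub>i\<close>, on the vectors and on the quadratic form: for \<open>\<alpha> = (u\<^sub>0, z) \<in> \<Delta>\<close>,
  \<open>Q (\<sigma> u)\<close> is congruent to \<open>\<alpha> \<circ> s\<close> up to a central element that does not depend on \<open>\<sigma>\<close>
  (\<open>scalar_Q\<close>). A direct consequence is that \<open>\<sigma>\<close> preserves \<open>Q\<close> modulo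
  \<open>\<Sigma>\<close> on the vectors that are small modulo \<open>(J, \<Sigma>)\<close>, and this is exactly what is needed for
  \<open>\<sigma>\<close> to normalise the congruence subgroup (\<open>compatible_conj\<close>). Another one is
  that \<open>\<sigma> \<tau>\<close> and \<open>\<tau> \<sigma>\<close> agree modulo \<open>(J, \<Sigma>)\<close> for every elementary generator \<open>\<tau>\<close>
  (\<open>scalar_commutator\<close>).
\<close>

section \<open>Eichler transvections\<close>

lemma theta_uminus_uminus [simp]: "- (- i) = (i :: 'n theta)"
  by (cases i) simp_all

lemma theta_uminus_eq_iff [simp]: "- i = - j \<longleftrightarrow> i = (j :: 'n theta)"
  by (metis theta_uminus_uminus)

lemma theta_uminus_Mid_iff [simp]: "- i = Mid \<longleftrightarrow> i = (Mid :: 'n theta)" "Mid = - i \<longleftrightarrow> i = Mid"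
  by (cases i; simp)+

lemma theta_uminus_fixed_iff [simp]: "- i = i \<longleftrightarrow> i = (Mid :: 'n theta)" "i = - i \<longleftrightarrow> i = Mid"
  by (cases i; simp)+

lemma theta_hb_iff: "i \<in> theta_hb \<longleftrightarrow> i \<noteq> Mid"
  by (cases i) (auto simp: theta_hb_def)

lemma uminus_in_theta_hb [simp]: "- i \<in> theta_hb \<longleftrightarrow> i \<in> theta_hb"
  by (simp add: theta_hb_iff)

lemma sum_theta:
  fixes f :: "('n::finite) theta \<Rightarrow> 'b::comm_monoid_add"
  shows "(\<Sum>i\<in>UNIV. f i) = (\<Sum>k\<in>UNIV. f (Pos k)) + f Mid + (\<Sum>k\<in>UNIV. f (Neg k))"
proof -
  have inj: "inj Pos" "inj Neg" by (auto intro: injI)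
  have "(\<Sum>i\<in>UNIV. f i) = sum f (range Pos \<union> {Mid}) + sum f (range Neg)"
    unfolding UNIV_theta by (subst sum.union_disjoint) auto
  also have "sum f (range Pos \<union> {Mid}) = sum f (range Pos) + f Mid"
    by (subst sum.union_disjoint) auto
  finally show ?thesis by (simp add: sum.reindex inj o_def)
qed

lemma sum_uminus_theta:
  fixes f :: "('n::finite) theta \<Rightarrow> 'b::comm_monoid_add"
  shows "(\<Sum>i\<in>UNIV. f (- i)) = (\<Sum>i\<in>UNIV. f i)"
  by (simp add: sum_theta add.commute add.left_commute)

lemma matrix_vector_smult:
  fixes A :: "'a::comm_semiring_1 ^ 'n ^ 'm"
  shows "A *v (c *s x) = c *s (A *v x)"
  by (simp add: vector_scalar_mult_def matrix_vector_mult_def mult_ac sum_distrib_left)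

lemma matrix_vector_axis:
  fixes A :: "'a::comm_semiring_1 ^ 'n ^ 'm"
  shows "A *v axis j 1 = column j A"
  by (simp add: vec_eq_iff matrix_vector_mult_def column_def axis_def if_distrib cong: if_cong)

lemma matrix_entry: "A $ i $ j = (A *v axis j 1) $ i"
  for A :: "'a::comm_semiring_1 ^ 'n ^ 'm"
  by (simp add: matrix_vector_axis column_def)

lemma vector_axis_expansion: "u = (\<Sum>i\<in>UNIV. u $ i *s axis i 1)"
  for u :: "'a::comm_semiring_1 ^ 'n"
  by (simp add: vec_eq_iff axis_def if_distrib cong: if_cong)

context hermitian_ring
begin

abbreviation cj :: "'a \<Rightarrow> 'a" where "cj \<equiv> bar F"
abbreviation B :: "'a ^ ('n::finite) theta \<Rightarrow> 'a ^ 'n theta \<Rightarrow> 'a" where "B \<equiv> form_B F"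
abbreviation Q :: "'a ^ ('n::finite) theta \<Rightarrow> 'a \<times> 'a" where "Q \<equiv> form_Q F"
abbreviation ax :: "('n::finite) theta \<Rightarrow> 'a ^ 'n theta" where "ax i \<equiv> axis i 1"

lemma lam_unit [simp]: "lam F * cj (lam F) = 1" "cj (lam F) * lam F = 1"
  using lam_mult_bar_lam by (simp_all add: mult.commute)

lemma cj_cj [simp]: "cj (cj x) = x"
  using bar_bar[of x] by (metis lam_unit(1) mult.assoc mult.commute mult_1)

lemmas cj_simps [simp] = bar_add bar_one bar_zero bar_uminus

lemma cj_mult [simp]: "cj (x * y) = cj x * cj y"
  by (simp add: bar_mult mult.commute)

lemma cj_diff [simp]: "cj (x - y) = cj x - cj y"
  using bar_add[of x "- y"] by simp

lemma cj_sum: "cj (sum f A) = (\<Sum>x\<in>A. cj (f x))"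
  by (induction A rule: infinite_finite_induct) simp_all

lemma cj_lam_mu [simp]: "cj (mu F) * lam F = mu F" "lam F * cj (mu F) = mu F"
  using mu_eq by (simp_all add: mult.commute)

lemma lam_cancel [simp]: "lam F * (cj (lam F) * x) = x" "cj (lam F) * (lam F * x) = x"
  by (simp_all add: mult.assoc[symmetric])

lemma lam_mu_cancel [simp]: "lam F * (cj (mu F) * x) = mu F * x" "cj (mu F) * (lam F * x) = mu F * x"
  by (simp_all add: mult.assoc[symmetric])

text \<open>The Gram coefficients of the form, \<open>B (ax i) w = beta i * w $ (- i)\<close>. They are units for \<open>i \<noteq> Mid\<close>.\<close>
primrec beta :: "'n theta \<Rightarrow> 'a" where
  "beta (Pos k) = 1"
| "beta Mid = mu F"
| "beta (Neg k) = lam F"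

text \<open>The coefficient that takes the place of \<open>beta i\<close> in \<open>C (ax i)\<close> below; it is the unit by which the
  parameters of the long elementary generators differ from those of transvections.\<close>
definition rho :: "'n theta \<Rightarrow> 'a" where
  "rho i = cj (beta (- i))"

lemma rho_lam [simp]: "rho i * lam F = beta i" "lam F * rho i = beta i"
  by (cases i; simp add: rho_def)+

lemma cj_beta_lam: "cj (beta i) * lam F = beta (- i)"
  by (cases i) simp_all

lemma beta_unit: "i \<noteq> Mid \<Longrightarrow> beta i * cj (beta i) = 1"
  by (cases i) simp_all

lemma rho_unit: "i \<noteq> Mid \<Longrightarrow> rho i * cj (rho i) = 1"
  by (cases i) (simp_all add: rho_def)

lemma rho_beta: "i \<noteq> Mid \<Longrightarrow> rho i * beta (- i) = 1"
  by (cases i) (simp_all add: rho_def)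

lemma form_B_sum: "B u w = (\<Sum>i\<in>UNIV. cj (u $ i) * beta i * w $ (- i))"
  by (simp add: sum_theta form_B_def)

lemma B_add_left: "B (u + v) w = B u w + B v w"
  by (simp add: form_B_sum algebra_simps sum.distrib)

lemma B_add_right: "B u (v + w) = B u v + B u w"
  by (simp add: form_B_sum algebra_simps sum.distrib)

lemma B_diff_left: "B (u - v) w = B u w - B v w"
  by (simp add: form_B_sum algebra_simps sum_subtractf)

lemma B_diff_right: "B u (v - w) = B u v - B u w"
  by (simp add: form_B_sum algebra_simps sum_subtractf)

lemma B_minus_left: "B (- v) w = - B v w"
  by (simp add: form_B_sum sum_negf)

lemma B_minus_right: "B u (- w) = - B u w"
  by (simp add: form_B_sum sum_negf)

lemma B_smult_left: "B (c *s u) w = cj c * B u w"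
  by (simp add: form_B_sum sum_distrib_left mult_ac)

lemma B_smult_right: "B u (c *s w) = c * B u w"
  by (simp add: form_B_sum sum_distrib_left mult_ac)

lemma B_zero_left [simp]: "B 0 w = 0"
  by (simp add: form_B_sum)

lemma B_zero_right [simp]: "B u 0 = 0"
  by (simp add: form_B_sum)

lemmas B_lin = B_add_left B_add_right B_diff_left B_diff_right B_minus_left B_minus_right
  B_smult_left B_smult_right

lemma B_swap: "B w u = cj (B u w) * lam F"
proof -
  have "B w u = (\<Sum>i\<in>UNIV. cj (w $ (- i)) * beta (- i) * u $ i)"
    using sum_uminus_theta[of "\<lambda>i. cj (w $ i) * beta i * u $ (- i)"] by (simp add: form_B_sum)
  also have "\<dots> = cj (B u w) * lam F"
    unfolding form_B_sum cj_sum sum_distrib_right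
    by (rule sum.cong) (simp_all add: cj_beta_lam[symmetric] mult_ac)
  finally show ?thesis .
qed

lemma B_ax_left [simp]: "B (ax i) w = beta i * w $ (- i)"
  by (simp add: form_B_sum axis_def if_distrib[of cj] if_distrib[of "\<lambda>x. x * _"] cong: if_cong)

lemma B_ax_right: "B u (ax i) = cj (u $ (- i)) * beta (- i)"
  by (simp add: B_swap[of u] cj_beta_lam mult_ac)
     (metis cj_beta_lam mult.commute mult.left_commute)

text \<open>The form with its arguments exchanged and conjugated. It is linear in the vector \<open>w\<close>, and it equals
  \<open>B u w\<close> up to the unit \<open>lam F\<close> (lemma \<open>lam_C\<close>).\<close>
definition C :: "'a ^ ('n::finite) theta \<Rightarrow> 'a ^ 'n theta \<Rightarrow> 'a" where
  "C u w = cj (B w u)"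

lemma C_lin:
  "C (u + v) w = C u w + C v w" "C u (v + w) = C u v + C u w"
  "C (u - v) w = C u w - C v w" "C u (v - w) = C u v - C u w"
  "C (- v) w = - C v w" "C u (- w) = - C u w"
  "C (c *s u) w = cj c * C u w" "C u (c *s w) = c * C u w"
  "C 0 w = 0" "C u 0 = 0"
  by (simp_all add: C_def B_lin)

lemma lam_C: "lam F * C u w = B u w"
  by (simp add: C_def B_swap[of u w] mult.commute)

lemma C_eq: "C u w = cj (lam F) * B u w"
  by (simp add: lam_C[symmetric])

lemma C_ax_left [simp]: "C (ax i) w = rho i * w $ (- i)"
  by (simp add: C_def B_ax_right rho_def mult.commute)

lemma B_zero_sym: "B u v = 0 \<longleftrightarrow> B v u = 0"
  by (metis B_swap bar_zero mult_zero_left)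

text \<open>Eichler transvections. For isotropic \<open>u\<close> orthogonal to \<open>v\<close> they are isometries as soon as
  \<open>z + cj z * lam F + B v v = 0\<close>. Both kinds of elementary generators have this form with basis vectors for
  \<open>u\<close> and, up to a factor, for \<open>v\<close>; unlike the matrices, it does not depend on coordinates.\<close>
definition transv :: "'a ^ ('n::finite) theta \<Rightarrow> 'a ^ 'n theta \<Rightarrow> 'a \<Rightarrow> ('a, 'n) tmat" where
  "transv u v z = (\<chi> i j. (if i = j then 1 else 0) + C u (ax j) * v $ i - B v (ax j) * u $ i
     + z * C u (ax j) * u $ i)"

lemma B_expand_right: "(\<Sum>j\<in>UNIV. B u (ax j) * w $ j) = B u w"
proof -
  have "B u w = B u (\<Sum>j\<in>UNIV. w $ j *s ax j)"
    using vector_axis_expansion[of w] by simp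
  also have "\<dots> = (\<Sum>j\<in>UNIV. B u (w $ j *s ax j))"
    by (induction rule: finite_induct[OF finite]) (simp_all add: B_add_right)
  finally show ?thesis by (simp add: B_smult_right mult.commute)
qed

lemma C_expand_right: "(\<Sum>j\<in>UNIV. C u (ax j) * w $ j) = C u w"
  by (simp add: C_eq mult.assoc sum_distrib_left[symmetric] B_expand_right)

lemma transv_apply:
  "transv u v z *v w = w + C u w *s v - B v w *s u + (z * C u w) *s u"
proof (subst vec_eq_iff, rule allI)
  fix i
  have "(transv u v z *v w) $ i
     = (\<Sum>j\<in>UNIV. (if i = j then 1 else 0) * w $ j) + (\<Sum>j\<in>UNIV. C u (ax j) * w $ j) * v $ i
       - (\<Sum>j\<in>UNIV. B v (ax j) * w $ j) * u $ i + z * (\<Sum>j\<in>UNIV. C u (ax j) * w $ j) * u $ i"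
    unfolding matrix_vector_mult_def transv_def
    by (simp add: algebra_simps sum.distrib sum_subtractf sum_distrib_left sum_distrib_right
        del: B_ax_left C_ax_left)
  then show "(transv u v z *v w) $ i = (w + C u w *s v - B v w *s u + (z * C u w) *s u) $ i"
    by (simp add: B_expand_right C_expand_right if_distrib[of "\<lambda>x. x * _"] cong: if_cong)
qed

text \<open>For a fixed axis \<open>u\<close> the transvections multiply like a Heisenberg group: \<open>v\<close> is additive, and the
  failure of commutativity sits in the central parameter \<open>z\<close>.\<close>
lemma transv_mult:
  assumes "B u u = 0" "B u v = 0" "B u v' = 0"
  shows "transv u v z ** transv u v' z' = transv u (v + v') (z + z' - B v v')"
proof (subst matrix_eq, rule allI)
  fix w
  have "B v u = 0" "C u u = 0" "C u v = 0" "C u v' = 0"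
    using assms B_zero_sym by (auto simp: C_eq)
  then show "(transv u v z ** transv u v' z') *v w = transv u (v + v') (z + z' - B v v') *v w"
    unfolding matrix_vector_mul_assoc[symmetric] transv_apply
    using assms by (simp add: B_lin C_lin) (simp add: vec_eq_iff algebra_simps)
qed

lemma transv_zero [simp]: "transv u 0 0 = mat 1"
  by (simp add: matrix_eq transv_apply)

definition isometry :: "('a, 'n::finite) tmat \<Rightarrow> bool" where
  "isometry \<sigma> \<longleftrightarrow> (\<forall>u v. B (\<sigma> *v u) (\<sigma> *v v) = B u v)"

lemma transv_conj:
  assumes "isometry \<sigma>" "\<sigma> ** \<tau> = mat 1"
  shows "\<sigma> ** transv u v z ** \<tau> = transv (\<sigma> *v u) (\<sigma> *v v) z"
proof (subst matrix_eq, rule allI)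
  fix w
  have w: "\<sigma> *v (\<tau> *v w) = w" using assms(2) by (simp add: matrix_vector_mul_assoc)
  have *: "B x (\<tau> *v w) = B (\<sigma> *v x) w" "C x (\<tau> *v w) = C (\<sigma> *v x) w" for x
    using assms(1) w unfolding isometry_def C_eq by metis+
  show "(\<sigma> ** transv u v z ** \<tau>) *v w = transv (\<sigma> *v u) (\<sigma> *v v) z *v w"
    unfolding matrix_vector_mul_assoc[symmetric] transv_apply
    by (simp add: w * matrix_vector_right_distrib matrix_vector_mult_diff_distrib matrix_vector_smult)
qed

text \<open>A transvection with \<open>z = 0\<close> can be read with either of its two vectors as the axis. This is the symmetry
  between the roots \<open>(i, j)\<close> and \<open>(- j, - i)\<close> of a short generator.\<close>
lemma transv_swap: "transv u v 0 = transv v (- (lam F *s u)) 0"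
  by (simp add: matrix_eq transv_apply B_lin C_lin lam_C[symmetric] vec_eq_iff)

lemma transv_smult_left: "transv (x *s u) v z = transv u (cj x *s v) (x * cj x * z)"
  by (simp add: matrix_eq transv_apply B_lin C_lin vec_eq_iff algebra_simps)

lemma transv_parallel: "transv u (x *s u) z = transv u 0 (z + x - cj x * lam F)"
  by (simp add: matrix_eq transv_apply B_lin lam_C[symmetric] C_lin vec_eq_iff algebra_simps)

end

section \<open>Heisenberg group, quadratic form and unitary group\<close>

text \<open>Rewriting modulo commutativity reorders products, so a unit and its inverse need not end up next to each
  other. These equations cancel them in all positions that occur.\<close>
lemma absorb_prod:
  fixes a b c :: "'a::comm_ring_1"
  assumes "a * b = c"
  shows "a * b = c" "b * a = c" "a * (b * t) = c * t" "b * (a * t) = c * t"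
    "a * (t * b) = c * t" "b * (t * a) = c * t"
    "a * (t * (b * s)) = c * (t * s)" "b * (t * (a * s)) = c * (t * s)"
    "a * (t * (s * b)) = c * (t * s)" "b * (t * (s * a)) = c * (t * s)"
    "a * (t * (s * (b * r))) = c * (t * (s * r))" "b * (t * (s * (a * r))) = c * (t * (s * r))"
    "a * (t * (s * (r * b))) = c * (t * (s * r))" "b * (t * (s * (r * a))) = c * (t * (s * r))"
    "a * (t * (s * (r * (b * q)))) = c * (t * (s * (r * q)))" "b * (t * (s * (r * (a * q)))) = c * (t * (s * (r * q)))"
  by (simp_all add: assms[symmetric] mult_ac)

context hermitian_ring
begin

lemmas lam_absorb = absorb_prod[OF lam_unit(1)] absorb_prod[OF cj_lam_mu(1)]

lemma ax_nth: "ax i $ j = (if j = i then 1 else 0)"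
  by (simp add: axis_def)

lemma heis_mult [simp]:
  "(x1, y1) \<otimes>\<^bsub>heis F\<^esub> (x2, y2) = (x1 + x2, y1 + y2 - cj x1 * mu F * x2)"
  by (simp add: heis_def)

lemma heis_one [simp]: "\<one>\<^bsub>heis F\<^esub> = (0, 0)"
  by (simp add: heis_def)

lemma heis_carrier [simp]: "carrier (heis F) = UNIV"
  by (simp add: heis_def)

sublocale heis: Group.group "heis F"
  by (rule group_heis)

lemma heis_inv [simp]: "inv\<^bsub>heis F\<^esub> (x, y) = (- x, - y - cj x * mu F * x)"
  by (rule heis.inv_equality) simp_all

lemma heis_act_Pair [simp]: "heis_act F (x, y) a = (x * a, cj a * y * a)"
  by (simp add: heis_act_def)

lemma heis_act_mult:
  "heis_act F (\<alpha> \<otimes>\<^bsub>heis F\<^esub> \<beta>) a = heis_act F \<alpha> a \<otimes>\<^bsub>heis F\<^esub> heis_act F \<beta> a"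
  by (cases \<alpha>; cases \<beta>) (simp add: algebra_simps)

lemma heis_act_inv: "heis_act F (inv\<^bsub>heis F\<^esub> \<alpha>) a = inv\<^bsub>heis F\<^esub> (heis_act F \<alpha> a)"
  by (cases \<alpha>) (simp add: algebra_simps)

lemma heis_act_act: "heis_act F (heis_act F \<alpha> a) b = heis_act F \<alpha> (a * b)"
  by (cases \<alpha>) (simp add: algebra_simps)

lemma heis_act_one [simp]: "heis_act F \<alpha> 1 = \<alpha>"
  by (cases \<alpha>) simp

text \<open>The hyperbolic half of the form, which is also the second component of \<open>Q\<close>; it is not hermitian, and its
  asymmetry is what appears in \<open>Q_add\<close>.\<close>
definition cross :: "'a ^ ('n::finite) theta \<Rightarrow> 'a ^ 'n theta \<Rightarrow> 'a" where
  "cross w u = (\<Sum>k\<in>UNIV. cj (w $ Pos k) * u $ Neg k)"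

lemma form_Q_eq: "Q u = (u $ Mid, cross u u)"
  by (simp add: form_Q_def cross_def)

lemma cross_lin:
  "cross (u + v) w = cross u w + cross v w" "cross u (v + w) = cross u v + cross u w"
  "cross (u - v) w = cross u w - cross v w" "cross u (v - w) = cross u v - cross u w"
  "cross (c *s u) w = cj c * cross u w" "cross u (c *s w) = c * cross u w"
  "cross 0 w = 0" "cross u 0 = 0"
  by (simp_all add: cross_def algebra_simps sum.distrib sum_subtractf sum_distrib_left)

lemma form_B_cross: "B u w = cross u w + cj (u $ Mid) * mu F * w $ Mid + cj (cross w u) * lam F"
  by (simp add: form_B_def cross_def cj_sum sum_distrib_left mult_ac)

text \<open>The typical element of the smallest form parameter. These elements are central in the Heisenberg group, and
  commutators in that group and the defects of the additivity of \<open>Q\<close> all have this shape.\<close>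
definition tr0 :: "'a \<Rightarrow> 'a \<times> 'a" where
  "tr0 c = (0, c - cj c * lam F)"

lemma Q_add: "Q (u + w) = Q u \<otimes>\<^bsub>heis F\<^esub> Q w \<otimes>\<^bsub>heis F\<^esub> (0, B u w) \<otimes>\<^bsub>heis F\<^esub> tr0 (cross w u)"
  by (simp add: form_Q_eq tr0_def cross_lin form_B_cross algebra_simps)

lemma Q_smult: "Q (x *s u) = heis_act F (Q u) x"
  by (simp add: form_Q_eq cross_lin algebra_simps)

lemma Q_zero [simp]: "Q 0 = (0, 0)"
  by (simp add: form_Q_eq cross_lin)

lemma cross_ax_left: "cross (ax i) u = (case i of Pos k \<Rightarrow> u $ Neg k | _ \<Rightarrow> 0)"
  by (cases i) (simp_all add: cross_def axis_def if_distrib[of cj] if_distrib[of "\<lambda>x. x * _"] cong: if_cong)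

lemma cross_ax_right: "cross u (ax i) = (case i of Neg k \<Rightarrow> cj (u $ Pos k) | _ \<Rightarrow> 0)"
  by (cases i) (simp_all add: cross_def axis_def if_distrib[of "\<lambda>x. _ * x"] cong: if_cong)

lemma cross_add_ax:
  assumes "v $ (- k) = 0" "k \<noteq> Mid"
  shows "cross (v + t *s ax k) (v + t *s ax k) = cross v v"
  using assms by (cases k) (simp_all add: cross_lin cross_ax_left cross_ax_right, simp_all add: axis_def)

lemma transv_isometry:
  assumes "B u u = 0" "B u v = 0" "z + cj z * lam F + B v v = 0"
  shows "isometry (transv u v z)"
  unfolding isometry_def
proof (intro allI)
  fix w w'
  have vu: "B v u = 0" using assms B_zero_sym by auto
  have 1: "B w u = cj (C u w)" "B u w' = lam F * C u w'" by (simp add: C_def) (simp add: lam_C)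
  have 2: "B w v = cj (B v w) * lam F" by (rule B_swap)
  have "B (transv u v z *v w) (transv u v z *v w')
      = B w w' + cj (C u w) * C u w' * (z + cj z * lam F + B v v)"
    unfolding transv_apply by (simp add: B_lin 1 2 vu assms(1,2) algebra_simps)
  then show "B (transv u v z *v w) (transv u v z *v w') = B w w'"
    using assms(3) by simp
qed

lemma transv_inverse:
  assumes "B u u = 0" "B u v = 0"
  shows "transv u v z ** transv u (- v) (- z - B v v) = mat 1"
    and "transv u (- v) (- z - B v v) ** transv u v z = mat 1"
  using assms by (simp_all add: transv_mult B_lin)

text \<open>The last factor is invisible modulo \<open>Delta F\<close>, so \<open>transv (ax k) v z\<close> preserves \<open>Q\<close> modulo \<open>Delta F\<close> as
  soon as \<open>(v $ Mid, cross v v + z)\<close> is in \<open>Delta F\<close>. Its precise value is needed to compare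
  \<open>Q\<close> of two products in the computation of commutators.\<close>
lemma Q_transv_ax:
  assumes "v $ (- k) = 0" "k \<noteq> Mid"
  defines "y \<equiv> \<lambda>u. C (ax k) u"
  shows "Q (transv (ax k) v z *v u) = Q u \<otimes>\<^bsub>heis F\<^esub> heis_act F (v $ Mid, cross v v + z) (y u)
    \<otimes>\<^bsub>heis F\<^esub> tr0 (B u v * y u + cross (transv (ax k) v z *v u - u) u)"
proof -
  define \<eta> where "\<eta> = - B v u + z * y u"
  define w where "w = y u *s v + \<eta> *s ax k"
  have tw: "transv (ax k) v z *v u = u + w"
    by (simp add: transv_apply w_def \<eta>_def y_def vec_eq_iff algebra_simps)
  have "cross w w = cross (y u *s v) (y u *s v)"
    unfolding w_def by (rule cross_add_ax) (use assms in auto)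
  then have cw: "cross w w = cj (y u) * y u * cross v v" by (simp add: cross_lin)
  have Bu: "B u (ax k) = cj (y u)" by (simp add: y_def C_def)
  have Buw: "B u w = y u * B u v + \<eta> * cj (y u)" by (simp add: w_def B_lin Bu)
  have vu: "B v u = cj (B u v) * lam F" by (rule B_swap)
  have w0: "w $ Mid = v $ Mid * y u" using assms(2) by (simp add: w_def axis_def)
  show ?thesis unfolding tw Q_add
    by (simp add: tr0_def form_Q_eq Buw cw w0) (simp add: \<eta>_def vu algebra_simps)
qed

end

lemma (in hermitian_ring) U_carrier_iff:
  "\<sigma> \<in> carrier (U F) \<longleftrightarrow> invertible \<sigma> \<and> isometry \<sigma>
     \<and> (\<forall>u. heis_cong F (Delta F) (Q (\<sigma> *v u)) (Q u))"
  by (simp add: U_def GL_def isometry_def)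

lemma (in hermitian_ring) U_mult [simp]: "\<sigma> \<otimes>\<^bsub>U F\<^esub> \<tau> = \<sigma> ** \<tau>"
  by (simp add: U_def GL_def)

lemma (in hermitian_ring) U_one [simp]: "\<one>\<^bsub>U F\<^esub> = mat 1"
  by (simp add: U_def GL_def)

context hermitian_form_ring
begin

lemma Delta_subgroup: "subgroup (Delta F) (heis F)"
  using Delta_submodule by (simp add: heis_submodule_def)

lemma Delta_act: "\<alpha> \<in> Delta F \<Longrightarrow> heis_act F \<alpha> a \<in> Delta F"
  using Delta_submodule by (simp add: heis_submodule_def)

lemma Delta_mult: "\<alpha> \<in> Delta F \<Longrightarrow> \<beta> \<in> Delta F \<Longrightarrow> \<alpha> \<otimes>\<^bsub>heis F\<^esub> \<beta> \<in> Delta F"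
  by (rule subgroup.m_closed[OF Delta_subgroup])

lemma Delta_inv: "\<alpha> \<in> Delta F \<Longrightarrow> inv\<^bsub>heis F\<^esub> \<alpha> \<in> Delta F"
  by (rule subgroup.m_inv_closed[OF Delta_subgroup])

lemma Delta_zero: "(0, 0) \<in> Delta F"
  using subgroup.one_closed[OF Delta_subgroup] by simp

lemma Delta_tr0: "tr0 c \<in> Delta F"
  using Delta_min_subset by (auto simp: Delta_min_def tr0_def)

lemma Delta_maxD: "(x, y) \<in> Delta F \<Longrightarrow> cj x * mu F * x + y + cj y * lam F = 0"
  using Delta_subset_max by (auto simp: Delta_max_def)

lemma heis_cong_Delta_sym:
  "heis_cong F (Delta F) \<alpha> \<beta> \<Longrightarrow> heis_cong F (Delta F) \<beta> \<alpha>"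
  unfolding heis_cong_def using Delta_inv[of "\<alpha> \<otimes>\<^bsub>heis F\<^esub> inv\<^bsub>heis F\<^esub> \<beta>"]
  by (cases \<alpha>; cases \<beta>) (simp add: algebra_simps)

lemma heis_cong_Delta_trans:
  "heis_cong F (Delta F) \<alpha> \<beta> \<Longrightarrow> heis_cong F (Delta F) \<beta> \<gamma> \<Longrightarrow> heis_cong F (Delta F) \<alpha> \<gamma>"
  unfolding heis_cong_def
  using Delta_mult[of "\<alpha> \<otimes>\<^bsub>heis F\<^esub> inv\<^bsub>heis F\<^esub> \<beta>" "\<beta> \<otimes>\<^bsub>heis F\<^esub> inv\<^bsub>heis F\<^esub> \<gamma>"]
  by (cases \<alpha>; cases \<beta>; cases \<gamma>) (simp add: algebra_simps)

lemma heis_cong_Delta_fst: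
  assumes "heis_cong F (Delta F) \<alpha> \<beta>"
  shows "fst \<alpha> - fst \<beta> \<in> J_Delta F"
  using assms by (cases \<alpha>; cases \<beta>) (auto simp: heis_cong_def J_Delta_def)

lemma J_Delta_add: "x \<in> J_Delta F \<Longrightarrow> y \<in> J_Delta F \<Longrightarrow> x + y \<in> J_Delta F"
  unfolding J_Delta_def using Delta_mult by fastforce

lemma J_Delta_mult: "x \<in> J_Delta F \<Longrightarrow> x * a \<in> J_Delta F"
  unfolding J_Delta_def using Delta_act by fastforce

lemma J_Delta_zero: "0 \<in> J_Delta F"
  unfolding J_Delta_def using Delta_zero by auto

lemma J_Delta_diff: "x \<in> J_Delta F \<Longrightarrow> y \<in> J_Delta F \<Longrightarrow> x - y \<in> J_Delta F"
  using J_Delta_add[of x "y * (-1)"] J_Delta_mult[of y "-1"] by simp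

lemma U_D:
  assumes "\<sigma> \<in> carrier (U F)"
  shows "isometry \<sigma>" "heis_cong F (Delta F) (Q (\<sigma> *v u)) (Q u)"
    "(\<sigma> *v u) $ Mid - u $ Mid \<in> J_Delta F"
proof -
  show "isometry \<sigma>" and *: "heis_cong F (Delta F) (Q (\<sigma> *v u)) (Q u)"
    using assms by (simp_all add: U_carrier_iff)
  show "(\<sigma> *v u) $ Mid - u $ Mid \<in> J_Delta F"
    using heis_cong_Delta_fst[OF *] by (simp add: form_Q_def)
qed

lemma U_group: "Group.group (U F :: ('a, 'n::finite) tmat monoid)"
proof (rule groupI)
  fix x y :: "('a, 'n) tmat" assume "x \<in> carrier (U F)" "y \<in> carrier (U F)"
  then show "x \<otimes>\<^bsub>U F\<^esub> y \<in> carrier (U F)"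
    unfolding U_carrier_iff isometry_def
    by (auto simp: invertible_mult matrix_vector_mul_assoc[symmetric] intro: heis_cong_Delta_trans)
next
  show "\<one>\<^bsub>U F\<^esub> \<in> carrier (U F :: ('a, 'n) tmat monoid)"
    by (auto simp: U_carrier_iff isometry_def heis_cong_def invertible_def Delta_zero form_Q_eq
        intro: exI[of _ "mat 1"])
next
  fix x :: "('a, 'n) tmat" assume x: "x \<in> carrier (U F)"
  then obtain y where y: "x ** y = mat 1" "y ** x = mat 1"
    by (auto simp: U_carrier_iff invertible_def)
  have xy: "x *v (y *v u) = u" for u using y by (simp add: matrix_vector_mul_assoc)
  have "isometry y" using x xy unfolding U_carrier_iff isometry_def by metis
  moreover have "heis_cong F (Delta F) (Q (y *v u)) (Q u)" for u
    using x xy[of u] heis_cong_Delta_sym unfolding U_carrier_iff by metis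
  ultimately have "y \<in> carrier (U F)" using y by (auto simp: U_carrier_iff invertible_def)
  then show "\<exists>y\<in>carrier (U F). y \<otimes>\<^bsub>U F\<^esub> x = \<one>\<^bsub>U F\<^esub>" using y by auto
qed (simp_all add: matrix_mul_assoc)

lemma U_inv:
  fixes \<sigma> :: "('a, 'n::finite) tmat"
  assumes "\<sigma> \<in> carrier (U F)"
  shows "\<sigma> ** inv\<^bsub>U F\<^esub> \<sigma> = mat 1" "inv\<^bsub>U F\<^esub> \<sigma> ** \<sigma> = mat 1" "inv\<^bsub>U F\<^esub> \<sigma> \<in> carrier (U F)"
  using Group.group.r_inv[OF U_group assms] Group.group.l_inv[OF U_group assms]
    Group.group.inv_closed[OF U_group assms] by simp_all

lemma U_inv_apply:
  assumes "\<sigma> \<in> carrier (U F)"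
  shows "\<sigma> *v (inv\<^bsub>U F\<^esub> \<sigma> *v u) = u" "inv\<^bsub>U F\<^esub> \<sigma> *v (\<sigma> *v u) = u"
  using U_inv[OF assms] by (simp_all add: matrix_vector_mul_assoc)

lemma U_adjoint:
  assumes "\<sigma> \<in> carrier (U F)"
  shows "B u (inv\<^bsub>U F\<^esub> \<sigma> *v v) = B (\<sigma> *v u) v"
  using U_D(1)[OF assms] U_inv_apply[OF assms] unfolding isometry_def by metis

lemma U_inv_entry:
  assumes "\<sigma> \<in> carrier (U F)"
  shows "beta i * (inv\<^bsub>U F\<^esub> \<sigma>) $ (- i) $ j = cj (\<sigma> $ (- j) $ i) * beta (- j)"
  using U_adjoint[OF assms, of "ax i" "ax j"] unfolding B_ax_left B_ax_right by (simp add: matrix_entry)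

lemma transv_ax_in_U:
  assumes "v $ (- k) = 0" "k \<noteq> Mid" "(v $ Mid, cross v v + z) \<in> Delta F"
  shows "transv (ax k) v z \<in> carrier (U F)"
proof -
  have k: "B (ax k) (ax k) = 0" "B (ax k) v = 0"
    using assms by (simp_all add: ax_nth)
  have 1: "z + cj z * lam F + B v v = 0"
    using Delta_maxD[OF assms(3)] by (simp add: form_B_cross algebra_simps)
  have 2: "heis_cong F (Delta F) (Q (transv (ax k) v z *v u)) (Q u)" for u
  proof -
    define \<alpha> where "\<alpha> = heis_act F (v $ Mid, cross v v + z) (C (ax k) u)"
    define c where "c = B u v * C (ax k) u + cross (transv (ax k) v z *v u - u) u"
    have \<alpha>: "\<alpha> \<in> Delta F" unfolding \<alpha>_def by (rule Delta_act[OF assms(3)])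
    obtain x y where xy: "\<alpha> = (x, y)" by (cases \<alpha>)
    obtain p q where pq: "Q u = (p, q)" by (cases "Q u")
    have "Q (transv (ax k) v z *v u) \<otimes>\<^bsub>heis F\<^esub> inv\<^bsub>heis F\<^esub> Q u
       = \<alpha> \<otimes>\<^bsub>heis F\<^esub> tr0 (c + cj x * mu F * p)"
      unfolding Q_transv_ax[OF assms(1,2)] \<alpha>_def[symmetric] c_def[symmetric] xy pq
      by (simp add: tr0_def algebra_simps lam_absorb)
    then show ?thesis unfolding heis_cong_def using Delta_mult[OF \<alpha> Delta_tr0] by simp
  qed
  show ?thesis unfolding U_carrier_iff
    using transv_isometry[OF k 1] 2 transv_inverse[OF k] by (auto simp: invertible_def)
qed

lemma munit_apply: "munit i j x *v w = (x * w $ j) *s ax i"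
  by (simp add: vec_eq_iff matrix_vector_mult_def munit_def axis_def if_distrib[of "\<lambda>x. x * _"]
      cong: if_cong)

text \<open>The powers of \<open>lam F\<close> in the generator are the Gram coefficients of the two basis vectors.\<close>
lemma T_short_transv:
  assumes "i \<in> theta_hb" "j \<in> theta_hb" "i \<noteq> j" "i \<noteq> - j"
  shows "T_short F i j a = transv (ax i) ((- (cj a * beta (- j))) *s ax (- j)) 0"
proof -
  have 1: "lam_pow F ((eps j - 1) div 2) * lam F = beta (- j)"
    "lam_pow F ((1 - eps i) div 2) = beta i"
    using assms(1,2) by (cases j; cases i; simp add: lam_pow_def theta_hb_iff)+
  have 2: "lam_pow F ((eps j - 1) div 2) * cj a * lam_pow F ((1 - eps i) div 2) = cj a * beta (- j) * rho i"
    unfolding 1(1)[symmetric] 1(2) by (subst rho_lam(1)[symmetric]) (simp only: mult_ac)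
  have 3: "cj (beta (- j)) * beta (- j) = 1" using beta_unit[of "- j"] assms(2)
    by (simp add: theta_hb_iff mult.commute)
  show ?thesis
    unfolding T_short_def 2 using assms
    by (simp add: matrix_eq matrix_vector_mult_add_rdistrib matrix_vector_mult_diff_rdistrib
          munit_apply transv_apply B_lin theta_hb_iff)
       (simp add: vec_eq_iff mult_ac absorb_prod[OF 3])
qed

lemma T_long_transv:
  assumes "i \<in> theta_hb"
  shows "T_long F i (x, y) = transv (ax i) ((x * cj (rho i)) *s ax Mid) (y * cj (rho i))"
proof -
  have 1: "lam_pow F (- ((1 + eps i) div 2)) = rho i"
    using assms by (cases i) (simp_all add: lam_pow_def theta_hb_iff rho_def)
  have 2: "rho i * cj (rho i) = 1" using rho_unit[of i] assms by (simp add: theta_hb_iff)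
  show ?thesis
    unfolding T_long_def 1 using assms
    by (simp add: matrix_eq matrix_vector_mult_add_rdistrib matrix_vector_mult_diff_rdistrib
          munit_apply transv_apply B_lin theta_hb_iff)
       (simp add: vec_eq_iff mult_ac absorb_prod[OF 2])
qed

end

section \<open>Ideals, form parameters and elementary generators\<close>

lemma is_ideal_iff:
  "is_ideal I \<longleftrightarrow> 0 \<in> I \<and> (\<forall>x\<in>I. \<forall>y\<in>I. x + y \<in> I) \<and> (\<forall>c. \<forall>x\<in>I. c * x \<in> I)"
  for I :: "'a::comm_ring_1 set"
  by (rule module.subspace_def[OF module_self])

lemma ideal_zero: "is_ideal I \<Longrightarrow> 0 \<in> I" for I :: "'a::comm_ring_1 set"
  by (simp add: is_ideal_iff)

lemma ideal_add: "is_ideal I \<Longrightarrow> x \<in> I \<Longrightarrow> y \<in> I \<Longrightarrow> x + y \<in> I" for I :: "'a::comm_ring_1 set"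
  by (simp add: is_ideal_iff)

lemma ideal_mult: "is_ideal I \<Longrightarrow> x \<in> I \<Longrightarrow> c * x \<in> I" for I :: "'a::comm_ring_1 set"
  by (simp add: is_ideal_iff)

lemma ideal_mult': "is_ideal I \<Longrightarrow> x \<in> I \<Longrightarrow> x * c \<in> I" for I :: "'a::comm_ring_1 set"
  using ideal_mult[of I x c] by (simp add: mult.commute)

lemma ideal_neg: "is_ideal I \<Longrightarrow> x \<in> I \<Longrightarrow> - x \<in> I" for I :: "'a::comm_ring_1 set"
  using ideal_mult[of I x "-1"] by simp

lemma ideal_diff: "is_ideal I \<Longrightarrow> x \<in> I \<Longrightarrow> y \<in> I \<Longrightarrow> x - y \<in> I" for I :: "'a::comm_ring_1 set"
  using ideal_add[of I x "- y"] ideal_neg by fastforce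

lemma ideal_sum:
  "is_ideal I \<Longrightarrow> (\<And>x. x \<in> A \<Longrightarrow> f x \<in> I) \<Longrightarrow> sum f A \<in> I" for I :: "'a::comm_ring_1 set"
  by (induction A rule: infinite_finite_induct) (auto intro: ideal_zero ideal_add)

lemmas ideal_intros = ideal_zero ideal_add ideal_mult ideal_mult' ideal_neg ideal_diff ideal_sum

lemma ideal_generated_ideal: "is_ideal (ideal_generated S)"
  by (rule module.subspace_span[OF module_self])

lemma ideal_generated_base: "x \<in> S \<Longrightarrow> x \<in> ideal_generated S"
  by (rule module.span_base[OF module_self])

lemma ideal_generated_least: "is_ideal I \<Longrightarrow> S \<subseteq> I \<Longrightarrow> ideal_generated S \<subseteq> I"
  by (rule module.span_minimal[OF module_self])

lemma ideal_prod_ideal: "is_ideal (ideal_prod I J)"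
  by (simp add: ideal_prod_def ideal_generated_ideal)

lemma ideal_prod_mult: "a \<in> I \<Longrightarrow> b \<in> J \<Longrightarrow> a * b \<in> ideal_prod I J"
  unfolding ideal_prod_def by (rule ideal_generated_base) auto

lemma ideal_prod_least:
  "is_ideal K \<Longrightarrow> (\<And>a b. a \<in> I \<Longrightarrow> b \<in> J \<Longrightarrow> a * b \<in> K) \<Longrightarrow> ideal_prod I J \<subseteq> K"
  unfolding ideal_prod_def by (rule ideal_generated_least) auto

lemma ideal_UNIV: "is_ideal UNIV"
  by (simp add: is_ideal_iff)

lemma ideal_pow_ideal: "is_ideal (ideal_pow I k)"
  by (cases k) (simp_all add: ideal_UNIV ideal_prod_ideal)

lemma ideal_pow_Suc_mult: "a \<in> I \<Longrightarrow> b \<in> ideal_pow I k \<Longrightarrow> a * b \<in> ideal_pow I (Suc k)"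
  by (simp add: ideal_prod_mult)

lemma ideal_pow_Suc_subset: "ideal_pow I (Suc k) \<subseteq> ideal_pow I k"
  by (simp add: ideal_prod_least ideal_pow_ideal ideal_mult)

lemma ideal_pow_antimono: "k \<le> l \<Longrightarrow> ideal_pow I l \<subseteq> ideal_pow I k"
  by (induction l rule: dec_induct) (use ideal_pow_Suc_subset in blast)+

context hermitian_ring
begin

lemma involution_invariantD: "involution_invariant F I \<Longrightarrow> x \<in> I \<Longrightarrow> cj x \<in> I"
  by (simp add: involution_invariant_def)

lemma cj_ideal_generated:
  assumes "\<And>x. x \<in> S \<Longrightarrow> cj x \<in> ideal_generated S"
  shows "involution_invariant F (ideal_generated S)"
proof -
  have "ideal_generated S \<subseteq> {x. cj x \<in> ideal_generated S}"
    by (rule ideal_generated_least)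
      (use assms ideal_generated_ideal in \<open>auto simp: is_ideal_iff\<close>)
  then show ?thesis by (auto simp: involution_invariant_def)
qed

lemma cj_ideal_prod:
  assumes "involution_invariant F I" "involution_invariant F J"
  shows "involution_invariant F (ideal_prod I J)"
  unfolding ideal_prod_def
  by (rule cj_ideal_generated, rule ideal_generated_base)
    (use assms in \<open>auto simp: involution_invariant_def, metis\<close>)

lemma cj_ideal_pow: "involution_invariant F I \<Longrightarrow> involution_invariant F (ideal_pow I k)"
  by (induction k) (simp_all add: cj_ideal_prod, simp add: involution_invariant_def)

lemma heis_submodule_circ:
  assumes "is_ideal K"
  shows "heis_submodule F (heis_circ F A K)"
  unfolding heis_submodule_def
proof (intro conjI ballI allI)
  show "subgroup (heis_circ F A K) (heis F)"
    unfolding heis_circ_def by (rule heis.generate_is_subgroup) simp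
  fix \<alpha> a assume "\<alpha> \<in> heis_circ F A K"
  then show "heis_act F \<alpha> a \<in> heis_circ F A K"
    unfolding heis_circ_def
  proof (induction rule: generate.induct)
    case one
    show ?case using generate.one[of "heis F"] by simp
  next
    case (incl h)
    then obtain \<beta> b where "h = heis_act F \<beta> b" "\<beta> \<in> A" "b \<in> K" by auto
    then have "heis_act F h a = heis_act F \<beta> (b * a)" "b * a \<in> K"
      using assms by (auto simp: heis_act_act ideal_mult')
    with \<open>\<beta> \<in> A\<close> show ?case by (simp only:) (rule generate.incl, blast)
  next
    case (inv h)
    then obtain \<beta> b where "h = heis_act F \<beta> b" "\<beta> \<in> A" "b \<in> K" by auto
    then have "heis_act F (inv\<^bsub>heis F\<^esub> h) a = inv\<^bsub>heis F\<^esub> (heis_act F \<beta> (b * a))" "b * a \<in> K"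
      using assms by (auto simp: heis_act_act heis_act_inv ideal_mult' simp del: heis_inv)
    with \<open>\<beta> \<in> A\<close> show ?case by (simp only:) (rule generate.inv, blast)
  next
    case (eng h1 h2)
    then show ?case by (simp only: heis_act_mult generate.eng)
  qed
qed

lemma heis_circ_base: "\<alpha> \<in> A \<Longrightarrow> b \<in> K \<Longrightarrow> heis_act F \<alpha> b \<in> heis_circ F A K"
  unfolding heis_circ_def by (rule generate.incl) blast

lemma heis_circ_least:
  assumes "subgroup S (heis F)" "\<And>\<alpha> b. \<alpha> \<in> A \<Longrightarrow> b \<in> K \<Longrightarrow> heis_act F \<alpha> b \<in> S"
  shows "heis_circ F A K \<subseteq> S"
  unfolding heis_circ_def by (rule heis.generate_subgroup_incl[OF _ assms(1)]) (use assms(2) in blast)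

lemma heis_submoduleI:
  assumes "(0, 0) \<in> X" "\<And>\<alpha> \<beta>. \<alpha> \<in> X \<Longrightarrow> \<beta> \<in> X \<Longrightarrow> \<alpha> \<otimes>\<^bsub>heis F\<^esub> \<beta> \<in> X"
    "\<And>\<alpha>. \<alpha> \<in> X \<Longrightarrow> inv\<^bsub>heis F\<^esub> \<alpha> \<in> X" "\<And>\<alpha> a. \<alpha> \<in> X \<Longrightarrow> heis_act F \<alpha> a \<in> X"
  shows "heis_submodule F X"
proof -
  have "subgroup X (heis F)"
  proof (rule heis.subgroupI)
    show "X \<noteq> {}" using assms(1) by auto
  qed (simp, rule assms(3), assumption, rule assms(2))
  then show ?thesis using assms(4) by (simp add: heis_submodule_def)
qed

lemma heis_submoduleD:
  assumes "heis_submodule F X"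
  shows "subgroup X (heis F)" "(0, 0) \<in> X" "\<alpha> \<in> X \<Longrightarrow> \<beta> \<in> X \<Longrightarrow> \<alpha> \<otimes>\<^bsub>heis F\<^esub> \<beta> \<in> X"
    "\<alpha> \<in> X \<Longrightarrow> inv\<^bsub>heis F\<^esub> \<alpha> \<in> X" "\<alpha> \<in> X \<Longrightarrow> heis_act F \<alpha> a \<in> X"
proof -
  show *: "subgroup X (heis F)" and "\<alpha> \<in> X \<Longrightarrow> heis_act F \<alpha> a \<in> X"
    using assms by (simp_all add: heis_submodule_def)
  show "(0, 0) \<in> X" using subgroup.one_closed[OF *] by simp
  show "\<alpha> \<in> X \<Longrightarrow> \<beta> \<in> X \<Longrightarrow> \<alpha> \<otimes>\<^bsub>heis F\<^esub> \<beta> \<in> X" by (rule subgroup.m_closed[OF *])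
  show "\<alpha> \<in> X \<Longrightarrow> inv\<^bsub>heis F\<^esub> \<alpha> \<in> X" by (rule subgroup.m_inv_closed[OF *])
qed

lemma set_mult_memI: "a \<in> X \<Longrightarrow> b \<in> Y \<Longrightarrow> a \<otimes>\<^bsub>G\<^esub> b \<in> X <#>\<^bsub>G\<^esub> Y"
  unfolding set_mult_def by blast

lemma set_mult_memE:
  assumes "x \<in> X <#>\<^bsub>G\<^esub> Y"
  obtains a b where "x = a \<otimes>\<^bsub>G\<^esub> b" "a \<in> X" "b \<in> Y"
  using assms unfolding set_mult_def by blast

lemma heis_submodule_set_mult:
  assumes X: "heis_submodule F X" and Y: "heis_submodule F Y"
    and norm: "\<And>a b. a \<in> X \<Longrightarrow> b \<in> Y \<Longrightarrow> b \<otimes>\<^bsub>heis F\<^esub> a \<otimes>\<^bsub>heis F\<^esub> inv\<^bsub>heis F\<^esub> b \<in> X"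
  shows "heis_submodule F (X <#>\<^bsub>heis F\<^esub> Y)"
proof (rule heis_submoduleI)
  let ?m = "(\<otimes>\<^bsub>heis F\<^esub>)" and ?i = "\<lambda>x. inv\<^bsub>heis F\<^esub> x"
  have "?m (0, 0) (0, 0) \<in> X <#>\<^bsub>heis F\<^esub> Y"
    by (intro set_mult_memI heis_submoduleD(2)[OF X] heis_submoduleD(2)[OF Y])
  then show "(0, 0) \<in> X <#>\<^bsub>heis F\<^esub> Y" by simp
  fix x assume "x \<in> X <#>\<^bsub>heis F\<^esub> Y"
  then obtain a b where x: "x = ?m a b" "a \<in> X" "b \<in> Y" by (rule set_mult_memE)
  have "?i x = ?m (?m (?m (?i b) (?i a)) (?i (?i b))) (?i b)"
    unfolding x by (cases a; cases b) (simp add: algebra_simps)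
  moreover have "?m (?m (?i b) (?i a)) (?i (?i b)) \<in> X"
    by (intro norm heis_submoduleD(4)[OF X] heis_submoduleD(4)[OF Y] x)
  ultimately show "?i x \<in> X <#>\<^bsub>heis F\<^esub> Y"
    using set_mult_memI heis_submoduleD(4)[OF Y x(3)] by metis
  show "heis_act F x r \<in> X <#>\<^bsub>heis F\<^esub> Y" for r
    unfolding x(1) heis_act_mult by (intro set_mult_memI heis_submoduleD(5)[OF X] heis_submoduleD(5)[OF Y] x)
  fix y assume "y \<in> X <#>\<^bsub>heis F\<^esub> Y"
  then obtain a' b' where y: "y = ?m a' b'" "a' \<in> X" "b' \<in> Y" by (rule set_mult_memE)
  have "?m x y = ?m (?m a (?m (?m b a') (?i b))) (?m b b')"
    unfolding x y by (cases a; cases b; cases a'; cases b') (simp add: algebra_simps)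
  moreover have "?m a (?m (?m b a') (?i b)) \<in> X"
    by (intro norm heis_submoduleD(3)[OF X] x y)
  moreover have "?m b b' \<in> Y" by (intro heis_submoduleD(3)[OF Y] x y)
  ultimately show "?m x y \<in> X <#>\<^bsub>heis F\<^esub> Y" using set_mult_memI by metis
qed

lemma tr0_add: "tr0 x \<otimes>\<^bsub>heis F\<^esub> tr0 y = tr0 (x + y)"
  by (simp add: tr0_def algebra_simps)

lemma tr0_inv: "inv\<^bsub>heis F\<^esub> tr0 x = tr0 (- x)"
  by (simp add: tr0_def)

lemma tr0_zero: "tr0 0 = (0, 0)"
  by (simp add: tr0_def)

lemma tr0_act: "heis_act F (tr0 x) a = tr0 (x * (cj a * a))"
  by (simp add: tr0_def algebra_simps)

lemma tr0_central: "\<alpha> \<otimes>\<^bsub>heis F\<^esub> tr0 x = tr0 x \<otimes>\<^bsub>heis F\<^esub> \<alpha>"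
  by (cases \<alpha>) (simp add: tr0_def)

lemma heis_submodule_tr0:
  assumes "is_ideal I" shows "heis_submodule F (tr0 ` I)"
proof (rule heis_submoduleI)
  show "(0, 0) \<in> tr0 ` I" using ideal_zero[OF assms] tr0_zero by (metis image_eqI)
qed (use assms in \<open>auto simp: tr0_add tr0_inv tr0_act simp del: heis_mult heis_inv intro!: imageI ideal_intros\<close>)

end

context hermitian_form_ring
begin

lemma Omega_min_eq: "Omega_min F I = tr0 ` I <#>\<^bsub>heis F\<^esub> heis_circ F (Delta F) I"
  unfolding Omega_min_def tr0_def image_def by (rule arg_cong2[where f = "(<#>\<^bsub>heis F\<^esub>)"]) auto

lemma Omega_min_submodule:
  assumes "is_ideal I"
  shows "heis_submodule F (Omega_min F I)"
  unfolding Omega_min_eq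
proof (rule heis_submodule_set_mult[OF heis_submodule_tr0[OF assms] heis_submodule_circ[OF assms]])
  fix a b assume a: "a \<in> tr0 ` I"
  then have "b \<otimes>\<^bsub>heis F\<^esub> a \<otimes>\<^bsub>heis F\<^esub> inv\<^bsub>heis F\<^esub> b = a"
    by (cases b) (auto simp: tr0_def)
  with a show "b \<otimes>\<^bsub>heis F\<^esub> a \<otimes>\<^bsub>heis F\<^esub> inv\<^bsub>heis F\<^esub> b \<in> tr0 ` I" by simp
qed

lemma tr0_in_Omega_min: "is_ideal I \<Longrightarrow> x \<in> I \<Longrightarrow> tr0 x \<in> Omega_min F I"
  unfolding Omega_min_eq
  using set_mult_memI[of "tr0 x" "tr0 ` I" "(0, 0)" "heis_circ F (Delta F) I" "heis F"]
    heis_submoduleD(2)[OF heis_submodule_circ[of I "Delta F"]] by (simp add: tr0_def)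

lemma act_in_Omega_min:
  assumes "is_ideal I" "x \<in> I" "\<alpha> \<in> Delta F"
  shows "heis_act F \<alpha> x \<in> Omega_min F I"
proof -
  have "tr0 0 \<otimes>\<^bsub>heis F\<^esub> heis_act F \<alpha> x \<in> Omega_min F I"
    unfolding Omega_min_eq
    by (intro set_mult_memI imageI ideal_zero[OF assms(1)] heis_circ_base assms)
  then show ?thesis by (cases \<alpha>) (simp add: tr0_def)
qed

text \<open>The smallest form parameter of level \<open>I\<close> is generated, as a group, by two kinds of elements, so inclusions
  are checked on these.\<close>
lemma Omega_min_least:
  assumes "subgroup S (heis F)" "\<And>x. x \<in> I \<Longrightarrow> tr0 x \<in> S"
    "\<And>\<alpha> x. \<alpha> \<in> Delta F \<Longrightarrow> x \<in> I \<Longrightarrow> heis_act F \<alpha> x \<in> S"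
  shows "Omega_min F I \<subseteq> S"
proof -
  have "heis_circ F (Delta F) I \<subseteq> S" by (rule heis_circ_least) (use assms in auto)
  then show ?thesis unfolding Omega_min_eq
    using subgroup.m_closed[OF assms(1)] assms(2) by (blast elim: set_mult_memE)
qed

lemma Omega_min_Delta: "Omega_min F I \<subseteq> Delta F"
  by (rule Omega_min_least[OF Delta_subgroup]) (simp_all add: Delta_tr0 Delta_act)

text \<open>The element \<open>(x, cj z * lam F)\<close> is the inverse of \<open>(x, z)\<close> acted on by \<open>- 1\<close>, by the equation that defines
  the largest form parameter.\<close>
lemma submodule_sharp:
  assumes "heis_submodule F \<Omega>" "\<Omega> \<subseteq> Delta F" "(x, z) \<in> \<Omega>"
  shows "(x, cj z * lam F) \<in> \<Omega>"
proof -
  have "heis_act F (inv\<^bsub>heis F\<^esub> (x, z)) (- 1) \<in> \<Omega>"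
    by (intro heis_submoduleD(5)[OF assms(1)] heis_submoduleD(4)[OF assms(1)] assms(3))
  moreover have "- z - cj x * mu F * x = cj z * lam F"
    using Delta_maxD[of x z] assms by (auto simp: add_eq_0_iff)
  ultimately show ?thesis by simp
qed

text \<open>Rescaling by the unit \<open>rho i\<close> removes the sign of the form parameter. For positive \<open>i\<close> the parameter set
  is twisted by \<open>bar\<close>, and \<open>submodule_sharp\<close> undoes the twist.\<close>
lemma T_long_param:
  assumes "heis_submodule F \<Omega>" "\<Omega> \<subseteq> Delta F" "i \<in> theta_hb"
  shows "(x * rho i, z * rho i) \<in> param_pow F \<Omega> (- eps i) \<longleftrightarrow> (x, z) \<in> \<Omega>"
proof (cases i)
  case (Pos k)
  have "(x, z) \<in> \<Omega>" if "(x * cj (lam F), cj z * lam F) \<in> \<Omega>"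
    using heis_submoduleD(5)[OF assms(1) submodule_sharp[OF assms(1,2) that], of "lam F"]
    by (simp add: mult_ac lam_absorb)
  moreover have "(x * cj (lam F), cj z * lam F) \<in> \<Omega>" if "(x, z) \<in> \<Omega>"
    using heis_submoduleD(5)[OF assms(1) submodule_sharp[OF assms(1,2) that], of "cj (lam F)"]
    by (simp add: mult_ac lam_absorb)
  ultimately show ?thesis using Pos by (auto simp: param_pow_def rho_def)
qed (use assms(3) in \<open>simp_all add: param_pow_def rho_def theta_hb_iff\<close>)

lemma T_long_transv_rho:
  assumes "i \<in> theta_hb"
  shows "T_long F i (x * rho i, z * rho i) = transv (ax i) (x *s ax Mid) z"
  using rho_unit[of i] assms by (simp add: T_long_transv theta_hb_iff mult.assoc)

lemma T_long_params:
  assumes "heis_submodule F \<Omega>" "\<Omega> \<subseteq> Delta F" "i \<in> theta_hb"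
  shows "{T_long F i \<alpha> | \<alpha>. \<alpha> \<in> param_pow F \<Omega> (- eps i)} = {transv (ax i) (x *s ax Mid) z | x z. (x, z) \<in> \<Omega>}"
proof (intro equalityI subsetI)
  fix t assume "t \<in> {T_long F i \<alpha> | \<alpha>. \<alpha> \<in> param_pow F \<Omega> (- eps i)}"
  then obtain x y where t: "t = T_long F i (x, y)" "(x, y) \<in> param_pow F \<Omega> (- eps i)" by auto
  define x' z' where "x' = x * cj (rho i)" and "z' = y * cj (rho i)"
  have "x' * rho i = x" "z' * rho i = y"
    using rho_unit[of i] assms(3) by (simp_all add: x'_def z'_def theta_hb_iff mult_ac)
  then show "t \<in> {transv (ax i) (x *s ax Mid) z | x z. (x, z) \<in> \<Omega>}"
    using T_long_param[OF assms, of x' z'] T_long_transv_rho[OF assms(3), of x' z'] t by auto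
next
  fix t assume "t \<in> {transv (ax i) (x *s ax Mid) z | x z. (x, z) \<in> \<Omega>}"
  then obtain x z where t: "t = transv (ax i) (x *s ax Mid) z" "(x, z) \<in> \<Omega>" by blast
  have "t = T_long F i (x * rho i, z * rho i)" using T_long_transv_rho[OF assms(3)] t by simp
  then show "t \<in> {T_long F i \<alpha> | \<alpha>. \<alpha> \<in> param_pow F \<Omega> (- eps i)}"
    using T_long_param[OF assms, of x z] t(2) by blast
qed

lemma T_short_params:
  assumes "is_ideal I" "involution_invariant F I" "i \<in> theta_hb" "j \<in> theta_hb" "i \<noteq> j" "i \<noteq> - j"
  shows "{T_short F i j a | a. a \<in> I} = {transv (ax i) (x *s ax (- j)) 0 | x. x \<in> I}"
proof (intro equalityI subsetI)
  fix t assume "t \<in> {T_short F i j a | a. a \<in> I}"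
  then obtain a where "t = T_short F i j a" "a \<in> I" by auto
  then have "t = transv (ax i) ((- (cj a * beta (- j))) *s ax (- j)) 0" "- (cj a * beta (- j)) \<in> I"
    using T_short_transv[OF assms(3-6)] assms(1,2) by (auto intro: ideal_intros involution_invariantD)
  then show "t \<in> {transv (ax i) (x *s ax (- j)) 0 | x. x \<in> I}" by blast
next
  fix t assume "t \<in> {transv (ax i) (x *s ax (- j)) 0 | x. x \<in> I}"
  then obtain x where x: "t = transv (ax i) (x *s ax (- j)) 0" "x \<in> I" by auto
  define a where "a = - (cj x * beta (- j))"
  have "cj a * beta (- j) = - x"
    using beta_unit[of "- j"] assms(4) by (simp add: a_def theta_hb_iff mult_ac)
  then have "- (cj a * beta (- j)) = x" by simp
  then have "t = T_short F i j a" using T_short_transv[OF assms(3-6), of a] x by simp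
  moreover have "a \<in> I" unfolding a_def using assms(1,2) x(2) by (auto intro: ideal_intros involution_invariantD)
  ultimately show "t \<in> {T_short F i j a | a. a \<in> I}" by blast
qed

text \<open>In terms of transvections the elementary group of level \<open>(I, \<Omega>)\<close> no longer involves the unit factors or
  the signs of the indices, because \<open>I\<close> and \<open>\<Omega>\<close> absorb them.\<close>
lemma EU_eq:
  assumes "is_ideal I" "involution_invariant F I" "heis_submodule F \<Omega>" "\<Omega> \<subseteq> Delta F"
  shows "(EU F (I, \<Omega>) :: ('a, 'n::finite) tmat set) = generate (U F)
    ({transv (ax i) (x *s ax j) 0 | i j x. i \<noteq> Mid \<and> j \<noteq> Mid \<and> i \<noteq> j \<and> i \<noteq> - j \<and> x \<in> I} \<union>
     {transv (ax i) (x *s ax Mid) z | i x z. i \<noteq> Mid \<and> (x, z) \<in> \<Omega>})"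
proof -
  have "{T_short F i j x | i j x. i \<in> theta_hb \<and> j \<in> theta_hb \<and> i \<noteq> j \<and> i \<noteq> - j \<and> x \<in> I}
    = (\<Union>i\<in>theta_hb. \<Union>j\<in>{j \<in> theta_hb. i \<noteq> j \<and> i \<noteq> - j}. {T_short F i j a | a. a \<in> I} :: ('a, 'n) tmat set)"
    by blast
  also have "\<dots> = (\<Union>i\<in>theta_hb. \<Union>j\<in>{j \<in> theta_hb. i \<noteq> j \<and> i \<noteq> - j}. {transv (ax i) (x *s ax (- j)) 0 | x. x \<in> I})"
    using T_short_params[OF assms(1,2)] by (intro SUP_cong refl) blast
  also have "\<dots> = {transv (ax i) (x *s ax j) 0 | i j x. i \<noteq> Mid \<and> j \<noteq> Mid \<and> i \<noteq> j \<and> i \<noteq> - j \<and> x \<in> I}"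
    (is "?L = ?R")
  proof (intro equalityI subsetI)
    fix t assume "t \<in> ?L"
    then obtain i j x where "t = transv (ax i) (x *s ax (- j)) 0" "i \<noteq> Mid" "j \<noteq> Mid" "i \<noteq> j" "i \<noteq> - j" "x \<in> I"
      by (auto simp: theta_hb_iff)
    moreover then have "- j \<noteq> Mid" "i \<noteq> - (- j)" by simp_all
    ultimately show "t \<in> ?R" by blast
  next
    fix t assume "t \<in> ?R"
    then obtain i j x where t: "t = transv (ax i) (x *s ax j) 0" "i \<noteq> Mid" "j \<noteq> Mid" "i \<noteq> j" "i \<noteq> - j" "x \<in> I"
      by blast
    then have "i \<in> theta_hb" "- j \<in> {j \<in> theta_hb. i \<noteq> j \<and> i \<noteq> - j}" "t = transv (ax i) (x *s ax (- (- j))) 0"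
      by (simp_all add: theta_hb_iff)
    with t(6) show "t \<in> ?L" by blast
  qed
  finally have 1: "{T_short F i j x | i j x. i \<in> theta_hb \<and> j \<in> theta_hb \<and> i \<noteq> j \<and> i \<noteq> - j \<and> x \<in> I}
    = ({transv (ax i) (x *s ax j) 0 | i j x. i \<noteq> Mid \<and> j \<noteq> Mid \<and> i \<noteq> j \<and> i \<noteq> - j \<and> x \<in> I} :: ('a, 'n) tmat set)" .
  have "{T_long F i \<alpha> | i \<alpha>. i \<in> theta_hb \<and> \<alpha> \<in> param_pow F \<Omega> (- eps i)}
    = (\<Union>i\<in>theta_hb. {T_long F i \<alpha> | \<alpha>. \<alpha> \<in> param_pow F \<Omega> (- eps i)} :: ('a, 'n) tmat set)" by blast
  also have "\<dots> = (\<Union>i\<in>theta_hb. {transv (ax i) (x *s ax Mid) z | x z. (x, z) \<in> \<Omega>})"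
    using T_long_params[OF assms(3,4)] by (intro SUP_cong refl) blast
  also have "\<dots> = {transv (ax i) (x *s ax Mid) z | i x z. i \<noteq> Mid \<and> (x, z) \<in> \<Omega>}"
  proof -
    have hb: "theta_hb = {i :: 'n theta. i \<noteq> Mid}" by (auto simp: theta_hb_iff)
    show ?thesis unfolding hb by blast
  qed
  finally show ?thesis unfolding EU_def prod.case 1 by simp
qed

end

section \<open>Subgroups normalised by an elementary group\<close>

text \<open>The index pairs \<open>(i, j)\<close> of the short roots.\<close>
definition apart :: "'n theta \<Rightarrow> 'n theta \<Rightarrow> bool" where
  "apart i j \<longleftrightarrow> i \<noteq> Mid \<and> j \<noteq> Mid \<and> i \<noteq> j \<and> i \<noteq> - j"

lemma apartD:
  assumes "apart i j"
  shows "i \<noteq> Mid" "j \<noteq> Mid" "i \<noteq> j" "j \<noteq> i" "i \<noteq> - j" "- j \<noteq> i" "j \<noteq> - i" "- i \<noteq> j"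
  using assms unfolding apart_def by auto

lemma apart_sym: "apart i j \<Longrightarrow> apart j i"
  by (auto simp: apart_def)

lemma apart_uminus [simp]: "apart (- i) j \<longleftrightarrow> apart i j" "apart i (- j) \<longleftrightarrow> apart i j"
  unfolding apart_def by (metis theta_uminus_uminus theta_uminus_Mid_iff(1))+

context hermitian_ring
begin

lemma transv_intertwine:
  assumes "isometry g"
  shows "g ** transv u v z = transv (g *v u) (g *v v) z ** g"
proof (subst matrix_eq, rule allI)
  fix w
  have *: "B (g *v x) (g *v w) = B x w" "C (g *v x) (g *v w) = C x w" for x
    using assms unfolding isometry_def C_eq by metis+
  show "(g ** transv u v z) *v w = (transv (g *v u) (g *v v) z ** g) *v w"
    unfolding matrix_vector_mul_assoc[symmetric] transv_apply
    by (simp add: * matrix_vector_right_distrib matrix_vector_mult_diff_distrib matrix_vector_smult)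
qed

lemma transv_commute:
  assumes "isometry g" "g *v u = u" "g *v v = v"
  shows "g ** transv u v z = transv u v z ** g"
  using transv_intertwine[OF assms(1), of u v z] assms by simp

lemma transv_add_left:
  assumes "B v v = 0" "B v u = 0" "B v u' = 0" "B u u' = 0"
  shows "transv (u + u') v 0 = transv u v 0 ** transv u' v 0"
proof -
  have "transv (u + u') v 0 = transv v (- (lam F *s u) + - (lam F *s u')) 0"
    by (subst transv_swap) (simp add: vector_add_ldistrib)
  also have "\<dots> = transv v (- (lam F *s u)) 0 ** transv v (- (lam F *s u')) 0"
    using assms by (subst transv_mult) (simp_all add: B_lin)
  also have "\<dots> = transv u v 0 ** transv u' v 0"
    by (simp add: transv_swap[symmetric])
  finally show ?thesis .
qed

lemma transv_add_right:
  assumes "B u u = 0" "B u v = 0" "B u v' = 0" "B v v' = 0"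
  shows "transv u (v + v') 0 = transv u v 0 ** transv u v' 0"
  using assms by (simp add: transv_mult)

lemma short_apply:
  "transv (ax i) (x *s ax j) 0 *v w
     = w + (rho i * w $ (- i) * x) *s ax j - (cj x * beta j * w $ (- j)) *s ax i"
  by (simp add: transv_apply B_lin vec_eq_iff)

declare ax_nth [simp]

lemma isometry_mult: "isometry g \<Longrightarrow> isometry h \<Longrightarrow> isometry (g ** h)"
  by (simp add: isometry_def matrix_vector_mul_assoc[symmetric])

end

lemma (in Group.group) normalizer_iff:
  assumes X: "X \<subseteq> carrier G"
  shows "g \<in> normalizer G X \<longleftrightarrow> g \<in> carrier G \<and> (\<forall>x\<in>X. g \<otimes> x \<otimes> inv g \<in> X \<and> inv g \<otimes> x \<otimes> g \<in> X)"
proof -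
  have conj: "g <# X #> inv g = (\<lambda>x. g \<otimes> x \<otimes> inv g) ` X" for g
    by (auto simp: l_coset_def r_coset_def)
  have "(\<lambda>x. g \<otimes> x \<otimes> inv g) ` X = X \<longleftrightarrow> (\<forall>x\<in>X. g \<otimes> x \<otimes> inv g \<in> X \<and> inv g \<otimes> x \<otimes> g \<in> X)"
    if g: "g \<in> carrier G" for g
  proof
    have c: "inv g \<otimes> (g \<otimes> x \<otimes> inv g) \<otimes> g = x" "g \<otimes> (inv g \<otimes> x \<otimes> g) \<otimes> inv g = x" if "x \<in> carrier G" for x
      using g that by (simp_all add: m_assoc) (simp_all add: m_assoc[symmetric])
    show "\<forall>x\<in>X. g \<otimes> x \<otimes> inv g \<in> X \<and> inv g \<otimes> x \<otimes> g \<in> X" if "(\<lambda>x. g \<otimes> x \<otimes> inv g) ` X = X"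
    proof (intro ballI conjI)
      fix x assume x: "x \<in> X"
      show "g \<otimes> x \<otimes> inv g \<in> X" by (rule subsetD[OF equalityD1[OF that] imageI[OF x]])
      have "x \<in> (\<lambda>x. g \<otimes> x \<otimes> inv g) ` X" unfolding that by (rule x)
      then obtain y where y: "y \<in> X" "x = g \<otimes> y \<otimes> inv g" by (elim imageE)
      then show "inv g \<otimes> x \<otimes> g \<in> X" using c(1)[of y] X by auto
    qed
    show "(\<lambda>x. g \<otimes> x \<otimes> inv g) ` X = X" if "\<forall>x\<in>X. g \<otimes> x \<otimes> inv g \<in> X \<and> inv g \<otimes> x \<otimes> g \<in> X"
    proof (intro equalityI subsetI)
      fix x
      show "x \<in> X" if x: "x \<in> (\<lambda>x. g \<otimes> x \<otimes> inv g) ` X"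
        using x \<open>\<forall>x\<in>X. _\<close> by (elim imageE) simp
      assume x: "x \<in> X"
      then have "g \<otimes> (inv g \<otimes> x \<otimes> g) \<otimes> inv g = x" using c(2) X by blast
      moreover have "inv g \<otimes> x \<otimes> g \<in> X" using x \<open>\<forall>x\<in>X. _\<close> by simp
      ultimately show "x \<in> (\<lambda>x. g \<otimes> x \<otimes> inv g) ` X" by (rule image_eqI[OF sym])
    qed
  qed
  moreover have "g \<in> normalizer G X \<longleftrightarrow> g \<in> carrier G \<and> (\<lambda>x. g \<otimes> x \<otimes> inv g) ` X = X"
    unfolding conj[symmetric] using X by (auto simp: normalizer_def stabilizer_def)
  ultimately show ?thesis by blast
qed

text \<open>The elements that commute with \<open>s\<close> modulo \<open>X\<close> and normalise \<open>X\<close> form a subgroup, by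
  \<open>[s, t u] = [s, t] (t [s, u] t\<inverse>)\<close>. Hence a commutator condition on a generated group can be checked on
  generators.\<close>
lemma (in Group.group) commutator_subgroup:
  assumes X: "subgroup X G" and s: "s \<in> carrier G"
  shows "subgroup {t \<in> normalizer G X. s \<otimes> t \<otimes> inv s \<otimes> inv t \<in> X} G"
proof -
  have XC: "X \<subseteq> carrier G" by (rule subgroup.subset[OF X])
  note N = normalizer_imp_subgroup[OF XC]
  have NC: "t \<in> carrier G" if "t \<in> normalizer G X" for t using that subgroup.subset[OF N] by blast
  show ?thesis
  proof (rule subgroupI)
    show "{t \<in> normalizer G X. s \<otimes> t \<otimes> inv s \<otimes> inv t \<in> X} \<noteq> {}"
      using subgroup.one_closed[OF N] subgroup.one_closed[OF X] s by (auto intro!: exI[of _ \<one>])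
    show "{t \<in> normalizer G X. s \<otimes> t \<otimes> inv s \<otimes> inv t \<in> X} \<subseteq> carrier G" using NC by blast
  next
    fix t assume t: "t \<in> {t \<in> normalizer G X. s \<otimes> t \<otimes> inv s \<otimes> inv t \<in> X}"
    then have tC: "t \<in> carrier G" using NC by blast
    have "inv t \<otimes> inv (s \<otimes> t \<otimes> inv s \<otimes> inv t) \<otimes> t \<in> X"
      using t normalizer_iff[OF XC] subgroup.m_inv_closed[OF X] by blast
    moreover have "inv t \<otimes> inv (s \<otimes> t \<otimes> inv s \<otimes> inv t) \<otimes> t = s \<otimes> inv t \<otimes> inv s \<otimes> inv (inv t)"
      using s tC by (simp add: inv_mult_group m_assoc, simp add: m_assoc[symmetric])
    ultimately show "inv t \<in> {t \<in> normalizer G X. s \<otimes> t \<otimes> inv s \<otimes> inv t \<in> X}"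
      using t subgroup.m_inv_closed[OF N] by auto
  next
    fix t u assume t: "t \<in> {t \<in> normalizer G X. s \<otimes> t \<otimes> inv s \<otimes> inv t \<in> X}"
      and u: "u \<in> {t \<in> normalizer G X. s \<otimes> t \<otimes> inv s \<otimes> inv t \<in> X}"
    then have C: "t \<in> carrier G" "u \<in> carrier G" using NC by blast+
    have "(s \<otimes> t \<otimes> inv s \<otimes> inv t) \<otimes> (t \<otimes> (s \<otimes> u \<otimes> inv s \<otimes> inv u) \<otimes> inv t) \<in> X"
      using t u normalizer_iff[OF XC] subgroup.m_closed[OF X] by blast
    moreover have "(s \<otimes> t \<otimes> inv s \<otimes> inv t) \<otimes> (t \<otimes> (s \<otimes> u \<otimes> inv s \<otimes> inv u) \<otimes> inv t)
       = s \<otimes> (t \<otimes> u) \<otimes> inv s \<otimes> inv (t \<otimes> u)"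
    proof -
      have 1: "inv t \<otimes> (t \<otimes> x) = x" "inv s \<otimes> (s \<otimes> x) = x" if "x \<in> carrier G" for x
        using that s C by (simp_all add: m_assoc[symmetric])
      show ?thesis using s C by (simp add: inv_mult_group m_assoc 1)
    qed
    ultimately show "t \<otimes> u \<in> {t \<in> normalizer G X. s \<otimes> t \<otimes> inv s \<otimes> inv t \<in> X}"
      using t u subgroup.m_closed[OF N] by auto
  qed
qed

text \<open>The setting of the lower bound. At least three hyperbolic pairs are needed to choose, for any two hyperbolic
  indices, a third one that is apart from both.\<close>
locale subnormal = hermitian_form_ring F for F :: "'a::comm_ring_1 form_ring" +
  fixes I :: "'a set" and H :: "('a, 'n::finite) tmat set"
  assumes three: "3 \<le> CARD('n)"
    and I_ideal: "is_ideal I" and I_cj: "involution_invariant F I"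
    and H_subgroup: "subgroup H (U F)"
    and EU_normalizes: "EU F (I, Omega_min F I) \<subseteq> normalizer (U F) H"
begin

abbreviation iv :: "('a, 'n) tmat \<Rightarrow> ('a, 'n) tmat" where "iv g \<equiv> inv\<^bsub>U F\<^esub> g"

text \<open>The normaliser of \<open>H\<close>, in the elementwise form in which it is used.\<close>
definition N :: "('a, 'n) tmat set" where
  "N = {g \<in> carrier (U F). \<forall>h\<in>H. g ** h ** iv g \<in> H \<and> iv g ** h ** g \<in> H}"

lemma H_U: "h \<in> H \<Longrightarrow> h \<in> carrier (U F)"
  using subgroup.mem_carrier[OF H_subgroup] .

lemma H_mult: "g \<in> H \<Longrightarrow> h \<in> H \<Longrightarrow> g ** h \<in> H"
  using subgroup.m_closed[OF H_subgroup] by simp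

lemma H_inv: "h \<in> H \<Longrightarrow> iv h \<in> H"
  using subgroup.m_inv_closed[OF H_subgroup] .

lemma H_one: "mat 1 \<in> H"
  using subgroup.one_closed[OF H_subgroup] by simp

lemma N_U: "g \<in> N \<Longrightarrow> g \<in> carrier (U F)"
  by (simp add: N_def)

lemma N_conj: "g \<in> N \<Longrightarrow> h \<in> H \<Longrightarrow> g ** h ** iv g \<in> H" "g \<in> N \<Longrightarrow> h \<in> H \<Longrightarrow> iv g ** h ** g \<in> H"
  by (simp_all add: N_def)

lemma U_cancel:
  fixes g :: "('a, 'n) tmat"
  assumes "g \<in> carrier (U F)"
  shows "iv g ** (g ** h) = h" "g ** (iv g ** h) = h"
  using U_inv[OF assms] by (simp_all add: matrix_mul_assoc)

lemma H_cancel_left: assumes "x \<in> H" "x ** y \<in> H" shows "y \<in> H"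
  using H_mult[OF H_inv[OF assms(1)] assms(2)] by (simp add: U_cancel(1)[OF H_U[OF assms(1)]])

lemma H_cancel_right: assumes "y \<in> H" "x ** y \<in> H" shows "x \<in> H"
  using H_mult[OF assms(2) H_inv[OF assms(1)]] U_inv(1)[OF H_U[OF assms(1)]]
  by (simp add: matrix_mul_assoc[symmetric])

lemma U_inv_mult:
  fixes g h :: "('a, 'n) tmat"
  assumes "g \<in> carrier (U F)" "h \<in> carrier (U F)"
  shows "iv (g ** h) = iv h ** iv g"
  using Group.group.inv_mult_group[OF U_group assms] by simp

lemma U_inv_inv: "g \<in> carrier (U F) \<Longrightarrow> iv (iv g) = g"
  using Group.group.inv_inv[OF U_group] .

lemma U_mult_closed: "g \<in> carrier (U F) \<Longrightarrow> h \<in> carrier (U F) \<Longrightarrow> g ** h \<in> carrier (U F)"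
  for g h :: "('a, 'n) tmat"
  using monoid.m_closed[OF group.is_monoid[OF U_group], of g h] by simp

lemma N_mult: assumes "g \<in> N" "h \<in> N" shows "g ** h \<in> N"
proof -
  have "g ** (h ** x ** iv h) ** iv g \<in> H" "iv h ** (iv g ** x ** g) ** h \<in> H" if "x \<in> H" for x
    by (intro N_conj assms that)+
  then show ?thesis
    using N_U[OF assms(1)] N_U[OF assms(2)]
    by (simp add: N_def U_mult_closed U_inv_mult matrix_mul_assoc)
qed

lemma N_inv: "g \<in> N \<Longrightarrow> iv g \<in> N"
  by (simp add: N_def U_inv U_inv_inv)

lemma normalizer_N: "normalizer (U F) H \<subseteq> N"
  unfolding N_def using group.normalizer_iff[OF U_group subgroup.subset[OF H_subgroup]] by auto

lemma H_N: "h \<in> H \<Longrightarrow> h \<in> N"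
  by (simp add: N_def H_U H_mult H_inv)

lemma EU_N: "g \<in> EU F (I, Omega_min F I) \<Longrightarrow> g \<in> N"
  using EU_normalizes normalizer_N by blast

lemma N_gen:
  "apart i j \<Longrightarrow> x \<in> I \<Longrightarrow> transv (ax i) (x *s ax j) 0 \<in> N"
  "i \<noteq> Mid \<Longrightarrow> (x, z) \<in> Omega_min F I \<Longrightarrow> transv (ax i) (x *s ax Mid) z \<in> N"
proof -
  note eq = EU_eq[OF I_ideal I_cj Omega_min_submodule[OF I_ideal] Omega_min_Delta]
  show "transv (ax i) (x *s ax j) 0 \<in> N" if "apart i j" "x \<in> I"
    by (rule EU_N, subst eq, rule generate.incl) (use that in \<open>unfold apart_def, blast\<close>)
  show "transv (ax i) (x *s ax Mid) z \<in> N" if "i \<noteq> Mid" "(x, z) \<in> Omega_min F I"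
    by (rule EU_N, subst eq, rule generate.incl) (use that in blast)
qed

lemmas N_short = N_gen(1)

lemma N_tr:
  assumes "i \<noteq> Mid" "x \<in> I"
  shows "transv (ax i) 0 (x - cj x * lam F) \<in> N"
  using N_gen(2)[OF assms(1), of 0] tr0_in_Omega_min[OF I_ideal assms(2)] by (simp add: tr0_def)

lemma N_long:
  assumes "i \<noteq> Mid" "(y, z) \<in> Delta F" "a \<in> I"
  shows "transv (ax i) ((y * a) *s ax Mid) (cj a * z * a) \<in> N"
  using N_gen(2)[OF assms(1)] act_in_Omega_min[OF I_ideal assms(3,2)] by simp

lemma cj_I: "x \<in> I \<Longrightarrow> cj x \<in> I"
  using involution_invariantD[OF I_cj] .

lemma I_mult: "x \<in> I \<Longrightarrow> c * x \<in> I" "x \<in> I \<Longrightarrow> x * c \<in> I"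
  using ideal_mult[OF I_ideal] ideal_mult'[OF I_ideal] by auto

lemma U_conj_transv:
  fixes g :: "('a, 'n) tmat"
  assumes "g \<in> carrier (U F)"
  shows "g ** transv u v z ** iv g = transv (g *v u) (g *v v) z"
  by (rule transv_conj[OF U_D(1)[OF assms] U_inv(1)[OF assms]])

lemma U_inv_transv:
  assumes "transv u v z \<in> carrier (U F)" "B u u = 0" "B u v = 0"
  shows "iv (transv u v z) = transv u (- v) (- z - B v v)"
proof -
  have "iv (transv u v z) = iv (transv u v z) ** (transv u v z ** transv u (- v) (- z - B v v))"
    using transv_inverse[OF assms(2,3)] by simp
  then show ?thesis by (simp only: U_cancel(1)[OF assms(1)])
qed

lemma H_conj_transv: "g \<in> N \<Longrightarrow> transv u v z \<in> H \<Longrightarrow> transv (g *v u) (g *v v) z \<in> H"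
  using N_conj(1)[of g "transv u v z"] U_conj_transv[OF N_U] by simp

text \<open>The parameters of the short transvections in \<open>H\<close>, for one root position.\<close>
definition S :: "'n theta \<Rightarrow> 'n theta \<Rightarrow> 'a set" where
  "S i j = {x. transv (ax i) (x *s ax j) 0 \<in> H}"

lemma S_zero: "0 \<in> S i j"
  by (simp add: S_def H_one)

lemma S_add:
  assumes "apart i j" "x \<in> S i j" "y \<in> S i j"
  shows "x + y \<in> S i j"
proof -
  have "transv (ax i) ((x + y) *s ax j) 0 = transv (ax i) (x *s ax j) 0 ** transv (ax i) (y *s ax j) 0"
    using apartD[OF assms(1)] by (subst transv_mult) (simp_all add: B_lin vector_sadd_rdistrib)
  then show ?thesis using assms H_mult by (simp add: S_def)
qed

lemma S_swap: "x \<in> S i j \<longleftrightarrow> - (lam F * cj x) \<in> S j i"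
proof -
  have "cj x *s - (lam F *s ax i) = (- (lam F * cj x)) *s ax i" by (simp add: vec_eq_iff)
  then have "transv (ax i) (x *s ax j) 0 = transv (ax j) ((- (lam F * cj x)) *s ax i) 0"
    by (subst transv_swap, subst transv_smult_left) simp
  then show ?thesis by (simp add: S_def)
qed

text \<open>Conjugation by an elementary element of level \<open>I\<close> adds to \<open>ax j\<close> a multiple of \<open>ax m\<close>, and the
  original transvection cancels. This moves a parameter to a neighbouring root position at the cost of one
  factor from \<open>I\<close>.\<close>
lemma right_step:
  assumes "x \<in> S i j" "a \<in> I" "apart i j" "apart m i" "apart m j"
  shows "x * a \<in> S i m"
proof -
  note ap = apartD[OF assms(3)] apartD[OF assms(4)] apartD[OF assms(5)]
  define W where "W = transv (ax (- j)) ((a * cj (rho (- j))) *s ax m) 0"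
  have W: "W \<in> N" unfolding W_def using assms by (intro N_short I_mult) (simp_all add: apart_sym)
  have r: "rho (- j) * cj (rho (- j)) = 1" by (rule rho_unit) (use ap in simp)
  have Wi: "W *v ax i = ax i" using ap by (simp add: W_def short_apply ax_nth)
  have Wj: "W *v ax j = ax j + a *s ax m"
    using ap by (simp add: W_def short_apply ax_nth) (simp add: mult_ac absorb_prod[OF r])
  have "transv (ax i) (x *s ax j + (x * a) *s ax m) 0 \<in> H"
    using H_conj_transv[OF W, of "ax i" "x *s ax j" 0] assms(1)
    by (simp add: S_def Wi Wj matrix_vector_smult)
  also have "transv (ax i) (x *s ax j + (x * a) *s ax m) 0
      = transv (ax i) (x *s ax j) 0 ** transv (ax i) ((x * a) *s ax m) 0"
    using ap by (subst transv_mult) (simp_all add: B_lin)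
  finally show ?thesis using assms(1) unfolding S_def mem_Collect_eq by (rule H_cancel_left[rotated])
qed

lemma left_step:
  assumes "x \<in> S i j" "a \<in> I" "apart i j" "apart m i" "apart m j"
  shows "x * a \<in> S m j"
proof -
  have "- (lam F * cj x) \<in> S j i" using assms(1) by (rule S_swap[THEN iffD1])
  then have "- (lam F * cj x) * cj a \<in> S j m"
    by (rule right_step) (use assms in \<open>auto simp: cj_I apart_sym\<close>)
  then have "- (lam F * cj (- (lam F * cj x) * cj a)) \<in> S m j" by (rule S_swap[THEN iffD1])
  moreover have "- (lam F * cj (- (lam F * cj x) * cj a)) = x * a" by (simp add: mult_ac lam_absorb)
  ultimately show ?thesis by simp
qed

text \<open>The starting point of all extractions. The element \<open>\<xi> = \<sigma> \<tau>\<inverse> \<sigma>\<inverse>\<close> fixes \<open>u\<close>, because \<open>\<tau>\<close> fixes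
  \<open>\<sigma>\<inverse> u\<close>. With \<open>g = transv u v 0\<close> the product \<open>(\<tau>\<inverse> g \<tau>) (\<xi> g\<inverse> \<xi>\<inverse>)\<close> can be rewritten so that every
  occurrence of \<open>\<sigma>\<close> is inside a conjugate of an element of \<open>H\<close> by elements of \<open>N\<close>; its second factor is a
  transvection along \<open>u\<close>, whatever \<open>v\<close> becomes.\<close>
lemma parabolic:
  assumes "\<sigma> \<in> H" "\<tau> \<in> N" "transv u v 0 \<in> N" "B u u = 0" "B u v = 0" "B v v = 0"
    and fx: "\<tau> *v (iv \<sigma> *v u) = iv \<sigma> *v u"
  defines "v' \<equiv> \<sigma> *v (iv \<tau> *v (iv \<sigma> *v v))"
  shows "transv (iv \<tau> *v u) (iv \<tau> *v v) 0 ** transv u (- v') 0 \<in> H"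
    and "B u v' = 0" and "transv (iv \<tau> *v u) (iv \<tau> *v v) 0 \<in> carrier (U F)"
    and "transv u (- v') 0 \<in> carrier (U F)"
proof -
  let ?g = "transv u v 0"
  note U = H_U[OF assms(1)] N_U[OF assms(2)] N_U[OF assms(3)]
  note Ui = U[THEN U_inv(3)]
  define \<xi> where "\<xi> = \<sigma> ** (iv \<tau> ** iv \<sigma>)"
  have \<xi>U: "\<xi> \<in> carrier (U F)" unfolding \<xi>_def by (intro U_mult_closed U Ui)
  have \<xi>i: "iv \<xi> = \<sigma> ** (\<tau> ** iv \<sigma>)"
    unfolding \<xi>_def by (simp add: U Ui U_inv_mult U_mult_closed U_inv_inv matrix_mul_assoc)
  have fix': "iv \<tau> *v (iv \<sigma> *v u) = iv \<sigma> *v u"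
    using U_inv_apply(2)[OF U(2), of "iv \<sigma> *v u"] fx by simp
  have \<xi>u: "\<xi> *v u = u"
    by (simp add: fix' U_inv_apply[OF U(1)] \<xi>_def matrix_vector_mul_assoc[symmetric])
  have \<xi>v: "\<xi> *v v = v'" by (simp add: \<xi>_def v'_def matrix_vector_mul_assoc)
  have ig: "iv ?g = transv u (- v) 0" using U_inv_transv[OF U(3)] assms by simp
  have D: "\<xi> ** iv ?g ** iv \<xi> = transv u (- v') 0"
    unfolding ig U_conj_transv[OF \<xi>U] \<xi>u
    using matrix_vector_mult_diff_distrib[of \<xi> 0 v] \<xi>v by simp
  have X: "iv \<tau> ** ?g ** \<tau> = transv (iv \<tau> *v u) (iv \<tau> *v v) 0"
    using U_conj_transv[OF Ui(2), of u v 0] by (simp add: U_inv_inv[OF U(2)])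
  have 1: "?g ** (\<tau> ** \<sigma> ** iv \<tau> ** iv \<sigma>) ** iv ?g \<in> H"
    by (intro N_conj assms H_mult H_inv)
  have 2: "\<sigma> ** (\<tau> ** iv \<sigma> ** iv \<tau>) \<in> H"
    by (intro N_conj assms H_mult H_inv)
  have "iv \<tau> ** ((?g ** (\<tau> ** \<sigma> ** iv \<tau> ** iv \<sigma>) ** iv ?g) ** (\<sigma> ** (\<tau> ** iv \<sigma> ** iv \<tau>))) ** \<tau> \<in> H"
    by (intro N_conj(2)[OF assms(2)] H_mult 1 2)
  also have "iv \<tau> ** ((?g ** (\<tau> ** \<sigma> ** iv \<tau> ** iv \<sigma>) ** iv ?g) ** (\<sigma> ** (\<tau> ** iv \<sigma> ** iv \<tau>))) ** \<tau>
      = (iv \<tau> ** ?g ** \<tau>) ** (\<xi> ** iv ?g ** iv \<xi>)"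
    unfolding \<xi>i unfolding \<xi>_def by (simp add: matrix_mul_assoc[symmetric] U_inv[OF U(2)] U_cancel[OF U(2)])
  finally show "transv (iv \<tau> *v u) (iv \<tau> *v v) 0 ** transv u (- v') 0 \<in> H" unfolding X D .
  show "transv (iv \<tau> *v u) (iv \<tau> *v v) 0 \<in> carrier (U F)"
    unfolding X[symmetric] by (intro U_mult_closed U Ui)
  show "transv u (- v') 0 \<in> carrier (U F)"
    unfolding D[symmetric] by (intro U_mult_closed U Ui \<xi>U U_inv(3))
  have "B (\<xi> *v u) (\<xi> *v v) = B u v" using U_D(1)[OF \<xi>U] by (simp add: isometry_def)
  then show "B u v' = 0" using \<xi>u \<xi>v assms(5) by simp
qed

end

section \<open>Short transvections from products of column entries\<close>

context subnormal
begin

text \<open>Write the element of \<open>H\<close> provided by \<open>parabolic\<close> as \<open>A1 C1 D\<close>, where \<open>A1 C1\<close> is the transvection along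
  \<open>ax q\<close> and \<open>A1\<close> is its component in direction \<open>ax (- k)\<close>. Conjugation by \<open>h = transv (ax k) (a' *s ax (- r)) 0\<close>
  fixes the axes of all three factors and multiplies each by a root transvection. These three root
  transvections remain after \<open>A1 C1 D\<close> is cancelled; the unknown vector in \<open>D\<close> only affects \<open>\<zeta>\<close>.\<close>
lemma commutator_three_factors:
  assumes ap: "apart k q" "apart k r" "apart q r"
    and \<sigma>: "\<sigma> \<in> H" and \<tau>: "\<tau> \<in> N" "\<tau> *v (iv \<sigma> *v ax k) = iv \<sigma> *v ax k"
    and \<tau>k: "iv \<tau> *v ax k = ax k - (fp *s ax (- k) + fq *s ax q + fr *s ax r)"
    and \<tau>q: "iv \<tau> *v ax q = ax q"
    and a: "a \<in> I" "a' \<in> I"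
  shows "\<exists>\<kappa> \<zeta>. (fp = 0 \<longrightarrow> \<kappa> = 0) \<and>
    transv (ax q) (\<kappa> *s ax (- r)) 0 ** transv (ax q) ((- (cj a * lam F * fr * cj a' * beta (- r))) *s ax k) 0
      ** transv (ax k) (\<zeta> *s ax k) 0 \<in> H"
proof -
  note d = apartD[OF ap(1)] apartD[OF ap(2)] apartD[OF ap(3)]
  define v' where "v' = \<sigma> *v (iv \<tau> *v (iv \<sigma> *v (a *s ax q)))"
  \<comment> \<open>component of the second vector along the only basis vector that is not orthogonal to \<open>ax k\<close>\<close>
  define p1 where "p1 = (cj a * lam F * fp) *s ax (- k)"
  define v1 where "v1 = (cj a * lam F) *s (fq *s ax q + fr *s ax r - ax k)"
  define X where "X = transv (iv \<tau> *v ax k) (iv \<tau> *v (a *s ax q)) 0"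
  define D where "D = transv (ax k) (- v') 0"
  define A1 where "A1 = transv (ax q) p1 0"
  define C1 where "C1 = transv (ax q) v1 (B p1 v1)"
  have g: "transv (ax k) (a *s ax q) 0 \<in> N" by (rule N_short[OF ap(1) a(1)])
  have bs: "B (ax k) (ax k) = 0" "B (ax k) (a *s ax q) = 0" "B (a *s ax q) (a *s ax q) = 0"
    using d by (simp_all add: B_lin)
  note par = parabolic[OF \<sigma> \<tau>(1) g bs \<tau>(2), folded v'_def, folded X_def D_def]
  have XA: "X = A1 ** C1"
  proof -
    have "X = transv (ax k - (fp *s ax (- k) + fq *s ax q + fr *s ax r)) (a *s ax q) 0"
      by (simp add: X_def \<tau>k \<tau>q matrix_vector_smult)
    also have "\<dots> = transv (ax q) (cj a *s (- (lam F *s (ax k - (fp *s ax (- k) + fq *s ax q + fr *s ax r))))) 0"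
      by (subst transv_swap, subst transv_smult_left) simp
    also have "cj a *s (- (lam F *s (ax k - (fp *s ax (- k) + fq *s ax q + fr *s ax r)))) = p1 + v1"
      by (simp add: p1_def v1_def vec_eq_iff algebra_simps)
    also have "transv (ax q) (p1 + v1) 0 = A1 ** C1"
      unfolding A1_def C1_def using d by (subst transv_mult) (simp_all add: p1_def v1_def B_lin)
    finally show ?thesis .
  qed
  have A1N: "A1 \<in> N" unfolding A1_def p1_def
    using ap a by (intro N_short I_mult) (simp_all add: apart_sym cj_I)
  have C1eq: "C1 = iv A1 ** X" unfolding XA U_cancel(1)[OF N_U[OF A1N]] ..
  have isoC: "isometry C1" unfolding C1eq
    by (intro isometry_mult U_D(1) U_inv(3) N_U[OF A1N] par)
  define h where "h = transv (ax k) (a' *s ax (- r)) 0"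
  have hN: "h \<in> N" unfolding h_def using ap a by (intro N_short) simp_all
  have happ: "h *v w = w + (rho k * w $ (- k) * a') *s ax (- r) - (cj a' * beta (- r) * w $ r) *s ax k" for w
    by (simp add: h_def short_apply)
  have hq: "h *v ax q = ax q" and hk: "h *v ax k = ax k"
    using d by (simp_all add: happ)
  define \<kappa> where "\<kappa> = cj a * lam F * fp * rho k * a'"
  define \<psi> where "\<psi> = - (cj a * lam F * fr * cj a' * beta (- r))"
  have hp1: "h *v p1 = p1 + \<kappa> *s ax (- r)"
    unfolding happ using d by (simp add: p1_def \<kappa>_def mult_ac)
  have hv1: "h *v v1 = \<psi> *s ax k + v1"
    unfolding happ using d by (simp add: v1_def \<psi>_def mult_ac vector_smult_lneg)
  define \<zeta> where "\<zeta> = cj a' * beta (- r) * v' $ r"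
  have v'k: "v' $ (- k) = 0"
  proof -
    have "beta k * v' $ (- k) = 0" using par(2) by simp
    then have "cj (beta k) * (beta k * v' $ (- k)) = 0" by simp
    then show ?thesis using beta_unit[OF d(1)] by (simp add: mult_ac absorb_prod[OF beta_unit[OF d(1)]])
  qed
  have hv': "h *v (- v') = - v' + \<zeta> *s ax k"
    unfolding happ using v'k by (simp add: \<zeta>_def vec_eq_iff)
  define A2 where "A2 = transv (ax q) (\<kappa> *s ax (- r)) 0"
  define A3 where "A3 = transv (ax q) (\<psi> *s ax k) 0"
  define Z where "Z = transv (ax k) (\<zeta> *s ax k) 0"
  have hA1: "h ** A1 ** iv h = A1 ** A2"
    unfolding A1_def A2_def U_conj_transv[OF N_U[OF hN]] hq hp1
    using d by (subst transv_mult) (simp_all add: p1_def B_lin)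
  have hC1: "h ** C1 ** iv h = A3 ** C1"
    unfolding C1_def A3_def U_conj_transv[OF N_U[OF hN]] hq hv1
    using d by (subst transv_mult) (simp_all add: v1_def B_lin)
  have hD: "h ** D ** iv h = D ** Z"
    unfolding D_def Z_def U_conj_transv[OF N_U[OF hN]] hk hv'
    using d par(2) B_zero_sym[of v' "ax k"] by (subst transv_mult) (simp_all add: B_lin)
  have ZC: "C1 ** Z = Z ** C1" unfolding Z_def
    by (rule transv_commute[OF isoC])
      (use d in \<open>simp_all add: C1_def transv_apply v1_def B_lin matrix_vector_smult\<close>)
  have ZD: "D ** Z = Z ** D" unfolding Z_def
    by (rule transv_commute[OF U_D(1)[OF par(4)]])
      (use d v'k B_zero_sym[of v' "ax k"] in \<open>simp_all add: D_def transv_apply B_lin matrix_vector_smult\<close>)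
  have \<theta>: "A1 ** C1 ** D \<in> H" using par(1) XA by simp
  have "h ** (A1 ** C1 ** D) ** iv h = (h ** A1 ** iv h) ** (h ** C1 ** iv h) ** (h ** D ** iv h)"
    by (simp add: matrix_mul_assoc[symmetric] U_cancel[OF N_U[OF hN]])
  also have "\<dots> = A1 ** A2 ** A3 ** (C1 ** (D ** Z))" unfolding hA1 hC1 hD by (simp add: matrix_mul_assoc)
  also have "C1 ** (D ** Z) = Z ** (C1 ** D)"
    unfolding ZD matrix_mul_assoc ZC ..
  also have "A1 ** A2 ** A3 ** (Z ** (C1 ** D)) = (A1 ** (A2 ** A3 ** Z) ** iv A1) ** (A1 ** C1 ** D)"
    by (simp add: matrix_mul_assoc[symmetric] U_cancel[OF N_U[OF A1N]])
  finally have "(A1 ** (A2 ** A3 ** Z) ** iv A1) ** (A1 ** C1 ** D) \<in> H"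
    using N_conj(1)[OF hN \<theta>] by simp
  then have "A1 ** (A2 ** A3 ** Z) ** iv A1 \<in> H" by (rule H_cancel_right[OF \<theta>])
  then have "iv A1 ** (A1 ** (A2 ** A3 ** Z) ** iv A1) ** A1 \<in> H" by (rule N_conj(2)[OF A1N])
  then have "A2 ** A3 ** Z \<in> H"
    by (simp add: matrix_mul_assoc[symmetric] U_cancel[OF N_U[OF A1N]] U_inv[OF N_U[OF A1N]])
  moreover have "fp = 0 \<longrightarrow> \<kappa> = 0" by (simp add: \<kappa>_def)
  ultimately show ?thesis unfolding A2_def A3_def Z_def \<psi>_def by blast
qed

text \<open>Two further commutators isolate the middle factor, whose parameter is known: conjugation by \<open>Y\<close> fixes the
  long transvection with the unknown parameter \<open>\<zeta>\<close>, and conjugation by \<open>W\<close> fixes what is left of the factor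
  with \<open>\<kappa>\<close>. For \<open>m = r\<close> the latter would not be an isometry, hence the condition \<open>\<kappa> = 0\<close>.\<close>
lemma three_factors_short:
  assumes ap: "apart k q" "apart k r" "apart q r"
    and \<rho>: "transv (ax q) (\<kappa> *s ax (- r)) 0 ** transv (ax q) (\<psi> *s ax k) 0 ** transv (ax k) (\<zeta> *s ax k) 0 \<in> H"
    and m: "m = - r \<or> m = r \<and> \<kappa> = 0" and m': "m' = q \<or> m' = - q"
    and ab: "a \<in> I" "b \<in> I"
  shows "a * \<psi> * b \<in> S m m'"
proof -
  note d = apartD[OF ap(1)] apartD[OF ap(2)] apartD[OF ap(3)]
  have apm: "apart k m" "apart q m" "apart k m'" "apart m m'" using ap m m' by (auto simp: apart_sym)
  note dm = apartD[OF apm(1)] apartD[OF apm(2)] apartD[OF apm(3)] apartD[OF apm(4)]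
  define A2 where "A2 = transv (ax q) (\<kappa> *s ax (- r)) 0"
  define A3 where "A3 = transv (ax q) (\<psi> *s ax k) 0"
  define Z where "Z = transv (ax k) (\<zeta> *s ax k) 0"
  define Y where "Y = transv (ax (- q)) ((cj a * cj (rho (- q))) *s ax m) 0"
  have YN: "Y \<in> N" unfolding Y_def using apm ab by (intro N_short I_mult cj_I) simp_all
  have rq: "rho (- q) * cj (rho (- q)) = 1" and rk: "rho (- k) * cj (rho (- k)) = 1"
    using rho_unit[of "- q"] rho_unit[of "- k"] d by simp_all
  have Yq: "Y *v ax q = ax q + cj a *s ax m"
    using d dm by (simp add: Y_def short_apply mult_ac absorb_prod[OF rq])
  have Yk: "Y *v ax k = ax k" using d dm by (simp add: Y_def short_apply)
  have Yr: "Y *v (\<kappa> *s ax (- r)) = \<kappa> *s ax (- r)"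
    using d dm m by (auto simp: Y_def short_apply matrix_vector_smult)
  have Br: "\<kappa> * beta m * ax (- r) $ (- m) = 0" "\<kappa> * beta (- r) * ax m $ r = 0"
    using d m by auto
  define Z2 where "Z2 = transv (cj a *s ax m) (\<kappa> *s ax (- r)) 0"
  define A4 where "A4 = transv (cj a *s ax m) (\<psi> *s ax k) 0"
  have YA2: "Y ** A2 ** iv Y = A2 ** Z2"
    unfolding A2_def Z2_def U_conj_transv[OF N_U[OF YN]] Yq Yr
    by (rule transv_add_left) (use d dm m in \<open>auto simp: B_lin\<close>)
  have YA3: "Y ** A3 ** iv Y = A3 ** A4"
    unfolding A3_def A4_def U_conj_transv[OF N_U[OF YN]] matrix_vector_smult Yq Yk
    by (rule transv_add_left) (use d dm in \<open>auto simp: B_lin\<close>)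
  have YZ: "Y ** Z ** iv Y = Z"
    unfolding Z_def U_conj_transv[OF N_U[OF YN]] matrix_vector_smult Yk ..
  have iso: "isometry A2" "isometry A3"
    unfolding A2_def A3_def by (rule transv_isometry; use d in \<open>simp add: B_lin\<close>)+
  have c1: "A2 ** Z2 = Z2 ** A2" unfolding Z2_def
    by (rule transv_commute[OF iso(1)]) (use d dm m in \<open>auto simp: A2_def short_apply matrix_vector_smult\<close>)
  have c2: "A3 ** Z2 = Z2 ** A3" unfolding Z2_def
    by (rule transv_commute[OF iso(2)]) (use d dm m in \<open>auto simp: A3_def short_apply matrix_vector_smult\<close>)
  have c3: "A2 ** A4 = A4 ** A2" unfolding A4_def
    by (rule transv_commute[OF iso(1)]) (use d dm m in \<open>auto simp: A2_def short_apply matrix_vector_smult\<close>)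
  have c4: "A3 ** A4 = A4 ** A3" unfolding A4_def
    by (rule transv_commute[OF iso(2)]) (use d dm m in \<open>auto simp: A3_def short_apply matrix_vector_smult\<close>)
  have \<rho>': "A2 ** A3 ** Z \<in> H" using \<rho> by (simp add: A2_def A3_def Z_def)
  have "Y ** (A2 ** A3 ** Z) ** iv Y = (Y ** A2 ** iv Y) ** (Y ** A3 ** iv Y) ** (Y ** Z ** iv Y)"
    by (simp add: matrix_mul_assoc[symmetric] U_cancel[OF N_U[OF YN]])
  also have "\<dots> = (A2 ** Z2) ** (A4 ** A3) ** Z" unfolding YA2 YA3 YZ c4 ..
  also have "\<dots> = Z2 ** (A2 ** A4) ** A3 ** Z" unfolding c1 by (simp add: matrix_mul_assoc)
  also have "\<dots> = (Z2 ** A4) ** (A2 ** A3 ** Z)" unfolding c3 by (simp add: matrix_mul_assoc)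
  finally have "(Z2 ** A4) ** (A2 ** A3 ** Z) \<in> H" using N_conj(1)[OF YN \<rho>'] by simp
  then have ZA: "Z2 ** A4 \<in> H" by (rule H_cancel_right[OF \<rho>'])
  define W where "W = transv (ax (- k)) ((b * cj (rho (- k))) *s ax m') 0"
  have WN: "W \<in> N" unfolding W_def using apm ab by (intro N_short I_mult) simp_all
  have Wk: "W *v ax k = ax k + b *s ax m'"
    using d dm by (simp add: W_def short_apply mult_ac absorb_prod[OF rk])
  have Wm: "W *v (cj a *s ax m) = cj a *s ax m"
    using d dm by (simp add: W_def short_apply matrix_vector_smult)
  have Wr: "W *v (\<kappa> *s ax (- r)) = \<kappa> *s ax (- r)"
    using d dm m by (auto simp: W_def short_apply matrix_vector_smult)
  define A5 where "A5 = transv (ax m) ((a * \<psi> * b) *s ax m') 0"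
  have WA4: "W ** A4 ** iv W = A4 ** A5"
  proof -
    have "W ** A4 ** iv W = transv (cj a *s ax m) (\<psi> *s ax k + (\<psi> * b) *s ax m') 0"
      unfolding A4_def U_conj_transv[OF N_U[OF WN]] Wm by (simp add: matrix_vector_smult Wk)
    also have "\<dots> = A4 ** transv (cj a *s ax m) ((\<psi> * b) *s ax m') 0" unfolding A4_def
      by (rule transv_add_right) (use d dm in \<open>simp_all add: B_lin\<close>)
    also have "transv (cj a *s ax m) ((\<psi> * b) *s ax m') 0 = A5"
      unfolding A5_def by (subst transv_smult_left) (simp add: mult_ac)
    finally show ?thesis .
  qed
  have WZ: "W ** Z2 ** iv W = Z2"
    unfolding Z2_def U_conj_transv[OF N_U[OF WN]] Wm Wr ..
  have "W ** (Z2 ** A4) ** iv W = (W ** Z2 ** iv W) ** (W ** A4 ** iv W)"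
    by (simp add: matrix_mul_assoc[symmetric] U_cancel[OF N_U[OF WN]])
  also have "\<dots> = (Z2 ** A4) ** A5" unfolding WZ WA4 by (simp add: matrix_mul_assoc)
  finally have "(Z2 ** A4) ** A5 \<in> H" using N_conj(1)[OF WN ZA] by simp
  then have "A5 \<in> H" by (rule H_cancel_left[OF ZA])
  then show ?thesis by (simp add: S_def A5_def)
qed

text \<open>The two preceding steps combined. The four factors from \<open>I\<close> are the parameters of the elementary elements
  \<open>g\<close>, \<open>h\<close>, \<open>Y\<close> and \<open>W\<close> used there, up to units.\<close>
lemma fixing_transvection_short:
  assumes ap: "apart k q" "apart k r" "apart q r"
    and \<sigma>: "\<sigma> \<in> H" and \<tau>: "\<tau> \<in> N" "\<tau> *v (iv \<sigma> *v ax k) = iv \<sigma> *v ax k"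
    and \<tau>k: "iv \<tau> *v ax k = ax k - (fp *s ax (- k) + fq *s ax q + fr *s ax r)"
    and \<tau>q: "iv \<tau> *v ax q = ax q"
    and m: "m = - r \<or> m = r \<and> fp = 0" and m': "m' = q \<or> m' = - q"
    and a: "a1 \<in> I" "a2 \<in> I" "a3 \<in> I" "a4 \<in> I"
  shows "fr * (a1 * a2 * a3 * a4) \<in> S m m'"
proof -
  define a where "a = cj a1"
  \<comment> \<open>chosen to cancel the units in the parameter of the middle factor\<close>
  define a' where "a' = cj (- (a2 * cj (lam F) * cj (beta (- r))))"
  have aI: "a \<in> I" "a' \<in> I" unfolding a_def a'_def
    using a by (auto intro!: cj_I I_mult ideal_neg[OF I_ideal])
  have b: "beta (- r) * cj (beta (- r)) = 1" using beta_unit[of "- r"] apartD[OF ap(2)] by simp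
  have \<psi>: "- (cj a * lam F * fr * cj a' * beta (- r)) = fr * (a1 * a2)"
    by (simp add: a_def a'_def mult_ac lam_absorb absorb_prod[OF b])
  obtain \<kappa> \<zeta> where k: "fp = 0 \<longrightarrow> \<kappa> = 0" and
    h: "transv (ax q) (\<kappa> *s ax (- r)) 0 ** transv (ax q) ((fr * (a1 * a2)) *s ax k) 0
      ** transv (ax k) (\<zeta> *s ax k) 0 \<in> H"
    using commutator_three_factors[OF ap \<sigma> \<tau> \<tau>k \<tau>q aI] unfolding \<psi> by blast
  have "a3 * (fr * (a1 * a2)) * a4 \<in> S m m'"
    by (rule three_factors_short[OF ap h _ m' a(3,4)]) (use m k in blast)
  then show ?thesis by (simp add: mult_ac)
qed

text \<open>On the totally isotropic span of three basis vectors with indices apart from each other, transvections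
  decompose into root transvections without further terms.\<close>
lemma N_span:
  assumes ap: "apart p q" "apart p r" "apart q r" and b: "b \<in> I"
    and u: "u = up *s ax p + uq *s ax q + ur *s ax r"
    and w: "w = wp *s ax p + wq *s ax q + wr *s ax r"
  shows "transv u (b *s w) 0 \<in> N"
proof -
  note d = apartD[OF ap(1)] apartD[OF ap(2)] apartD[OF ap(3)]
  have gen: "transv (ax i) (x *s ax j) 0 \<in> N" if "x \<in> I" "apart i j \<or> i = j \<and> i \<noteq> Mid" for i j x
    using that N_short N_tr by (auto simp: transv_parallel)
  have row: "transv (ax i) (x *s w) 0 \<in> N" if "x \<in> I" "i \<in> {p, q, r}" for i x
  proof -
    have "transv (ax i) (x *s w) 0 = transv (ax i) ((x * wp) *s ax p + (x * wq) *s ax q + (x * wr) *s ax r) 0"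
      by (simp add: w)
    also have "\<dots> = transv (ax i) ((x * wp) *s ax p + (x * wq) *s ax q) 0 ** transv (ax i) ((x * wr) *s ax r) 0"
      by (rule transv_add_right) (use d that(2) in \<open>auto simp: B_lin\<close>)
    also have "transv (ax i) ((x * wp) *s ax p + (x * wq) *s ax q) 0
        = transv (ax i) ((x * wp) *s ax p) 0 ** transv (ax i) ((x * wq) *s ax q) 0"
      by (rule transv_add_right) (use d that(2) in \<open>auto simp: B_lin\<close>)
    finally have "transv (ax i) (x *s w) 0 = transv (ax i) ((x * wp) *s ax p) 0 ** transv (ax i) ((x * wq) *s ax q) 0
       ** transv (ax i) ((x * wr) *s ax r) 0" .
    moreover have "x * y \<in> I" for y using that(1) by (rule I_mult(2))
    moreover have "apart i j \<or> i = j \<and> i \<noteq> Mid" if "j \<in> {p, q, r}" for j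
      using ap ap[THEN apart_sym] d \<open>i \<in> {p, q, r}\<close> that by blast
    ultimately show ?thesis by (simp add: N_mult gen)
  qed
  have one: "transv (c *s ax i) (b *s w) 0 \<in> N" if "i \<in> {p, q, r}" for c i
    using row[of "cj c * b" i] that b by (subst transv_smult_left) (simp add: vector_smult_assoc I_mult)
  have "transv u (b *s w) 0 = transv (up *s ax p + uq *s ax q) (b *s w) 0 ** transv (ur *s ax r) (b *s w) 0"
    unfolding u by (rule transv_add_left) (use d in \<open>simp_all add: w B_lin\<close>)
  also have "transv (up *s ax p + uq *s ax q) (b *s w) 0 = transv (up *s ax p) (b *s w) 0 ** transv (uq *s ax q) (b *s w) 0"
    by (rule transv_add_left) (use d in \<open>simp_all add: w B_lin\<close>)
  finally show ?thesis using one by (simp add: N_mult)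
qed

lemma inv_span_apply:
  assumes "transv u (b *s w) 0 \<in> N" "B u u = 0" "B u w = 0" "B w w = 0"
  shows "iv (transv u (b *s w) 0) *v x = x + (- (C u x * b)) *s w + (cj b * B w x) *s u"
  using U_inv_transv[OF N_U[OF assms(1)]] assms
  by (simp add: B_lin transv_apply) (simp add: vec_eq_iff)

text \<open>The vectors \<open>u\<close> and \<open>w\<close> are the obvious solutions of \<open>B u c = 0\<close> and \<open>B w c = 0\<close> with support in two
  coordinates, where \<open>c\<close> is the \<open>k\<close>-th column of \<open>\<sigma>\<inverse>\<close>. Since \<open>u\<close> has no \<open>- k\<close>-coordinate, the displacement of \<open>ax k\<close>
  is a multiple of \<open>u\<close>, and its \<open>r\<close>-coordinate is a product of two entries of \<open>c\<close>.\<close>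
lemma column_products:
  assumes ap: "apart k q" "apart k r" "apart q r" and \<sigma>: "\<sigma> \<in> H" and x: "x = q \<or> x = r"
    and m: "m = r \<or> m = - r" "m' = q \<or> m' = - q"
    and a: "a1 \<in> I" "a2 \<in> I" "a3 \<in> I" "a4 \<in> I" "a5 \<in> I"
  shows "iv \<sigma> $ (- x) $ k * cj (iv \<sigma> $ (- q) $ k) * (a1 * a2 * a3 * a4 * a5) \<in> S m m'"
proof -
  note d = apartD[OF ap(1)] apartD[OF ap(2)] apartD[OF ap(3)]
  define c where "c i = iv \<sigma> $ i $ k" for i
  have ck: "(iv \<sigma> *v ax k) $ i = c i" for i by (simp add: c_def matrix_entry[symmetric])
  define u where "u = cj (beta r * c (- r)) *s ax q - cj (beta q * c (- q)) *s ax r"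
  define w where "w = cj (beta x * c (- x)) *s ax (- k) - cj (beta (- k) * c k) *s ax x"
  define b where "b = cj a5 * (beta x * beta (- k) * cj (beta q))"
  have bI: "b \<in> I" unfolding b_def using a by (intro I_mult cj_I)
  define \<tau> where "\<tau> = transv u (b *s w) 0"
  have \<tau>N: "\<tau> \<in> N" unfolding \<tau>_def
    by (rule N_span[OF _ _ ap(3) bI, of "- k" u 0 "cj (beta r * c (- r))" "- cj (beta q * c (- q))" w
          "cj (beta x * c (- x))" "if x = q then - cj (beta (- k) * c k) else 0" "if x = q then 0 else - cj (beta (- k) * c k)"])
      (use ap x d in \<open>auto simp: u_def w_def vec_eq_iff\<close>)
  have bs: "B u u = 0" "B u w = 0" "B w w = 0"
    using d x by (auto simp: u_def w_def B_lin)
  have uc: "B u (iv \<sigma> *v ax k) = 0" by (simp add: u_def B_lin ck mult_ac)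
  have wc: "B w (iv \<sigma> *v ax k) = 0" by (simp add: w_def B_lin ck mult_ac)
  have \<tau>c: "\<tau> *v (iv \<sigma> *v ax k) = iv \<sigma> *v ax k"
    unfolding \<tau>_def transv_apply by (simp add: B_lin uc wc C_eq)
  note app = inv_span_apply[OF \<tau>N[unfolded \<tau>_def] bs, folded \<tau>_def]
  define f where "f = cj b * (beta x * c (- x)) * beta (- k)"
  have Cuk: "C u (ax k) = 0" "B w (ax k) = beta x * c (- x) * beta (- k)"
    "C u (ax q) = 0" "B w (ax q) = 0"
    using d x by (auto simp: C_eq u_def w_def B_lin)
  have \<tau>k: "iv \<tau> *v ax k = ax k - (0 *s ax (- k) + (- (f * cj (beta r * c (- r)))) *s ax q + (f * cj (beta q * c (- q))) *s ax r)"
    unfolding app Cuk by (simp add: f_def u_def vec_eq_iff algebra_simps)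
  have \<tau>q: "iv \<tau> *v ax q = ax q" unfolding app by (simp add: Cuk)
  have "f * cj (beta q * c (- q)) * (a1 * a2 * a3 * a4) \<in> S m m'"
    by (rule fixing_transvection_short[OF ap \<sigma> \<tau>N \<tau>c \<tau>k \<tau>q _ m(2) a(1-4)]) (use m in auto)
  moreover have "f * cj (beta q * c (- q)) = c (- x) * cj (c (- q)) * a5"
  proof -
    have "x \<noteq> Mid" using x d by auto
    then have u: "beta x * cj (beta x) = 1" "beta (- k) * cj (beta (- k)) = 1" "beta q * cj (beta q) = 1"
      using beta_unit[of x] beta_unit[of "- k"] beta_unit[of q] d by simp_all
    have "f * cj (beta q * c (- q)) = (beta x * cj (beta x)) * (beta (- k) * cj (beta (- k))) * (beta q * cj (beta q))
        * (c (- x) * cj (c (- q)) * a5)"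
      by (simp add: f_def b_def mult_ac)
    then show ?thesis by (simp add: u)
  qed
  ultimately show ?thesis unfolding c_def by (simp add: mult_ac)
qed

text \<open>As in \<open>column_products\<close>, now with \<open>u\<close> and \<open>w\<close> both involving the diagonal entry \<open>c\<^sub>k\<close>.\<close>
lemma column_products_diag:
  assumes ap: "apart k q" "apart k r" "apart q r" and \<sigma>: "\<sigma> \<in> H"
    and m': "m' = q \<or> m' = - q"
    and a: "a1 \<in> I" "a2 \<in> I" "a3 \<in> I" "a4 \<in> I" "a5 \<in> I"
  shows "iv \<sigma> $ (- q) $ k * cj (iv \<sigma> $ k $ k) * (a1 * a2 * a3 * a4 * a5) \<in> S (- r) m'"
proof -
  note d = apartD[OF ap(1)] apartD[OF ap(2)] apartD[OF ap(3)]
  define c where "c i = iv \<sigma> $ i $ k" for i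
  have ck: "(iv \<sigma> *v ax k) $ i = c i" for i by (simp add: c_def matrix_entry[symmetric])
  define u where "u = cj (beta q * c (- q)) *s ax (- k) - cj (beta (- k) * c k) *s ax q"
  define w where "w = cj (beta r * c (- r)) *s ax (- k) - cj (beta (- k) * c k) *s ax r"
  define b where "b = - (a5 * (beta k * cj (beta q) * beta (- k)))"
  have bI: "b \<in> I" unfolding b_def using a by (intro I_mult ideal_neg[OF I_ideal])
  define \<tau> where "\<tau> = transv u (b *s w) 0"
  have \<tau>N: "\<tau> \<in> N" unfolding \<tau>_def
    by (rule N_span[OF _ _ ap(3) bI, of "- k" u "cj (beta q * c (- q))" "- cj (beta (- k) * c k)" 0 w
          "cj (beta r * c (- r))" 0 "- cj (beta (- k) * c k)"])
      (use ap d in \<open>auto simp: u_def w_def vec_eq_iff\<close>)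
  have bs: "B u u = 0" "B u w = 0" "B w w = 0"
    using d by (auto simp: u_def w_def B_lin)
  have uc: "B u (iv \<sigma> *v ax k) = 0" by (simp add: u_def B_lin ck mult_ac)
  have wc: "B w (iv \<sigma> *v ax k) = 0" by (simp add: w_def B_lin ck mult_ac)
  have \<tau>c: "\<tau> *v (iv \<sigma> *v ax k) = iv \<sigma> *v ax k"
    unfolding \<tau>_def transv_apply by (simp add: B_lin uc wc C_eq)
  note app = inv_span_apply[OF \<tau>N[unfolded \<tau>_def] bs, folded \<tau>_def]
  have Cuk: "C u (ax q) = 0" "B w (ax q) = 0" "C u (ax k) = cj (beta k) * (beta q * c (- q))"
    using d by (simp_all add: C_def[of u "ax k"]) (auto simp: C_eq u_def w_def B_lin)
  define fr where "fr = - (C u (ax k) * b * cj (beta (- k) * c k))"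
  obtain fp fq where \<tau>k: "iv \<tau> *v ax k = ax k - (fp *s ax (- k) + fq *s ax q + fr *s ax r)"
  proof
    show "iv \<tau> *v ax k = ax k - ((C u (ax k) * b * cj (beta r * c (- r)) - cj b * B w (ax k) * cj (beta q * c (- q))) *s ax (- k)
        + (cj b * B w (ax k) * cj (beta (- k) * c k)) *s ax q + fr *s ax r)"
      unfolding app fr_def by (simp add: vec_eq_iff) (simp add: u_def w_def algebra_simps)
  qed
  have \<tau>q: "iv \<tau> *v ax q = ax q" unfolding app by (simp add: Cuk)
  have "fr * (a1 * a2 * a3 * a4) \<in> S (- r) m'"
    by (rule fixing_transvection_short[OF ap \<sigma> \<tau>N \<tau>c \<tau>k \<tau>q _ m' a(1-4)]) simp
  moreover have "fr = c (- q) * cj (c k) * a5"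
  proof -
    have u: "beta k * cj (beta k) = 1" "beta (- k) * cj (beta (- k)) = 1" "beta q * cj (beta q) = 1"
      using beta_unit[of k] beta_unit[of "- k"] beta_unit[of q] d by simp_all
    have "fr = (beta k * cj (beta k)) * (beta (- k) * cj (beta (- k))) * (beta q * cj (beta q))
        * (c (- q) * cj (c k) * a5)"
      by (simp add: fr_def Cuk b_def mult_ac)
    then show ?thesis by (simp add: u)
  qed
  ultimately show ?thesis unfolding c_def by (simp add: mult_ac)
qed

end

section \<open>Off-diagonal entries with six factors\<close>

lemma card3_third:
  assumes "3 \<le> CARD('n::finite)" shows "\<exists>m::'n. m \<noteq> a \<and> m \<noteq> b"
proof (rule ccontr)
  assume "\<not> ?thesis"
  then have "(UNIV :: 'n set) \<subseteq> {a, b}" by auto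
  then have "CARD('n) \<le> card {a, b}" by (intro card_mono) auto
  also have "\<dots> \<le> 2" by (simp add: card_insert_if)
  finally show False using assms by simp
qed

lemma third_apart:
  fixes i j :: "('n::finite) theta"
  assumes "3 \<le> CARD('n)" "i \<noteq> Mid" "j \<noteq> Mid"
  obtains k where "apart i k" "apart j k"
proof -
  obtain a where a: "i = Pos a \<or> i = Neg a" using assms(2) by (cases i) auto
  obtain b where b: "j = Pos b \<or> j = Neg b" using assms(3) by (cases j) auto
  obtain m where "m \<noteq> a" "m \<noteq> b" using card3_third[OF assms(1)] by blast
  then have "apart i (Pos m)" "apart j (Pos m)" using a b by (auto simp: apart_def)
  then show ?thesis by (rule that)
qed

context subnormal
begin

text \<open>Membership in an additive set is checked on products of elements of the two ideals, although the set need
  not be closed under multiplication by the ring.\<close>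
lemma ideal_prod_additive:
  assumes "0 \<in> T" "\<And>x y. x \<in> T \<Longrightarrow> y \<in> T \<Longrightarrow> x + y \<in> T"
    and "\<And>a b. a \<in> I1 \<Longrightarrow> b \<in> I2 \<Longrightarrow> x * (a * b) \<in> (T :: 'a set)"
    and "is_ideal I1" "z \<in> ideal_prod I1 I2"
  shows "x * z \<in> T"
proof -
  have "ideal_prod I1 I2 \<subseteq> {z. \<forall>r. x * (r * z) \<in> T}"
  proof (rule ideal_prod_least)
    have "x * (r * (c * z)) \<in> T" if "\<forall>r. x * (r * z) \<in> T" for r c z
      using that[rule_format, of "r * c"] by (simp add: mult.assoc)
    then show "is_ideal {z. \<forall>r. x * (r * z) \<in> T}"
      using assms(1,2) by (auto simp: is_ideal_iff distrib_left)
    fix a b assume "a \<in> I1" "b \<in> I2"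
    then show "a * b \<in> {z. \<forall>r. x * (r * z) \<in> T}"
      using assms(3)[OF ideal_mult[OF assms(4)]] by (simp add: mult.assoc)
  qed
  then have "x * (1 * z) \<in> T" using assms(5) by blast
  then show ?thesis by simp
qed

text \<open>The filtration on which the exponents are counted; \<open>x\<close> is said to have level \<open>s\<close> at the root \<open>(i, j)\<close>.\<close>
definition lev :: "nat \<Rightarrow> 'n theta \<Rightarrow> 'n theta \<Rightarrow> 'a \<Rightarrow> bool" where
  "lev s i j x \<longleftrightarrow> (\<forall>y\<in>ideal_pow I s. x * y \<in> S i j)"

lemma pow_ideal: "is_ideal (ideal_pow I s)"
  by (rule ideal_pow_ideal)

lemma lev_0: "lev s i j 0"
  by (simp add: lev_def S_zero)

lemma lev_add: "apart i j \<Longrightarrow> lev s i j x \<Longrightarrow> lev s i j y \<Longrightarrow> lev s i j (x + y)"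
  by (simp add: lev_def distrib_right S_add)

lemma lev_mult: "lev s i j x \<Longrightarrow> lev s i j (c * x)"
  unfolding lev_def
proof
  fix y assume *: "\<forall>y\<in>ideal_pow I s. x * y \<in> S i j" and y: "y \<in> ideal_pow I s"
  have "x * (c * y) \<in> S i j" using * ideal_mult[OF pow_ideal y] by blast
  then show "c * x * y \<in> S i j" by (simp add: mult_ac)
qed

lemma lev_diff: "apart i j \<Longrightarrow> lev s i j x \<Longrightarrow> lev s i j y \<Longrightarrow> lev s i j (x - y)"
  using lev_add[of i j s x "- 1 * y"] lev_mult[of s i j y "- 1"] by simp

lemma lev_sum: "apart i j \<Longrightarrow> (\<And>x. x \<in> X \<Longrightarrow> lev s i j (f x)) \<Longrightarrow> lev s i j (sum f X)"
  by (induction X rule: infinite_finite_induct) (auto intro: lev_0 lev_add)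

lemma lev_SucD: "lev (Suc s) i j x \<Longrightarrow> a \<in> I \<Longrightarrow> lev s i j (x * a)"
  unfolding lev_def using ideal_pow_Suc_mult[of a I _ s] by (simp add: mult.assoc)

lemma lev_SucI:
  assumes "apart i j" "\<And>a. a \<in> I \<Longrightarrow> lev s i j (x * a)"
  shows "lev (Suc s) i j x"
  unfolding lev_def
proof
  fix y assume "y \<in> ideal_pow I (Suc s)"
  then have y: "y \<in> ideal_prod I (ideal_pow I s)" by simp
  show "x * y \<in> S i j"
  proof (rule ideal_prod_additive[OF S_zero S_add[OF assms(1)] _ I_ideal y])
    fix a b assume "a \<in> I" "b \<in> ideal_pow I s"
    then show "x * (a * b) \<in> S i j" using assms(2)[of a] by (simp add: lev_def mult.assoc)
  qed
qed

lemma lev_mono: "s \<le> t \<Longrightarrow> lev s i j x \<Longrightarrow> lev t i j x"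
  unfolding lev_def using ideal_pow_antimono by blast

lemma lev_right:
  assumes "lev s i j x" "apart i j" "apart m i" "apart m j"
  shows "lev (Suc s) i m x"
proof (rule lev_SucI)
  show "apart i m" by (rule apart_sym[OF assms(3)])
  fix a assume a: "a \<in> I"
  have "x * y * a \<in> S i m" if "y \<in> ideal_pow I s" for y
    by (rule right_step[of _ i j]) (use assms a that in \<open>auto simp: lev_def\<close>)
  then show "lev s i m (x * a)" by (simp add: lev_def mult_ac)
qed

lemma lev_left:
  assumes "lev s i j x" "apart i j" "apart m i" "apart m j"
  shows "lev (Suc s) m j x"
proof (rule lev_SucI)
  show "apart m j" using assms by simp
  fix a assume a: "a \<in> I"
  have "x * y * a \<in> S m j" if "y \<in> ideal_pow I s" for y
    by (rule left_step[of _ i j]) (use assms a that in \<open>auto simp: lev_def\<close>)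
  then show "lev s m j (x * a)" by (simp add: lev_def mult_ac)
qed

lemma cj_pow: "x \<in> ideal_pow I s \<Longrightarrow> cj x \<in> ideal_pow I s"
  using involution_invariantD[OF cj_ideal_pow[OF I_cj]] .

lemma lev_swap: assumes "lev s i j x" shows "lev s j i (cj x)"
  unfolding lev_def
proof
  fix y assume y: "y \<in> ideal_pow I s"
  have "- (lam F * cj y) \<in> ideal_pow I s"
    using pow_ideal[of s] cj_pow[OF y] by (auto intro: ideal_intros)
  then have "x * - (lam F * cj y) \<in> S i j" using assms unfolding lev_def by blast
  then have "- (lam F * cj (x * - (lam F * cj y))) \<in> S j i" by (rule S_swap[THEN iffD1])
  moreover have "- (lam F * cj (x * - (lam F * cj y))) = cj x * y" by (simp add: mult_ac lam_absorb)
  ultimately show "cj x * y \<in> S j i" by simp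
qed

lemma lev_5I: 
  assumes "apart i j" "\<And>a1 a2 a3 a4 a5. a1 \<in> I \<Longrightarrow> a2 \<in> I \<Longrightarrow> a3 \<in> I \<Longrightarrow> a4 \<in> I \<Longrightarrow> a5 \<in> I \<Longrightarrow>
    x * (a1 * a2 * a3 * a4 * a5) \<in> S i j"
  shows "lev 5 i j x"
proof -
  have "lev (Suc (Suc (Suc (Suc (Suc 0))))) i j x"
  proof (intro lev_SucI assms(1))
    fix a1 a2 a3 a4 a5 assume a: "a1 \<in> I" "a2 \<in> I" "a3 \<in> I" "a4 \<in> I" "a5 \<in> I"
    show "lev 0 i j (x * a1 * a2 * a3 * a4 * a5)"
      unfolding lev_def using assms(2)[OF a(1-4) I_mult(2)[OF a(5)]] by (simp add: mult.assoc)
  qed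
  then show ?thesis by (simp add: numeral_eq_Suc)
qed

text \<open>The products of entries found above, for \<open>\<sigma>\<inverse>\<close> in place of \<open>\<sigma>\<close>.\<close>
lemma base_products:
  assumes ap: "apart k q" "apart k r" "apart q r" and \<sigma>: "\<sigma> \<in> H"
    and i: "i = q \<or> i = - q"
  shows "lev 5 r q (\<sigma> $ i $ k * cj (\<sigma> $ i $ k))"
    and "j = r \<or> j = - r \<Longrightarrow> lev 5 r q (\<sigma> $ j $ k * cj (\<sigma> $ i $ k))"
    and "lev 5 r q (\<sigma> $ i $ k * cj (\<sigma> $ k $ k))"
proof -
  have iv: "iv \<sigma> \<in> H" "iv (iv \<sigma>) = \<sigma>" using \<sigma> by (simp_all add: H_inv U_inv_inv H_U)
  have rq: "apart r q" by (rule apart_sym[OF ap(3)])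
  have q: "q = - i \<or> q = - (- i)" using i by auto
  have ap': "apart k (- i)" "apart (- i) r" using i ap by auto
  show "lev 5 r q (\<sigma> $ i $ k * cj (\<sigma> $ i $ k))"
    using column_products[OF ap'(1) ap(2) ap'(2) iv(1) _ _ q, of "- i" r] by (intro lev_5I rq) (simp add: iv(2))
  show "lev 5 r q (\<sigma> $ j $ k * cj (\<sigma> $ i $ k))" if j: "j = r \<or> j = - r"
  proof -
    have "r = - j \<or> r = - (- j)" "apart k (- j)" "apart (- i) (- j)" using j ap' ap i by auto
    then show ?thesis
      using column_products[OF ap'(1) _ _ iv(1) _ _ q, of "- j" "- j" r] by (intro lev_5I rq) (simp add: iv(2))
  qed
  have "apart k (- r)" "apart (- i) (- r)" using ap ap' by auto
  then show "lev 5 r q (\<sigma> $ i $ k * cj (\<sigma> $ k $ k))"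
    using column_products_diag[OF ap'(1) _ _ iv(1) q, of "- r"] by (intro lev_5I rq) (simp add: iv(2))
qed

text \<open>The short elementary transvection whose main entry is \<open>a\<close>, in position \<open>(p, l)\<close>.\<close>
definition E :: "'n theta \<Rightarrow> 'n theta \<Rightarrow> 'a \<Rightarrow> ('a, 'n) tmat" where
  "E p l a = transv (ax (- l)) ((a * cj (rho (- l))) *s ax p) 0"

lemma E_N: "apart p l \<Longrightarrow> a \<in> I \<Longrightarrow> E p l a \<in> N"
  unfolding E_def by (intro N_short I_mult(2)) (simp_all add: apart_sym[of p l])

lemma E_apply:
  assumes "apart p l"
  shows "E p l a *v w = w + (a * w $ l) *s ax p - (cj a * rho (- l) * beta p * w $ (- p)) *s ax (- l)"
proof -
  have r: "rho (- l) * cj (rho (- l)) = 1" using rho_unit[of "- l"] apartD[OF assms] by simp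
  show ?thesis by (simp add: E_def short_apply mult_ac absorb_prod[OF r])
qed

text \<open>If \<open>T\<close> fixes \<open>ax k\<close>, conjugation by \<open>T\<close> acts on the \<open>k\<close>-th column like \<open>T\<close>. This is how relations
  between entries of one column are multiplied.\<close>
lemma conj_col:
  assumes "\<sigma> \<in> H" "T \<in> N" "T *v ax k = ax k"
  shows "T ** \<sigma> ** iv T \<in> H" "(T ** \<sigma> ** iv T) $ i $ k = (T *v (\<sigma> *v ax k)) $ i"
proof -
  show "T ** \<sigma> ** iv T \<in> H" by (rule N_conj(1)[OF assms(2,1)])
  have "iv T *v ax k = ax k" using U_inv_apply(2)[OF N_U[OF assms(2)], of "ax k"] assms(3) by simp
  then show "(T ** \<sigma> ** iv T) $ i $ k = (T *v (\<sigma> *v ax k)) $ i"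
    by (simp add: matrix_entry[of _ i k] matrix_vector_mul_assoc[symmetric])
qed

lemma E_conj:
  assumes "\<sigma> \<in> H" "apart p l" "a \<in> I" "k \<noteq> l" "k \<noteq> - p"
  shows "\<exists>\<sigma>'\<in>H. \<forall>i. \<sigma>' $ i $ k = \<sigma> $ i $ k + (if i = p then a * \<sigma> $ l $ k else 0)
    - (if i = - l then cj a * rho (- l) * beta p * \<sigma> $ (- p) $ k else 0)"
proof (intro bexI allI)
  have fx: "E p l a *v ax k = ax k"
    using assms(4,5) by (auto simp: E_apply[OF assms(2)])
  show "E p l a ** \<sigma> ** iv (E p l a) \<in> H"
    by (rule conj_col(1)[OF assms(1) E_N[OF assms(2,3)] fx])
  show "(E p l a ** \<sigma> ** iv (E p l a)) $ i $ k = \<sigma> $ i $ k + (if i = p then a * \<sigma> $ l $ k else 0)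
    - (if i = - l then cj a * rho (- l) * beta p * \<sigma> $ (- p) $ k else 0)" for i
    unfolding conj_col(2)[OF assms(1) E_N[OF assms(2,3)] fx] E_apply[OF assms(2)]
    by (simp add: matrix_entry[symmetric])
qed

lemma long_conj:
  assumes "\<sigma> \<in> H" "(y, z) \<in> Delta F" "a \<in> I" "k \<noteq> Mid"
  obtains \<sigma>' where "\<sigma>' \<in> H" "\<And>i. i \<noteq> Mid \<Longrightarrow> i \<noteq> k \<Longrightarrow> \<sigma>' $ i $ k = \<sigma> $ i $ k"
    "\<sigma>' $ k $ k = \<sigma> $ k $ k + rho k * \<sigma> $ (- k) $ k * (cj a * z * a) - cj (y * a) * mu F * \<sigma> $ Mid $ k"
proof
  define T :: "('a, 'n) tmat" where "T = transv (ax k) ((y * a) *s ax Mid) (cj a * z * a)"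
  have T: "T \<in> N" unfolding T_def by (rule N_long[OF assms(4,2,3)])
  have app: "T *v w = w + (rho k * w $ (- k)) *s ((y * a) *s ax Mid) - (cj (y * a) * mu F * w $ Mid) *s ax k
     + (cj a * z * a * (rho k * w $ (- k))) *s ax k" for w
    by (simp add: T_def transv_apply B_lin mult_ac)
  have fx: "T *v ax k = ax k" using assms(4) by (simp add: app)
  show "T ** \<sigma> ** iv T \<in> H" by (rule conj_col(1)[OF assms(1) T fx])
  show "(T ** \<sigma> ** iv T) $ i $ k = \<sigma> $ i $ k" if "i \<noteq> Mid" "i \<noteq> k" for i
    unfolding conj_col(2)[OF assms(1) T fx] app using that by (simp add: matrix_entry[symmetric])
  show "(T ** \<sigma> ** iv T) $ k $ k = \<sigma> $ k $ k + rho k * \<sigma> $ (- k) $ k * (cj a * z * a) - cj (y * a) * mu F * \<sigma> $ Mid $ k"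
    unfolding conj_col(2)[OF assms(1) T fx] app using assms(4) by (simp add: matrix_entry[symmetric] mult_ac)
qed

text \<open>Since \<open>\<sigma>\<close> preserves the form, this entry comes from a first component \<open>y\<close> of an element of \<open>Delta F\<close>, and
  the long transvections over \<open>y\<close> give access to it.\<close>
lemma row_zero_entry:
  assumes "\<sigma> \<in> carrier (U F)" "k \<noteq> Mid"
  shows "\<exists>y\<in>J_Delta F. iv \<sigma> $ k $ Mid = cj (beta (- k)) * cj y * mu F"
proof
  show "\<sigma> $ Mid $ (- k) \<in> J_Delta F"
    using U_D(3)[OF assms(1), of "ax (- k)"] assms(2) by (simp add: matrix_entry)
  have "cj (beta (- k)) * (beta (- k) * iv \<sigma> $ k $ Mid) = cj (beta (- k)) * (cj (\<sigma> $ Mid $ (- k)) * mu F)"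
    using U_inv_entry[OF assms(1), of "- k" Mid] by simp
  then show "iv \<sigma> $ k $ Mid = cj (beta (- k)) * cj (\<sigma> $ Mid $ (- k)) * mu F"
    using beta_unit[of "- k"] assms(2) by (simp only: mult.assoc[symmetric] mult.commute[of "cj (beta (- k))" "beta (- k)"] theta_uminus_Mid_iff mult_1 simp_thms)
qed

text \<open>Put \<open>c = \<sigma> e\<^sub>k\<close>. The products \<open>c\<^sub>i cj c\<^sub>k\<close>, \<open>c\<^sub>i cj c\<^sub>i\<close> and \<open>c\<^sub>r cj c\<^sub>i\<close> of \<open>base_products\<close> have level 5 for every
  element of \<open>H\<close>. Replacing \<open>\<sigma>\<close> by conjugates that alter one entry and subtracting shows that all
  \<open>c\<^sub>i cj c\<^sub>m\<close> with hyperbolic \<open>m \<noteq> - i\<close> have level 6, and long transvections do the same for the middle entry. As \<open>1\<close> is a combination of the entries \<open>c\<^sub>m\<close>, the entry \<open>c\<^sub>i\<close> is a multiple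
  of \<open>c\<^sub>i cj c\<^sub>-\<^sub>i\<close> modulo elements of level 6. Up to a unit the latter is congruent to \<open>c\<^sub>-\<^sub>i cj c\<^sub>i\<close>, and
  substituting \<open>c\<^sub>i\<close> into itself leaves a multiple of \<open>c\<^sub>-\<^sub>i cj c\<^sub>-\<^sub>i\<close>, which has level 5.\<close>
lemma offdiag6:
  assumes ap: "apart k q" "apart k r" "apart q r" and \<sigma>: "\<sigma> \<in> H" and i: "i = q \<or> i = - q"
  shows "lev 6 r q (\<sigma> $ i $ k)"
proof -
  have rq: "apart r q" by (rule apart_sym[OF ap(3)])
  note d = apartD[OF ap(1)] apartD[OF ap(2)] apartD[OF ap(3)]
  have six: "lev 6 r q x" if "\<And>a. a \<in> I \<Longrightarrow> lev 5 r q (x * a)" for x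
    using lev_SucI[OF rq that] by (simp add: numeral_eq_Suc)
  have five: "lev 5 r q (x * a)" if "lev 6 r q x" "a \<in> I" for x a
    using lev_SucD[of 5 r q x a] that by (simp add: numeral_eq_Suc)
  note lv = lev_add[OF rq] lev_diff[OF rq]
  have F1: "lev 5 r q (\<tau> $ j $ k * cj (\<tau> $ k $ k))" if "\<tau> \<in> H" "j = q \<or> j = - q" for \<tau> j
    by (rule base_products(3)[OF ap that])
  have F2: "lev 5 r q (\<tau> $ j $ k * cj (\<tau> $ j $ k))" if "\<tau> \<in> H" "j = q \<or> j = - q" for \<tau> j
    by (rule base_products(1)[OF ap that])
  have F3: "lev 5 r q (\<tau> $ r $ k * cj (\<tau> $ j $ k))" if "\<tau> \<in> H" "j = q \<or> j = - q" for \<tau> j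
    by (rule base_products(2)[OF ap that]) simp
  \<comment> \<open>in \<open>F1\<close>, add a multiple of entry \<open>m\<close> to entry \<open>k\<close>\<close>
  have G1: "lev 6 r q (\<tau> $ j $ k * cj (\<tau> $ m $ k))"
    if \<tau>: "\<tau> \<in> H" and j: "j = q \<or> j = - q" and m: "apart m k" "apart m q" for \<tau> j m
  proof (rule six)
    fix a assume a: "a \<in> I"
    note dm = apartD[OF m(1)] apartD[OF m(2)]
    have kl: "k \<noteq> m" "k \<noteq> - k" using d dm by auto
    obtain \<tau>' where "\<tau>' \<in> H" and e: "\<And>i. \<tau>' $ i $ k = \<tau> $ i $ k + (if i = k then cj a * \<tau> $ m $ k else 0)
      - (if i = - m then cj (cj a) * rho (- m) * beta k * \<tau> $ (- k) $ k else 0)"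
      using E_conj[OF \<tau> apart_sym[OF m(1)] cj_I[OF a] kl] by blast
    then have "lev 5 r q (\<tau> $ j $ k * cj (\<tau> $ k $ k + cj a * \<tau> $ m $ k))"
      using F1[of \<tau>' j] j d dm by auto
    then have "lev 5 r q (\<tau> $ j $ k * cj (\<tau> $ k $ k + cj a * \<tau> $ m $ k) - \<tau> $ j $ k * cj (\<tau> $ k $ k))"
      by (intro lv F1[OF \<tau> j])
    then show "lev 5 r q (\<tau> $ j $ k * cj (\<tau> $ m $ k) * a)" by (simp add: algebra_simps)
  qed
  \<comment> \<open>in \<open>F3\<close>, add a multiple of entry \<open>- k\<close> to entry \<open>r\<close>\<close>
  have G2: "lev 6 r q (\<tau> $ (- k) $ k * cj (\<tau> $ j $ k))" if \<tau>: "\<tau> \<in> H" and j: "j = q \<or> j = - q" for \<tau> j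
  proof (rule six)
    fix a assume a: "a \<in> I"
    have ark: "apart r (- k)" using ap(2)[THEN apart_sym] by simp
    have kl: "k \<noteq> - k" "k \<noteq> - r" using d by auto
    then obtain \<tau>' where "\<tau>' \<in> H" and e: "\<And>i. \<tau>' $ i $ k = \<tau> $ i $ k + (if i = r then a * \<tau> $ (- k) $ k else 0)
      - (if i = - (- k) then cj a * rho (- (- k)) * beta r * \<tau> $ (- r) $ k else 0)"
      using E_conj[OF \<tau> ark a kl] by blast
    then have "lev 5 r q ((\<tau> $ r $ k + a * \<tau> $ (- k) $ k) * cj (\<tau> $ j $ k))"
      using F3[of \<tau>' j] j d by auto
    then have "lev 5 r q ((\<tau> $ r $ k + a * \<tau> $ (- k) $ k) * cj (\<tau> $ j $ k) - \<tau> $ r $ k * cj (\<tau> $ j $ k))"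
      by (intro lv F3[OF \<tau> j])
    then show "lev 5 r q (\<tau> $ (- k) $ k * cj (\<tau> $ j $ k) * a)" by (simp add: algebra_simps)
  qed
  have Eq: "\<exists>\<tau>'\<in>H. \<tau>' $ j $ k = \<tau> $ j $ k + a * \<tau> $ (- k) $ k \<and> \<tau>' $ (- k) $ k = \<tau> $ (- k) $ k"
    if \<tau>: "\<tau> \<in> H" and j: "j = q \<or> j = - q" and a: "a \<in> I" for \<tau> j a
  proof -
    have ark: "apart j (- k)" using ap ap[THEN apart_sym] j by auto
    have kl: "k \<noteq> - k" "k \<noteq> - j" using d j by auto
    then obtain \<tau>' where "\<tau>' \<in> H" and e: "\<And>i. \<tau>' $ i $ k = \<tau> $ i $ k + (if i = j then a * \<tau> $ (- k) $ k else 0)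
      - (if i = - (- k) then cj a * rho (- (- k)) * beta j * \<tau> $ (- j) $ k else 0)"
      using E_conj[OF \<tau> ark a kl] by blast
    then show ?thesis using j d by (intro bexI[of _ \<tau>']) auto
  qed
  \<comment> \<open>in \<open>G2\<close>, add a multiple of entry \<open>- k\<close> to entry \<open>q\<close>\<close>
  have G3: "lev 5 r q (\<tau> $ (- k) $ k * cj (\<tau> $ (- k) $ k) * a * b)"
    if \<tau>: "\<tau> \<in> H" and ab: "a \<in> I" "b \<in> I" for \<tau> a b
  proof -
    obtain \<tau>' where t: "\<tau>' \<in> H" "\<tau>' $ q $ k = \<tau> $ q $ k + cj a * \<tau> $ (- k) $ k" "\<tau>' $ (- k) $ k = \<tau> $ (- k) $ k"
      using Eq[OF \<tau> _ cj_I[OF ab(1)], of q] by auto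
    have "lev 6 r q (\<tau> $ (- k) $ k * cj (\<tau> $ q $ k + cj a * \<tau> $ (- k) $ k))"
      using G2[OF t(1), of q] unfolding t(2,3) by simp
    then have "lev 6 r q (\<tau> $ (- k) $ k * cj (\<tau> $ q $ k + cj a * \<tau> $ (- k) $ k) - \<tau> $ (- k) $ k * cj (\<tau> $ q $ k))"
      by (intro lv G2[OF \<tau>], assumption, simp)
    then have "lev 6 r q (\<tau> $ (- k) $ k * cj (\<tau> $ (- k) $ k) * a)" by (simp add: algebra_simps)
    then show ?thesis by (rule five[OF _ ab(2)])
  qed
  \<comment> \<open>in \<open>F2\<close>, add a multiple of entry \<open>- k\<close> to entry \<open>j\<close>\<close>
  have G4: "lev 6 r q (\<tau> $ j $ k * cj (\<tau> $ (- k) $ k))" if \<tau>: "\<tau> \<in> H" and j: "j = q \<or> j = - q" for \<tau> j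
  proof (rule six)
    fix a assume a: "a \<in> I"
    obtain \<tau>' where t: "\<tau>' \<in> H" "\<tau>' $ j $ k = \<tau> $ j $ k + cj a * \<tau> $ (- k) $ k"
      using Eq[OF \<tau> j cj_I[OF a]] by auto
    have "lev 5 r q ((\<tau> $ j $ k + cj a * \<tau> $ (- k) $ k) * cj (\<tau> $ j $ k + cj a * \<tau> $ (- k) $ k))"
      using F2[OF t(1) j] unfolding t(2) .
    then have "lev 5 r q ((\<tau> $ j $ k + cj a * \<tau> $ (- k) $ k) * cj (\<tau> $ j $ k + cj a * \<tau> $ (- k) $ k)
      - \<tau> $ j $ k * cj (\<tau> $ j $ k) - \<tau> $ (- k) $ k * cj (\<tau> $ j $ k) * cj a
      - \<tau> $ (- k) $ k * cj (\<tau> $ (- k) $ k) * cj a * a)"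
      by (intro lv F2[OF \<tau> j] five[OF G2[OF \<tau> j]] G3[OF \<tau>] cj_I a)
    then show "lev 5 r q (\<tau> $ j $ k * cj (\<tau> $ (- k) $ k) * a)" by (simp add: algebra_simps)
  qed
  \<comment> \<open>in \<open>F1\<close>, add a multiple of the middle entry to entry \<open>k\<close>\<close>
  have G5: "lev 6 r q (\<sigma> $ i $ k * cj (cj y * mu F * \<sigma> $ Mid $ k))" if y: "y \<in> J_Delta F" for y
  proof (rule six)
    fix a assume a: "a \<in> I"
    obtain z where z: "(y, z) \<in> Delta F" using y by (auto simp: J_Delta_def)
    obtain \<tau>' where t: "\<tau>' \<in> H" "\<And>i. i \<noteq> Mid \<Longrightarrow> i \<noteq> k \<Longrightarrow> \<tau>' $ i $ k = \<sigma> $ i $ k"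
      "\<tau>' $ k $ k = \<sigma> $ k $ k + rho k * \<sigma> $ (- k) $ k * (cj a * z * a) - cj (y * a) * mu F * \<sigma> $ Mid $ k"
      using long_conj[OF \<sigma> z a d(1)] by blast
    have "i \<noteq> Mid" "i \<noteq> k" using i d by auto
    then have "lev 5 r q (\<sigma> $ i $ k * cj (\<sigma> $ k $ k + rho k * \<sigma> $ (- k) $ k * (cj a * z * a) - cj (y * a) * mu F * \<sigma> $ Mid $ k))"
      using F1[OF t(1) i] unfolding t(2)[OF \<open>i \<noteq> Mid\<close> \<open>i \<noteq> k\<close>] t(3) by simp
    then have "lev 5 r q (\<sigma> $ i $ k * cj (\<sigma> $ k $ k)
       + (cj (rho k) * cj z * a) * (\<sigma> $ i $ k * cj (\<sigma> $ (- k) $ k) * cj a)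
       - \<sigma> $ i $ k * cj (\<sigma> $ k $ k + rho k * \<sigma> $ (- k) $ k * (cj a * z * a) - cj (y * a) * mu F * \<sigma> $ Mid $ k))"
      by (intro lv F1[OF \<sigma> i] lev_mult[OF five[OF G4[OF \<sigma> i]]] cj_I a)
    then show "lev 5 r q (\<sigma> $ i $ k * cj (cj y * mu F * \<sigma> $ Mid $ k) * a)" by (simp add: algebra_simps)
  qed
  \<comment> \<open>in \<open>F1\<close>, add a multiple of entry \<open>- j\<close> to entry \<open>k\<close>, which also adds one of entry \<open>- k\<close> to entry \<open>j\<close>\<close>
  have G6: "lev 6 r q (\<sigma> $ j $ k * cj (\<sigma> $ (- j) $ k) - rho j * beta k * (\<sigma> $ (- k) $ k * cj (\<sigma> $ k $ k)))"
    if j: "j = q \<or> j = - q" for j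
  proof (rule six)
    fix a assume a: "a \<in> I"
    have j': "- j = q \<or> - j = - q" using j by auto
    have ark: "apart k (- j)" using ap ap[THEN apart_sym] j by auto
    have kl: "k \<noteq> - j" "k \<noteq> - k" using d j by auto
    then obtain \<tau>' where t: "\<tau>' \<in> H" and e: "\<And>i. \<tau>' $ i $ k = \<sigma> $ i $ k + (if i = k then cj a * \<sigma> $ (- j) $ k else 0)
      - (if i = - (- j) then cj (cj a) * rho (- (- j)) * beta k * \<sigma> $ (- k) $ k else 0)"
      using E_conj[OF \<sigma> ark cj_I[OF a] kl] by blast
    have e': "\<tau>' $ j $ k = \<sigma> $ j $ k - a * rho j * beta k * \<sigma> $ (- k) $ k"
      "\<tau>' $ k $ k = \<sigma> $ k $ k + cj a * \<sigma> $ (- j) $ k"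
      unfolding e using j d by auto
    have "lev 5 r q ((\<sigma> $ j $ k - a * rho j * beta k * \<sigma> $ (- k) $ k) * cj (\<sigma> $ k $ k + cj a * \<sigma> $ (- j) $ k))"
      using F1[OF t j] unfolding e' .
    then have "lev 5 r q ((\<sigma> $ j $ k - a * rho j * beta k * \<sigma> $ (- k) $ k) * cj (\<sigma> $ k $ k + cj a * \<sigma> $ (- j) $ k)
       - \<sigma> $ j $ k * cj (\<sigma> $ k $ k) + (a * rho j * beta k) * (\<sigma> $ (- k) $ k * cj (\<sigma> $ (- j) $ k) * a))"
      by (intro lv F1[OF \<sigma> j] lev_mult[OF five[OF G2[OF \<sigma> j']]] a)
    then show "lev 5 r q ((\<sigma> $ j $ k * cj (\<sigma> $ (- j) $ k) - rho j * beta k * (\<sigma> $ (- k) $ k * cj (\<sigma> $ k $ k))) * a)"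
      by (simp add: algebra_simps)
  qed
  have up: "lev 5 r q x \<Longrightarrow> lev 6 r q x" for x by (rule lev_mono) simp_all
  have i': "- i = q \<or> - i = - q" using i by auto
  have di: "i \<noteq> Mid" "i \<noteq> k" "i \<noteq> - k" "- i \<noteq> Mid" "- i \<noteq> k" using i d by auto
  \<comment> \<open>coefficient of the one product that is not yet known, in the equation row times column equals one\<close>
  define t where "t = cj (iv \<sigma> $ k $ (- i))"
  have one: "lev 6 r q (\<sigma> $ i $ k - t * (\<sigma> $ i $ k * cj (\<sigma> $ (- i) $ k)))"
  proof -
    have "(iv \<sigma> ** \<sigma>) $ k $ k = 1" using U_inv(2)[OF H_U[OF \<sigma>]] by (simp add: mat_def)
    then have "1 = (\<Sum>m\<in>UNIV. iv \<sigma> $ k $ m * \<sigma> $ m $ k)" by (simp add: matrix_matrix_mult_def)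
    then have "1 = cj (\<Sum>m\<in>UNIV. iv \<sigma> $ k $ m * \<sigma> $ m $ k)" by simp
    then have "\<sigma> $ i $ k = \<sigma> $ i $ k * cj (\<Sum>m\<in>UNIV. iv \<sigma> $ k $ m * \<sigma> $ m $ k)" by simp
    also have "\<dots> = (\<Sum>m\<in>UNIV. \<sigma> $ i $ k * cj (iv \<sigma> $ k $ m * \<sigma> $ m $ k))"
      by (simp add: cj_sum sum_distrib_left)
    also have "\<dots> = \<sigma> $ i $ k * cj (iv \<sigma> $ k $ (- i) * \<sigma> $ (- i) $ k)
        + (\<Sum>m\<in>UNIV - {- i}. \<sigma> $ i $ k * cj (iv \<sigma> $ k $ m * \<sigma> $ m $ k))"
      by (rule sum.remove) simp_all
    finally have eq: "\<sigma> $ i $ k - t * (\<sigma> $ i $ k * cj (\<sigma> $ (- i) $ k))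
      = (\<Sum>m\<in>UNIV - {- i}. \<sigma> $ i $ k * cj (iv \<sigma> $ k $ m * \<sigma> $ m $ k))"
      by (simp add: t_def algebra_simps)
    have "lev 6 r q (\<sigma> $ i $ k * cj (iv \<sigma> $ k $ m * \<sigma> $ m $ k))" if m: "m \<noteq> - i" for m
    proof -
      have "lev 6 r q (\<sigma> $ i $ k * cj (\<sigma> $ m $ k))" if "m \<noteq> Mid"
      proof -
        have "m = k \<or> m = - k \<or> m = i \<or> apart m k \<and> apart m q"
          using that m i d by (auto simp: apart_def)
        then consider "m = k" | "m = - k" | "m = i" | "apart m k" "apart m q" by blast
        then show ?thesis
        proof cases
          case 1 then show ?thesis using up[OF F1[OF \<sigma> i]] by simp
        next
          case 2 then show ?thesis using G4[OF \<sigma> i] by simp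
        next
          case 3 then show ?thesis using up[OF F2[OF \<sigma> i]] by simp
        next
          case 4 then show ?thesis by (rule G1[OF \<sigma> i])
        qed
      qed
      moreover have "lev 6 r q (\<sigma> $ i $ k * cj (iv \<sigma> $ k $ Mid * \<sigma> $ Mid $ k))"
      proof -
        obtain y where y: "y \<in> J_Delta F" "iv \<sigma> $ k $ Mid = cj (beta (- k)) * cj y * mu F"
          using row_zero_entry[OF H_U[OF \<sigma>] d(1)] by auto
        show ?thesis using lev_mult[OF G5[OF y(1)], of "beta (- k)"] by (simp add: y(2) mult_ac)
      qed
      ultimately show ?thesis
        using lev_mult[of 6 r q "\<sigma> $ i $ k * cj (\<sigma> $ m $ k)" "cj (iv \<sigma> $ k $ m)"]
        by (cases "m = Mid") (simp_all add: mult_ac)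
    qed
    then show ?thesis unfolding eq by (intro lev_sum rq) auto
  qed
  define \<nu> where "\<nu> = rho i * beta k * cj (rho (- i)) * cj (beta k)"
  have two: "lev 6 r q (\<sigma> $ i $ k * cj (\<sigma> $ (- i) $ k) - \<nu> * (\<sigma> $ (- i) $ k * cj (\<sigma> $ i $ k)))"
  proof -
    have u: "rho (- i) * cj (rho (- i)) = 1" "beta k * cj (beta k) = 1"
      using rho_unit[of "- i"] beta_unit[of k] di d by simp_all
    have "lev 6 r q ((\<sigma> $ i $ k * cj (\<sigma> $ (- i) $ k) - rho i * beta k * (\<sigma> $ (- k) $ k * cj (\<sigma> $ k $ k)))
       - \<nu> * (\<sigma> $ (- i) $ k * cj (\<sigma> $ (- (- i)) $ k) - rho (- i) * beta k * (\<sigma> $ (- k) $ k * cj (\<sigma> $ k $ k))))"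
      by (intro lv lev_mult G6 i i')
    moreover have "\<nu> * (rho (- i) * beta k) = rho i * beta k"
      by (simp add: \<nu>_def mult_ac absorb_prod[OF u(1)] absorb_prod[OF u(2)])
    ultimately show ?thesis by (simp add: right_diff_distrib mult.assoc[symmetric])
  qed
  \<comment> \<open>substitution of \<open>\<sigma> $ i $ k\<close> into itself by means of \<open>one\<close> and \<open>two\<close>\<close>
  have n1: "lev 6 r q (t * (t * \<nu>) * cj (\<sigma> $ i $ k) * (\<sigma> $ (- i) $ k * cj (\<sigma> $ (- i) $ k)))"
    by (intro lev_mult up F2 \<sigma> i')
  have n2: "lev 6 r q ((t * cj (\<sigma> $ (- i) $ k)) * (\<sigma> $ i $ k - t * (\<sigma> $ i $ k * cj (\<sigma> $ (- i) $ k)))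
     + (t * t * cj (\<sigma> $ (- i) $ k)) * (\<sigma> $ i $ k * cj (\<sigma> $ (- i) $ k) - \<nu> * (\<sigma> $ (- i) $ k * cj (\<sigma> $ i $ k))))"
    by (intro lv lev_mult one two)
  have "lev 6 r q ((t * cj (\<sigma> $ (- i) $ k)) * (\<sigma> $ i $ k - t * (\<sigma> $ i $ k * cj (\<sigma> $ (- i) $ k)))
     + (t * t * cj (\<sigma> $ (- i) $ k)) * (\<sigma> $ i $ k * cj (\<sigma> $ (- i) $ k) - \<nu> * (\<sigma> $ (- i) $ k * cj (\<sigma> $ i $ k)))
     + t * (t * \<nu>) * cj (\<sigma> $ i $ k) * (\<sigma> $ (- i) $ k * cj (\<sigma> $ (- i) $ k))
     + (\<sigma> $ i $ k - t * (\<sigma> $ i $ k * cj (\<sigma> $ (- i) $ k))))"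
    by (rule lev_add[OF rq lev_add[OF rq n2 n1] one])
  then show ?thesis by (simp add: algebra_simps)
qed

end

section \<open>The ideal of the upper level\<close>

context subnormal
begin

text \<open>The entries of the inverse are conjugates of entries, so the statement about columns becomes one about
  rows.\<close>
lemma offdiag6_dual:
  assumes ap: "apart i k" "apart i r" "apart k r" and \<sigma>: "\<sigma> \<in> H" and q: "q = k \<or> q = - k"
  shows "lev 6 q r (\<sigma> $ i $ k)"
proof -
  have ap': "apart (- i) q" "apart (- i) r" "apart q r" and q': "- k = q \<or> - k = - q"
    using ap q by auto
  have l: "lev 6 r q (iv \<sigma> $ (- k) $ (- i))"
    by (rule offdiag6[OF ap' H_inv[OF \<sigma>] q'])
  have u: "beta i * cj (beta i) = 1" using beta_unit[of i] apartD[OF ap(1)] by simp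
  have "cj (\<sigma> $ i $ k) = cj (\<sigma> $ i $ k) * (beta i * cj (beta i))" unfolding u by simp
  also have "\<dots> = (beta k * iv \<sigma> $ (- k) $ (- i)) * cj (beta i)"
    using U_inv_entry[OF H_U[OF \<sigma>], of k "- i"] by (simp add: mult.assoc)
  finally have "cj (\<sigma> $ i $ k) = (beta k * cj (beta i)) * iv \<sigma> $ (- k) $ (- i)" by (simp add: mult_ac)
  then have "lev 6 r q (cj (\<sigma> $ i $ k))" using lev_mult[OF l] by simp
  then show ?thesis using lev_swap by fastforce
qed

text \<open>From the positions of level 6 in \<open>offdiag6\<close> and its dual all root positions are reached in one step, except
  those with \<open>x\<close> equal to \<open>i\<close> or \<open>- i\<close> and \<open>y\<close> equal to \<open>k\<close> or \<open>- k\<close>, which take two.\<close>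
lemma offdiag_lev:
  assumes ik: "apart i k" and xy: "apart x y" and \<sigma>: "\<sigma> \<in> H"
  shows "(x = i \<or> x = - i) \<and> (y = k \<or> y = - k) \<or> lev 7 x y (\<sigma> $ i $ k)" and "lev 8 x y (\<sigma> $ i $ k)"
proof -
  note s = ik[THEN apart_sym] xy[THEN apart_sym]
  note d = apartD[OF ik] apartD[OF xy]
  have up7: "lev 7 p r (\<sigma> $ i $ k)" if "lev 6 p r (\<sigma> $ i $ k)" for p r
    using lev_mono[OF _ that] by simp
  have R: "lev 7 p r (\<sigma> $ i $ k)" if "lev 6 p m (\<sigma> $ i $ k)" "apart p m" "apart r p" "apart r m" for p m r
    using lev_right[OF that] by (simp add: numeral_eq_Suc)
  have L: "lev 7 r p (\<sigma> $ i $ k)" if "lev 6 m p (\<sigma> $ i $ k)" "apart m p" "apart r m" "apart r p" for p m r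
    using lev_left[OF that] by (simp add: numeral_eq_Suc)
  have D1: "lev 6 r q (\<sigma> $ i $ k)" if "apart i r" "apart k r" "q = i \<or> q = - i" for r q
    by (rule offdiag6[of k q r]) (use that s \<sigma> in auto)
  have D2: "lev 6 q r (\<sigma> $ i $ k)" if "apart i r" "apart k r" "q = k \<or> q = - k" for r q
    by (rule offdiag6_dual[OF ik that(1,2) \<sigma> that(3)])
  have cls: "v = i \<or> v = - i \<or> v = k \<or> v = - k \<or> apart i v \<and> apart k v" if "v \<noteq> Mid" for v
    using that d unfolding apart_def by (metis theta_uminus_uminus)
  obtain r where r: "apart i r" "apart k r" using third_apart[OF three d(1,2)] .
  note r' = r[THEN apart_sym]
  consider "apart i x" "apart k x" | "x = i \<or> x = - i" | "x = k \<or> x = - k"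
    using cls[of x] d by blast
  then have main: "(x = i \<or> x = - i) \<and> (y = k \<or> y = - k) \<or> lev 7 x y (\<sigma> $ i $ k)"
  proof cases
    case 1
    note x' = 1[THEN apart_sym]
    consider "y = i \<or> y = - i" | "y = k \<or> y = - k" | "apart i y" "apart k y" using cls[of y] d by blast
    then show ?thesis
    proof cases
      case 1
      then show ?thesis using up7[OF D1[OF \<open>apart i x\<close> \<open>apart k x\<close>]] by blast
    next
      case 2
      have "lev 7 x y (\<sigma> $ i $ k)"
        by (rule R[OF D1[OF \<open>apart i x\<close> \<open>apart k x\<close>, of i]]) (use 2 1 x' s in auto)
      then show ?thesis ..
    next
      case 3
      have "lev 7 x y (\<sigma> $ i $ k)"
        by (rule R[OF D1[OF \<open>apart i x\<close> \<open>apart k x\<close>, of i]]) (use 3[THEN apart_sym] 1 x' s in auto)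
      then show ?thesis ..
    qed
  next
    case 2
    show ?thesis
    proof (cases "y = k \<or> y = - k")
      case True
      then show ?thesis using 2 by blast
    next
      case False
      then have y: "apart i y" "apart k y" using cls[of y] d 2 by auto
      have "lev 7 x y (\<sigma> $ i $ k)"
        by (rule L[OF D2[OF y, of k]]) (use 2 y ik xy in auto)
      then show ?thesis ..
    qed
  next
    case 3
    consider "y = i \<or> y = - i" | "apart i y" "apart k y" using cls[of y] d 3 by auto
    then show ?thesis
    proof cases
      case 1
      have "lev 7 x y (\<sigma> $ i $ k)"
        by (rule R[OF D2[OF r 3]]) (use 1 3 r ik in auto)
      then show ?thesis ..
    next
      case 2
      show ?thesis using up7[OF D2[OF 2 3]] by blast
    qed
  qed
  then show "(x = i \<or> x = - i) \<and> (y = k \<or> y = - k) \<or> lev 7 x y (\<sigma> $ i $ k)" .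
  show "lev 8 x y (\<sigma> $ i $ k)"
  proof (cases "(x = i \<or> x = - i) \<and> (y = k \<or> y = - k)")
    case True
    have "lev 7 r y (\<sigma> $ i $ k)"
      by (rule R[OF D1[OF r, of i]]) (use True r r' s in auto)
    then have "lev (Suc 7) x y (\<sigma> $ i $ k)"
      by (rule lev_left) (use True r r' xy in auto)
    then show ?thesis by simp
  next
    case False
    then have "lev 7 x y (\<sigma> $ i $ k)" using main by blast
    then show ?thesis by (rule lev_mono[rotated]) simp
  qed
qed

text \<open>The ideals in which the entries of elements of \<open>H\<close> are measured.\<close>
definition A :: "nat \<Rightarrow> 'a set" where
  "A s = {x. \<forall>i j. apart i j \<longrightarrow> lev s i j x}"

lemma A_ideal: "is_ideal (A s)"
  unfolding is_ideal_iff A_def by (auto intro: lev_0 lev_add lev_mult)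

lemma A_cj: "x \<in> A s \<Longrightarrow> cj x \<in> A s"
  unfolding A_def using lev_swap apart_sym by blast

lemma A_mono: "s \<le> t \<Longrightarrow> x \<in> A s \<Longrightarrow> x \<in> A t"
  unfolding A_def using lev_mono by blast

lemma A_SucI: "(\<And>a. a \<in> I \<Longrightarrow> x * a \<in> A s) \<Longrightarrow> x \<in> A (Suc s)"
  unfolding A_def using lev_SucI by blast

lemmas A_intros = ideal_intros[OF A_ideal]

text \<open>For an entry in position \<open>(- k, k)\<close>, conjugation adds it to an entry \<open>(j, k)\<close>, with \<open>j\<close> chosen such that
  both copies of that entry have level 7 at the given root.\<close>
lemma offdiag8:
  assumes \<sigma>: "\<sigma> \<in> H" and ik: "i \<noteq> Mid" "k \<noteq> Mid" "i \<noteq> k"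
  shows "\<sigma> $ i $ k \<in> A 8"
proof (cases "i = - k")
  case False
  then have "apart i k" using ik by (simp add: apart_def)
  then show ?thesis unfolding A_def using offdiag_lev(2)[OF _ _ \<sigma>] by blast
next
  case True
  have "lev (Suc 7) x y (\<sigma> $ (- k) $ k)" if xy: "apart x y" for x y
  proof (rule lev_SucI[OF xy])
    fix a assume a: "a \<in> I"
    obtain j where j: "apart k j" "apart x j" using third_apart[OF three ik(2) apartD(1)[OF xy]] .
    have ark: "apart j (- k)" "apart j k" using j[THEN apart_sym] by simp_all
    have kl: "k \<noteq> - k" "k \<noteq> - j" using apartD[OF j(1)] by simp_all
    obtain \<sigma>' where t: "\<sigma>' \<in> H" and e: "\<And>i. \<sigma>' $ i $ k = \<sigma> $ i $ k + (if i = j then a * \<sigma> $ (- k) $ k else 0)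
      - (if i = - (- k) then cj a * rho (- (- k)) * beta j * \<sigma> $ (- j) $ k else 0)"
      using E_conj[OF \<sigma> ark(1) a kl] by blast
    have e': "\<sigma>' $ j $ k = \<sigma> $ j $ k + a * \<sigma> $ (- k) $ k"
      unfolding e using apartD[OF j(1)] by simp
    have "lev 7 x y (\<tau> $ j $ k)" if "\<tau> \<in> H" for \<tau>
      using offdiag_lev(1)[OF ark(2) xy that] apartD[OF j(2)] by auto
    from lev_diff[OF xy this[OF t] this[OF \<sigma>]] have "lev 7 x y (\<sigma>' $ j $ k - \<sigma> $ j $ k)" .
    then show "lev 7 x y (\<sigma> $ (- k) $ k * a)" by (simp add: e' mult.commute)
  qed
  then show ?thesis unfolding A_def True by simp
qed

lemma in_A9I: "(\<And>a. a \<in> I \<Longrightarrow> x * a \<in> A 8) \<Longrightarrow> x \<in> A 9"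
  using A_SucI[of x 8] by simp

text \<open>Conjugation by an elementary transvection puts the difference of the diagonal entries into an
  off-diagonal position.\<close>
lemma diag9_apart:
  assumes \<sigma>: "\<sigma> \<in> H" and ij: "apart i j"
  shows "\<sigma> $ i $ i - \<sigma> $ j $ j \<in> A 9"
proof (rule in_A9I)
  fix a assume a: "a \<in> I"
  note d = apartD[OF ij]
  define T where "T = E i j a"
  have T: "T \<in> N" unfolding T_def by (rule E_N[OF ij a])
  have "T *v (ax j - a *s ax i) = ax j"
    using d by (simp add: T_def E_apply[OF ij] vec_eq_iff)
  then have Tj: "iv T *v ax j = ax j - a *s ax i"
    using U_inv_apply(2)[OF N_U[OF T], of "ax j - a *s ax i"] by simp
  have H': "T ** \<sigma> ** iv T \<in> H" by (rule N_conj(1)[OF T \<sigma>])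
  have "(T ** \<sigma> ** iv T) $ i $ j = (T *v (\<sigma> *v (ax j - a *s ax i))) $ i"
    by (simp add: matrix_entry[of _ i j] matrix_vector_mul_assoc[symmetric] Tj)
  also have "\<dots> = \<sigma> $ i $ j - a * \<sigma> $ i $ i + a * (\<sigma> $ j $ j - a * \<sigma> $ j $ i)"
    using d by (simp add: T_def E_apply[OF ij] matrix_vector_mult_diff_distrib matrix_vector_smult matrix_entry[symmetric] right_diff_distrib)
  finally have e: "(\<sigma> $ i $ i - \<sigma> $ j $ j) * a = \<sigma> $ i $ j - a * a * \<sigma> $ j $ i - (T ** \<sigma> ** iv T) $ i $ j"
    by (simp add: algebra_simps)
  show "(\<sigma> $ i $ i - \<sigma> $ j $ j) * a \<in> A 8"
    unfolding e using d by (intro A_intros offdiag8 H' \<sigma>)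
qed

lemma diag9:
  assumes \<sigma>: "\<sigma> \<in> H" and ij: "i \<noteq> Mid" "j \<noteq> Mid"
  shows "\<sigma> $ i $ i - \<sigma> $ j $ j \<in> A 9"
proof -
  obtain k where k: "apart i k" "apart j k" using third_apart[OF three ij] .
  have "(\<sigma> $ i $ i - \<sigma> $ k $ k) - (\<sigma> $ j $ j - \<sigma> $ k $ k) \<in> A 9"
    by (intro A_intros diag9_apart \<sigma> k)
  then show ?thesis by simp
qed

text \<open>The long elementary transvections of the smallest level over \<open>I\<close>.\<close>
definition L :: "'n theta \<Rightarrow> 'a \<Rightarrow> 'a \<Rightarrow> 'a \<Rightarrow> ('a, 'n) tmat" where
  "L k y z a = transv (ax k) ((y * a) *s ax Mid) (cj a * z * a)"

lemma L_N: "k \<noteq> Mid \<Longrightarrow> (y, z) \<in> Delta F \<Longrightarrow> a \<in> I \<Longrightarrow> L k y z a \<in> N"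
  unfolding L_def by (rule N_long)

lemma L_apply:
  "L k y z a *v w = w + (rho k * w $ (- k) * (y * a)) *s ax Mid
     + (cj a * z * a * rho k * w $ (- k) - cj (y * a) * mu F * w $ Mid) *s ax k"
  by (simp add: L_def transv_apply B_lin vec_eq_iff algebra_simps)

lemma L_inv_apply:
  assumes "k \<noteq> Mid" "(y, z) \<in> Delta F" "a \<in> I"
  shows "\<exists>t. iv (L k y z a) *v w = w - (rho k * w $ (- k) * (y * a)) *s ax Mid + t *s ax k"
proof -
  define v :: "'a ^ 'n theta" where "v = (y * a) *s ax Mid"
  have "transv (ax k) v (cj a * z * a) \<in> carrier (U F)"
    using N_U[OF L_N[OF assms]] by (simp add: L_def v_def)
  then have "iv (transv (ax k) v (cj a * z * a)) = transv (ax k) (- v) (- (cj a * z * a) - B v v)"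
    by (rule U_inv_transv) (use assms(1) in \<open>simp_all add: v_def B_lin\<close>)
  then have eq: "iv (L k y z a) = transv (ax k) (- v) (- (cj a * z * a) - B v v)"
    by (simp add: L_def v_def)
  have "iv (L k y z a) *v w = w - (rho k * w $ (- k) * (y * a)) *s ax Mid
    + (B v w + (- (cj a * z * a) - B v v) * (rho k * w $ (- k))) *s ax k"
    unfolding eq transv_apply by (simp add: B_lin) (simp add: v_def vec_eq_iff algebra_simps)
  then show ?thesis by blast
qed

text \<open>Conjugation by a long transvection adds a multiple of the middle column to the column of index \<open>j\<close>.\<close>
lemma entry_i0:
  assumes \<sigma>: "\<sigma> \<in> H" and i: "i \<noteq> Mid" and y: "y \<in> J_Delta F"
  shows "\<sigma> $ i $ Mid * y \<in> A 9"
proof (rule in_A9I)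
  fix a assume a: "a \<in> I"
  obtain z where z: "(y, z) \<in> Delta F" using y by (auto simp: J_Delta_def)
  obtain j where j: "apart i j" using third_apart[OF three i i] by blast
  note d = apartD[OF j]
  define T where "T = L (- j) y z a"
  have T: "T \<in> N" unfolding T_def by (rule L_N[OF _ z a]) (use d in simp)
  have H': "iv T ** \<sigma> ** T \<in> H" by (rule N_conj(2)[OF T \<sigma>])
  obtain t where t: "iv T *v (\<sigma> *v (T *v ax j)) = \<sigma> *v (T *v ax j)
      - (rho (- j) * (\<sigma> *v (T *v ax j)) $ (- (- j)) * (y * a)) *s ax Mid + t *s ax (- j)"
    using L_inv_apply[OF _ z a, of "- j"] d unfolding T_def by (metis theta_uminus_Mid_iff(1))
  have "(iv T ** \<sigma> ** T) $ i $ j = (iv T *v (\<sigma> *v (T *v ax j))) $ i"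
    by (simp add: matrix_entry[of _ i j] matrix_vector_mul_assoc[symmetric])
  also have "\<dots> = (\<sigma> *v (T *v ax j)) $ i" unfolding t using d by simp
  also have "\<dots> = \<sigma> $ i $ j + rho (- j) * (\<sigma> $ i $ Mid * (y * a)) + (cj a * z * a * rho (- j)) * \<sigma> $ i $ (- j)"
    using d by (simp add: T_def L_apply matrix_vector_right_distrib matrix_vector_smult matrix_entry[symmetric] mult_ac)
  finally have e: "rho (- j) * (\<sigma> $ i $ Mid * (y * a)) = (iv T ** \<sigma> ** T) $ i $ j - \<sigma> $ i $ j
     - (cj a * z * a * rho (- j)) * \<sigma> $ i $ (- j)" by simp
  have "rho (- j) * (\<sigma> $ i $ Mid * (y * a)) \<in> A 8"
    unfolding e using d by (intro A_intros offdiag8 H' \<sigma>) auto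
  then have "cj (rho (- j)) * (rho (- j) * (\<sigma> $ i $ Mid * (y * a))) \<in> A 8" by (rule A_intros)
  then show "\<sigma> $ i $ Mid * y * a \<in> A 8"
    using absorb_prod(4)[OF rho_unit[of "- j"]] d by (simp add: mult.assoc)
qed

lemma entry_0j:
  assumes \<sigma>: "\<sigma> \<in> H" and j: "j \<noteq> Mid" and y: "y \<in> J_Delta F"
  shows "cj y * mu F * \<sigma> $ Mid $ j \<in> A 9"
proof (rule in_A9I)
  fix a assume a: "a \<in> I"
  obtain z where z: "(y, z) \<in> Delta F" using y by (auto simp: J_Delta_def)
  obtain i where i: "apart j i" using third_apart[OF three j j] by blast
  note d = apartD[OF i]
  define T where "T = L i y z (cj a)"
  have T: "T \<in> N" unfolding T_def by (rule L_N[OF _ z cj_I[OF a]]) (use d in simp)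
  have fx: "T *v ax j = ax j" using d by (simp add: T_def L_apply)
  note c = conj_col[OF \<sigma> T fx]
  have "(T ** \<sigma> ** iv T) $ i $ j = \<sigma> $ i $ j + cj y * a * mu F * - \<sigma> $ Mid $ j + a * z * cj a * rho i * \<sigma> $ (- i) $ j"
    unfolding c(2) using d by (simp add: T_def L_apply matrix_entry[symmetric] mult_ac)
  then have e: "cj y * mu F * \<sigma> $ Mid $ j * a = \<sigma> $ i $ j + a * z * cj a * rho i * \<sigma> $ (- i) $ j - (T ** \<sigma> ** iv T) $ i $ j"
    by (simp add: algebra_simps)
  show "cj y * mu F * \<sigma> $ Mid $ j * a \<in> A 8"
    unfolding e using d by (intro A_intros offdiag8 c(1) \<sigma>) auto
qed

text \<open>Here the long transvection moves the difference of diagonal entries into the middle row, where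
  \<open>entry_0j\<close> applies; this is why the exponent increases once more.\<close>
lemma entry_00:
  assumes \<sigma>: "\<sigma> \<in> H" and j: "j \<noteq> Mid" and x: "x \<in> J_Delta F" and y: "y \<in> J_Delta F"
  shows "cj x * mu F * (\<sigma> $ Mid $ Mid - \<sigma> $ j $ j) * y \<in> A 10"
proof -
  have "cj x * mu F * (\<sigma> $ Mid $ Mid - \<sigma> $ j $ j) * y * a \<in> A 9" if a: "a \<in> I" for a
  proof -
    obtain z where z: "(y, z) \<in> Delta F" using y by (auto simp: J_Delta_def)
    define T where "T = L (- j) y z a"
    have T: "T \<in> N" unfolding T_def by (rule L_N[OF _ z a]) (use j in simp)
    have H': "iv T ** \<sigma> ** T \<in> H" by (rule N_conj(2)[OF T \<sigma>])
    define p where "p = rho (- j)"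
    define s where "s = cj a * z * a * p"
    define w where "w = \<sigma> *v (T *v ax j)"
    have w: "w $ i = \<sigma> $ i $ j + p * y * a * \<sigma> $ i $ Mid + s * \<sigma> $ i $ (- j)" for i
      using j by (simp add: w_def T_def L_apply matrix_vector_right_distrib matrix_vector_smult matrix_entry[symmetric] s_def p_def mult_ac)
    obtain t where t: "iv T *v w = w - (rho (- j) * w $ (- (- j)) * (y * a)) *s ax Mid + t *s ax (- j)"
      using L_inv_apply[OF _ z a, of "- j"] j unfolding T_def by (metis theta_uminus_Mid_iff(1))
    have "(iv T ** \<sigma> ** T) $ Mid $ j = (iv T *v w) $ Mid"
      by (simp add: matrix_entry[of _ Mid j] matrix_vector_mul_assoc[symmetric] w_def)
    also have "\<dots> = w $ Mid - p * w $ j * (y * a)" unfolding t p_def using j by simp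
    finally have e0: "(iv T ** \<sigma> ** T) $ Mid $ j = w $ Mid - p * w $ j * (y * a)" .
    have e: "p * (cj x * mu F * (\<sigma> $ Mid $ Mid - \<sigma> $ j $ j) * y * a)
      = cj x * mu F * (iv T ** \<sigma> ** T) $ Mid $ j - cj x * mu F * \<sigma> $ Mid $ j
        - s * (cj x * mu F * \<sigma> $ Mid $ (- j)) + (p * a * cj x * mu F * p * y * a) * (\<sigma> $ j $ Mid * y)
        + (p * a * cj x * mu F * y * s) * \<sigma> $ j $ (- j)"
      unfolding e0 w by (simp add: algebra_simps)
    have "p * (cj x * mu F * (\<sigma> $ Mid $ Mid - \<sigma> $ j $ j) * y * a) \<in> A 9"
      unfolding e using j by (intro A_intros entry_0j entry_i0 H' \<sigma> x y A_mono[OF _ offdiag8[OF \<sigma>]]) auto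
    then have "cj p * (p * (cj x * mu F * (\<sigma> $ Mid $ Mid - \<sigma> $ j $ j) * y * a)) \<in> A 9" by (rule A_intros)
    then show ?thesis
      using absorb_prod(4)[OF rho_unit[of "- j"]] j unfolding p_def by simp
  qed
  then have "cj x * mu F * (\<sigma> $ Mid $ Mid - \<sigma> $ j $ j) * y \<in> A (Suc 9)" by (rule A_SucI)
  then show ?thesis by simp
qed

lemma level_J_subset: "ideal_generated (level_Y F H \<union> cj ` level_Y F H) \<subseteq> A 10"
proof (rule ideal_generated_least[OF A_ideal])
  have "level_Y F H \<subseteq> A 10"
    unfolding level_Y_def theta_hb_iff using offdiag8 diag9 entry_i0 entry_0j entry_00
    by (auto simp: theta_hb_iff intro: A_mono[of 8] A_mono[of 9])
  then show "level_Y F H \<union> cj ` level_Y F H \<subseteq> A 10" using A_cj by blast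
qed

end

section \<open>From short to long transvections\<close>

context hermitian_form_ring
begin

text \<open>The action of the ring on the Heisenberg group is additive only up to a central element.\<close>
lemma Delta_act_add:
  assumes "(p, z) \<in> Delta F"
  shows "heis_act F (p, z) (x + y) = heis_act F (p, z) x \<otimes>\<^bsub>heis F\<^esub> heis_act F (p, z) y \<otimes>\<^bsub>heis F\<^esub> tr0 (cj y * z * x)"
proof -
  have "cj p * mu F * p = - z - cj z * lam F"
    using Delta_maxD[OF assms] by (simp add: eq_neg_iff_add_eq_0 algebra_simps)
  then have "cj x * (cj p * mu F * p) * y = cj x * (- z - cj z * lam F) * y" by simp
  then show ?thesis by (simp add: tr0_def algebra_simps)
qed

lemma Q_U_Delta:
  assumes "\<sigma> \<in> carrier (U F)"
  shows "i \<noteq> Mid \<Longrightarrow> Q (\<sigma> *v ax i) \<in> Delta F"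
    and "Q (\<sigma> *v ax Mid) \<otimes>\<^bsub>heis F\<^esub> inv\<^bsub>heis F\<^esub> (1, 0) \<in> Delta F"
proof -
  show "Q (\<sigma> *v ax i) \<in> Delta F" if "i \<noteq> Mid"
    using U_D(2)[OF assms, of "ax i"] that by (cases i; cases "Q (\<sigma> *v ax i)") (simp_all add: heis_cong_def form_Q_eq cross_ax_left)
  show "Q (\<sigma> *v ax Mid) \<otimes>\<^bsub>heis F\<^esub> inv\<^bsub>heis F\<^esub> (1, 0) \<in> Delta F"
    using U_D(2)[OF assms, of "ax Mid"] by (simp add: heis_cong_def form_Q_eq cross_ax_left)
qed

lemma U_entry_0j:
  assumes "\<sigma> \<in> carrier (U F)" "j \<noteq> Mid"
  shows "\<sigma> $ Mid $ j \<in> J_Delta F"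
  using U_D(3)[OF assms(1), of "ax j"] assms(2) by (simp add: matrix_entry)

lemma U_inv_diag:
  assumes "\<sigma> \<in> carrier (U F)" "i \<noteq> Mid"
  shows "(inv\<^bsub>U F\<^esub> \<sigma>) $ i $ i = cj (\<sigma> $ (- i) $ (- i))"
proof -
  have "cj (beta (- i)) * (beta (- i) * (inv\<^bsub>U F\<^esub> \<sigma>) $ i $ i) = cj (beta (- i)) * (cj (\<sigma> $ (- i) $ (- i)) * beta (- i))"
    using U_inv_entry[OF assms(1), of "- i" i] by simp
  moreover have "beta (- i) * cj (beta (- i)) = 1" using beta_unit[of "- i"] assms(2) by simp
  ultimately show ?thesis by (simp add: absorb_prod[OF \<open>beta (- i) * cj (beta (- i)) = 1\<close>])
qed

text \<open>The conditions on \<open>\<sigma>\<close> to be scalar modulo \<open>J\<close> that do not involve the entry in the middle.\<close>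
definition near :: "'a set \<Rightarrow> ('a, 'n::finite) tmat \<Rightarrow> bool" where
  "near J \<sigma> \<longleftrightarrow> (\<forall>i j. i \<noteq> Mid \<longrightarrow> j \<noteq> Mid \<longrightarrow>
     (i \<noteq> j \<longrightarrow> \<sigma> $ i $ j \<in> J) \<and> \<sigma> $ i $ i - \<sigma> $ j $ j \<in> J \<and>
     (\<forall>y\<in>J_Delta F. \<sigma> $ i $ Mid * y \<in> J \<and> cj y * mu F * \<sigma> $ Mid $ j \<in> J))"

lemma nearD:
  assumes "near J \<sigma>"
  shows "i \<noteq> Mid \<Longrightarrow> j \<noteq> Mid \<Longrightarrow> i \<noteq> j \<Longrightarrow> \<sigma> $ i $ j \<in> J"
    "i \<noteq> Mid \<Longrightarrow> j \<noteq> Mid \<Longrightarrow> \<sigma> $ i $ i - \<sigma> $ j $ j \<in> J"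
    "i \<noteq> Mid \<Longrightarrow> y \<in> J_Delta F \<Longrightarrow> \<sigma> $ i $ Mid * y \<in> J"
    "j \<noteq> Mid \<Longrightarrow> y \<in> J_Delta F \<Longrightarrow> cj y * mu F * \<sigma> $ Mid $ j \<in> J"
  using assms unfolding near_def by blast+

lemma near_inv_diag:
  fixes \<sigma> :: "('a, 'n::finite) tmat"
  assumes J: "is_ideal J" and \<sigma>: "\<sigma> \<in> carrier (U F)" "near J \<sigma>" and i: "i \<noteq> Mid"
  shows "\<sigma> $ i $ i * (inv\<^bsub>U F\<^esub> \<sigma>) $ i $ i - 1 \<in> J"
proof -
  have "(\<sigma> ** inv\<^bsub>U F\<^esub> \<sigma>) $ i $ i = 1" using U_inv(1)[OF \<sigma>(1)] by (simp add: mat_def)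
  then have "1 = (\<Sum>m\<in>UNIV. \<sigma> $ i $ m * (inv\<^bsub>U F\<^esub> \<sigma>) $ m $ i)" by (simp add: matrix_matrix_mult_def)
  also have "\<dots> = \<sigma> $ i $ i * (inv\<^bsub>U F\<^esub> \<sigma>) $ i $ i + (\<Sum>m\<in>UNIV - {i}. \<sigma> $ i $ m * (inv\<^bsub>U F\<^esub> \<sigma>) $ m $ i)"
    by (rule sum.remove) simp_all
  finally have eq: "\<sigma> $ i $ i * (inv\<^bsub>U F\<^esub> \<sigma>) $ i $ i - 1 = - (\<Sum>m\<in>UNIV - {i}. \<sigma> $ i $ m * (inv\<^bsub>U F\<^esub> \<sigma>) $ m $ i)"
    by (simp add: eq_diff_eq' algebra_simps)
  have "\<sigma> $ i $ m * (inv\<^bsub>U F\<^esub> \<sigma>) $ m $ i \<in> J" if "m \<noteq> i" for m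
  proof (cases "m = Mid")
    case True
    then show ?thesis using nearD(3)[OF \<sigma>(2) i U_entry_0j[OF U_inv(3)[OF \<sigma>(1)] i]] by simp
  next
    case False
    then show ?thesis using nearD(1)[OF \<sigma>(2) i False] that ideal_mult'[OF J] by blast
  qed
  then show ?thesis unfolding eq by (intro ideal_neg ideal_sum J) auto
qed

lemma near_unit:
  fixes \<sigma> :: "('a, 'n::finite) tmat"
  assumes J: "is_ideal J" and \<sigma>: "\<sigma> \<in> carrier (U F)" "near J \<sigma>" and ij: "i \<noteq> Mid" "j \<noteq> Mid"
  shows "\<sigma> $ i $ i * (inv\<^bsub>U F\<^esub> \<sigma>) $ j $ j - 1 \<in> J"
proof -
  have "(\<sigma> $ j $ j * (inv\<^bsub>U F\<^esub> \<sigma>) $ j $ j - 1) + (inv\<^bsub>U F\<^esub> \<sigma>) $ j $ j * (\<sigma> $ i $ i - \<sigma> $ j $ j) \<in> J"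
    by (intro ideal_add ideal_mult J near_inv_diag \<sigma> ij nearD(2)[OF \<sigma>(2)])
  then show ?thesis by (simp add: algebra_simps)
qed

text \<open>The diagonal entries are units modulo \<open>J\<close> with inverse \<open>cj\<close>, because those of the inverse
  matrix are their conjugates at the opposite index.\<close>
lemma near_norm_diag:
  fixes \<sigma> :: "('a, 'n::finite) tmat"
  assumes J: "is_ideal J" and \<sigma>: "\<sigma> \<in> carrier (U F)" "near J \<sigma>" and i: "i \<noteq> Mid"
  shows "\<sigma> $ i $ i * cj (\<sigma> $ i $ i) - 1 \<in> J"
  using near_unit[OF J \<sigma> i, of "- i"] U_inv_diag[OF \<sigma>(1), of "- i"] i by simp

lemma cross_near:
  fixes v w :: "'a ^ ('n::finite) theta"
  assumes J: "is_ideal J" "involution_invariant F J" and "\<And>k. v $ Pos k \<in> J \<or> w $ Neg k \<in> J"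
  shows "cross v w \<in> J"
  unfolding cross_def
proof (rule ideal_sum[OF J(1)])
  fix k show "cj (v $ Pos k) * w $ Neg k \<in> J"
    using assms(3)[of k] involution_invariantD[OF J(2), of "v $ Pos k"] J(1) by (auto intro: ideal_intros)
qed

lemma near_Q_snd:
  assumes J: "is_ideal J" "involution_invariant F J" and \<sigma>: "near J \<sigma>" and i: "i \<noteq> Mid"
  shows "snd (Q (\<sigma> *v ax i)) \<in> J"
proof -
  have "cross (\<sigma> *v ax i) (\<sigma> *v ax i) \<in> J"
  proof (rule cross_near[OF J])
    fix k
    have "Pos k \<noteq> i \<or> Neg k \<noteq> i" by (cases i) auto
    then show "(\<sigma> *v ax i) $ Pos k \<in> J \<or> (\<sigma> *v ax i) $ Neg k \<in> J"
      using nearD(1)[OF \<sigma>, of "Pos k" i] nearD(1)[OF \<sigma>, of "Neg k" i] i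
      by (auto simp: matrix_entry[symmetric])
  qed
  then show ?thesis by (simp add: form_Q_eq)
qed

text \<open>The generators of the second kind of the form parameter of the upper level.\<close>
definition zeta :: "('a, 'n::finite) tmat \<Rightarrow> 'n theta \<Rightarrow> 'a \<times> 'a \<Rightarrow> 'a \<times> 'a" where
  "zeta \<sigma> i \<alpha> = heis_act F (Q (\<sigma> *v ax Mid) \<otimes>\<^bsub>heis F\<^esub> inv\<^bsub>heis F\<^esub> (1, 0)) (fst \<alpha>)
        \<otimes>\<^bsub>heis F\<^esub> \<alpha> \<otimes>\<^bsub>heis F\<^esub> inv\<^bsub>heis F\<^esub> (heis_act F \<alpha> (\<sigma> $ i $ i))"

lemma zeta_eq:
  "zeta \<sigma> i (y, z) = ((\<sigma> $ Mid $ Mid - \<sigma> $ i $ i) * y,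
     cj y * y * cross (\<sigma> *v ax Mid) (\<sigma> *v ax Mid) + z * (1 - cj (\<sigma> $ i $ i) * \<sigma> $ i $ i)
     + cj y * mu F * y * \<sigma> $ i $ i * cj (\<sigma> $ Mid $ Mid - \<sigma> $ i $ i))"
  by (simp add: zeta_def form_Q_eq matrix_entry[symmetric]) (simp add: algebra_simps)

lemma zeta_Delta:
  assumes "\<sigma> \<in> carrier (U F)" "\<alpha> \<in> Delta F"
  shows "zeta \<sigma> i \<alpha> \<in> Delta F"
  unfolding zeta_def by (intro Delta_mult Delta_act Delta_inv Q_U_Delta assms)

lemma zeta_snd:
  fixes \<sigma> :: "('a, 'n::finite) tmat"
  assumes J: "is_ideal J" "involution_invariant F J" and \<sigma>: "\<sigma> \<in> carrier (U F)" "near J \<sigma>"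
    and \<sigma>0: "\<And>x y. x \<in> J_Delta F \<Longrightarrow> y \<in> J_Delta F \<Longrightarrow> cj x * mu F * (\<sigma> $ Mid $ Mid - \<sigma> $ i $ i) * y \<in> J"
    and i: "i \<noteq> Mid" and \<alpha>: "\<alpha> \<in> Delta F"
  shows "snd (zeta \<sigma> i \<alpha>) \<in> J"
proof -
  obtain y z where yz: "\<alpha> = (y, z)" by (cases \<alpha>)
  have y: "y \<in> J_Delta F" using \<alpha> yz by (auto simp: J_Delta_def)
  have "cross (y *s (\<sigma> *v ax Mid)) (y *s (\<sigma> *v ax Mid)) \<in> J"
    by (rule cross_near[OF J]) (use nearD(3)[OF \<sigma>(2) _ y] in \<open>simp add: matrix_entry[symmetric] mult.commute\<close>)
  then have 1: "cj y * y * cross (\<sigma> *v ax Mid) (\<sigma> *v ax Mid) \<in> J" by (simp add: cross_lin mult_ac)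
  have "(- z) * (\<sigma> $ i $ i * cj (\<sigma> $ i $ i) - 1) \<in> J"
    by (intro ideal_mult J near_norm_diag \<sigma> i)
  then have 2: "z * (1 - cj (\<sigma> $ i $ i) * \<sigma> $ i $ i) \<in> J" by (simp add: algebra_simps)
  have "cj (cj y * mu F * (\<sigma> $ Mid $ Mid - \<sigma> $ i $ i) * y) * (lam F * \<sigma> $ i $ i) \<in> J"
    by (intro ideal_mult' J(1) involution_invariantD[OF J(2)] \<sigma>0 y)
  then have 3: "cj y * mu F * y * \<sigma> $ i $ i * cj (\<sigma> $ Mid $ Mid - \<sigma> $ i $ i) \<in> J"
    by (simp add: mult_ac lam_absorb algebra_simps)
  show ?thesis unfolding yz zeta_eq using 1 2 3 by (simp add: ideal_add[OF J(1)])
qed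

end

context subnormal
begin

text \<open>Stability under the action of the ring is not available for this set, which is why \<open>K\<close> and \<open>Lam_additive\<close>
  are needed.\<close>
definition Lam :: "'n theta \<Rightarrow> ('a \<times> 'a) set" where
  "Lam k = {(x, z). transv (ax k) (x *s ax Mid) z \<in> H}"

lemma Lam_subgroup: assumes "k \<noteq> Mid" shows "subgroup (Lam k) (heis F)"
proof (rule heis.subgroupI)
  show "Lam k \<noteq> {}" using H_one by (auto simp: Lam_def intro!: exI[of _ 0])
  have m: "transv (ax k) (x *s ax Mid) z ** transv (ax k) (x' *s ax Mid) z'
      = transv (ax k) ((x + x') *s ax Mid) (z + z' - cj x * mu F * x')" for x z x' z'
    using assms by (subst transv_mult) (simp_all add: B_lin vector_sadd_rdistrib mult_ac)
  show "\<alpha> \<otimes>\<^bsub>heis F\<^esub> \<beta> \<in> Lam k" if "\<alpha> \<in> Lam k" "\<beta> \<in> Lam k" for \<alpha> \<beta>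
  proof -
    obtain x z x' z' where ab: "\<alpha> = (x, z)" "\<beta> = (x', z')" by (cases \<alpha>; cases \<beta>)
    have "transv (ax k) (x *s ax Mid) z ** transv (ax k) (x' *s ax Mid) z' \<in> H"
      using that by (intro H_mult) (simp_all add: Lam_def ab)
    then show ?thesis unfolding m by (simp add: Lam_def ab)
  qed
  show "inv\<^bsub>heis F\<^esub> \<alpha> \<in> Lam k" if "\<alpha> \<in> Lam k" for \<alpha>
  proof -
    obtain x z where \<alpha>: "\<alpha> = (x, z)" by (cases \<alpha>)
    then have h: "transv (ax k) (x *s ax Mid) z \<in> H" using that by (simp add: Lam_def)
    have "transv (ax k) (x *s ax Mid) z ** transv (ax k) ((- x) *s ax Mid) (- z - cj x * mu F * x) = mat 1"
      unfolding m by simp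
    then have "transv (ax k) (x *s ax Mid) z ** transv (ax k) ((- x) *s ax Mid) (- z - cj x * mu F * x) \<in> H"
      using H_one by simp
    then show ?thesis using H_cancel_left[OF h] by (simp add: Lam_def \<alpha>)
  qed
qed simp

lemma Lam_mult: "k \<noteq> Mid \<Longrightarrow> \<alpha> \<in> Lam k \<Longrightarrow> \<beta> \<in> Lam k \<Longrightarrow> \<alpha> \<otimes>\<^bsub>heis F\<^esub> \<beta> \<in> Lam k"
  by (rule subgroup.m_closed[OF Lam_subgroup])

lemma Lam_inv: "k \<noteq> Mid \<Longrightarrow> \<alpha> \<in> Lam k \<Longrightarrow> inv\<^bsub>heis F\<^esub> \<alpha> \<in> Lam k"
  by (rule subgroup.m_inv_closed[OF Lam_subgroup])

lemma Lam_one: "k \<noteq> Mid \<Longrightarrow> (0, 0) \<in> Lam k"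
  using subgroup.one_closed[OF Lam_subgroup] by simp

lemma Lam_cancel:
  assumes k: "k \<noteq> Mid" and "\<beta> \<in> Lam k"
  shows "\<alpha> \<otimes>\<^bsub>heis F\<^esub> \<beta> \<in> Lam k \<longleftrightarrow> \<alpha> \<in> Lam k" "\<beta> \<otimes>\<^bsub>heis F\<^esub> \<alpha> \<in> Lam k \<longleftrightarrow> \<alpha> \<in> Lam k"
proof -
  have e: "\<alpha> = (\<alpha> \<otimes>\<^bsub>heis F\<^esub> \<beta>) \<otimes>\<^bsub>heis F\<^esub> inv\<^bsub>heis F\<^esub> \<beta>" "\<alpha> = inv\<^bsub>heis F\<^esub> \<beta> \<otimes>\<^bsub>heis F\<^esub> (\<beta> \<otimes>\<^bsub>heis F\<^esub> \<alpha>)"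
    by (cases \<alpha>; cases \<beta>; simp add: algebra_simps)+
  show "\<alpha> \<otimes>\<^bsub>heis F\<^esub> \<beta> \<in> Lam k \<longleftrightarrow> \<alpha> \<in> Lam k"
    using e(1) Lam_mult[OF k] Lam_inv[OF k] assms(2) by metis
  show "\<beta> \<otimes>\<^bsub>heis F\<^esub> \<alpha> \<in> Lam k \<longleftrightarrow> \<alpha> \<in> Lam k"
    using e(2) Lam_mult[OF k] Lam_inv[OF k] assms(2) by metis
qed

text \<open>The elements all of whose multiples are parameters in \<open>H\<close> for short transvections and for both kinds of
  generators of the smallest form parameter. Terms with parameters in this ideal can be dropped in all
  computations with long transvections.\<close>
definition K :: "'a set" where
  "K = {x. \<forall>r. (\<forall>i j. apart i j \<longrightarrow> x * r \<in> S i j) \<and>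
    (\<forall>k. k \<noteq> Mid \<longrightarrow> tr0 (x * r) \<in> Lam k \<and> (\<forall>\<alpha>\<in>Delta F. heis_act F \<alpha> (x * r) \<in> Lam k))}"

lemma K_D:
  assumes "x \<in> K"
  shows "apart i j \<Longrightarrow> x \<in> S i j" "k \<noteq> Mid \<Longrightarrow> tr0 x \<in> Lam k"
    "k \<noteq> Mid \<Longrightarrow> \<alpha> \<in> Delta F \<Longrightarrow> heis_act F \<alpha> x \<in> Lam k"
  using assms[unfolded K_def mem_Collect_eq, THEN spec[of _ 1]] by auto

lemma K_ideal: "is_ideal K"
  unfolding is_ideal_iff
proof (intro conjI ballI allI)
  have z: "heis_act F \<alpha> 0 = (0, 0)" for \<alpha> by (cases \<alpha>) simp
  show "0 \<in> K" by (simp add: K_def S_zero tr0_zero z Lam_one)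
next
  fix c x assume x: "x \<in> K"
  show "c * x \<in> K" unfolding K_def
  proof (rule CollectI, rule allI)
    fix r
    have e: "c * x * r = x * (c * r)" by (simp only: mult_ac)
    show "(\<forall>i j. apart i j \<longrightarrow> c * x * r \<in> S i j) \<and>
      (\<forall>k. k \<noteq> Mid \<longrightarrow> tr0 (c * x * r) \<in> Lam k \<and> (\<forall>\<alpha>\<in>Delta F. heis_act F \<alpha> (c * x * r) \<in> Lam k))"
      unfolding e using x[unfolded K_def mem_Collect_eq, THEN spec[of _ "c * r"]] .
  qed
next
  fix x y assume x: "x \<in> K" and y: "y \<in> K"
  note xr = x[unfolded K_def mem_Collect_eq, rule_format] and yr = y[unfolded K_def mem_Collect_eq, rule_format]
  show "x + y \<in> K" unfolding K_def
  proof (rule CollectI, rule allI, intro conjI allI impI ballI)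
    fix r
    have d: "(x + y) * r = x * r + y * r" by (simp add: algebra_simps)
    show "(x + y) * r \<in> S i j" if "apart i j" for i j
      unfolding d using that xr yr by (intro S_add) auto
    fix k :: "'n theta" assume k: "k \<noteq> Mid"
    show "tr0 ((x + y) * r) \<in> Lam k"
      unfolding d tr0_add[symmetric] using xr yr k by (intro Lam_mult) auto
    fix \<alpha> assume \<alpha>: "\<alpha> \<in> Delta F"
    obtain p z where pz: "\<alpha> = (p, z)" by (cases \<alpha>)
    have t: "tr0 (x * (r * cj (y * r) * z)) \<in> Lam k" using xr k by blast
    have e: "x * (r * cj (y * r) * z) = cj (y * r) * z * (x * r)" by (simp only: mult_ac)
    show "heis_act F \<alpha> ((x + y) * r) \<in> Lam k"
      unfolding d pz Delta_act_add[OF \<alpha>[unfolded pz]]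
      by (intro Lam_mult k t[unfolded e]) (use xr yr k \<alpha> pz in blast)+
  qed
qed

lemmas K_intros = ideal_intros[OF K_ideal]

text \<open>The commutator of a long and a short transvection is a product of a long and a short one.\<close>
lemma long_short:
  fixes k j :: "'n theta"
  assumes kj: "apart k j" and Lt: "transv (ax j) (y *s ax Mid) z \<in> carrier (U F)"
  shows "transv (ax j) (y *s ax Mid) z ** transv (ax k) (w *s ax (- j)) 0 ** iv (transv (ax j) (y *s ax Mid) z)
    = transv (ax k) (w *s ax (- j)) 0 ** (transv (ax k) ((y * (w * rho j)) *s ax Mid) (cj (w * rho j) * z * (w * rho j))
       ** transv (ax k) ((w * rho j * z) *s ax j) 0)"
proof -
  note d = apartD[OF kj]
  have r: "rho j * beta (- j) = 1" "rho j * cj (rho j) = 1" using rho_beta rho_unit d by simp_all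
  let ?T = "transv (ax j) (y *s ax Mid) z"
  have Tk: "?T *v ax k = ax k" using d by (simp add: transv_apply B_lin)
  have Tj: "?T *v ax (- j) = ax (- j) + (rho j * y) *s ax Mid + (rho j * z) *s ax j"
    using d by (simp add: transv_apply B_lin vec_eq_iff mult_ac)
  have "?T ** transv (ax k) (w *s ax (- j)) 0 ** iv ?T
     = transv (ax k) (w *s ax (- j) + ((y * (w * rho j)) *s ax Mid + (w * rho j * z) *s ax j)) 0"
    unfolding U_conj_transv[OF Lt] matrix_vector_smult Tk Tj by (rule arg_cong2[where f = "transv (ax k)"])
      (simp_all add: vec_eq_iff algebra_simps)
  also have "\<dots> = transv (ax k) (w *s ax (- j)) 0 ** transv (ax k) ((y * (w * rho j)) *s ax Mid + (w * rho j * z) *s ax j)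
      (cj (w * rho j) * z * (w * rho j))"
    using d by (subst transv_mult) (simp_all add: B_lin mult_ac absorb_prod[OF r(1)] absorb_prod[OF r(2)])
  also have "transv (ax k) ((y * (w * rho j)) *s ax Mid + (w * rho j * z) *s ax j) (cj (w * rho j) * z * (w * rho j))
     = transv (ax k) ((y * (w * rho j)) *s ax Mid) (cj (w * rho j) * z * (w * rho j))
       ** transv (ax k) ((w * rho j * z) *s ax j) 0"
    using d by (subst transv_mult) (simp_all add: B_lin)
  finally show ?thesis .
qed

text \<open>Reading \<open>long_short\<close> modulo \<open>H\<close>: a long transvection at index \<open>j\<close>, or a short one at \<open>(k, - j)\<close>, produces a long
  one at index \<open>k\<close>, provided the short factor is known to be in \<open>H\<close>.\<close>
lemma long_transport:
  fixes k j :: "'n theta"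
  assumes kj: "apart k j"
    and LN: "transv (ax j) (y *s ax Mid) z \<in> N" and wN: "transv (ax k) (w *s ax (- j)) 0 \<in> N"
    and one: "transv (ax j) (y *s ax Mid) z \<in> H \<or> transv (ax k) (w *s ax (- j)) 0 \<in> H"
    and s: "w * rho j * z \<in> S k j"
  shows "heis_act F (y, z) (w * rho j) \<in> Lam k"
proof -
  let ?T = "transv (ax j) (y *s ax Mid) z" and ?h = "transv (ax k) (w *s ax (- j)) 0"
  let ?m = "transv (ax k) ((y * (w * rho j)) *s ax Mid) (cj (w * rho j) * z * (w * rho j))"
  let ?s = "transv (ax k) ((w * rho j * z) *s ax j) 0"
  note eq = long_short[OF kj N_U[OF LN], of w]
  have "?m ** ?s \<in> H"
  proof (cases "?h \<in> H")
    case True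
    have "?h ** (?m ** ?s) \<in> H" unfolding eq[symmetric] by (rule N_conj(1)[OF LN True])
    then show ?thesis by (rule H_cancel_left[OF True])
  next
    case False
    then have T: "?T \<in> H" using one by blast
    have "?T ** (?h ** iv ?T ** iv ?h) \<in> H" by (intro H_mult T N_conj(1)[OF wN] H_inv)
    then have "(?T ** ?h ** iv ?T) ** iv ?h \<in> H" by (simp add: matrix_mul_assoc)
    then have "?h ** (?m ** ?s) ** iv ?h \<in> H" unfolding eq .
    then have "iv ?h ** (?h ** (?m ** ?s) ** iv ?h) ** ?h \<in> H" by (rule N_conj(2)[OF wN])
    then show ?thesis by (simp add: matrix_mul_assoc[symmetric] U_cancel[OF N_U[OF wN]] U_inv[OF N_U[OF wN]])
  qed
  then have "?m \<in> H" by (rule H_cancel_right[rotated]) (use s in \<open>simp add: S_def\<close>)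
  then show ?thesis by (simp add: Lam_def)
qed

lemma A_S: "x \<in> A s \<Longrightarrow> y \<in> ideal_pow I s \<Longrightarrow> apart i j \<Longrightarrow> x * y \<in> S i j"
  by (simp add: A_def lev_def)

text \<open>One factor from \<open>I\<close> is spent on a commutator that turns a short transvection into a long one: with
  \<open>E k j a\<close> for the elements \<open>tr0\<close>, and with a long transvection of level \<open>I\<close> for the multiples of \<open>Delta F\<close>.\<close>
lemma A_I_K:
  assumes x: "x \<in> A s" and y: "y \<in> ideal_pow I (Suc s)"
  shows "x * y \<in> K"
proof -
  have "x * (a * b) \<in> K" if a: "a \<in> I" and b: "b \<in> ideal_pow I s" for a b
    unfolding K_def
  proof (rule CollectI, rule allI, intro conjI allI impI ballI)
    fix r
    have br: "b * r \<in> ideal_pow I s" for r using ideal_mult'[OF pow_ideal b] .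
    have ar: "a * r \<in> I" for r using I_mult(2)[OF a] .
    have e: "x * (a * b) * r = x * b * (a * r)" by (simp only: mult_ac)
    show "x * (a * b) * r \<in> S i j" if "apart i j" for i j
      using A_S[OF x br[of "a * r"] that] by (simp add: mult_ac)
    fix k :: "'n theta" assume k: "k \<noteq> Mid"
    obtain j where kj: "apart k j" using third_apart[OF three k k] by blast
    note d = apartD[OF kj]
    have h: "transv (ax k) ((x * b) *s ax j) 0 \<in> H" using A_S[OF x b kj] by (simp add: S_def)
    have Ek: "E k j (a * r) *v ax k = ax k" "E k j (a * r) *v ax j = ax j + (a * r) *s ax k"
      using d by (simp_all add: E_apply[OF kj])
    have "transv (ax k) ((x * b) *s ax j + (x * b * (a * r)) *s ax k) 0 \<in> H"
      using H_conj_transv[OF E_N[OF kj ar] h, of r] by (simp add: Ek matrix_vector_smult)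
    also have "transv (ax k) ((x * b) *s ax j + (x * b * (a * r)) *s ax k) 0
        = transv (ax k) ((x * b) *s ax j) 0 ** transv (ax k) ((x * b * (a * r)) *s ax k) 0"
      by (rule transv_add_right) (use d in \<open>simp_all add: B_lin\<close>)
    finally have "transv (ax k) ((x * b * (a * r)) *s ax k) 0 \<in> H" by (rule H_cancel_left[OF h])
    then show "tr0 (x * (a * b) * r) \<in> Lam k"
      by (simp add: Lam_def tr0_def e transv_parallel)
    fix \<alpha> assume \<alpha>: "\<alpha> \<in> Delta F"
    obtain y z where yz: "\<alpha> = (y, z)" by (cases \<alpha>)
    define w where "w = x * b * cj (rho j) * r"
    have wS: "w * c \<in> S k i" if "apart k i" for c i
      using A_S[OF x br[of "cj (rho j) * r * c"] that] by (simp add: w_def mult_ac)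
    have wH: "transv (ax k) (w *s ax (- j)) 0 \<in> H" using wS[of "- j" 1] kj by (simp add: S_def)
    have "heis_act F (y * a, cj a * z * a) (w * rho j) \<in> Lam k"
      by (rule long_transport[OF kj N_long[OF d(2) \<alpha>[unfolded yz] a] H_N[OF wH]])
        (use wH wS[OF kj, of "rho j * (cj a * z * a)"] in \<open>simp_all add: mult.assoc\<close>)
    moreover have "w * rho j = x * b * r"
      using rho_unit[OF d(2)] by (simp add: w_def mult_ac absorb_prod[OF rho_unit[OF d(2)]])
    ultimately have "heis_act F (heis_act F \<alpha> a) (x * b * r) \<in> Lam k" by (simp add: yz)
    then show "heis_act F \<alpha> (x * (a * b) * r) \<in> Lam k" by (simp add: heis_act_act mult_ac)
  qed
  then have "ideal_prod I (ideal_pow I s) \<subseteq> {y. x * y \<in> K}"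
    by (intro ideal_prod_least) (auto simp: is_ideal_iff distrib_left mult.left_commute[of x] intro: K_intros)
  then show ?thesis using y by auto
qed

text \<open>The condition \<open>- m \<notin> X\<close> makes the directions orthogonal to each other, so the transvection is
  the product of root transvections without central terms.\<close>
lemma H_sum_transv:
  assumes k: "k \<noteq> Mid" and X: "finite X" "\<And>m. m \<in> X \<Longrightarrow> m \<noteq> Mid \<and> - m \<notin> X"
    and c: "\<And>m. m \<in> X \<Longrightarrow> m \<noteq> - k \<Longrightarrow> c m \<in> K" "c (- k) = 0"
  shows "transv (ax k) (\<Sum>m\<in>X. c m *s ax m) 0 \<in> H"
  using X c
proof (induction X rule: finite_induct)
  case empty
  then show ?case by (simp add: H_one)
next
  case (insert m X)
  have "(\<Sum>m\<in>X. c m *s ax m) $ (- k) = 0" "(c m *s ax m) $ (- k) = 0"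
    using insert.prems(3) by (auto intro!: sum.neutral)
  then have B1: "B (ax k) (\<Sum>m\<in>X. c m *s ax m) = 0" "B (ax k) (c m *s ax m) = 0"
    by (simp_all only: B_ax_left mult_zero_right)
  have "- m \<notin> X" using insert.prems(1)[of m] by auto
  then have "(\<Sum>x\<in>X. c x *s ax x) $ (- m) = 0" by (auto intro!: sum.neutral)
  then have B2: "B (c m *s ax m) (\<Sum>x\<in>X. c x *s ax x) = 0"
    by (simp only: B_smult_left B_ax_left mult_zero_right)
  have "transv (ax k) (c m *s ax m) 0 \<in> H"
  proof (cases "m = - k")
    case True then show ?thesis using insert.prems(3) H_one by simp
  next
    case False
    then have cK: "c m \<in> K" using insert.prems(2) by blast
    show ?thesis
    proof (cases "m = k")
      case True then show ?thesis using K_D(2)[OF cK k] by (simp add: Lam_def tr0_def transv_parallel)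
    next
      case m: False
      then have "apart k m" using insert.prems(1)[of m] k False by (auto simp: apart_def)
      then show ?thesis using K_D(1)[OF cK] by (simp add: S_def)
    qed
  qed
  moreover have "transv (ax k) (\<Sum>m\<in>X. c m *s ax m) 0 \<in> H"
    using insert by auto
  moreover have "transv (ax k) (\<Sum>m\<in>insert m X. c m *s ax m) 0
      = transv (ax k) (c m *s ax m) 0 ** transv (ax k) (\<Sum>m\<in>X. c m *s ax m) 0"
    unfolding sum.insert[OF insert.hyps] by (rule transv_add_right) (use k B1 B2 in simp_all)
  ultimately show ?case by (simp add: H_mult)
qed

text \<open>Splitting off the positive and the negative coordinates of \<open>v\<close>, which contribute elements of \<open>H\<close>, leaves the
  long transvection in the middle direction. The two halves are not orthogonal to each other, and their product
  accounts for \<open>cross v v\<close>.\<close>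
lemma Lam_extract:
  assumes k: "k \<noteq> Mid" and h: "transv (ax k) v z \<in> H" and vk: "v $ (- k) = 0"
    and v: "\<And>m. m \<noteq> Mid \<Longrightarrow> m \<noteq> - k \<Longrightarrow> v $ m \<in> K"
  shows "(v $ Mid, z + cross v v) \<in> Lam k"
proof -
  define vp where "vp = (\<Sum>m\<in>range Pos. v $ m *s ax m)"
  define vn where "vn = (\<Sum>m\<in>range Neg. v $ m *s ax m)"
  have vpn: "vp $ Pos i = v $ Pos i" "vp $ Neg i = 0" "vp $ Mid = 0"
      "vn $ Pos i = 0" "vn $ Neg i = v $ Neg i" "vn $ Mid = 0" for i
    by (auto simp: vp_def vn_def if_distrib[of "\<lambda>x. _ * x"] cong: if_cong)
  have split: "v = (vp + vn) + v $ Mid *s ax Mid"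
    unfolding vec_eq_iff
  proof
    fix i show "v $ i = ((vp + vn) + v $ Mid *s ax Mid) $ i" by (cases i) (simp_all add: vpn)
  qed
  have hp: "transv (ax k) vp 0 \<in> H" unfolding vp_def
    by (rule H_sum_transv[OF k]) (use vk v in auto)
  have hn: "transv (ax k) vn 0 \<in> H" unfolding vn_def
    by (rule H_sum_transv[OF k]) (use vk v in auto)
  have Bk: "B (ax k) vp = 0" "B (ax k) vn = 0" using vk k by (cases k; simp add: vpn)+
  have Bpn: "B vp vn = cross v v"
    by (simp add: form_B_cross) (simp add: cross_def vpn)
  have Bm: "B (vp + vn) (v $ Mid *s ax Mid) = 0"
    unfolding B_lin by (simp add: B_ax_right vpn)
  have "transv (ax k) v z = transv (ax k) ((vp + vn) + v $ Mid *s ax Mid) z" using split by simp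
  also have "\<dots> = transv (ax k) (vp + vn) (- cross v v) ** transv (ax k) (v $ Mid *s ax Mid) (z + cross v v)"
    using k Bk Bm by (subst transv_mult) (simp_all add: B_lin)
  also have "transv (ax k) (vp + vn) (- cross v v) = transv (ax k) vp 0 ** transv (ax k) vn 0"
    using k Bk Bpn by (subst transv_mult) simp_all
  finally have "(transv (ax k) vp 0 ** transv (ax k) vn 0) ** transv (ax k) (v $ Mid *s ax Mid) (z + cross v v) \<in> H"
    using h by simp
  then have "transv (ax k) (v $ Mid *s ax Mid) (z + cross v v) \<in> H"
    by (rule H_cancel_left[OF H_mult[OF hp hn]])
  then show ?thesis by (simp add: Lam_def)
qed

end

section \<open>Long transvections from a column\<close>

context subnormal
begin

lemma pow_Suc_I: "ideal_pow I (Suc s) \<subseteq> I"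
  by (simp add: ideal_prod_least[OF I_ideal] I_mult)

lemma near9: "\<sigma> \<in> H \<Longrightarrow> near (A 9) \<sigma>"
  unfolding near_def
  by (auto intro: A_mono[OF _ offdiag8] diag9 entry_i0 entry_0j)

lemma A_inv: "involution_invariant F (A s)"
  by (simp add: involution_invariant_def A_cj)

lemma H_parallel: "k \<noteq> Mid \<Longrightarrow> x \<in> K \<Longrightarrow> transv (ax k) (x *s ax k) 0 \<in> H"
  using K_D(2) by (auto simp: Lam_def tr0_def transv_parallel)

lemma H_short: "apart i j \<Longrightarrow> x \<in> K \<Longrightarrow> transv (ax i) (x *s ax j) 0 \<in> H"
  using K_D(1) by (auto simp: S_def)

text \<open>Again \<open>\<tau> = transv u (b *s w) 0\<close> with \<open>u\<close> and \<open>w\<close> orthogonal to the \<open>k\<close>-th column of \<open>\<sigma>\<inverse>\<close>, but now the main parts of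
  \<open>u\<close> and \<open>w\<close> are multiples of \<open>ax r\<close> and \<open>ax (- l)\<close>. As off-diagonal entries are small, \<open>\<tau>\<close> is an
  elementary transvection \<open>\<tau>0\<close> times an element of \<open>H\<close>, and the first factor of \<open>parabolic\<close> is known modulo \<open>H\<close>. The
  second one is a transvection along \<open>ax k\<close> in direction \<open>v' = \<sigma> \<tau>\<inverse> \<sigma>\<inverse> (a e\<^sub>l)\<close>, which is \<open>a e\<^sub>l\<close> plus a multiple of
  the \<open>r\<close>-th column of \<open>\<sigma>\<close> and small terms. So \<open>Q\<close> of that multiple is the parameter of a long transvection in
  \<open>H\<close>.\<close>
lemma Q_core:
  assumes ap: "apart k l" "apart r l" "apart k r" and \<sigma>: "\<sigma> \<in> H" and a: "a \<in> I" and b: "b \<in> ideal_pow I 9"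
  defines "c \<equiv> \<lambda>i. iv \<sigma> $ i $ k" and "d \<equiv> \<lambda>i. iv \<sigma> $ i $ l"
  shows "heis_act F (Q (\<sigma> *v ax r)) (cj b * a * (cj (c k) * (c k * d l - c l * d k) * beta (- l))) \<in> Lam k"
proof -
  note ds = apartD[OF ap(1)] apartD[OF ap(2)] apartD[OF ap(3)]
  note U\<sigma> = H_U[OF \<sigma>]
  have k: "k \<noteq> Mid" and nk: "- k \<noteq> Mid" using ds by simp_all
  have bI: "b \<in> I" using b pow_Suc_I[of 8] by (auto simp: numeral_eq_Suc)
  have b9: "b \<in> ideal_pow I (Suc 8)" "cj b \<in> ideal_pow I (Suc 8)" "cj b * a \<in> ideal_pow I (Suc 9)"
    using b cj_pow[OF b] ideal_pow_Suc_mult[OF a cj_pow[OF b]] by (simp_all add: mult.commute numeral_eq_Suc)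
  have bK: "b * (x * t) \<in> K" "cj b * (x * t) \<in> K" if "x \<in> A 8" for x t
    using A_I_K[OF that b9(1)] A_I_K[OF that b9(2)] K_intros(4)[of "x * b" t] K_intros(4)[of "x * cj b" t]
    by (simp_all add: mult_ac)
  define uk where "uk = cj (beta (- k) * c k)"
  define uK where "uK = - cj (beta r * c (- r))"
  define wK where "wK = - cj (beta (- l) * c l)"
  define u where "u = uK *s ax (- k) + uk *s ax r"
  define w where "w = wK *s ax (- k) + uk *s ax (- l)"
  have off: "iv \<sigma> $ i $ j \<in> A 8" if "i \<noteq> Mid" "j \<noteq> Mid" "i \<noteq> j" for i j
    by (rule offdiag8[OF H_inv[OF \<sigma>] that])
  have "beta r * c (- r) \<in> A 8" "beta (- l) * c l \<in> A 8"
    unfolding c_def by (intro A_intros(3) off; use ds in simp)+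
  then have uKA: "uK \<in> A 8" "cj uK \<in> A 8" and wKA: "wK \<in> A 8" "cj wK \<in> A 8"
    unfolding uK_def wK_def using A_cj A_intros(5) by (blast, metis, blast, metis)
  define \<tau> where "\<tau> = transv u (b *s w) 0"
  have \<tau>N: "\<tau> \<in> N" unfolding \<tau>_def
    by (rule N_span[OF _ _ _ bI, of "- k" "- l" r u uK 0 uk w wK uk 0])
      (use ap ap[THEN apart_sym] in \<open>simp_all add: u_def w_def\<close>)
  have bs: "B u u = 0" "B u w = 0" "B w w = 0" using ds by (simp_all add: u_def w_def B_lin)
  have col: "(iv \<sigma> *v ax k) $ i = c i" "(iv \<sigma> *v ax l) $ i = d i" for i
    by (simp_all add: c_def d_def matrix_entry[symmetric])
  have uc: "B u (iv \<sigma> *v ax k) = 0" "B w (iv \<sigma> *v ax k) = 0"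
    by (simp_all add: u_def w_def B_lin col uk_def uK_def wK_def mult_ac)
  have \<tau>c: "\<tau> *v (iv \<sigma> *v ax k) = iv \<sigma> *v ax k"
    unfolding \<tau>_def transv_apply by (simp add: B_lin uc C_eq)
  note app = inv_span_apply[OF \<tau>N[unfolded \<tau>_def] bs, folded \<tau>_def]
  \<comment> \<open>main part and small parts of \<open>\<tau>\<close>\<close>
  define b0 where "b0 = cj uk * b * uk"
  define \<tau>0 where "\<tau>0 = transv (ax r) (b0 *s ax (- l)) 0"
  define t1 where "t1 = transv (ax r) ((b * (wK * cj uk)) *s ax (- k)) 0"
  define t2 where "t2 = transv (ax (- k)) ((b * (cj uK * uk)) *s ax (- l)) 0"
  define t3 where "t3 = transv (ax (- k)) ((b * (cj uK * wK)) *s ax (- k)) 0"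
  define \<tau>' where "\<tau>' = t1 ** (t2 ** t3)"
  have \<tau>'H: "\<tau>' \<in> H" unfolding \<tau>'_def t1_def t2_def t3_def
    using ap ap[THEN apart_sym] nk by (intro H_mult H_short H_parallel bK uKA wKA) simp_all
  have \<tau>0N: "\<tau>0 \<in> N" unfolding \<tau>0_def b0_def
    using ap bI by (intro N_short I_mult(2)[OF I_mult(1)]) simp_all
  have \<tau>eq: "\<tau> = \<tau>0 ** \<tau>'"
  proof -
    have "\<tau> = transv (uk *s ax r) (b *s w) 0 ** transv (uK *s ax (- k)) (b *s w) 0"
      unfolding \<tau>_def u_def add.commute[of "uK *s ax (- k)"]
      by (rule transv_add_left) (use ds in \<open>simp_all add: w_def B_lin\<close>)
    also have "transv (uk *s ax r) (b *s w) 0 = transv (ax r) (b0 *s ax (- l) + (b * (wK * cj uk)) *s ax (- k)) 0"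
      by (subst transv_smult_left, rule arg_cong2[where f = "transv (ax r)"])
        (simp_all add: w_def b0_def vec_eq_iff algebra_simps)
    also have "\<dots> = \<tau>0 ** t1" unfolding \<tau>0_def t1_def
      by (rule transv_add_right) (use ds in \<open>simp_all add: B_lin\<close>)
    also have "transv (uK *s ax (- k)) (b *s w) 0
       = transv (ax (- k)) ((b * (cj uK * uk)) *s ax (- l) + (b * (cj uK * wK)) *s ax (- k)) 0"
      by (subst transv_smult_left, rule arg_cong2[where f = "transv (ax (- k))"])
        (simp_all add: w_def vec_eq_iff algebra_simps)
    also have "\<dots> = t2 ** t3" unfolding t2_def t3_def
      by (rule transv_add_right) (use ds in \<open>simp_all add: B_lin\<close>)
    finally show ?thesis by (simp add: \<tau>'_def matrix_mul_assoc)
  qed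
  define g where "g = transv (ax k) (a *s ax l) 0"
  have gN: "g \<in> N" unfolding g_def by (rule N_short[OF ap(1) a])
  have gb: "B (ax k) (ax k) = 0" "B (ax k) (a *s ax l) = 0" "B (a *s ax l) (a *s ax l) = 0"
    using ds by (simp_all add: B_lin)
  define d' where "d' = iv \<sigma> *v (a *s ax l)"
  define v' where "v' = \<sigma> *v (iv \<tau> *v d')"
  define D where "D = transv (ax k) (- v') 0"
  note par = parabolic[OF \<sigma> \<tau>N gN[unfolded g_def] gb \<tau>c, folded g_def d'_def, folded v'_def, folded D_def]
  have X: "transv (iv \<tau> *v ax k) (iv \<tau> *v (a *s ax l)) 0 = iv \<tau> ** g ** \<tau>"
    using U_conj_transv[OF U_inv(3)[OF N_U[OF \<tau>N]], of "ax k" "a *s ax l" 0]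
    by (simp add: U_inv_inv[OF N_U[OF \<tau>N]] g_def)
  define g1 where "g1 = iv \<tau>0 ** g ** \<tau>0"
  have g1N: "g1 \<in> N" unfolding g1_def by (intro N_mult N_inv gN \<tau>0N)
  have "(iv \<tau>' ** (g1 ** \<tau>' ** iv g1)) ** (g1 ** D) = (iv \<tau> ** g ** \<tau>) ** D"
    unfolding \<tau>eq U_inv_mult[OF N_U[OF \<tau>0N] H_U[OF \<tau>'H]] g1_def[symmetric]
    by (simp add: matrix_mul_assoc[symmetric] U_cancel[OF N_U[OF g1N]]) (simp add: g1_def matrix_mul_assoc)
  then have "(iv \<tau>' ** (g1 ** \<tau>' ** iv g1)) ** (g1 ** D) \<in> H" using par(1) X by simp
  then have g1D: "g1 ** D \<in> H"
    by (rule H_cancel_left[rotated]) (intro H_mult H_inv \<tau>'H N_conj(1)[OF g1N])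
  define e where "e = a * (cj b0 * beta (- l))"
  define v2 where "v2 = a *s ax l + e *s ax r"
  have g1eq: "g1 = transv (ax k) v2 0"
  proof -
    have i0: "iv \<tau>0 = transv (ax r) (- (b0 *s ax (- l))) 0"
      using U_inv_transv[of "ax r" "b0 *s ax (- l)" 0] N_U[OF \<tau>0N] ds by (simp add: \<tau>0_def B_lin)
    have 0: "iv \<tau>0 *v ax k = ax k" "iv \<tau>0 *v ax l = ax l + (cj b0 * beta (- l)) *s ax r"
      unfolding i0 transv_apply using ds by (simp_all add: B_lin vector_smult_lneg)
    have "g1 = transv (iv \<tau>0 *v ax k) (iv \<tau>0 *v (a *s ax l)) 0"
      using U_conj_transv[OF U_inv(3)[OF N_U[OF \<tau>0N]], of "ax k" "a *s ax l" 0]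
      by (simp add: U_inv_inv[OF N_U[OF \<tau>0N]] g_def g1_def)
    then show ?thesis by (simp add: 0 matrix_vector_smult v2_def e_def)
  qed
  have Bkv: "B (ax k) v' = 0" by (rule par(2))
  have Bkv2: "B (ax k) v2 = 0" and v2v2: "B v2 v2 = 0" "cross v2 v2 = 0"
    using ds by (auto simp: v2_def B_lin cross_lin cross_ax_left split: theta.split)
  have iso: "B (\<sigma> *v x) (\<sigma> *v y) = B x y" "B (iv \<sigma> *v x) (iv \<sigma> *v y) = B x y" "B (iv \<tau> *v x) (iv \<tau> *v y) = B x y" for x y
    using U_D(1)[OF U\<sigma>] U_D(1)[OF U_inv(3)[OF U\<sigma>]] U_D(1)[OF U_inv(3)[OF N_U[OF \<tau>N]]] by (simp_all add: isometry_def)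
  have v'v': "B v' v' = 0" unfolding v'_def d'_def iso using gb(3) .
  \<comment> \<open>difference of the direction of \<open>D\<close> and its elementary main part; its hyperbolic coordinates turn out to be in \<open>K\<close>\<close>
  define \<delta> where "\<delta> = v' - v2"
  have \<delta>H: "transv (ax k) \<delta> (B v' v2) \<in> H"
  proof -
    have "(g1 ** D) ** transv (ax k) \<delta> (B v' v2) = transv (ax k) 0 0"
      unfolding g1eq D_def \<delta>_def using gb(1) Bkv Bkv2 v2v2(1) v'v'
      by (subst transv_mult, simp_all add: B_lin, subst transv_mult, simp_all add: B_lin)
    then have "(g1 ** D) ** transv (ax k) \<delta> (B v' v2) \<in> H" using H_one by simp
    then show ?thesis by (rule H_cancel_left[OF g1D])
  qed
  define p where "p = B w d'"
  define q where "q = B u d'"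
  define yr where "yr = cj b * p * uk"
  define yk where "yk = - (cj (lam F) * q * b * wK) + cj b * p * uK"
  define yl where "yl = - (cj (lam F) * q * b * uk)"
  have d'eq: "d' $ i = a * d i" for i by (simp add: d'_def matrix_vector_smult col)
  have ph: "p = a * (beta (- k) * beta (- l) * (c k * d l - c l * d k))"
    unfolding p_def w_def by (simp add: B_lin d'eq uk_def wK_def algebra_simps)
  have qh: "q = a * (cj uk * beta r * d (- r) + cj uK * beta (- k) * d k)"
    unfolding q_def u_def by (simp add: B_lin d'eq algebra_simps)
  have qA: "q \<in> A 8" "cj q \<in> A 8"
  proof -
    show "q \<in> A 8" unfolding qh d_def using uKA off[of "- r" l] ds by (intro A_intros) auto
    then show "cj q \<in> A 8" by (rule A_cj)
  qed
  have v'eq: "v' = a *s ax l + (yr *s (\<sigma> *v ax r) + (yk *s (\<sigma> *v ax (- k)) + yl *s (\<sigma> *v ax (- l))))"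
  proof -
    have y: "iv \<tau> *v d' = d' + (yr *s ax r + (yk *s ax (- k) + yl *s ax (- l)))"
      unfolding app p_def[symmetric] by (simp add: C_eq q_def[symmetric] vec_eq_iff)
        (simp add: u_def w_def yr_def yk_def yl_def algebra_simps)
    have "\<sigma> *v d' = a *s ax l" unfolding d'_def by (rule U_inv_apply(1)[OF U\<sigma>])
    then show ?thesis unfolding v'_def y
      by (simp only: matrix_vector_right_distrib matrix_vector_smult)
  qed
  define Y where "Y = yr *s (\<sigma> *v ax r) + (yk *s (\<sigma> *v ax (- k)) + yl *s (\<sigma> *v ax (- l)))"
  have \<delta>eq: "\<delta> = Y - e *s ax r" unfolding \<delta>_def v'eq v2_def Y_def by simp
  have ykK: "yk \<in> K" "cj yk \<in> K"
    unfolding yk_def using bK[OF qA(1), of "cj (lam F) * wK"] bK(2)[OF uKA(1), of p]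
      bK[OF qA(2), of "lam F * cj wK"] bK(1)[OF uKA(2), of "cj p"]
    by (auto intro!: K_intros(6) simp: mult_ac)
  have ylK: "yl \<in> K" "cj yl \<in> K"
    unfolding yl_def using bK[OF qA(1), of "cj (lam F) * uk"] bK[OF qA(2), of "lam F * cj uk"]
    by (auto intro!: K_intros(5) simp: mult_ac)
  have uu: "beta (- k) * cj (beta (- k)) = 1" using beta_unit[OF nk] .
  have yrh: "yr = cj b * a * (cj (c k) * (c k * d l - c l * d k) * beta (- l))"
    unfolding yr_def ph uk_def by (simp add: mult_ac absorb_prod[OF uu])
  have eh: "e = cj b * a * (cj (c k) * c k * beta (- l))"
    unfolding e_def b0_def uk_def by (simp add: mult_ac absorb_prod[OF uu])
  have \<delta>K: "\<delta> $ m \<in> K" if m: "m \<noteq> Mid" "m \<noteq> - k" for m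
  proof -
    have "Y $ m = \<sigma> $ m $ r * yr + (yk * \<sigma> $ m $ (- k) + yl * \<sigma> $ m $ (- l))"
      by (simp add: Y_def matrix_entry[symmetric] mult.commute)
    moreover have "yk * \<sigma> $ m $ (- k) + yl * \<sigma> $ m $ (- l) \<in> K"
      by (intro K_intros ykK ylK)
    moreover have "\<sigma> $ m $ r * yr - (if m = r then e else 0) \<in> K"
    proof (cases "m = r")
      case False
      then have "cj b * (\<sigma> $ m $ r * (p * uk)) \<in> K" by (intro bK offdiag8 \<sigma>) (use m ds in auto)
      then show ?thesis using False by (simp add: yr_def mult_ac)
    next
      case True
      have "\<sigma> $ r $ r * d l - 1 \<in> A 9" unfolding d_def
        by (rule near_unit[OF A_ideal U\<sigma> near9[OF \<sigma>]]) (use ds in simp_all)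
      moreover have "c l \<in> A 9" unfolding c_def by (rule A_mono[OF _ off]) (use ds in simp_all)
      ultimately have "cj (c k) * beta (- l) * (c k * (\<sigma> $ r $ r * d l - 1) - \<sigma> $ r $ r * d k * c l) \<in> A 9"
        by (rule A_intros(3)[OF A_intros(6)[OF A_intros(3) A_intros(3)]])
      then have "(cj (c k) * beta (- l) * (c k * (\<sigma> $ r $ r * d l - 1) - \<sigma> $ r $ r * d k * c l)) * (cj b * a) \<in> K"
        by (rule A_I_K[OF _ b9(3)])
      moreover have "\<sigma> $ r $ r * yr - e = (cj (c k) * beta (- l) * (c k * (\<sigma> $ r $ r * d l - 1) - \<sigma> $ r $ r * d k * c l)) * (cj b * a)"
        unfolding yrh eh by (simp add: algebra_simps)
      ultimately show ?thesis using True by simp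
    qed
    moreover have "\<delta> $ m = (Y $ m - \<sigma> $ m $ r * yr) + (\<sigma> $ m $ r * yr - (if m = r then e else 0))"
      by (simp add: \<delta>eq)
    ultimately show ?thesis by (metis K_intros(2) add_diff_cancel_left')
  qed
  have \<delta>k: "\<delta> $ (- k) = 0"
  proof -
    have "beta k * \<delta> $ (- k) = B (ax k) \<delta>" by simp
    also have "\<dots> = 0" unfolding \<delta>_def using Bkv Bkv2 by (simp add: B_lin del: B_ax_left)
    finally have "cj (beta k) * (beta k * \<delta> $ (- k)) = 0" by simp
    then show ?thesis by (simp add: absorb_prod[OF beta_unit[OF k]])
  qed
  have L1: "(\<delta> $ Mid, B v' v2 + cross \<delta> \<delta>) \<in> Lam k"
    by (rule Lam_extract[OF k \<delta>H \<delta>k \<delta>K])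
  have "(\<delta> $ Mid, B v' v2 + cross \<delta> \<delta>) = Q v' \<otimes>\<^bsub>heis F\<^esub> tr0 (- cross v2 v')"
    using ds v2v2(2) by (simp add: \<delta>_def form_Q_eq tr0_def cross_lin form_B_cross[of v' v2])
      (simp add: v2_def)
  moreover have lr: "Y $ (- l) \<in> K" "Y $ (- r) \<in> K" "v' $ (- l) \<in> K" "v' $ (- r) \<in> K"
    using \<delta>K[of "- l"] \<delta>K[of "- r"] ds unfolding \<delta>eq v'eq Y_def[symmetric] by simp_all
  have "cross v2 v' \<in> K"
    unfolding v2_def cross_lin cross_ax_left using lr
    by (cases l; cases r) (auto intro!: K_intros(1-3))
  then have "tr0 (- cross v2 v') \<in> Lam k" by (intro K_D(2)[OF _ k] K_intros)
  ultimately have L2: "Q v' \<in> Lam k" using L1 Lam_cancel(1)[OF k] by metis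
  have "Q v' = Q Y \<otimes>\<^bsub>heis F\<^esub> (0, B Y (a *s ax l)) \<otimes>\<^bsub>heis F\<^esub> tr0 (cross (a *s ax l) Y)"
  proof -
    have "Q (a *s ax l) = (0, 0)" using ds by (simp add: form_Q_eq cross_lin cross_ax_left split: theta.split)
    moreover have "v' = Y + a *s ax l" unfolding v'eq Y_def[symmetric] by simp
    ultimately show ?thesis by (cases "Q Y") (simp add: Q_add)
  qed
  moreover have "cross (a *s ax l) Y \<in> K"
    unfolding cross_lin cross_ax_left using lr by (cases l) (auto intro!: K_intros(1-3))
  then have "tr0 (cross (a *s ax l) Y) \<in> Lam k" by (rule K_D(2)[OF _ k])
  ultimately have "Q Y \<otimes>\<^bsub>heis F\<^esub> (0, B Y (a *s ax l)) \<in> Lam k" using L2 Lam_cancel(1)[OF k] by metis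
  moreover have "(0, B Y (a *s ax l)) \<in> Lam k"
  proof -
    define y where "y = yr *s ax r + (yk *s ax (- k) + yl *s ax (- l))"
    have "Y = \<sigma> *v y" unfolding Y_def y_def by (simp only: matrix_vector_right_distrib matrix_vector_smult)
    then have "B Y (a *s ax l) = B y d'" unfolding d'_def using U_adjoint[OF U\<sigma>] by metis
    also have "y = (cj b * p) *s u - (cj (lam F) * q * b) *s w"
      unfolding y_def u_def w_def yr_def yk_def yl_def by (simp add: vec_eq_iff algebra_simps)
    finally have BY: "B Y (a *s ax l) = b * cj p * q - cj (b * cj p * q) * lam F"
      by (simp add: B_lin p_def[symmetric] q_def[symmetric] mult_ac)
    have "b * cj p * q \<in> K" using bK(1)[OF qA(1), of "cj p"] by (simp add: mult_ac)
    then show ?thesis unfolding BY tr0_def[symmetric] by (rule K_D(2)[OF _ k])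
  qed
  ultimately have L3: "Q Y \<in> Lam k" using Lam_cancel(1)[OF k] by blast
  \<comment> \<open>the two remaining columns have coefficients in \<open>K\<close>\<close>
  define R where "R = yk *s (\<sigma> *v ax (- k)) + yl *s (\<sigma> *v ax (- l))"
  have QR: "Q R \<in> Lam k"
  proof -
    have "B (yk *s (\<sigma> *v ax (- k))) (yl *s (\<sigma> *v ax (- l))) = 0" using ds by (simp add: B_lin iso)
    then have "Q R = heis_act F (Q (\<sigma> *v ax (- k))) yk \<otimes>\<^bsub>heis F\<^esub> heis_act F (Q (\<sigma> *v ax (- l))) yl
       \<otimes>\<^bsub>heis F\<^esub> (0, 0) \<otimes>\<^bsub>heis F\<^esub> tr0 (yk * (cj yl * cross (\<sigma> *v ax (- l)) (\<sigma> *v ax (- k))))"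
      unfolding R_def Q_add Q_smult by (simp add: cross_lin mult_ac)
    moreover have "Q (\<sigma> *v ax (- k)) \<in> Delta F" "Q (\<sigma> *v ax (- l)) \<in> Delta F"
      using ds by (auto intro!: Q_U_Delta(1) U\<sigma>)
    ultimately show ?thesis
      by (simp only:) (intro Lam_mult k K_D(3)[OF ykK(1)] K_D(3)[OF ylK(1)] Lam_one K_D(2) K_intros(4) ykK(1))
  qed
  have "B (yr *s (\<sigma> *v ax r)) R = 0" unfolding R_def using ds by (simp add: B_lin iso)
  moreover have "Y = yr *s (\<sigma> *v ax r) + R" by (simp add: Y_def R_def)
  ultimately have "Q Y = heis_act F (Q (\<sigma> *v ax r)) yr \<otimes>\<^bsub>heis F\<^esub> Q R \<otimes>\<^bsub>heis F\<^esub> (0, 0) \<otimes>\<^bsub>heis F\<^esub> tr0 (cross R (yr *s (\<sigma> *v ax r)))"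
    by (simp add: Q_add Q_smult)
  moreover have "cross R (yr *s (\<sigma> *v ax r)) \<in> K"
    using ykK(2) ylK(2) unfolding R_def cross_lin
    by (simp add: distrib_left mult.left_commute[of yr] mult.assoc[symmetric])
      (simp add: mult.commute[of yr] mult.assoc K_intros(2) K_intros(4))
  then have "tr0 (cross R (yr *s (\<sigma> *v ax r))) \<in> Lam k" by (rule K_D(2)[OF _ k])
  ultimately have "heis_act F (Q (\<sigma> *v ax r)) yr \<in> Lam k"
    using L3 Lam_cancel(1)[OF k] QR Lam_one[OF k] by metis
  then show ?thesis unfolding yrh .
qed

end

section \<open>The form parameter of the upper level\<close>

context hermitian_form_ring
begin

lemma Omega_min_fst:
  assumes "is_ideal J" "\<alpha> \<in> Omega_min F J"
  shows "fst \<alpha> \<in> J"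
proof -
  have "subgroup {\<alpha> :: 'a \<times> 'a. fst \<alpha> \<in> J} (heis F)"
  proof (rule heis.subgroupI)
    have "(0, 0) \<in> {\<alpha> :: 'a \<times> 'a. fst \<alpha> \<in> J}" using ideal_zero[OF assms(1)] by simp
    then show "{\<alpha> :: 'a \<times> 'a. fst \<alpha> \<in> J} \<noteq> {}" by (metis empty_iff)
  qed (use ideal_add[OF assms(1)] ideal_neg[OF assms(1)] in auto)
  then have "Omega_min F J \<subseteq> {\<alpha> :: 'a \<times> 'a. fst \<alpha> \<in> J}"
    by (rule Omega_min_least) (use ideal_zero[OF assms(1)] ideal_mult[OF assms(1)] in \<open>auto simp: tr0_def heis_act_def\<close>)
  then show ?thesis using assms(2) by blast
qed

lemma heis_comm: "\<alpha> \<otimes>\<^bsub>heis F\<^esub> \<beta> = \<beta> \<otimes>\<^bsub>heis F\<^esub> \<alpha> \<otimes>\<^bsub>heis F\<^esub> tr0 (cj (fst \<beta>) * mu F * fst \<alpha>)"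
  by (cases \<alpha>; cases \<beta>) (simp add: tr0_def mult_ac lam_absorb)

text \<open>Conjugation in the Heisenberg group only shifts the central part, so submodules that contain enough elements
  \<open>tr0\<close> are normal.\<close>
lemma heis_conj:
  "\<beta> \<otimes>\<^bsub>heis F\<^esub> \<alpha> \<otimes>\<^bsub>heis F\<^esub> inv\<^bsub>heis F\<^esub> \<beta> = \<alpha> \<otimes>\<^bsub>heis F\<^esub> tr0 (cj (fst \<alpha>) * mu F * fst \<beta>)"
  by (cases \<alpha>; cases \<beta>) (simp add: tr0_def algebra_simps lam_absorb)

lemma Omega_min_norm:
  assumes J: "is_ideal J" "involution_invariant F J" and "\<alpha> \<in> Omega_min F J"
  shows "\<beta> \<otimes>\<^bsub>heis F\<^esub> \<alpha> \<otimes>\<^bsub>heis F\<^esub> inv\<^bsub>heis F\<^esub> \<beta> \<in> Omega_min F J"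
  unfolding heis_conj
  by (intro heis_submoduleD(3)[OF Omega_min_submodule[OF J(1)]] assms(3) tr0_in_Omega_min J(1) ideal_mult'
      involution_invariantD[OF J(2)] Omega_min_fst[OF J(1)])

lemma submodule_with_Omega_min:
  assumes J: "is_ideal J" "involution_invariant F J" and "is_ideal K"
  shows "heis_submodule F (Omega_min F J <#>\<^bsub>heis F\<^esub> heis_circ F X K)"
  by (rule heis_submodule_set_mult[OF Omega_min_submodule[OF J(1)] heis_submodule_circ[OF assms(3)] Omega_min_norm[OF J]])

lemma set_mult_least: "subgroup T (heis F) \<Longrightarrow> X \<subseteq> T \<Longrightarrow> Y \<subseteq> T \<Longrightarrow> X <#>\<^bsub>heis F\<^esub> Y \<subseteq> T"
  by (auto elim!: set_mult_memE dest: subgroup.m_closed simp del: heis_mult)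

lemma set_mult_incl:
  assumes "heis_submodule F X" "heis_submodule F Y"
  shows "X \<subseteq> X <#>\<^bsub>heis F\<^esub> Y" "Y \<subseteq> X <#>\<^bsub>heis F\<^esub> Y"
proof -
  show "X \<subseteq> X <#>\<^bsub>heis F\<^esub> Y"
  proof
    fix x assume x: "x \<in> X"
    have "x \<otimes>\<^bsub>heis F\<^esub> (0, 0) \<in> X <#>\<^bsub>heis F\<^esub> Y" by (rule set_mult_memI[OF x heis_submoduleD(2)[OF assms(2)]])
    then show "x \<in> X <#>\<^bsub>heis F\<^esub> Y" by (cases x) simp
  qed
  show "Y \<subseteq> X <#>\<^bsub>heis F\<^esub> Y"
  proof
    fix y assume y: "y \<in> Y"
    have "(0, 0) \<otimes>\<^bsub>heis F\<^esub> y \<in> X <#>\<^bsub>heis F\<^esub> Y" by (rule set_mult_memI[OF heis_submoduleD(2)[OF assms(1)] y])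
    then show "y \<in> X <#>\<^bsub>heis F\<^esub> Y" by (cases y) simp
  qed
qed

lemma level_Z_eq:
  "level_Z F X = {Q (\<sigma> *v ax j) | \<sigma> j. \<sigma> \<in> X \<and> j \<noteq> Mid} \<union> {zeta \<sigma> i \<alpha> | \<sigma> i \<alpha>. \<sigma> \<in> X \<and> i \<noteq> Mid \<and> \<alpha> \<in> Delta F}"
  unfolding level_Z_def zeta_def matrix_vector_axis theta_hb_iff ..

lemma level_Z_Delta: "X \<subseteq> carrier (U F) \<Longrightarrow> level_Z F X \<subseteq> Delta F"
  unfolding level_Z_eq using Q_U_Delta(1) zeta_Delta by blast

lemma zeta_act:
  assumes "\<alpha> = (y, z)"
  shows "heis_act F (zeta \<sigma> i \<alpha>) a = heis_act F (Q (\<sigma> *v ax Mid)) (y * a) \<otimes>\<^bsub>heis F\<^esub> (0, cj a * z * a)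
     \<otimes>\<^bsub>heis F\<^esub> inv\<^bsub>heis F\<^esub> (heis_act F \<alpha> (\<sigma> $ i $ i * a))"
  unfolding assms by (cases "Q (\<sigma> *v ax Mid)") (simp add: zeta_def algebra_simps)

end

context subnormal
begin

lemma Lam_preimage: "k \<noteq> Mid \<Longrightarrow> subgroup {\<alpha>. heis_act F \<alpha> b \<in> Lam k} (heis F)"
proof (rule heis.subgroupI)
  assume k: "k \<noteq> Mid"
  have "(0, 0) \<in> {\<alpha>. heis_act F \<alpha> b \<in> Lam k}" using Lam_one[OF k] by simp
  then show "{\<alpha>. heis_act F \<alpha> b \<in> Lam k} \<noteq> {}" by (metis empty_iff)
  show "inv\<^bsub>heis F\<^esub> \<alpha> \<in> {\<alpha>. heis_act F \<alpha> b \<in> Lam k}" if "\<alpha> \<in> {\<alpha>. heis_act F \<alpha> b \<in> Lam k}" for \<alpha>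
    using that Lam_inv[OF k] by (simp only: mem_Collect_eq heis_act_inv)
  show "\<alpha> \<otimes>\<^bsub>heis F\<^esub> \<beta> \<in> {\<alpha>. heis_act F \<alpha> b \<in> Lam k}"
    if "\<alpha> \<in> {\<alpha>. heis_act F \<alpha> b \<in> Lam k}" "\<beta> \<in> {\<alpha>. heis_act F \<alpha> b \<in> Lam k}" for \<alpha> \<beta>
    using that Lam_mult[OF k] by (simp only: mem_Collect_eq heis_act_mult)
qed simp

text \<open>The obstruction to additivity of \<open>heis_act F \<alpha>\<close> involves only the second component of \<open>\<alpha>\<close>. If that
  component is in \<open>A s\<close>, the obstruction vanishes modulo \<open>H\<close>, and it suffices to consider products \<open>a * b\<close>.\<close>
lemma Lam_additive:
  assumes k: "k \<noteq> Mid" and \<alpha>: "\<alpha> \<in> Delta F" and s: "snd \<alpha> \<in> A s" "s \<le> t"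
    and gen: "\<And>a b. a \<in> I \<Longrightarrow> b \<in> ideal_pow I t \<Longrightarrow> heis_act F \<alpha> (a * b) \<in> Lam k"
    and y: "y \<in> ideal_pow I (Suc t)"
  shows "heis_act F \<alpha> y \<in> Lam k"
proof -
  obtain p z where pz: "\<alpha> = (p, z)" by (cases \<alpha>)
  have zK: "z * y \<in> K" if "y \<in> ideal_pow I (Suc t)" for y
    using A_I_K[OF A_mono[OF s(2,1)] that] by (simp add: pz)
  have "ideal_prod I (ideal_pow I t) \<subseteq> {y \<in> ideal_pow I (Suc t). \<forall>r. heis_act F \<alpha> (y * r) \<in> Lam k}"
  proof (rule ideal_prod_least)
    have z0: "heis_act F \<alpha> 0 = (0, 0)" by (cases \<alpha>) simp
    show "is_ideal {y \<in> ideal_pow I (Suc t). \<forall>r. heis_act F \<alpha> (y * r) \<in> Lam k}"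
      unfolding is_ideal_iff
    proof (intro conjI ballI allI)
      show "0 \<in> {y \<in> ideal_pow I (Suc t). \<forall>r. heis_act F \<alpha> (y * r) \<in> Lam k}"
        using ideal_zero[OF pow_ideal[of "Suc t"]] Lam_one[OF k] by (simp only: mem_Collect_eq mult_zero_left z0) simp
    next
      fix x y assume x: "x \<in> {y \<in> ideal_pow I (Suc t). \<forall>r. heis_act F \<alpha> (y * r) \<in> Lam k}"
        and y: "y \<in> {y \<in> ideal_pow I (Suc t). \<forall>r. heis_act F \<alpha> (y * r) \<in> Lam k}"
      have "heis_act F \<alpha> ((x + y) * r) \<in> Lam k" for r
      proof -
        have "z * (x * (r * cj (y * r))) \<in> K" using x by (intro zK ideal_mult'[OF pow_ideal]) blast
        then have "tr0 (cj (y * r) * z * (x * r)) \<in> Lam k" using K_D(2)[OF _ k] by (simp add: mult_ac)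
        moreover have "(x + y) * r = x * r + y * r" by (simp add: distrib_right)
        ultimately show ?thesis using x y unfolding pz
          by (simp only: Delta_act_add[OF \<alpha>[unfolded pz]]) (intro Lam_mult k; blast)
      qed
      then show "x + y \<in> {y \<in> ideal_pow I (Suc t). \<forall>r. heis_act F \<alpha> (y * r) \<in> Lam k}"
        using x y ideal_add[OF pow_ideal[of "Suc t"]] by blast
    next
      fix c x assume x: "x \<in> {y \<in> ideal_pow I (Suc t). \<forall>r. heis_act F \<alpha> (y * r) \<in> Lam k}"
      have e: "c * x * r = x * (c * r)" for r by (simp only: mult_ac)
      have "heis_act F \<alpha> (c * x * r) \<in> Lam k" for r unfolding e using x by blast
      then show "c * x \<in> {y \<in> ideal_pow I (Suc t). \<forall>r. heis_act F \<alpha> (y * r) \<in> Lam k}"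
        using x ideal_mult[OF pow_ideal[of "Suc t"]] by blast
    qed
    fix a b assume a: "a \<in> I" and b: "b \<in> ideal_pow I t"
    have "heis_act F \<alpha> (a * b * r) \<in> Lam k" for r
      using gen[OF a ideal_mult'[OF pow_ideal b]] by (simp add: mult.assoc)
    then show "a * b \<in> {y \<in> ideal_pow I (Suc t). \<forall>r. heis_act F \<alpha> (y * r) \<in> Lam k}"
      using ideal_pow_Suc_mult[OF a b] by blast
  qed
  moreover have "y \<in> ideal_prod I (ideal_pow I t)" using y by simp
  ultimately have "\<forall>r. heis_act F \<alpha> (y * r) \<in> Lam k" by blast
  from this[rule_format, of 1] show ?thesis by simp
qed

text \<open>The factor in parentheses in \<open>Q_core\<close> is a product of a unit and diagonal entries, up to elements of \<open>A 9\<close>. Hence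
  the coefficient becomes \<open>a * b\<close> after multiplication by the inverse diagonal entries.\<close>
lemma Q_apart:
  assumes kr: "apart k r" and \<sigma>: "\<sigma> \<in> H" and t: "t \<in> ideal_pow I 10"
  shows "heis_act F (Q (\<sigma> *v ax r)) t \<in> Lam k"
proof -
  note d = apartD[OF kr] and U\<sigma> = H_U[OF \<sigma>]
  obtain l where l: "apart k l" "apart r l" using third_apart[OF three d(1,2)] .
  note dl = apartD[OF l(1)]
  have \<alpha>: "Q (\<sigma> *v ax r) \<in> Delta F" by (rule Q_U_Delta(1)[OF U\<sigma> d(2)])
  have sA: "snd (Q (\<sigma> *v ax r)) \<in> A 9" by (rule near_Q_snd[OF A_ideal A_inv near9[OF \<sigma>] d(2)])
  obtain p z where pz: "Q (\<sigma> *v ax r) = (p, z)" by (cases "Q (\<sigma> *v ax r)")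
  have gen: "heis_act F (Q (\<sigma> *v ax r)) (a * b) \<in> Lam k" if a: "a \<in> I" and b: "b \<in> ideal_pow I 9" for a b
  proof -
    define x where "x = \<sigma> $ r $ r"
    define c where "c i = iv \<sigma> $ i $ k" for i
    define e where "e i = iv \<sigma> $ i $ l" for i
    have xc: "x * c k - 1 \<in> A 9" "x * e l - 1 \<in> A 9" unfolding x_def c_def e_def
      by (rule near_unit[OF A_ideal U\<sigma> near9[OF \<sigma>]]; use d dl in simp)+
    have xc': "cj x * cj (c k) - 1 \<in> A 9" using A_cj[OF xc(1)] by simp
    have cl: "c l \<in> A 9" unfolding c_def
      by (rule A_mono[OF _ offdiag8[OF H_inv[OF \<sigma>]]]) (use dl in simp_all)
    \<comment> \<open>inverse modulo \<open>A 9\<close> of the coefficient in \<open>Q_core\<close>\<close>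
    define \<nu> where "\<nu> = cj (beta (- l)) * (cj x * x * x)"
    define j where "j = cj x * x * x * cj (c k) * (c k * e l - c l * e k) - 1"
    have "j = (x * c k * (x * e l)) * (cj x * cj (c k) - 1) + (x * e l) * (x * c k - 1) + (x * e l - 1)
       - (cj x * x * x * cj (c k) * e k) * c l"
      by (simp add: j_def algebra_simps)
    also have "\<dots> \<in> A 9"
      by (rule A_intros(6)[OF A_intros(2)[OF A_intros(2)[OF A_intros(3)[OF xc'] A_intros(3)[OF xc(1)]] xc(2)] A_intros(3)[OF cl]])
    finally have j: "j \<in> A 9" .
    have "cj (b * \<nu>) \<in> ideal_pow I 9" by (intro cj_pow ideal_mult'[OF pow_ideal b])
    from Q_core[OF l kr \<sigma> a this]
    have q: "heis_act F (p, z) (b * \<nu> * a * (cj (c k) * (c k * e l - c l * e k) * beta (- l))) \<in> Lam k"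
      unfolding c_def e_def pz by simp
    have u: "beta (- l) * cj (beta (- l)) = 1" by (rule beta_unit) (use dl in simp)
    have "b * \<nu> * a * (cj (c k) * (c k * e l - c l * e k) * beta (- l)) = a * b + (a * b) * j"
      unfolding j_def \<nu>_def by (simp add: mult_ac absorb_prod[OF u] right_diff_distrib)
    with q have q': "heis_act F (p, z) (a * b + (a * b) * j) \<in> Lam k" by simp
    have ab: "a * b \<in> ideal_pow I (Suc 9)" by (rule ideal_pow_Suc_mult[OF a b])
    have jK: "j * (a * b * r) \<in> K" "cj j * (a * b * r) \<in> K" for r
      by (intro A_I_K[OF j] A_I_K[OF A_cj[OF j]] ideal_mult'[OF pow_ideal ab])+
    have "heis_act F (p, z) ((a * b) * j) \<in> Lam k"
      using K_D(3)[OF jK(1)[of 1] d(1) \<alpha>] by (simp add: pz mult_ac)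
    moreover have "tr0 (cj ((a * b) * j) * z * (a * b)) \<in> Lam k"
      using K_D(2)[OF jK(2)[of "cj (a * b) * z"] d(1)] by (simp add: mult_ac)
    ultimately show ?thesis
      using q' unfolding Delta_act_add[OF \<alpha>[unfolded pz]] pz using Lam_cancel(1)[OF d(1)] by blast
  qed
  show ?thesis
    by (rule Lam_additive[OF d(1) \<alpha> sA _ gen, of 9]) (use t in \<open>simp_all add: numeral_eq_Suc\<close>)
qed

text \<open>If \<open>k = r\<close> or \<open>k = - r\<close>, the parameter is first obtained at an index apart from both and then
  transported, which takes one more factor.\<close>
lemma Q_all:
  assumes k: "k \<noteq> Mid" and r: "r \<noteq> Mid" and \<sigma>: "\<sigma> \<in> H" and t: "t \<in> ideal_pow I 11"
  shows "heis_act F (Q (\<sigma> *v ax r)) t \<in> Lam k"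
proof (cases "apart k r")
  case True
  have "t \<in> ideal_pow I 10" using t ideal_pow_antimono[of 10 11 I] by auto
  then show ?thesis by (rule Q_apart[OF True \<sigma>])
next
  case False
  obtain j where j: "apart k j" using third_apart[OF three k k] by blast
  note d = apartD[OF j]
  have jr: "apart j r" using False j k r by (auto simp: apart_def)
  have U\<sigma>: "\<sigma> \<in> carrier (U F)" by (rule H_U[OF \<sigma>])
  have \<alpha>: "Q (\<sigma> *v ax r) \<in> Delta F" by (rule Q_U_Delta(1)[OF U\<sigma> r])
  have sA: "snd (Q (\<sigma> *v ax r)) \<in> A 9" by (rule near_Q_snd[OF A_ideal A_inv near9[OF \<sigma>] r])
  obtain p z where pz: "Q (\<sigma> *v ax r) = (p, z)" by (cases "Q (\<sigma> *v ax r)")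
  have gen: "heis_act F (Q (\<sigma> *v ax r)) (a * b) \<in> Lam k" if a: "a \<in> I" and b: "b \<in> ideal_pow I 10" for a b
  proof -
    have "transv (ax j) ((p * b) *s ax Mid) (cj b * z * b) \<in> H"
      using Q_apart[OF jr \<sigma> b] by (simp add: pz Lam_def)
    moreover have "transv (ax k) ((a * cj (rho j)) *s ax (- j)) 0 \<in> N"
      by (rule N_short) (use j a I_mult in auto)
    moreover have "a * cj (rho j) * rho j * (cj b * z * b) \<in> S k j"
    proof -
      have "b \<in> ideal_pow I (Suc 9)" using b by (simp add: numeral_eq_Suc)
      then have "z * (b * (a * cj (rho j) * rho j * cj b)) \<in> K"
        using sA pz by (intro A_I_K[of _ 9] ideal_mult'[OF pow_ideal]) auto
      then show ?thesis using K_D(1)[OF _ j] by (simp add: mult_ac)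
    qed
    ultimately have "heis_act F (p * b, cj b * z * b) (a * cj (rho j) * rho j) \<in> Lam k"
      using long_transport[OF j, of "p * b" "cj b * z * b" "a * cj (rho j)"] H_N by blast
    moreover have "a * cj (rho j) * rho j = a" using rho_unit[OF d(2)] by (simp add: mult_ac)
    moreover have "(p * b, cj b * z * b) = heis_act F (p, z) b" by simp
    ultimately show ?thesis unfolding pz by (metis heis_act_act mult.commute)
  qed
  show ?thesis
    by (rule Lam_additive[OF k \<alpha> sA _ gen, of 10]) (use t in \<open>simp_all add: numeral_eq_Suc\<close>)
qed

lemma near10: "\<sigma> \<in> H \<Longrightarrow> near (A 10) \<sigma>"
  using near9[of \<sigma>] A_mono[of 9 10] unfolding near_def by auto

text \<open>Let \<open>T\<close> be the long transvection at \<open>- i\<close> with parameter \<open>\<alpha> \<circ> a\<close>, and compare \<open>Q_all\<close> for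
  \<open>\<sigma>\<close> and for \<open>T\<inverse> \<sigma> T\<close> at the column \<open>i\<close>. Since \<open>T\<close> adds to \<open>ax i\<close> a multiple of \<open>ax Mid\<close>, the column
  of the conjugate contains that multiple of the middle column of \<open>\<sigma>\<close>, and \<open>T\<inverse>\<close> contributes the inverse of
  \<open>\<alpha> \<circ> a\<close> acted on by the diagonal entry. For positive \<open>i\<close> the units are trivial.\<close>
lemma zeta_Pos:
  assumes k: "k \<noteq> Mid" and \<sigma>: "\<sigma> \<in> H" and \<alpha>: "\<alpha> \<in> Delta F" and a: "a \<in> I" and b: "b \<in> ideal_pow I 11"
  shows "heis_act F (zeta \<sigma> (Pos m) \<alpha>) (a * b) \<in> Lam k"
proof -
  define i where "i = Pos m"
  have i: "i \<noteq> Mid" "i \<noteq> - i" "- i \<noteq> i" "- i \<noteq> Mid" "rho (- i) = 1" "beta i = 1"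
    and im: "- i = Neg m" by (simp_all add: i_def rho_def)
  obtain y z where yz: "\<alpha> = (y, z)" by (cases \<alpha>)
  have yJ: "y \<in> J_Delta F" using \<alpha> yz by (auto simp: J_Delta_def)
  have U\<sigma>: "\<sigma> \<in> carrier (U F)" by (rule H_U[OF \<sigma>])
  have iso: "B (\<sigma> *v x) (\<sigma> *v y) = B x y" for x y using U_D(1)[OF U\<sigma>] by (simp add: isometry_def)
  have e\<sigma>: "(\<sigma> *v ax q) $ p = \<sigma> $ p $ q" for p q by (simp add: matrix_entry)
  have b11: "b \<in> ideal_pow I (Suc 10)" using b by (simp add: numeral_eq_Suc)
  have AK: "x * (b * t) \<in> K" if "x \<in> A 10" for x t
    by (rule A_I_K[OF that ideal_mult'[OF pow_ideal b11]])
  have tr: "heis_act F (tr0 x) b \<in> Lam k" if "x \<in> A 10" for x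
    unfolding tr0_act using K_D(2)[OF AK[OF that, of "cj b"] k] by (simp add: mult_ac)
  note near = nearD[OF near10[OF \<sigma>]]
  have near4': "cj (\<sigma> $ Mid $ j) * mu F * y \<in> A 10" if "j \<noteq> Mid" for j
  proof -
    have "cj (cj y * mu F * \<sigma> $ Mid $ j) * lam F \<in> A 10" by (intro A_intros(4) A_cj near(4) that yJ)
    then show ?thesis by (simp add: mult_ac lam_absorb)
  qed
  define s where "s = cj a * z * a"
  define T where "T = L (- i) y z a"
  have TN: "T \<in> N" unfolding T_def by (rule L_N[OF i(4) \<alpha>[unfolded yz] a])
  define \<sigma>' where "\<sigma>' = iv T ** \<sigma> ** T"
  have \<sigma>'H: "\<sigma>' \<in> H" unfolding \<sigma>'_def by (rule N_conj(2)[OF TN \<sigma>])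
  define v :: "'a ^ 'n theta" where "v = (y * a) *s ax Mid"
  define w where "w = \<sigma> *v ax i + (y * a) *s (\<sigma> *v ax Mid) + s *s (\<sigma> *v ax (- i))"
  have Ti: "T *v ax i = ax i + (y * a) *s ax Mid + s *s ax (- i)"
    using i by (simp add: T_def L_apply s_def)
  have ivT: "iv T = transv (ax (- i)) (- v) (- s - B v v)"
    unfolding T_def L_def using N_U[OF TN] i
    by (subst U_inv_transv) (simp_all add: T_def L_def v_def B_lin s_def)
  have \<sigma>'i: "\<sigma>' *v ax i = iv T *v w"
    by (simp add: \<sigma>'_def matrix_vector_mul_assoc[symmetric] Ti w_def matrix_vector_right_distrib matrix_vector_smult)
  have wi: "w $ i = \<sigma> $ i $ i + ((y * a) * \<sigma> $ i $ Mid + s * \<sigma> $ i $ (- i))"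
    by (simp add: w_def e\<sigma>)
  have w0: "w $ Mid = \<sigma> $ Mid $ i + (y * a) * \<sigma> $ Mid $ Mid + s * \<sigma> $ Mid $ (- i)"
    by (simp add: w_def e\<sigma>)
  define j where "j = (y * a) * \<sigma> $ i $ Mid + s * \<sigma> $ i $ (- i)"
  have jA: "j \<in> A 10"
    unfolding j_def using A_intros(3)[OF near(3)[OF i(1) yJ], of a] near(1)[OF i(1) i(4)] i
    by (auto simp: mult_ac intro!: A_intros(2) intro: A_intros(3))
  define g where "g = - (B w v * w $ i)"
  have Q1: "Q (\<sigma>' *v ax i) = Q w \<otimes>\<^bsub>heis F\<^esub> heis_act F (inv\<^bsub>heis F\<^esub> (heis_act F \<alpha> a)) (w $ i) \<otimes>\<^bsub>heis F\<^esub> tr0 g"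
  proof -
    have "cross (ax (- i)) w = 0" "cross (ax Mid) w = 0" "cross (- v) w = - cross v w"
      by (simp_all add: im cross_ax_left) (simp add: cross_def sum_negf)
    then have "cross (iv T *v w - w) w = 0"
      unfolding ivT transv_apply by (simp add: cross_lin v_def)
    moreover have "cross (- v) (- v) = 0" by (simp add: v_def cross_def)
    moreover have "C (ax (- i)) w = w $ i" using i by simp
    moreover have "(- v) $ (- (- i)) = 0" using i by (simp add: v_def)
    ultimately show ?thesis
      unfolding \<sigma>'i using Q_transv_ax[of "- v" "- i" "- s - B v v" w, folded ivT] i
      by (simp add: g_def v_def yz s_def B_lin mult_ac)
  qed
  define c1 where "c1 = cross ((y * a) *s (\<sigma> *v ax Mid)) (\<sigma> *v ax i)"
  define c2 where "c2 = cross (s *s (\<sigma> *v ax (- i))) (\<sigma> *v ax i + (y * a) *s (\<sigma> *v ax Mid))"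
  have c1A: "c1 \<in> A 10"
    unfolding c1_def
  proof (rule cross_near[OF A_ideal A_inv])
    fix n
    have "(y * a) * \<sigma> $ Pos n $ Mid \<in> A 10" using A_intros(3)[OF near(3)[of "Pos n", OF _ yJ], of a] by (simp add: mult_ac)
    then show "((y * a) *s (\<sigma> *v ax Mid)) $ Pos n \<in> A 10 \<or> (\<sigma> *v ax i) $ Neg n \<in> A 10" by (simp add: e\<sigma>)
  qed
  have c2A: "c2 \<in> A 10"
    unfolding c2_def
  proof (rule cross_near[OF A_ideal A_inv])
    fix n
    have "s * \<sigma> $ Pos n $ (- i) \<in> A 10" by (intro A_intros(3) near(1)) (simp_all add: im)
    then show "(s *s (\<sigma> *v ax (- i))) $ Pos n \<in> A 10 \<or> (\<sigma> *v ax i + (y * a) *s (\<sigma> *v ax Mid)) $ Neg n \<in> A 10"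
      by (simp add: e\<sigma>)
  qed
  define q0 where "q0 = heis_act F (Q (\<sigma> *v ax Mid)) (y * a)"
  define qi where "qi = Q (\<sigma> *v ax i)"
  define qn where "qn = heis_act F (Q (\<sigma> *v ax (- i))) s"
  define c3 where "c3 = cj (fst qn) * mu F * fst q0"
  have c3A: "c3 \<in> A 10"
  proof -
    have "(cj s * a * \<sigma> $ Mid $ Mid) * (cj (\<sigma> $ Mid $ (- i)) * mu F * y) \<in> A 10"
      by (intro A_intros(3) near4' i(4))
    then show ?thesis by (simp add: c3_def qn_def q0_def form_Q_eq heis_act_def e\<sigma> mult_ac)
  qed
  have gA: "g + cj (y * a) * mu F * (y * a) * cj (\<sigma> $ i $ i) * \<sigma> $ i $ i \<in> A 10"
  proof -
    define X where "X = cj (y * a) * mu F * (y * a)"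
    have Xl: "cj X * lam F = X" by (simp add: X_def mult_ac lam_absorb)
    have "cj (cj a * a * (cj y * mu F * (\<sigma> $ Mid $ Mid - \<sigma> $ i $ i) * y)) * lam F \<in> A 10"
      by (intro A_intros(4) A_cj A_intros(3) entry_00 \<sigma> i yJ)
    also have "cj (cj a * a * (cj y * mu F * (\<sigma> $ Mid $ Mid - \<sigma> $ i $ i) * y)) * lam F
       = cj (X * (\<sigma> $ Mid $ Mid - \<sigma> $ i $ i)) * lam F" by (simp add: X_def mult_ac)
    also have "\<dots> = (cj X * lam F) * cj (\<sigma> $ Mid $ Mid - \<sigma> $ i $ i)" by (simp only: cj_mult mult_ac)
    also have "\<dots> = X * cj (\<sigma> $ Mid $ Mid - \<sigma> $ i $ i)" unfolding Xl ..
    finally have 1: "X * cj (\<sigma> $ Mid $ Mid - \<sigma> $ i $ i) \<in> A 10" .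
    have Bwv: "B w v = (cj (\<sigma> $ Mid $ i) * mu F * y) * a + X * cj (\<sigma> $ Mid $ Mid) + (cj s * a) * (cj (\<sigma> $ Mid $ (- i)) * mu F * y)"
      unfolding v_def B_lin B_ax_right by (simp add: w0 X_def algebra_simps)
    have e: "g + X * cj (\<sigma> $ i $ i) * \<sigma> $ i $ i
      = - (w $ i) * (a * (cj (\<sigma> $ Mid $ i) * mu F * y)) + - (w $ i) * ((cj s * a) * (cj (\<sigma> $ Mid $ (- i)) * mu F * y))
        + - (X * cj (\<sigma> $ Mid $ Mid)) * j + - (\<sigma> $ i $ i) * (X * cj (\<sigma> $ Mid $ Mid - \<sigma> $ i $ i))"
      unfolding g_def Bwv wi j_def[symmetric] by (simp add: algebra_simps)
    show ?thesis unfolding X_def[symmetric] e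
      by (rule A_intros(2)[OF A_intros(2)[OF A_intros(2)[OF A_intros(3)[OF A_intros(3)] A_intros(3)[OF A_intros(3)]] A_intros(3)] A_intros(3)])
        (rule near4' i jA 1)+
  qed
  have tg: "tr0 g = tr0 (g + cj (y * a) * mu F * (y * a) * cj (\<sigma> $ i $ i) * \<sigma> $ i $ i)"
    by (simp add: tr0_def algebra_simps lam_absorb)
  have Qw: "Q w = qi \<otimes>\<^bsub>heis F\<^esub> q0 \<otimes>\<^bsub>heis F\<^esub> (0, 0) \<otimes>\<^bsub>heis F\<^esub> tr0 c1 \<otimes>\<^bsub>heis F\<^esub> qn \<otimes>\<^bsub>heis F\<^esub> (0, s) \<otimes>\<^bsub>heis F\<^esub> tr0 c2"
  proof -
    have "B (\<sigma> *v ax i) ((y * a) *s (\<sigma> *v ax Mid)) = 0"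
      "B (\<sigma> *v ax i + (y * a) *s (\<sigma> *v ax Mid)) (s *s (\<sigma> *v ax (- i))) = s"
      using i by (simp_all add: B_lin iso)
    then show ?thesis unfolding w_def Q_add Q_smult c1_def[symmetric] c2_def[symmetric] q0_def qi_def qn_def by simp
  qed
  define h where "h = heis_act F \<alpha> (a * w $ i)"
  have Q2: "Q (\<sigma>' *v ax i) = qi \<otimes>\<^bsub>heis F\<^esub> (qn \<otimes>\<^bsub>heis F\<^esub> ((q0 \<otimes>\<^bsub>heis F\<^esub> (0, s) \<otimes>\<^bsub>heis F\<^esub> inv\<^bsub>heis F\<^esub> h)
      \<otimes>\<^bsub>heis F\<^esub> tr0 (c1 + c2 + c3 + (g + cj (y * a) * mu F * (y * a) * cj (\<sigma> $ i $ i) * \<sigma> $ i $ i))))"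
  proof -
    have inv: "heis_act F (inv\<^bsub>heis F\<^esub> (heis_act F \<alpha> a)) (w $ i) = inv\<^bsub>heis F\<^esub> h"
      unfolding heis_act_inv heis_act_act h_def ..
    have "Q (\<sigma>' *v ax i) = qi \<otimes>\<^bsub>heis F\<^esub> (q0 \<otimes>\<^bsub>heis F\<^esub> qn) \<otimes>\<^bsub>heis F\<^esub> (0, s) \<otimes>\<^bsub>heis F\<^esub> inv\<^bsub>heis F\<^esub> h
      \<otimes>\<^bsub>heis F\<^esub> tr0 (c1 + c2) \<otimes>\<^bsub>heis F\<^esub> tr0 g"
      unfolding Q1 inv Qw by (cases qi; cases q0; cases qn; cases h) (simp add: tr0_def algebra_simps)
    also have "\<dots> = qi \<otimes>\<^bsub>heis F\<^esub> (qn \<otimes>\<^bsub>heis F\<^esub> q0 \<otimes>\<^bsub>heis F\<^esub> tr0 c3) \<otimes>\<^bsub>heis F\<^esub> (0, s) \<otimes>\<^bsub>heis F\<^esub> inv\<^bsub>heis F\<^esub> h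
      \<otimes>\<^bsub>heis F\<^esub> tr0 (c1 + c2) \<otimes>\<^bsub>heis F\<^esub> tr0 (g + cj (y * a) * mu F * (y * a) * cj (\<sigma> $ i $ i) * \<sigma> $ i $ i)"
      unfolding heis_comm[of q0 qn] c3_def[symmetric] tg[symmetric] ..
    also have "\<dots> = qi \<otimes>\<^bsub>heis F\<^esub> (qn \<otimes>\<^bsub>heis F\<^esub> ((q0 \<otimes>\<^bsub>heis F\<^esub> (0, s) \<otimes>\<^bsub>heis F\<^esub> inv\<^bsub>heis F\<^esub> h)
      \<otimes>\<^bsub>heis F\<^esub> tr0 (c1 + c2 + c3 + (g + cj (y * a) * mu F * (y * a) * cj (\<sigma> $ i $ i) * \<sigma> $ i $ i))))"
      by (cases qi; cases q0; cases qn; cases h) (simp add: tr0_def algebra_simps)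
    finally show ?thesis .
  qed
  have L0: "heis_act F (Q (\<sigma>' *v ax i)) b \<in> Lam k" by (rule Q_all[OF k i(1) \<sigma>'H b])
  have L1: "heis_act F qi b \<in> Lam k" unfolding qi_def by (rule Q_all[OF k i(1) \<sigma> b])
  have L2: "heis_act F qn b \<in> Lam k" unfolding qn_def heis_act_act
    by (rule Q_all[OF k i(4) \<sigma>]) (rule ideal_mult[OF pow_ideal b])
  have L3: "heis_act F (tr0 (c1 + c2 + c3 + (g + cj (y * a) * mu F * (y * a) * cj (\<sigma> $ i $ i) * \<sigma> $ i $ i))) b \<in> Lam k"
    by (rule tr[OF A_intros(2)[OF A_intros(2)[OF A_intros(2)[OF c1A c2A] c3A] gA]])
  have L4: "heis_act F (q0 \<otimes>\<^bsub>heis F\<^esub> (0, s)) b \<otimes>\<^bsub>heis F\<^esub> inv\<^bsub>heis F\<^esub> (heis_act F \<alpha> (a * b * w $ i)) \<in> Lam k"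
  proof -
    define tot where "tot = c1 + c2 + c3 + (g + cj (y * a) * mu F * (y * a) * cj (\<sigma> $ i $ i) * \<sigma> $ i $ i)"
    have "heis_act F (q0 \<otimes>\<^bsub>heis F\<^esub> (0, s)) b \<otimes>\<^bsub>heis F\<^esub> inv\<^bsub>heis F\<^esub> (heis_act F h b) \<in> Lam k"
      using L0 unfolding Q2[folded tot_def] heis_act_mult heis_act_inv
        Lam_cancel[OF k L1] Lam_cancel[OF k L2] Lam_cancel[OF k L3[folded tot_def]] .
    moreover have "heis_act F h b = heis_act F \<alpha> (a * b * w $ i)"
      unfolding h_def heis_act_act by (simp only: mult.assoc mult.commute[of "w $ i" b])
    ultimately show ?thesis by simp
  qed
  have "heis_act F \<alpha> (a * b * w $ i) = heis_act F \<alpha> (a * b * j) \<otimes>\<^bsub>heis F\<^esub> heis_act F \<alpha> (a * b * \<sigma> $ i $ i)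
      \<otimes>\<^bsub>heis F\<^esub> tr0 (cj (a * b * \<sigma> $ i $ i) * z * (a * b * j))"
  proof -
    have "a * b * w $ i = a * b * j + a * b * \<sigma> $ i $ i"
      unfolding wi j_def by (simp add: algebra_simps)
    then show ?thesis unfolding yz by (simp only: Delta_act_add[OF \<alpha>[unfolded yz]])
  qed
  then have h: "inv\<^bsub>heis F\<^esub> (heis_act F \<alpha> (a * b * w $ i)) = inv\<^bsub>heis F\<^esub> (heis_act F \<alpha> (a * b * \<sigma> $ i $ i))
     \<otimes>\<^bsub>heis F\<^esub> (inv\<^bsub>heis F\<^esub> (heis_act F \<alpha> (a * b * j)) \<otimes>\<^bsub>heis F\<^esub> tr0 (- (cj (a * b * \<sigma> $ i $ i) * z * (a * b * j))))"
    by (simp only: heis.inv_mult_group heis_carrier UNIV_I tr0_inv)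
      (simp only: tr0_central[symmetric] heis.m_assoc heis_carrier UNIV_I)
  have "inv\<^bsub>heis F\<^esub> (heis_act F \<alpha> (a * b * j)) \<otimes>\<^bsub>heis F\<^esub> tr0 (- (cj (a * b * \<sigma> $ i $ i) * z * (a * b * j))) \<in> Lam k"
  proof (intro Lam_mult k Lam_inv)
    show "heis_act F \<alpha> (a * b * j) \<in> Lam k" using K_D(3)[OF AK[OF jA, of a] k \<alpha>] by (simp add: mult_ac)
    show "tr0 (- (cj (a * b * \<sigma> $ i $ i) * z * (a * b * j))) \<in> Lam k"
      using K_D(2)[OF AK[OF jA, of "- (cj (a * b * \<sigma> $ i $ i) * z * a)"] k] by (simp add: mult_ac)
  qed
  from Lam_cancel(1)[OF k this, of "heis_act F (q0 \<otimes>\<^bsub>heis F\<^esub> (0, s)) b \<otimes>\<^bsub>heis F\<^esub> inv\<^bsub>heis F\<^esub> (heis_act F \<alpha> (a * b * \<sigma> $ i $ i))"]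
  have "heis_act F (q0 \<otimes>\<^bsub>heis F\<^esub> (0, s)) b \<otimes>\<^bsub>heis F\<^esub> inv\<^bsub>heis F\<^esub> (heis_act F \<alpha> (a * b * \<sigma> $ i $ i)) \<in> Lam k"
    using L4 unfolding h by (simp only: heis.m_assoc heis_carrier UNIV_I)
  moreover have "heis_act F (zeta \<sigma> i \<alpha>) (a * b)
     = heis_act F (q0 \<otimes>\<^bsub>heis F\<^esub> (0, s)) b \<otimes>\<^bsub>heis F\<^esub> inv\<^bsub>heis F\<^esub> (heis_act F \<alpha> (a * b * \<sigma> $ i $ i))"
    unfolding zeta_act[OF yz] q0_def heis_act_mult heis_act_act by (simp add: s_def mult_ac)
  ultimately show ?thesis unfolding i_def by simp
qed

text \<open>Diagonal entries agree modulo \<open>A 10\<close>, so the index may be changed to a positive one.\<close>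
lemma zeta_all:
  assumes k: "k \<noteq> Mid" and i: "i \<noteq> Mid" and \<sigma>: "\<sigma> \<in> H" and \<alpha>: "\<alpha> \<in> Delta F" and t: "t \<in> ideal_pow I 12"
  shows "heis_act F (zeta \<sigma> i \<alpha>) t \<in> Lam k"
proof -
  have U\<sigma>: "\<sigma> \<in> carrier (U F)" by (rule H_U[OF \<sigma>])
  have D: "zeta \<sigma> i \<alpha> \<in> Delta F" by (rule zeta_Delta[OF U\<sigma> \<alpha>])
  have sA: "snd (zeta \<sigma> i \<alpha>) \<in> A 10"
    by (rule zeta_snd[OF A_ideal A_inv U\<sigma> near10[OF \<sigma>] entry_00[OF \<sigma> i] i \<alpha>])
  obtain y z where yz: "\<alpha> = (y, z)" by (cases \<alpha>)
  fix m :: 'n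
  \<comment> \<open>\<open>Pos m\<close> is an arbitrary positive index\<close>
  have gen: "heis_act F (zeta \<sigma> i \<alpha>) (a * b) \<in> Lam k" if a: "a \<in> I" and b: "b \<in> ideal_pow I 11" for a b
  proof -
    define j where "j = \<sigma> $ i $ i - \<sigma> $ Pos m $ Pos m"
    define x where "x = \<sigma> $ Pos m $ Pos m"
    have jA: "j \<in> A 10" unfolding j_def by (rule nearD(2)[OF near10[OF \<sigma>] i]) simp
    have ii: "\<sigma> $ i $ i = j + x" by (simp add: j_def x_def)
    have b11: "b \<in> ideal_pow I (Suc 10)" using b by (simp add: numeral_eq_Suc)
    have AK: "j * (b * t) \<in> K" for t
      by (rule A_I_K[OF jA ideal_mult'[OF pow_ideal b11]])
    define P where "P = heis_act F (Q (\<sigma> *v ax Mid)) (y * (a * b)) \<otimes>\<^bsub>heis F\<^esub> (0, cj (a * b) * z * (a * b))"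
    have 1: "P \<otimes>\<^bsub>heis F\<^esub> inv\<^bsub>heis F\<^esub> (heis_act F \<alpha> (x * (a * b))) \<in> Lam k"
      using zeta_Pos[OF k \<sigma> \<alpha> a b, of m] unfolding zeta_act[OF yz] P_def x_def .
    have "heis_act F \<alpha> (\<sigma> $ i $ i * (a * b)) = heis_act F \<alpha> (j * (a * b)) \<otimes>\<^bsub>heis F\<^esub> heis_act F \<alpha> (x * (a * b))
      \<otimes>\<^bsub>heis F\<^esub> tr0 (cj (x * (a * b)) * z * (j * (a * b)))"
      unfolding yz ii distrib_right by (simp only: Delta_act_add[OF \<alpha>[unfolded yz]])
    then have h: "inv\<^bsub>heis F\<^esub> (heis_act F \<alpha> (\<sigma> $ i $ i * (a * b))) = inv\<^bsub>heis F\<^esub> (heis_act F \<alpha> (x * (a * b)))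
       \<otimes>\<^bsub>heis F\<^esub> (inv\<^bsub>heis F\<^esub> (heis_act F \<alpha> (j * (a * b))) \<otimes>\<^bsub>heis F\<^esub> tr0 (- (cj (x * (a * b)) * z * (j * (a * b)))))"
      by (simp only: heis.inv_mult_group heis_carrier UNIV_I tr0_inv)
        (simp only: tr0_central[symmetric] heis.m_assoc heis_carrier UNIV_I)
    have "inv\<^bsub>heis F\<^esub> (heis_act F \<alpha> (j * (a * b))) \<otimes>\<^bsub>heis F\<^esub> tr0 (- (cj (x * (a * b)) * z * (j * (a * b)))) \<in> Lam k"
    proof (intro Lam_mult k Lam_inv)
      show "heis_act F \<alpha> (j * (a * b)) \<in> Lam k" using K_D(3)[OF AK[of a] k \<alpha>] by (simp add: mult_ac)
      show "tr0 (- (cj (x * (a * b)) * z * (j * (a * b)))) \<in> Lam k"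
        using K_D(2)[OF AK[of "- (cj (x * (a * b)) * z * a)"] k] by (simp add: mult_ac)
    qed
    from Lam_mult[OF k 1 this] show ?thesis
      unfolding zeta_act[OF yz] h P_def[symmetric] by (simp only: heis.m_assoc heis_carrier UNIV_I)
  qed
  show ?thesis
    by (rule Lam_additive[OF k D sA _ gen, of 11]) (use t in \<open>simp_all add: numeral_eq_Suc\<close>)
qed

end

section \<open>The lower bound\<close>

context subnormal
begin

lemma long_part_subset:
  assumes k: "k \<noteq> Mid"
  defines "J \<equiv> ideal_generated (level_Y F H \<union> cj ` level_Y F H)"
  shows "Omega_min F (ideal_prod J (ideal_pow I 12)) <#>\<^bsub>heis F\<^esub>
      heis_circ F (Omega_min F J <#>\<^bsub>heis F\<^esub> heis_circ F (level_Z F H) UNIV) (ideal_pow I 12) \<subseteq> Lam k"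
proof (rule set_mult_least[OF Lam_subgroup[OF k]])
  have JA: "J \<subseteq> A 10" unfolding J_def by (rule level_J_subset)
  have b11: "b \<in> ideal_pow I (Suc 10)" if "b \<in> ideal_pow I 12" for b
    using that ideal_pow_antimono[of 11 12 I] by (auto simp: numeral_eq_Suc)
  have JK: "x * b \<in> K" if "x \<in> J" "b \<in> ideal_pow I 12" for x b
    by (rule A_I_K[OF subsetD[OF JA that(1)] b11[OF that(2)]])
  have prodK: "ideal_prod J (ideal_pow I 12) \<subseteq> K"
    by (rule ideal_prod_least[OF K_ideal JK])
  show "Omega_min F (ideal_prod J (ideal_pow I 12)) \<subseteq> Lam k"
    by (rule Omega_min_least[OF Lam_subgroup[OF k]]) (rule K_D(2,3)[OF _ k] subsetD[OF prodK] | assumption)+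
  show "heis_circ F (Omega_min F J <#>\<^bsub>heis F\<^esub> heis_circ F (level_Z F H) UNIV) (ideal_pow I 12) \<subseteq> Lam k"
  proof (rule heis_circ_least[OF Lam_subgroup[OF k]])
    fix \<alpha> b
    assume \<alpha>: "\<alpha> \<in> Omega_min F J <#>\<^bsub>heis F\<^esub> heis_circ F (level_Z F H) UNIV" and b: "b \<in> ideal_pow I 12"
    let ?T = "{\<alpha>. heis_act F \<alpha> b \<in> Lam k}"
    have T: "subgroup ?T (heis F)" by (rule Lam_preimage[OF k])
    have "Omega_min F J \<subseteq> ?T"
    proof (rule Omega_min_least[OF T])
      fix x assume x: "x \<in> J"
      have "x * (cj b * b) \<in> K" using K_intros(4)[OF JK[OF x b], of "cj b"] by (simp add: mult_ac)
      then show "tr0 x \<in> ?T" using K_D(2)[OF _ k] by (simp add: tr0_act)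
      fix \<beta> assume "\<beta> \<in> Delta F"
      then show "heis_act F \<beta> x \<in> ?T" using K_D(3)[OF JK[OF x b] k] by (simp add: heis_act_act)
    qed
    moreover have "heis_circ F (level_Z F H) UNIV \<subseteq> ?T"
    proof (rule heis_circ_least[OF T])
      fix \<zeta> a assume \<zeta>: "\<zeta> \<in> level_Z F H"
      have ab: "a * b \<in> ideal_pow I 12" by (rule ideal_mult[OF pow_ideal b])
      have ab11: "a * b \<in> ideal_pow I 11" using ab ideal_pow_antimono[of 11 12 I] by auto
      have "heis_act F \<zeta> (a * b) \<in> Lam k"
        using \<zeta> Q_all[OF k _ _ ab11] zeta_all[OF k _ _ _ ab] unfolding level_Z_eq by blast
      then show "heis_act F \<zeta> a \<in> ?T" by (simp only: mem_Collect_eq heis_act_act)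
    qed
    ultimately show "heis_act F \<alpha> b \<in> Lam k" using set_mult_least[OF T] \<alpha> by blast
  qed
qed

theorem EU_prod_subset: "EU F (form_ideal_prod F (upper_level F H) (ideal_pow I 12)) \<subseteq> H"
proof -
  define J where "J = ideal_generated (level_Y F H \<union> cj ` level_Y F H)"
  define JP where "JP = ideal_prod J (ideal_pow I 12)"
  define \<Sigma> where "\<Sigma> = Omega_min F J <#>\<^bsub>heis F\<^esub> heis_circ F (level_Z F H) UNIV"
  define \<Omega> where "\<Omega> = Omega_min F JP <#>\<^bsub>heis F\<^esub> heis_circ F \<Sigma> (ideal_pow I 12)"
  have J: "is_ideal J" "involution_invariant F J"
    unfolding J_def by (rule ideal_generated_ideal) (rule cj_ideal_generated, auto intro: ideal_generated_base)
  have P: "is_ideal JP" "involution_invariant F JP"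
    unfolding JP_def by (rule ideal_prod_ideal) (rule cj_ideal_prod[OF J(2) cj_ideal_pow[OF I_cj]])
  have HU: "H \<subseteq> carrier (U F)" using H_U by blast
  have \<Sigma>D: "\<Sigma> \<subseteq> Delta F" unfolding \<Sigma>_def
    by (intro set_mult_least[OF Delta_subgroup] Omega_min_Delta heis_circ_least[OF Delta_subgroup] Delta_act
        subsetD[OF level_Z_Delta[OF HU]])
  have \<Omega>D: "\<Omega> \<subseteq> Delta F" unfolding \<Omega>_def
    by (intro set_mult_least[OF Delta_subgroup] Omega_min_Delta heis_circ_least[OF Delta_subgroup] Delta_act
        subsetD[OF \<Sigma>D])
  have \<Omega>: "heis_submodule F \<Omega>" unfolding \<Omega>_def by (rule submodule_with_Omega_min[OF P pow_ideal])
  have \<Omega>L: "\<Omega> \<subseteq> Lam k" if "k \<noteq> Mid" for k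
    using long_part_subset[OF that] unfolding \<Omega>_def \<Sigma>_def JP_def J_def .
  have PK: "JP \<subseteq> K"
    unfolding JP_def
  proof (rule ideal_prod_least[OF K_ideal])
    fix x b assume x: "x \<in> J" and "b \<in> ideal_pow I 12"
    then have "b \<in> ideal_pow I (Suc 10)" using ideal_pow_antimono[of 11 12 I] by (auto simp: numeral_eq_Suc)
    moreover have "x \<in> A 10" using x level_J_subset unfolding J_def by blast
    ultimately show "x * b \<in> K" by (intro A_I_K)
  qed
  have e: "form_ideal_prod F (upper_level F H) (ideal_pow I 12) = (JP, \<Omega>)"
    by (simp add: form_ideal_prod_def upper_level_def Let_def \<Omega>_def \<Sigma>_def JP_def J_def)
  show ?thesis
    unfolding e EU_eq[OF P \<Omega> \<Omega>D]
  proof (rule group.generate_subgroup_incl[OF U_group _ H_subgroup], rule Un_least)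
    show "{transv (ax i) (x *s ax j) 0 | i j x. i \<noteq> Mid \<and> j \<noteq> Mid \<and> i \<noteq> j \<and> i \<noteq> - j \<and> x \<in> JP} \<subseteq> H"
      using H_short PK by (auto simp: apart_def)
    show "{transv (ax i) (x *s ax Mid) z | i x z. i \<noteq> Mid \<and> (x, z) \<in> \<Omega>} \<subseteq> H"
      using \<Omega>L unfolding Lam_def by blast
  qed
qed

end

section \<open>Congruence subgroups of an odd form ideal\<close>

locale form_ideal = hermitian_form_ring F for F :: "'a::comm_ring_1 form_ring" +
  fixes J :: "'a set" and \<Omega> :: "('a \<times> 'a) set"
  assumes odd_form_ideal: "odd_form_ideal F (J, \<Omega>)"
begin

lemma J_ideal: "is_ideal J" and J_cj: "involution_invariant F J" and Om_submodule: "heis_submodule F \<Omega>"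
  using odd_form_ideal by (simp_all add: odd_form_ideal_def)

lemmas J_intros = ideal_intros[OF J_ideal]
lemmas Om_zero = heis_submoduleD(2)[OF Om_submodule]
lemmas Om_mult = heis_submoduleD(3)[OF Om_submodule]
lemmas Om_inv = heis_submoduleD(4)[OF Om_submodule]
lemmas Om_act = heis_submoduleD(5)[OF Om_submodule]

lemma Om_Delta: "\<omega> \<in> \<Omega> \<Longrightarrow> \<omega> \<in> Delta F"
  using odd_form_ideal by (auto simp: odd_form_ideal_def Omega_max_def)

lemma Omega_min_Om: "Omega_min F J \<subseteq> \<Omega>"
  using odd_form_ideal by (simp add: odd_form_ideal_def)

lemma Om_tr0: "x \<in> J \<Longrightarrow> tr0 x \<in> \<Omega>"
  by (rule subsetD[OF Omega_min_Om tr0_in_Omega_min[OF J_ideal]])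

lemma Om_Delta_act: "\<alpha> \<in> Delta F \<Longrightarrow> x \<in> J \<Longrightarrow> heis_act F \<alpha> x \<in> \<Omega>"
  by (rule subsetD[OF Omega_min_Om act_in_Omega_min[OF J_ideal]])

lemma Om_tilde: "\<omega> \<in> \<Omega> \<Longrightarrow> fst \<omega> \<in> ideal_tilde F J"
  using odd_form_ideal by (auto simp: odd_form_ideal_def Omega_max_def)

lemma Om_J_Delta: "\<omega> \<in> \<Omega> \<Longrightarrow> fst \<omega> \<in> J_Delta F"
  using Om_Delta[of \<omega>] by (cases \<omega>) (auto simp: J_Delta_def)

lemma tildeD:
  assumes "x \<in> ideal_tilde F J" "y \<in> J_Delta F"
  shows "cj y * mu F * x \<in> J" "cj x * mu F * y \<in> J"
proof -
  show 1: "cj y * mu F * x \<in> J" using assms by (simp add: ideal_tilde_def)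
  have "cj (cj y * mu F * x) * lam F \<in> J" by (rule J_intros(4)[OF involution_invariantD[OF J_cj 1]])
  then show "cj x * mu F * y \<in> J" by (simp add: mult_ac lam_absorb)
qed

lemma tilde_add: "x \<in> ideal_tilde F J \<Longrightarrow> y \<in> ideal_tilde F J \<Longrightarrow> x + y \<in> ideal_tilde F J"
  by (simp add: ideal_tilde_def distrib_left J_intros(2))

abbreviation eqv :: "'a \<times> 'a \<Rightarrow> 'a \<times> 'a \<Rightarrow> bool" (infix "\<doteq>" 50) where
  "\<alpha> \<doteq> \<beta> \<equiv> heis_cong F \<Omega> \<alpha> \<beta>"

lemma eqv_refl: "\<alpha> \<doteq> \<alpha>"
  using Om_zero by (cases \<alpha>) (simp add: heis_cong_def)

lemma eqv_sym: "\<alpha> \<doteq> \<beta> \<Longrightarrow> \<beta> \<doteq> \<alpha>"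
  unfolding heis_cong_def using Om_inv[of "\<alpha> \<otimes>\<^bsub>heis F\<^esub> inv\<^bsub>heis F\<^esub> \<beta>"]
  by (cases \<alpha>; cases \<beta>) (simp add: algebra_simps)

lemma eqv_trans [trans]: "\<alpha> \<doteq> \<beta> \<Longrightarrow> \<beta> \<doteq> \<gamma> \<Longrightarrow> \<alpha> \<doteq> \<gamma>"
  unfolding heis_cong_def
  using Om_mult[of "\<alpha> \<otimes>\<^bsub>heis F\<^esub> inv\<^bsub>heis F\<^esub> \<beta>" "\<beta> \<otimes>\<^bsub>heis F\<^esub> inv\<^bsub>heis F\<^esub> \<gamma>"]
  by (cases \<alpha>; cases \<beta>; cases \<gamma>) (simp add: algebra_simps)

lemma eqv_zero: "\<alpha> \<doteq> (0, 0) \<longleftrightarrow> \<alpha> \<in> \<Omega>"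
  by (cases \<alpha>) (simp add: heis_cong_def)

lemma fst_heis: "fst (\<alpha> \<otimes>\<^bsub>heis F\<^esub> \<beta>) = fst \<alpha> + fst \<beta>" "fst (heis_act F \<alpha> a) = fst \<alpha> * a" "fst (tr0 a) = 0"
  by (cases \<alpha>; cases \<beta>; simp add: tr0_def)+

lemma fst_Q: "fst (Q u) = u $ Mid"
  by (simp add: form_Q_eq)

lemma eqv_fst:
  assumes "\<alpha> \<doteq> \<beta>"
  obtains \<omega> where "\<omega> \<in> \<Omega>" "fst \<alpha> = fst \<omega> + fst \<beta>"
proof
  show "\<alpha> \<otimes>\<^bsub>heis F\<^esub> inv\<^bsub>heis F\<^esub> \<beta> \<in> \<Omega>" using assms by (simp add: heis_cong_def)
  show "fst \<alpha> = fst (\<alpha> \<otimes>\<^bsub>heis F\<^esub> inv\<^bsub>heis F\<^esub> \<beta>) + fst \<beta>" by (cases \<alpha>; cases \<beta>) simp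
qed

text \<open>By \<open>heis_conj\<close> the form parameter \<open>\<Omega>\<close> is normal only relative to elements whose first component is in
  \<open>J_Delta F\<close>. This is why the first components are tracked in everything that follows.\<close>
lemma Om_conj:
  assumes "\<omega> \<in> \<Omega>" "fst \<beta> \<in> J_Delta F"
  shows "\<beta> \<otimes>\<^bsub>heis F\<^esub> \<omega> \<otimes>\<^bsub>heis F\<^esub> inv\<^bsub>heis F\<^esub> \<beta> \<in> \<Omega>"
  unfolding heis_conj by (intro Om_mult assms(1) Om_tr0 tildeD(2) Om_tilde assms(2))

lemma eqv_mult:
  assumes "\<alpha> \<doteq> \<alpha>'" "\<beta> \<doteq> \<beta>'" "fst \<alpha> \<in> J_Delta F"
  shows "\<alpha> \<otimes>\<^bsub>heis F\<^esub> \<beta> \<doteq> \<alpha>' \<otimes>\<^bsub>heis F\<^esub> \<beta>'"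
proof -
  have "(\<alpha> \<otimes>\<^bsub>heis F\<^esub> \<beta>) \<otimes>\<^bsub>heis F\<^esub> inv\<^bsub>heis F\<^esub> (\<alpha>' \<otimes>\<^bsub>heis F\<^esub> \<beta>')
    = (\<alpha> \<otimes>\<^bsub>heis F\<^esub> (\<beta> \<otimes>\<^bsub>heis F\<^esub> inv\<^bsub>heis F\<^esub> \<beta>') \<otimes>\<^bsub>heis F\<^esub> inv\<^bsub>heis F\<^esub> \<alpha>) \<otimes>\<^bsub>heis F\<^esub> (\<alpha> \<otimes>\<^bsub>heis F\<^esub> inv\<^bsub>heis F\<^esub> \<alpha>')"
    by (cases \<alpha>; cases \<alpha>'; cases \<beta>; cases \<beta>') (simp add: algebra_simps)
  then show ?thesis
    using Om_mult[OF Om_conj[OF assms(2)[unfolded heis_cong_def] assms(3)] assms(1)[unfolded heis_cong_def]]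
    by (simp only: heis_cong_def)
qed

lemma eqv_tr0: "a - b \<in> J \<Longrightarrow> tr0 a \<doteq> tr0 b"
  using Om_tr0[of "a - b"] by (simp add: heis_cong_def tr0_inv tr0_add)

lemma eqv_tr0_right:
  assumes "a \<in> J" "fst \<alpha> \<in> J_Delta F"
  shows "\<alpha> \<otimes>\<^bsub>heis F\<^esub> tr0 a \<doteq> \<alpha>"
  using eqv_mult[OF eqv_refl eqv_tr0[of a 0] assms(2)] assms(1) by (cases \<alpha>) (simp add: tr0_zero)

lemma eqv_Om_left:
  assumes "\<omega> \<in> \<Omega>"
  shows "\<omega> \<otimes>\<^bsub>heis F\<^esub> \<alpha> \<doteq> \<alpha>"
  using eqv_mult[OF _ eqv_refl Om_J_Delta[OF assms], of "(0, 0)" \<alpha>] assms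
  by (cases \<alpha>) (simp add: eqv_zero)

lemma act_eqv:
  assumes "\<alpha> \<in> Delta F" "x - y \<in> J"
  shows "heis_act F \<alpha> x \<doteq> heis_act F \<alpha> y"
proof -
  obtain p z where pz: "\<alpha> = (p, z)" by (cases \<alpha>)
  have "heis_act F \<alpha> x = heis_act F \<alpha> ((x - y) + y)" by simp
  also have "\<dots> = heis_act F \<alpha> (x - y) \<otimes>\<^bsub>heis F\<^esub> heis_act F \<alpha> y \<otimes>\<^bsub>heis F\<^esub> tr0 (cj y * z * (x - y))"
    unfolding pz by (rule Delta_act_add[OF assms(1)[unfolded pz]])
  also have "\<dots> = (heis_act F \<alpha> (x - y) \<otimes>\<^bsub>heis F\<^esub> tr0 (cj y * z * (x - y))) \<otimes>\<^bsub>heis F\<^esub> heis_act F \<alpha> y"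
    by (simp only: heis.m_assoc heis_carrier UNIV_I tr0_central[of "heis_act F \<alpha> y"])
  also have "\<dots> \<doteq> heis_act F \<alpha> y"
    by (intro eqv_Om_left Om_mult Om_Delta_act Om_tr0 J_intros(3) assms)
  finally show ?thesis .
qed

lemma M_Delta_iff: "u \<in> M_Delta F \<longleftrightarrow> u $ Mid \<in> J_Delta F"
  by (simp add: M_Delta_def)

lemma U_M_Delta: "g \<in> carrier (U F) \<Longrightarrow> u \<in> M_Delta F \<Longrightarrow> g *v u \<in> M_Delta F"
  using U_D(3)[of g u] J_Delta_add[of "(g *v u) $ Mid - u $ Mid" "u $ Mid"] by (simp add: M_Delta_iff)

lemma ax_M_Delta: "i \<noteq> Mid \<Longrightarrow> ax i \<in> M_Delta F"
  by (simp add: M_Delta_iff J_Delta_zero)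

lemma Q_ax: "i \<noteq> Mid \<Longrightarrow> Q (ax i) = (0, 0)"
  by (cases i) (simp_all add: form_Q_eq cross_ax_left)

lemma cross_congr:
  assumes "\<And>i. i \<noteq> Mid \<Longrightarrow> (v - v') $ i \<in> J" "\<And>i. i \<noteq> Mid \<Longrightarrow> (w - w') $ i \<in> J"
  shows "cross v w - cross v' w' \<in> J"
proof -
  have "cross (v - v') w \<in> J" by (rule cross_near[OF J_ideal J_cj]) (use assms(1)[of "Pos _"] in simp)
  moreover have "cross v' (w - w') \<in> J" by (rule cross_near[OF J_ideal J_cj]) (use assms(2)[of "Neg _"] in simp)
  ultimately have "cross (v - v') w + cross v' (w - w') \<in> J" by (rule J_intros(2))
  then show ?thesis by (simp add: cross_lin)
qed

text \<open>Although \<open>Q\<close> is not additive, the defects of \<open>Q\<close> and of \<open>Q\<close> after \<open>g\<close> agree modulo \<open>\<Omega>\<close> on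
  sums in \<open>V\<close>. So invariance of \<open>Q\<close> under \<open>g\<close> need only be known on multiples of basis vectors.\<close>
lemma eqv_Q_basis:
  fixes g :: "('a, 'n::finite) tmat" and x :: "'a ^ 'n theta"
  assumes g: "isometry g"
    and V: "0 \<in> V" "\<And>x y. x \<in> V \<Longrightarrow> y \<in> V \<Longrightarrow> x + y \<in> V" "\<And>x. x \<in> V \<Longrightarrow> (g *v x) $ Mid \<in> J_Delta F"
      "\<And>x y. x \<in> V \<Longrightarrow> y \<in> V \<Longrightarrow> cross (g *v y) (g *v x) - cross y x \<in> J"
    and b: "\<And>i. x $ i *s ax i \<in> V" "\<And>i. Q (g *v (x $ i *s ax i)) \<doteq> Q (x $ i *s ax i)"
  shows "Q (g *v x) \<doteq> Q x"
proof -
  have "(\<Sum>i\<in>T. x $ i *s ax i) \<in> V \<and> Q (g *v (\<Sum>i\<in>T. x $ i *s ax i)) \<doteq> Q (\<Sum>i\<in>T. x $ i *s ax i)" if "finite T" for T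
    using that
  proof induction
    case empty
    then show ?case using V(1) eqv_refl by simp
  next
    case (insert i T)
    define u w where "u = x $ i *s ax i" and "w = (\<Sum>i\<in>T. x $ i *s ax i)"
    have uw: "u \<in> V" "w \<in> V" "Q (g *v u) \<doteq> Q u" "Q (g *v w) \<doteq> Q w"
      using b insert.IH by (simp_all add: u_def w_def)
    have "Q (g *v u) \<otimes>\<^bsub>heis F\<^esub> Q (g *v w) \<otimes>\<^bsub>heis F\<^esub> (0, B u w) \<otimes>\<^bsub>heis F\<^esub> tr0 (cross (g *v w) (g *v u))
       \<doteq> Q u \<otimes>\<^bsub>heis F\<^esub> Q w \<otimes>\<^bsub>heis F\<^esub> (0, B u w) \<otimes>\<^bsub>heis F\<^esub> tr0 (cross w u)"
      by (intro eqv_mult uw eqv_refl eqv_tr0 V(4))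
        (use V(3)[OF uw(1)] V(3)[OF uw(2)] in \<open>simp_all only: fst_heis fst_Q fst_conv add_0_right J_Delta_add\<close>)
    then have "Q (g *v (u + w)) \<doteq> Q (u + w)"
      using g by (simp only: matrix_vector_right_distrib Q_add isometry_def)
    moreover have "u + w \<in> V" by (rule V(2)[OF uw(1,2)])
    ultimately show ?case using insert.hyps by (simp add: u_def w_def)
  qed
  from this[of UNIV] show ?thesis using vector_axis_expansion[of x] by simp
qed

lemma U_entry_i0:
  fixes g :: "('a, 'n::finite) tmat"
  assumes g: "g \<in> carrier (U F)" and i: "i \<noteq> Mid"
  shows "g $ i $ Mid = cj (beta (- i)) * (cj ((inv\<^bsub>U F\<^esub> g) $ Mid $ (- i)) * mu F)"
proof -
  have "inv\<^bsub>U F\<^esub> (inv\<^bsub>U F\<^esub> g) = g" by (rule group.inv_inv[OF U_group g])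
  then have "beta (- i) * g $ i $ Mid = cj ((inv\<^bsub>U F\<^esub> g) $ Mid $ (- i)) * mu F"
    using U_inv_entry[OF U_inv(3)[OF g], of "- i" Mid] by simp
  then have "cj (beta (- i)) * (beta (- i) * g $ i $ Mid) = cj (beta (- i)) * (cj ((inv\<^bsub>U F\<^esub> g) $ Mid $ (- i)) * mu F)"
    by simp
  then show ?thesis using absorb_prod(4)[OF beta_unit[of "- i"]] i by simp
qed

text \<open>The vectors that vanish modulo \<open>J\<close>; in the middle coordinate only its pairing with \<open>J_Delta F\<close> is controlled.\<close>
definition small :: "('a ^ ('n::finite) theta) set" where
  "small = {w. (\<forall>i. i \<noteq> Mid \<longrightarrow> w $ i \<in> J) \<and> w $ Mid \<in> ideal_tilde F J}"

lemma smallD: "w \<in> small \<Longrightarrow> i \<noteq> Mid \<Longrightarrow> w $ i \<in> J" "w \<in> small \<Longrightarrow> w $ Mid \<in> ideal_tilde F J"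
  by (simp_all add: small_def)

lemma U_small:
  fixes g :: "('a, 'n::finite) tmat"
  assumes g: "g \<in> carrier (U F)" and w: "w \<in> small" and i: "i \<noteq> Mid"
  shows "(g *v w) $ i \<in> J"
proof -
  have "g $ i $ j * w $ j \<in> J" for j
  proof (cases "j = Mid")
    case True
    have "cj ((inv\<^bsub>U F\<^esub> g) $ Mid $ (- i)) * mu F * w $ Mid \<in> J"
      by (rule tildeD(1)[OF smallD(2)[OF w] U_entry_0j[OF U_inv(3)[OF g]]]) (use i in simp)
    then have "cj (beta (- i)) * (cj ((inv\<^bsub>U F\<^esub> g) $ Mid $ (- i)) * mu F * w $ Mid) \<in> J" by (rule J_intros(3))
    then show ?thesis unfolding True U_entry_i0[OF g i] by (simp only: mult.assoc)
  qed (intro J_intros(3) smallD(1)[OF w])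
  then show ?thesis unfolding matrix_vector_mult_def by (simp add: J_intros(7))
qed

lemma B_small:
  assumes w: "w \<in> small" and v: "v \<in> M_Delta F"
  shows "B w v \<in> J"
proof -
  have "cj (w $ i) * beta i * v $ (- i) \<in> J" for i
  proof (cases "i = Mid")
    case True
    then show ?thesis using tildeD(2)[OF smallD(2)[OF w]] v by (simp add: M_Delta_iff)
  next
    case False
    then show ?thesis by (intro J_intros(4) involution_invariantD[OF J_cj] smallD(1)[OF w])
  qed
  then show ?thesis unfolding form_B_sum by (simp add: J_intros(7))
qed

text \<open>The congruence conditions on the matrix say that \<open>\<tau>\<close> is the identity modulo \<open>J\<close> on the hyperbolic
  coordinates of all vectors in \<open>M_Delta F\<close>, including those with a nonzero middle coordinate: the condition on \<open>Q\<close>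
  controls the middle row of the inverse, hence the middle column of \<open>\<tau>\<close>.\<close>
lemma U_cong_iff:
  fixes \<tau> :: "('a, 'n::finite) tmat"
  shows "\<tau> \<in> U_cong F (J, \<Omega>) \<longleftrightarrow> \<tau> \<in> carrier (U F) \<and>
     (\<forall>v\<in>M_Delta F. (\<forall>i. i \<noteq> Mid \<longrightarrow> (\<tau> *v v - v) $ i \<in> J) \<and> Q (\<tau> *v v) \<doteq> Q v)"
proof -
  have hb: "(\<tau> *v v - v) $ i \<in> J"
    if \<tau>: "\<tau> \<in> carrier (U F)" and e: "\<And>i j. i \<noteq> Mid \<Longrightarrow> j \<noteq> Mid \<Longrightarrow> \<tau> $ i $ j - mat 1 $ i $ j \<in> J"
      and q: "\<And>u. u \<in> M_Delta F \<Longrightarrow> Q (\<tau> *v u) \<doteq> Q u" and v: "v \<in> M_Delta F" and i: "i \<noteq> Mid" for v i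
  proof -
    have "(\<tau> $ i $ j - mat 1 $ i $ j) * v $ j \<in> J" for j
    proof (cases "j = Mid")
      case True
      define u where "u = inv\<^bsub>U F\<^esub> \<tau> *v ax (- i)"
      have u: "u \<in> M_Delta F" unfolding u_def by (intro U_M_Delta U_inv(3) \<tau> ax_M_Delta) (use i in simp)
      have "Q u \<doteq> Q (ax (- i))" using eqv_sym[OF q[OF u]] by (simp add: u_def U_inv_apply[OF \<tau>])
      then have "Q u \<in> \<Omega>" using i by (simp add: Q_ax eqv_zero)
      from tildeD(2)[OF Om_tilde[OF this]] have "cj (u $ Mid) * mu F * v $ Mid \<in> J"
        using v by (simp add: fst_Q M_Delta_iff)
      then have "cj (beta (- i)) * (cj (u $ Mid) * mu F * v $ Mid) \<in> J" by (rule J_intros(3))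
      moreover have "u $ Mid = (inv\<^bsub>U F\<^esub> \<tau>) $ Mid $ (- i)" by (simp add: u_def matrix_entry)
      ultimately show ?thesis using i unfolding True U_entry_i0[OF \<tau> i] by (simp add: mat_def mult.assoc)
    qed (intro J_intros(4) e i)
    moreover have "(\<tau> *v v - v) $ i = (\<Sum>j\<in>UNIV. (\<tau> $ i $ j - mat 1 $ i $ j) * v $ j)"
    proof -
      have "\<tau> *v v - v = (\<tau> - mat 1) *v v" by (simp add: matrix_vector_mult_diff_rdistrib)
      then show ?thesis by (simp add: matrix_vector_mult_def)
    qed
    ultimately show ?thesis by (simp add: J_intros(7))
  qed
  have e: "\<tau> $ i $ j - mat 1 $ i $ j = (\<tau> *v ax j - ax j) $ i" for i j
    by (simp add: matrix_entry[symmetric] mat_def)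
  have hb': "\<tau> $ i $ j - mat 1 $ i $ j \<in> J"
    if "\<And>v i. v \<in> M_Delta F \<Longrightarrow> i \<noteq> Mid \<Longrightarrow> (\<tau> *v v - v) $ i \<in> J" "i \<noteq> Mid" "j \<noteq> Mid" for i j
    unfolding e by (rule that(1)[OF ax_M_Delta[OF that(3)] that(2)])
  have "\<tau> \<in> U_cong F (J, \<Omega>) \<longleftrightarrow> \<tau> \<in> carrier (U F) \<and> (\<forall>i j. i \<noteq> Mid \<longrightarrow> j \<noteq> Mid \<longrightarrow> \<tau> $ i $ j - mat 1 $ i $ j \<in> J)
      \<and> (\<forall>u\<in>M_Delta F. Q (\<tau> *v u) \<doteq> Q u)"
    by (auto simp: U_cong_def theta_hb_iff)
  then show ?thesis using hb hb' by meson
qed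

lemma U_congD:
  fixes \<tau> :: "('a, 'n::finite) tmat"
  assumes "\<tau> \<in> U_cong F (J, \<Omega>)"
  shows "\<tau> \<in> carrier (U F)" "v \<in> M_Delta F \<Longrightarrow> i \<noteq> Mid \<Longrightarrow> (\<tau> *v v - v) $ i \<in> J"
    "v \<in> M_Delta F \<Longrightarrow> Q (\<tau> *v v) \<doteq> Q v"
  using assms by (simp_all add: U_cong_iff)

lemma U_cong_subgroup: "subgroup (U_cong F (J, \<Omega>) :: ('a, 'n::finite) tmat set) (U F)"
proof (rule group.subgroupI[OF U_group])
  show "U_cong F (J, \<Omega>) \<subseteq> (carrier (U F) :: ('a, 'n) tmat set)" using U_congD(1) by blast
  have "\<one>\<^bsub>U F\<^esub> \<in> (carrier (U F) :: ('a, 'n) tmat set)" by (rule monoid.one_closed[OF group.is_monoid[OF U_group]])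
  then have "mat 1 \<in> (U_cong F (J, \<Omega>) :: ('a, 'n) tmat set)"
    by (simp add: U_cong_iff eqv_refl J_intros(1))
  then show "U_cong F (J, \<Omega>) \<noteq> ({} :: ('a, 'n) tmat set)" by blast
next
  fix a :: "('a, 'n) tmat" assume a: "a \<in> U_cong F (J, \<Omega>)"
  have "(inv\<^bsub>U F\<^esub> a *v v - v) $ i \<in> J" if v: "v \<in> M_Delta F" and i: "i \<noteq> Mid" for v i
    using J_intros(5)[OF U_congD(2)[OF a U_M_Delta[OF U_inv(3)[OF U_congD(1)[OF a]] v] i]]
    by (simp add: U_inv_apply[OF U_congD(1)[OF a]])
  moreover have "Q (inv\<^bsub>U F\<^esub> a *v v) \<doteq> Q v" if v: "v \<in> M_Delta F" for v
    using eqv_sym[OF U_congD(3)[OF a U_M_Delta[OF U_inv(3)[OF U_congD(1)[OF a]] v]]]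
    by (simp add: U_inv_apply[OF U_congD(1)[OF a]])
  ultimately show "inv\<^bsub>U F\<^esub> a \<in> U_cong F (J, \<Omega>)"
    using U_inv(3)[OF U_congD(1)[OF a]] by (simp add: U_cong_iff)
next
  fix a b :: "('a, 'n) tmat" assume a: "a \<in> U_cong F (J, \<Omega>)" and b: "b \<in> U_cong F (J, \<Omega>)"
  have bv: "b *v v \<in> M_Delta F" if "v \<in> M_Delta F" for v by (rule U_M_Delta[OF U_congD(1)[OF b] that])
  have "(a *v (b *v v) - v) $ i \<in> J" if v: "v \<in> M_Delta F" and i: "i \<noteq> Mid" for v i
    using J_intros(2)[OF U_congD(2)[OF a bv[OF v] i] U_congD(2)[OF b v i]] by simp
  moreover have "Q (a *v (b *v v)) \<doteq> Q v" if v: "v \<in> M_Delta F" for v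
    by (rule eqv_trans[OF U_congD(3)[OF a bv[OF v]] U_congD(3)[OF b v]])
  moreover have "a ** b \<in> carrier (U F)"
    using monoid.m_closed[OF group.is_monoid[OF U_group] U_congD(1)[OF a] U_congD(1)[OF b]] by simp
  ultimately show "a \<otimes>\<^bsub>U F\<^esub> b \<in> U_cong F (J, \<Omega>)"
    by (simp add: U_cong_iff matrix_vector_mul_assoc[symmetric])
qed

text \<open>The only obstruction for \<open>g\<close> to normalise the congruence subgroup is what it does to \<open>Q\<close> on the multiples
  of the middle basis vector by first components of \<open>\<Omega>\<close>.\<close>
definition Om_compatible :: "('a, 'n::finite) tmat \<Rightarrow> bool" where
  "Om_compatible g \<longleftrightarrow> (\<forall>\<omega>\<in>\<Omega>. heis_act F (Q (g *v ax Mid)) (fst \<omega>) \<doteq> (fst \<omega>, 0))"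

lemma compatible_Q:
  fixes g :: "('a, 'n::finite) tmat"
  assumes g: "g \<in> carrier (U F)" "Om_compatible g"
    and w: "\<And>i. i \<noteq> Mid \<Longrightarrow> w $ i \<in> J" "\<omega> \<in> \<Omega>" "w $ Mid = fst \<omega>"
  shows "Q (g *v w) \<doteq> Q w"
proof (rule eqv_Q_basis[OF U_D(1)[OF g(1)], where V = "{x \<in> small. x \<in> M_Delta F}"])
  show "0 \<in> {x \<in> small. x \<in> M_Delta F}"
    using J_Delta_zero by (simp add: small_def M_Delta_iff J_intros(1) ideal_tilde_def)
  show "x + y \<in> {x \<in> small. x \<in> M_Delta F}" if "x \<in> {x \<in> small. x \<in> M_Delta F}" "y \<in> {x \<in> small. x \<in> M_Delta F}"
    for x y :: "'a ^ 'n theta"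
    using that by (simp add: small_def M_Delta_iff J_intros(2) tilde_add J_Delta_add)
  show "(g *v x) $ Mid \<in> J_Delta F" if "x \<in> {x \<in> small. x \<in> M_Delta F}" for x
    using U_M_Delta[OF g(1), of x] that by (simp add: M_Delta_iff)
  show "cross (g *v y) (g *v x) - cross y x \<in> J"
    if "x \<in> {x \<in> small. x \<in> M_Delta F}" "y \<in> {x \<in> small. x \<in> M_Delta F}" for x y
    by (rule J_intros(6); rule cross_near[OF J_ideal J_cj])
      (use that U_small[OF g(1)] smallD(1)[of x] smallD(1)[of y] in simp_all)
  have tJ: "fst \<omega> \<in> ideal_tilde F J" "fst \<omega> \<in> J_Delta F" using Om_tilde Om_J_Delta w(2) by blast+
  have t0: "0 \<in> ideal_tilde F J" by (simp add: ideal_tilde_def J_intros(1))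
  fix i
  show "w $ i *s ax i \<in> {x \<in> small. x \<in> M_Delta F}"
    using w tJ t0 J_Delta_zero by (cases "i = Mid") (auto simp: small_def M_Delta_iff J_intros(1))
  show "Q (g *v (w $ i *s ax i)) \<doteq> Q (w $ i *s ax i)"
  proof (cases "i = Mid")
    case True
    have "Q (ax Mid :: 'a ^ 'n theta) = (1, 0)" by (simp add: form_Q_eq cross_ax_left)
    then show ?thesis using g(2) w(2) by (simp add: True w(3) Om_compatible_def matrix_vector_smult Q_smult)
  next
    case False
    have "heis_act F (Q (g *v ax i)) (w $ i) \<in> \<Omega>"
      by (rule Om_Delta_act[OF Q_U_Delta(1)[OF g(1) False] w(1)[OF False]])
    then show ?thesis using False by (simp add: matrix_vector_smult Q_smult Q_ax eqv_zero)
  qed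
qed

text \<open>Write \<open>\<tau> v = v + w\<close> with \<open>w\<close> small. By \<open>Q_add\<close>, \<open>\<tau>\<close> preserves \<open>Q v\<close> modulo \<open>\<Omega>\<close> iff \<open>Q w\<close> and \<open>B v w\<close> compensate
  each other modulo \<open>\<Omega>\<close>, and both are invariant under \<open>g\<close>: the first by \<open>compatible_Q\<close>, the second because \<open>g\<close> is an
  isometry.\<close>
lemma compatible_conj:
  fixes g \<tau> :: "('a, 'n::finite) tmat"
  assumes g: "g \<in> carrier (U F)" "Om_compatible g" and \<tau>: "\<tau> \<in> U_cong F (J, \<Omega>)"
  shows "g ** \<tau> ** inv\<^bsub>U F\<^esub> g \<in> U_cong F (J, \<Omega>)"
proof -
  have car: "g ** \<tau> ** inv\<^bsub>U F\<^esub> g \<in> carrier (U F)"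
    using g(1) U_congD(1)[OF \<tau>] U_inv(3)[OF g(1)] monoid.m_closed[OF group.is_monoid[OF U_group]]
    unfolding U_mult[symmetric] by blast
  have "(\<forall>i. i \<noteq> Mid \<longrightarrow> ((g ** \<tau> ** inv\<^bsub>U F\<^esub> g) *v u - u) $ i \<in> J) \<and> Q ((g ** \<tau> ** inv\<^bsub>U F\<^esub> g) *v u) \<doteq> Q u"
    if u: "u \<in> M_Delta F" for u
  proof -
    define v where "v = inv\<^bsub>U F\<^esub> g *v u"
    have v: "v \<in> M_Delta F" unfolding v_def by (rule U_M_Delta[OF U_inv(3)[OF g(1)] u])
    have gv: "g *v v = u" by (simp add: v_def U_inv_apply[OF g(1)])
    define w where "w = \<tau> *v v - v"
    have \<tau>v: "\<tau> *v v = v + w" by (simp add: w_def)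
    have l: "(g ** \<tau> ** inv\<^bsub>U F\<^esub> g) *v u = g *v (v + w)"
      by (simp add: matrix_vector_mul_assoc[symmetric] v_def[symmetric] \<tau>v)
    have wJ: "w $ i \<in> J" if "i \<noteq> Mid" for i unfolding w_def by (rule U_congD(2)[OF \<tau> v that])
    obtain \<omega> where \<omega>: "\<omega> \<in> \<Omega>" "w $ Mid = fst \<omega>"
      by (rule eqv_fst[OF U_congD(3)[OF \<tau> v]]) (simp add: fst_Q w_def)
    have ws: "w \<in> small" using wJ \<omega> Om_tilde by (simp add: small_def)
    have gw: "(g *v w) $ i \<in> J" if "i \<noteq> Mid" for i by (rule U_small[OF g(1) ws that])
    have Qgw: "Q (g *v w) \<doteq> Q w" by (rule compatible_Q[OF g wJ \<omega>])
    have crJ: "cross w v \<in> J" "cross (g *v w) u \<in> J"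
      by (rule cross_near[OF J_ideal J_cj]; use wJ gw in simp)+
    have v0: "v $ Mid \<in> J_Delta F" "u $ Mid \<in> J_Delta F" "w $ Mid \<in> J_Delta F"
      using u v \<omega> Om_J_Delta by (simp_all add: M_Delta_iff)
    have gw0: "(g *v w) $ Mid \<in> J_Delta F"
      using U_M_Delta[OF g(1), of w] v0(3) by (simp add: M_Delta_iff)
    have "Q w \<otimes>\<^bsub>heis F\<^esub> (0, B v w) \<in> \<Omega>"
    proof -
      have "(Q v \<otimes>\<^bsub>heis F\<^esub> Q w \<otimes>\<^bsub>heis F\<^esub> (0, B v w)) \<otimes>\<^bsub>heis F\<^esub> tr0 (cross w v) \<doteq> Q v"
        using U_congD(3)[OF \<tau> v] unfolding \<tau>v Q_add .
      then have 1: "Q v \<otimes>\<^bsub>heis F\<^esub> Q w \<otimes>\<^bsub>heis F\<^esub> (0, B v w) \<doteq> Q v"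
        by (rule eqv_trans[OF eqv_sym[OF eqv_tr0_right[OF crJ(1)]], rotated])
          (simp only: fst_heis fst_Q fst_conv J_Delta_add v0 add_0_right)
      have "fst (inv\<^bsub>heis F\<^esub> (Q v)) = - (v $ Mid)" by (simp add: form_Q_eq)
      then have "fst (inv\<^bsub>heis F\<^esub> (Q v)) \<in> J_Delta F" using J_Delta_diff[OF J_Delta_zero v0(1)] by simp
      from eqv_mult[OF eqv_refl 1 this]
      have "inv\<^bsub>heis F\<^esub> (Q v) \<otimes>\<^bsub>heis F\<^esub> (Q v \<otimes>\<^bsub>heis F\<^esub> Q w \<otimes>\<^bsub>heis F\<^esub> (0, B v w)) \<doteq> inv\<^bsub>heis F\<^esub> (Q v) \<otimes>\<^bsub>heis F\<^esub> Q v" .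
      moreover have "inv\<^bsub>heis F\<^esub> \<alpha> \<otimes>\<^bsub>heis F\<^esub> (\<alpha> \<otimes>\<^bsub>heis F\<^esub> \<beta> \<otimes>\<^bsub>heis F\<^esub> \<gamma>) = \<beta> \<otimes>\<^bsub>heis F\<^esub> \<gamma>" "inv\<^bsub>heis F\<^esub> \<alpha> \<otimes>\<^bsub>heis F\<^esub> \<alpha> = (0, 0)"
        for \<alpha> \<beta> \<gamma> by (cases \<alpha>; cases \<beta>; cases \<gamma>; simp add: algebra_simps)+
      ultimately show ?thesis by (simp only: eqv_zero)
    qed
    moreover have "Q (g *v w) \<otimes>\<^bsub>heis F\<^esub> (0, B v w) \<doteq> Q w \<otimes>\<^bsub>heis F\<^esub> (0, B v w)"
      by (rule eqv_mult[OF Qgw eqv_refl]) (simp only: fst_Q gw0)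
    ultimately have "Q (g *v w) \<otimes>\<^bsub>heis F\<^esub> (0, B v w) \<doteq> (0, 0)"
      using eqv_trans eqv_zero by blast
    then have "Q u \<otimes>\<^bsub>heis F\<^esub> (Q (g *v w) \<otimes>\<^bsub>heis F\<^esub> (0, B v w)) \<doteq> Q u \<otimes>\<^bsub>heis F\<^esub> (0, 0)"
      by (rule eqv_mult[OF eqv_refl]) (simp only: fst_Q v0)
    moreover have "Q (g *v (v + w)) = Q u \<otimes>\<^bsub>heis F\<^esub> (Q (g *v w) \<otimes>\<^bsub>heis F\<^esub> (0, B v w)) \<otimes>\<^bsub>heis F\<^esub> tr0 (cross (g *v w) u)"
      using U_D(1)[OF g(1)] unfolding matrix_vector_right_distrib Q_add gv[symmetric]
      by (simp only: isometry_def heis.m_assoc heis_carrier UNIV_I)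
    moreover have "Q u \<otimes>\<^bsub>heis F\<^esub> (Q (g *v w) \<otimes>\<^bsub>heis F\<^esub> (0, B v w)) \<otimes>\<^bsub>heis F\<^esub> tr0 (cross (g *v w) u)
        \<doteq> Q u \<otimes>\<^bsub>heis F\<^esub> (Q (g *v w) \<otimes>\<^bsub>heis F\<^esub> (0, B v w))"
      by (rule eqv_tr0_right[OF crJ(2)]) (simp only: fst_heis fst_Q fst_conv J_Delta_add v0 gw0 add_0_right)
    moreover have "Q u \<otimes>\<^bsub>heis F\<^esub> (0, 0) = Q u" by (cases "Q u") simp
    ultimately have "Q (g *v (v + w)) \<doteq> Q u" by (metis eqv_trans)
    moreover have "(g *v (v + w) - u) $ i \<in> J" if "i \<noteq> Mid" for i
      using gw[OF that] by (simp add: matrix_vector_right_distrib gv)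
    ultimately show ?thesis unfolding l by simp
  qed
  then show ?thesis using car by (simp add: U_cong_iff)
qed

lemma compatible_NU:
  fixes g :: "('a, 'n::finite) tmat"
  assumes g: "g \<in> carrier (U F)" "Om_compatible g" "Om_compatible (inv\<^bsub>U F\<^esub> g)"
  shows "g \<in> NU F (J, \<Omega>)"
proof -
  have "inv\<^bsub>U F\<^esub> (inv\<^bsub>U F\<^esub> g) = g" by (rule group.inv_inv[OF U_group g(1)])
  then show ?thesis
    unfolding NU_def group.normalizer_iff[OF U_group subgroup.subset[OF U_cong_subgroup]]
    using compatible_conj[OF g(1,2)] compatible_conj[OF U_inv(3)[OF g(1)] g(3)] g(1) by simp
qed

end

section \<open>The upper level is an odd form ideal\<close>

context hermitian_form_ring
begin

text \<open>Closure under the group operation holds because \<open>cj x * mu F * x'\<close> is in \<open>J\<close> as soon as one of \<open>x\<close>, \<open>x'\<close> is in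
  \<open>J_Delta F\<close> and the other in \<open>ideal_tilde F J\<close>.\<close>
lemma Omega_max_submodule:
  assumes J: "is_ideal J" "involution_invariant F J"
  shows "heis_submodule F (Omega_max F J)"
proof -
  have iff: "\<alpha> \<in> Omega_max F J \<longleftrightarrow> \<alpha> \<in> Delta F \<and> fst \<alpha> \<in> ideal_tilde F J \<and> snd \<alpha> \<in> J" for \<alpha>
    by (auto simp: Omega_max_def mem_Times_iff)
  have D: "fst \<alpha> \<in> J_Delta F" if "\<alpha> \<in> Delta F" for \<alpha>
    using that by (cases \<alpha>) (auto simp: J_Delta_def)
  have pair: "cj (fst \<alpha>) * mu F * fst \<beta> \<in> J" if "\<alpha> \<in> Delta F" "fst \<beta> \<in> ideal_tilde F J" for \<alpha> \<beta>
    using that D[OF that(1)] by (simp add: ideal_tilde_def)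
  show ?thesis
  proof (rule heis_submoduleI)
    show "(0, 0) \<in> Omega_max F J" by (simp add: iff Delta_zero ideal_tilde_def ideal_zero[OF J(1)])
    show "\<alpha> \<otimes>\<^bsub>heis F\<^esub> \<beta> \<in> Omega_max F J" if "\<alpha> \<in> Omega_max F J" "\<beta> \<in> Omega_max F J" for \<alpha> \<beta>
      using that pair[of \<alpha> \<beta>] Delta_mult[of \<alpha> \<beta>] unfolding iff
      by (cases \<alpha>; cases \<beta>) (simp add: ideal_tilde_def distrib_left ideal_add[OF J(1)] ideal_diff[OF J(1)])
    show "inv\<^bsub>heis F\<^esub> \<alpha> \<in> Omega_max F J" if "\<alpha> \<in> Omega_max F J" for \<alpha>
      using that pair[of \<alpha> \<alpha>] Delta_inv[of \<alpha>] unfolding iff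
      by (cases \<alpha>) (simp add: ideal_tilde_def ideal_neg[OF J(1)] ideal_diff[OF J(1)])
    show "heis_act F \<alpha> a \<in> Omega_max F J" if "\<alpha> \<in> Omega_max F J" for \<alpha> a
      using that Delta_act[of \<alpha> a] unfolding iff
      by (cases \<alpha>) (simp add: ideal_tilde_def mult.assoc[symmetric] ideal_mult[OF J(1)] ideal_mult'[OF J(1)])
  qed
qed

lemma Omega_min_max:
  assumes J: "is_ideal J" "involution_invariant F J"
  shows "Omega_min F J \<subseteq> Omega_max F J"
proof (rule Omega_min_least[OF heis_submoduleD(1)[OF Omega_max_submodule[OF J]]])
  fix x assume x: "x \<in> J"
  show "tr0 x \<in> Omega_max F J"
    using Delta_tr0[of x] ideal_diff[OF J(1) x ideal_mult'[OF J(1) involution_invariantD[OF J(2) x]]]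
    by (simp add: Omega_max_def tr0_def ideal_tilde_def ideal_zero[OF J(1)])
  fix \<alpha> assume "\<alpha> \<in> Delta F"
  then show "heis_act F \<alpha> x \<in> Omega_max F J"
    using Delta_act[of \<alpha> x] x
    by (cases \<alpha>) (simp add: Omega_max_def ideal_tilde_def ideal_mult[OF J(1)] mult.assoc[symmetric])
qed

lemma level_Y_D:
  assumes "\<sigma> \<in> X" "i \<noteq> Mid" "j \<noteq> Mid" "i \<noteq> j"
  shows "\<sigma> $ i $ j \<in> level_Y F X" "\<sigma> $ i $ i - \<sigma> $ j $ j \<in> level_Y F X"
    "y \<in> J_Delta F \<Longrightarrow> \<sigma> $ i $ Mid * y \<in> level_Y F X"
    "y \<in> J_Delta F \<Longrightarrow> cj y * mu F * \<sigma> $ Mid $ j \<in> level_Y F X"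
    "x \<in> J_Delta F \<Longrightarrow> y \<in> J_Delta F \<Longrightarrow> cj x * mu F * (\<sigma> $ Mid $ Mid - \<sigma> $ j $ j) * y \<in> level_Y F X"
proof -
  have "{\<sigma> $ i $ j, \<sigma> $ i $ i - \<sigma> $ j $ j} \<union> {\<sigma> $ i $ Mid * a | a. a \<in> J_Delta F}
     \<union> {cj a * mu F * \<sigma> $ Mid $ j | a. a \<in> J_Delta F}
     \<union> {cj a * mu F * (\<sigma> $ Mid $ Mid - \<sigma> $ j $ j) * b | a b. a \<in> J_Delta F \<and> b \<in> J_Delta F} \<subseteq> level_Y F X"
    unfolding level_Y_def using assms by (intro SUP_upper2[of \<sigma>] SUP_upper2[of i] SUP_upper2[of j]) (auto simp: theta_hb_iff)
  then show "\<sigma> $ i $ j \<in> level_Y F X" "\<sigma> $ i $ i - \<sigma> $ j $ j \<in> level_Y F X"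
    "y \<in> J_Delta F \<Longrightarrow> \<sigma> $ i $ Mid * y \<in> level_Y F X"
    "y \<in> J_Delta F \<Longrightarrow> cj y * mu F * \<sigma> $ Mid $ j \<in> level_Y F X"
    "x \<in> J_Delta F \<Longrightarrow> y \<in> J_Delta F \<Longrightarrow> cj x * mu F * (\<sigma> $ Mid $ Mid - \<sigma> $ j $ j) * y \<in> level_Y F X"
    by blast+
qed

lemma near_level:
  assumes "is_ideal J" "level_Y F X \<subseteq> J" "\<sigma> \<in> X"
  shows "near J \<sigma>"
    and "i \<noteq> Mid \<Longrightarrow> x \<in> J_Delta F \<Longrightarrow> y \<in> J_Delta F \<Longrightarrow> cj x * mu F * (\<sigma> $ Mid $ Mid - \<sigma> $ i $ i) * y \<in> J"
proof -
  note Y = level_Y_D[OF assms(3), THEN subsetD[OF assms(2)]]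
  show "near J \<sigma>"
    unfolding near_def
  proof (intro allI impI conjI ballI)
    fix i j :: "'b theta" and y assume i: "i \<noteq> Mid" and j: "j \<noteq> Mid"
    show "\<sigma> $ i $ j \<in> J" if "i \<noteq> j" using Y(1)[OF i j that] .
    show "\<sigma> $ i $ i - \<sigma> $ j $ j \<in> J" using Y(2)[OF i j] ideal_zero[OF assms(1)] by (cases "i = j") auto
    assume y: "y \<in> J_Delta F"
    show "\<sigma> $ i $ Mid * y \<in> J" using Y(3)[OF i, of "- i", OF _ _ y] i by simp
    show "cj y * mu F * \<sigma> $ Mid $ j \<in> J" using Y(4)[OF _ j, of "- j", OF _ _ y] j by simp
  qed
  show "cj x * mu F * (\<sigma> $ Mid $ Mid - \<sigma> $ i $ i) * y \<in> J"
    if "i \<noteq> Mid" "x \<in> J_Delta F" "y \<in> J_Delta F"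
    using Y(5)[of "- i" i, OF _ that(1) _ that(2,3)] that(1) by simp
qed

lemma level_Z_max:
  assumes J: "is_ideal J" "involution_invariant F J" and X: "X \<subseteq> carrier (U F)" "level_Y F X \<subseteq> J"
  shows "level_Z F X \<subseteq> Omega_max F J"
proof -
  have "Q (\<sigma> *v ax j) \<in> Omega_max F J" if "\<sigma> \<in> X" and j: "j \<noteq> Mid" for \<sigma> j
  proof -
    have \<sigma>: "\<sigma> \<in> carrier (U F)" "near J \<sigma>" using X that near_level(1)[OF J(1) X(2)] by blast+
    have "fst (Q (\<sigma> *v ax j)) \<in> ideal_tilde F J"
      using nearD(4)[OF \<sigma>(2) j] by (simp add: ideal_tilde_def form_Q_eq matrix_entry[symmetric])
    then show ?thesis
      using Q_U_Delta(1)[OF \<sigma>(1) j] near_Q_snd[OF J \<sigma>(2) j] by (simp add: Omega_max_def mem_Times_iff)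
  qed
  moreover have "zeta \<sigma> i \<alpha> \<in> Omega_max F J" if "\<sigma> \<in> X" and i: "i \<noteq> Mid" and \<alpha>: "\<alpha> \<in> Delta F" for \<sigma> i \<alpha>
  proof -
    have \<sigma>: "\<sigma> \<in> carrier (U F)" "near J \<sigma>" using X that near_level(1)[OF J(1) X(2)] by blast+
    note \<sigma>0 = near_level(2)[OF J(1) X(2) that(1) i]
    obtain y z where yz: "\<alpha> = (y, z)" by (cases \<alpha>)
    have "y \<in> J_Delta F" using \<alpha> yz by (auto simp: J_Delta_def)
    then have "fst (zeta \<sigma> i \<alpha>) \<in> ideal_tilde F J"
      using \<sigma>0 unfolding yz zeta_eq by (simp add: ideal_tilde_def mult.assoc)
    then show ?thesis
      using zeta_Delta[OF \<sigma>(1) \<alpha>] zeta_snd[OF J \<sigma> \<sigma>0 i \<alpha>] by (simp add: Omega_max_def mem_Times_iff)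
  qed
  ultimately show ?thesis unfolding level_Z_eq by blast
qed

lemma upper_level_odd_form_ideal:
  assumes "X \<subseteq> carrier (U F)"
  shows "odd_form_ideal F (upper_level F X)"
proof -
  define J where "J = ideal_generated (level_Y F X \<union> cj ` level_Y F X)"
  have J: "is_ideal J" "involution_invariant F J"
    unfolding J_def by (rule ideal_generated_ideal) (rule cj_ideal_generated, auto intro: ideal_generated_base)
  have Y: "level_Y F X \<subseteq> J" unfolding J_def using ideal_generated_base by blast
  note M = Omega_max_submodule[OF J]
  have "heis_circ F (level_Z F X) UNIV \<subseteq> Omega_max F J"
    using level_Z_max[OF J assms Y] heis_submoduleD(5)[OF M]
    by (intro heis_circ_least[OF heis_submoduleD(1)[OF M]]) blast
  then show ?thesis
    unfolding odd_form_ideal_def upper_level_def Let_def J_def[symmetric] prod.case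
    using J submodule_with_Omega_min[OF J ideal_UNIV] set_mult_incl(1)[OF Omega_min_submodule[OF J(1)] heis_submodule_circ[OF ideal_UNIV]]
      set_mult_least[OF heis_submoduleD(1)[OF M] Omega_min_max[OF J]] by blast
qed

lemma level_Z_upper_level: "level_Z F X \<subseteq> snd (upper_level F X)"
proof
  fix \<zeta> assume "\<zeta> \<in> level_Z F X"
  then have "heis_act F \<zeta> 1 \<in> heis_circ F (level_Z F X) UNIV" by (rule heis_circ_base) (rule UNIV_I)
  then show "\<zeta> \<in> snd (upper_level F X)"
    using set_mult_incl(2)[OF Omega_min_submodule[OF ideal_generated_ideal] heis_submodule_circ[OF ideal_UNIV]]
    by (auto simp: upper_level_def Let_def)
qed

end

section \<open>Elements that are scalar modulo an odd form ideal\<close>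

context form_ideal
begin

text \<open>The conditions that make \<open>\<sigma>\<close> act like the scalar \<open>\<sigma> $ i $ i\<close> modulo \<open>(J, \<Omega>)\<close>. For the upper level of \<open>H\<close> they
  hold for all elements of \<open>H\<close>.\<close>
definition scalar :: "('a, 'n::finite) tmat \<Rightarrow> bool" where
  "scalar \<sigma> \<longleftrightarrow> near J \<sigma>
    \<and> (\<forall>i x y. i \<noteq> Mid \<longrightarrow> x \<in> J_Delta F \<longrightarrow> y \<in> J_Delta F \<longrightarrow> cj x * mu F * (\<sigma> $ Mid $ Mid - \<sigma> $ i $ i) * y \<in> J)
    \<and> (\<forall>i. i \<noteq> Mid \<longrightarrow> Q (\<sigma> *v ax i) \<in> \<Omega> \<and> (\<forall>\<alpha>\<in>Delta F. zeta \<sigma> i \<alpha> \<in> \<Omega>))"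

lemma scalarD:
  assumes "scalar \<sigma>"
  shows "near J \<sigma>"
    "i \<noteq> Mid \<Longrightarrow> x \<in> J_Delta F \<Longrightarrow> y \<in> J_Delta F \<Longrightarrow> cj x * mu F * (\<sigma> $ Mid $ Mid - \<sigma> $ i $ i) * y \<in> J"
    "i \<noteq> Mid \<Longrightarrow> Q (\<sigma> *v ax i) \<in> \<Omega>" "i \<noteq> Mid \<Longrightarrow> \<alpha> \<in> Delta F \<Longrightarrow> zeta \<sigma> i \<alpha> \<in> \<Omega>"
  using assms unfolding scalar_def by blast+

lemma scalar_small:
  fixes \<sigma> :: "('a, 'n::finite) tmat"
  assumes \<sigma>: "scalar \<sigma>" and i: "i \<noteq> Mid" and x: "x \<in> M_Delta F"
  shows "\<sigma> *v x - \<sigma> $ i $ i *s x \<in> small"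
proof -
  define s where "s = \<sigma> $ i $ i"
  have x0: "x $ Mid \<in> J_Delta F" using x by (simp add: M_Delta_iff)
  have e: "(\<sigma> *v x - s *s x) $ k = (\<Sum>j\<in>UNIV. (\<sigma> $ k $ j - (if j = k then s else 0)) * x $ j)" for k
  proof -
    have "s * x $ k = (\<Sum>j\<in>UNIV. (if j = k then s else 0) * x $ j)"
      by (simp add: if_distrib[of "\<lambda>t. t * _"] cong: if_cong)
    then show ?thesis by (simp add: matrix_vector_mult_def left_diff_distrib sum_subtractf)
  qed
  have "(\<sigma> $ k $ j - (if j = k then s else 0)) * x $ j \<in> J" if k: "k \<noteq> Mid" for k j
  proof (cases "j = Mid")
    case True
    then show ?thesis using nearD(3)[OF scalarD(1)[OF \<sigma>] k x0] k by simp
  next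
    case False
    then show ?thesis
      using nearD(1)[OF scalarD(1)[OF \<sigma>] k False] nearD(2)[OF scalarD(1)[OF \<sigma>] False i]
      by (intro J_intros(4)) (auto simp: s_def)
  qed
  then have "(\<sigma> *v x - s *s x) $ k \<in> J" if "k \<noteq> Mid" for k
    unfolding e using that by (intro J_intros(7)) blast
  moreover have "cj y * mu F * (\<sigma> *v x - s *s x) $ Mid \<in> J" if y: "y \<in> J_Delta F" for y
  proof -
    have "cj y * mu F * ((\<sigma> $ Mid $ j - (if j = Mid then s else 0)) * x $ j) \<in> J" for j
    proof (cases "j = Mid")
      case True
      then show ?thesis using scalarD(2)[OF \<sigma> i y x0] by (simp add: s_def mult.assoc)
    next
      case False
      then show ?thesis using J_intros(4)[OF nearD(4)[OF scalarD(1)[OF \<sigma>] False y], of "x $ j"]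
        by (simp add: mult.assoc)
    qed
    then show ?thesis unfolding e sum_distrib_left by (intro J_intros(7)) blast
  qed
  ultimately show ?thesis by (simp add: small_def ideal_tilde_def s_def)
qed

lemma scalar_cross:
  fixes \<sigma> :: "('a, 'n::finite) tmat"
  assumes \<sigma>: "\<sigma> \<in> carrier (U F)" "scalar \<sigma>" and x: "x \<in> M_Delta F" and y: "y \<in> M_Delta F"
  shows "cross (\<sigma> *v y) (\<sigma> *v x) - cross y x \<in> J"
proof -
  obtain i :: "'n theta" where i: "i \<noteq> Mid" by (meson theta.distinct(1))
  define s where "s = \<sigma> $ i $ i"
  have "cross (\<sigma> *v y) (\<sigma> *v x) - cross (s *s y) (s *s x) \<in> J"
    by (rule cross_congr; unfold s_def; rule smallD(1)[OF scalar_small[OF \<sigma>(2) i]]) (use x y in auto)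
  moreover have "cross y x * (s * cj s - 1) \<in> J"
    unfolding s_def by (rule J_intros(3)[OF near_norm_diag[OF J_ideal \<sigma>(1) scalarD(1)[OF \<sigma>(2)] i]])
  ultimately have "cross (\<sigma> *v y) (\<sigma> *v x) - cross (s *s y) (s *s x) + cross y x * (s * cj s - 1) \<in> J"
    by (rule J_intros(2))
  then show ?thesis by (simp add: cross_lin algebra_simps)
qed

text \<open>For \<open>u $ Mid = 0\<close> the multiples of basis vectors satisfy \<open>Q (\<sigma> e) \<in> \<Omega>\<close>, and \<open>eqv_Q_basis\<close> applies. On the
  middle basis vector the condition on \<open>zeta\<close> gives the value of \<open>Q\<close>. The central term on the right-hand side does not depend on
  \<open>\<sigma>\<close>, and this is what makes the formula useful for commutators.\<close>
lemma scalar_Q: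
  fixes \<sigma> :: "('a, 'n::finite) tmat"
  assumes \<sigma>: "\<sigma> \<in> carrier (U F)" "scalar \<sigma>" and i: "i \<noteq> Mid" and u: "(u $ Mid, z) \<in> Delta F"
  shows "Q (\<sigma> *v u) \<doteq> heis_act F (u $ Mid, z) (\<sigma> $ i $ i) \<otimes>\<^bsub>heis F\<^esub> (0, cross u u - z)"
proof -
  define y where "y = u $ Mid"
  define u' where "u' = u - y *s ax Mid"
  define \<alpha> where "\<alpha> = heis_act F (y, z) (\<sigma> $ i $ i)"
  have y: "y \<in> J_Delta F" using u by (auto simp: y_def J_Delta_def)
  have u'0: "u' $ Mid = 0" by (simp add: u'_def y_def)
  have uu: "u = u' + y *s ax Mid" by (simp add: u'_def)
  have M: "u' \<in> M_Delta F" "y *s ax Mid \<in> M_Delta F"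
    using u'0 y J_Delta_zero by (simp_all add: M_Delta_iff)
  have MV: "x \<in> M_Delta F" if "x $ Mid = 0" for x using that J_Delta_zero by (simp add: M_Delta_iff)
  have Mid0: "(\<sigma> *v x) $ Mid \<in> J_Delta F" if "x \<in> M_Delta F" for x
    using U_M_Delta[OF \<sigma>(1) that] by (simp add: M_Delta_iff)
  have 1: "Q (\<sigma> *v u') \<doteq> Q u'"
  proof (rule eqv_Q_basis[OF U_D(1)[OF \<sigma>(1)], where V = "{x. x $ Mid = 0}"])
    show "(\<sigma> *v x) $ Mid \<in> J_Delta F" if "x \<in> {x. x $ Mid = 0}" for x
      using Mid0[OF MV] that by simp
    show "cross (\<sigma> *v y) (\<sigma> *v x) - cross y x \<in> J" if "x \<in> {x. x $ Mid = 0}" "y \<in> {x. x $ Mid = 0}" for x y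
      by (rule scalar_cross[OF \<sigma> MV MV]) (use that in simp_all)
    fix j
    show "u' $ j *s ax j \<in> {x. x $ Mid = 0}" using u'0 by (cases "j = Mid") auto
    show "Q (\<sigma> *v (u' $ j *s ax j)) \<doteq> Q (u' $ j *s ax j)"
    proof (cases "j = Mid")
      case True
      then show ?thesis using u'0 eqv_refl by simp
    next
      case False
      have "heis_act F (Q (\<sigma> *v ax j)) (u' $ j) \<in> \<Omega>" by (rule Om_act[OF scalarD(3)[OF \<sigma>(2) False]])
      then show ?thesis using False by (simp add: matrix_vector_smult Q_smult Q_ax eqv_zero)
    qed
  qed simp_all
  have "zeta \<sigma> i (y, z) \<in> \<Omega>" using scalarD(4)[OF \<sigma>(2) i] u by (simp add: y_def)
  moreover have "zeta \<sigma> i (y, z) = heis_act F (Q (\<sigma> *v ax Mid)) y \<otimes>\<^bsub>heis F\<^esub> inv\<^bsub>heis F\<^esub> (\<alpha> \<otimes>\<^bsub>heis F\<^esub> (0, - z))"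
    unfolding zeta_def \<alpha>_def by (cases "Q (\<sigma> *v ax Mid)") (simp add: algebra_simps)
  ultimately have 2: "Q (\<sigma> *v (y *s ax Mid)) \<doteq> \<alpha> \<otimes>\<^bsub>heis F\<^esub> (0, - z)"
    by (simp only: heis_cong_def matrix_vector_smult Q_smult)
  have c: "cross (\<sigma> *v (y *s ax Mid)) (\<sigma> *v u') \<in> J"
    using scalar_cross[OF \<sigma> M] by (simp add: cross_lin cross_ax_left)
  have "B (\<sigma> *v u') (\<sigma> *v (y *s ax Mid)) = B u' (y *s ax Mid)"
    using U_D(1)[OF \<sigma>(1)] by (simp add: isometry_def)
  also have "\<dots> = 0" by (simp add: B_lin B_ax_right u'0)
  finally have "Q (\<sigma> *v u) = Q (\<sigma> *v u') \<otimes>\<^bsub>heis F\<^esub> Q (\<sigma> *v (y *s ax Mid)) \<otimes>\<^bsub>heis F\<^esub> (0, 0)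
     \<otimes>\<^bsub>heis F\<^esub> tr0 (cross (\<sigma> *v (y *s ax Mid)) (\<sigma> *v u'))"
    by (subst uu) (simp only: matrix_vector_right_distrib Q_add)
  also have "\<dots> \<doteq> Q u' \<otimes>\<^bsub>heis F\<^esub> (\<alpha> \<otimes>\<^bsub>heis F\<^esub> (0, - z)) \<otimes>\<^bsub>heis F\<^esub> (0, 0) \<otimes>\<^bsub>heis F\<^esub> tr0 0"
    by (intro eqv_mult 1 2 eqv_refl eqv_tr0)
      (use c Mid0[OF M(1)] Mid0[OF M(2)] in \<open>simp_all only: fst_heis fst_Q fst_conv J_Delta_add add_0_right diff_zero\<close>)
  also have "\<dots> = \<alpha> \<otimes>\<^bsub>heis F\<^esub> (0, cross u u - z)"
  proof -
    have "cross u u = cross u' u'" unfolding uu by (simp add: cross_lin cross_ax_left cross_ax_right)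
    then show ?thesis by (cases \<alpha>) (simp add: form_Q_eq u'0 tr0_zero)
  qed
  finally show ?thesis by (simp add: \<alpha>_def y_def)
qed

text \<open>For \<open>(y, z) \<in> \<Omega>\<close> the action of a scalar stays in \<open>\<Omega>\<close>, so both sides of the condition are congruent to \<open>(0, - z)\<close>
  by \<open>scalar_Q\<close>.\<close>
lemma scalar_compatible:
  fixes \<sigma> :: "('a, 'n::finite) tmat"
  assumes \<sigma>: "\<sigma> \<in> carrier (U F)" "scalar \<sigma>"
  shows "Om_compatible \<sigma>"
  unfolding Om_compatible_def
proof
  fix \<omega> assume \<omega>: "\<omega> \<in> \<Omega>"
  obtain y z where yz: "\<omega> = (y, z)" by (cases \<omega>)
  obtain i :: "'n theta" where i: "i \<noteq> Mid" by (meson theta.distinct(1))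
  have "((y *s ax Mid :: 'a ^ 'n theta) $ Mid, z) \<in> Delta F" using Om_Delta[OF \<omega>] yz by simp
  from scalar_Q[OF \<sigma> i this]
  have "heis_act F (Q (\<sigma> *v ax Mid)) y \<doteq> heis_act F \<omega> (\<sigma> $ i $ i) \<otimes>\<^bsub>heis F\<^esub> (0, - z)"
    by (simp add: matrix_vector_smult Q_smult yz cross_lin cross_ax_left)
  also have "\<dots> \<doteq> (0, - z)" by (rule eqv_Om_left[OF Om_act[OF \<omega>]])
  also have "(0, - z) \<doteq> \<omega> \<otimes>\<^bsub>heis F\<^esub> (0, - z)" by (rule eqv_sym[OF eqv_Om_left[OF \<omega>]])
  also have "\<dots> = (y, 0)" by (simp add: yz)
  finally show "heis_act F (Q (\<sigma> *v ax Mid)) (fst \<omega>) \<doteq> (fst \<omega>, 0)" by (simp add: yz)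
qed

text \<open>These transvections do not change \<open>Q\<close> on the middle basis vector.\<close>
lemma transv_compatible:
  assumes "v $ (- k) = 0" "k \<noteq> Mid"
  shows "Om_compatible (transv (ax k) v z)"
proof -
  have "C (ax k) (ax Mid) = 0" using assms(2) by simp
  then have "Q (transv (ax k) v z *v ax Mid) = (1, 0)"
    unfolding Q_transv_ax[OF assms] by (simp add: form_Q_eq cross_ax_left cross_ax_right tr0_def)
  then show ?thesis by (simp add: Om_compatible_def eqv_refl)
qed

lemma transv_NU:
  fixes v :: "'a ^ ('n::finite) theta"
  assumes v: "v $ (- k) = 0" "k \<noteq> Mid" "(v $ Mid, cross v v + z) \<in> Delta F"
  shows "transv (ax k) v z \<in> NU F (J, \<Omega>)"
proof -
  note U = transv_ax_in_U[OF v]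
  have "B (ax k) (ax k) = 0" "B (ax k) v = 0" using v by simp_all
  from transv_inverse(1)[OF this, of z]
  have "inv\<^bsub>U F\<^esub> (transv (ax k) v z) ** (transv (ax k) v z ** transv (ax k) (- v) (- z - B v v)) = inv\<^bsub>U F\<^esub> (transv (ax k) v z)"
    by simp
  then have "inv\<^bsub>U F\<^esub> (transv (ax k) v z) = transv (ax k) (- v) (- z - B v v)"
    by (simp add: matrix_mul_assoc U_inv(2)[OF U])
  then show ?thesis
    using compatible_NU[OF U transv_compatible[OF v(1,2)]] transv_compatible[of "- v" k] v by simp
qed

text \<open>It suffices to compare \<open>\<sigma> \<tau> p\<close> and \<open>\<tau> \<sigma> p\<close> for \<open>p\<close> in \<open>M_Delta F\<close>. On hyperbolic coordinates both are congruent to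
  \<open>s *s (\<tau> p)\<close>. For \<open>Q\<close>, apply \<open>scalar_Q\<close> to \<open>\<tau> p\<close>, with the element of \<open>Delta F\<close> over its middle coordinate
  chosen as \<open>\<alpha>'\<close> below, so that the central terms of \<open>\<tau> p\<close> and of \<open>p\<close> coincide; on the other side use
  \<open>Q_transv_ax\<close> for the vector \<open>\<sigma> p\<close>.\<close>
lemma scalar_commutator:
  fixes \<sigma> :: "('a, 'n::finite) tmat"
  assumes \<sigma>: "\<sigma> \<in> carrier (U F)" "scalar \<sigma>"
    and v: "v $ (- k) = 0" "k \<noteq> Mid" "(v $ Mid, cross v v + z) \<in> Delta F"
  shows "\<sigma> \<otimes>\<^bsub>U F\<^esub> transv (ax k) v z \<otimes>\<^bsub>U F\<^esub> inv\<^bsub>U F\<^esub> \<sigma> \<otimes>\<^bsub>U F\<^esub> inv\<^bsub>U F\<^esub> (transv (ax k) v z) \<in> U_cong F (J, \<Omega>)"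
proof -
  define \<tau> where "\<tau> = transv (ax k) v z"
  define s where "s = \<sigma> $ k $ k"
  have \<tau>: "\<tau> \<in> carrier (U F)" unfolding \<tau>_def by (rule transv_ax_in_U[OF v])
  have vM: "v \<in> M_Delta F" using v(3) by (auto simp: M_Delta_iff J_Delta_def)
  note sm = scalar_small[OF \<sigma>(2) v(2), folded s_def]
  note MU = U_M_Delta[OF \<sigma>(1)] U_M_Delta[OF \<tau>]
  have hb: "(\<sigma> *v (\<tau> *v p) - \<tau> *v (\<sigma> *v p)) $ i \<in> J" if p: "p \<in> M_Delta F" and i: "i \<noteq> Mid" for p i
  proof -
    have "(\<sigma> *v (\<tau> *v p) - s *s (\<tau> *v p)) $ i - (\<tau> *v (\<sigma> *v p - s *s p)) $ i \<in> J"
      by (rule J_intros(6)[OF smallD(1)[OF sm[OF MU(2)[OF p]] i] U_small[OF \<tau> sm[OF p] i]])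
    then show ?thesis by (simp add: matrix_vector_mult_diff_distrib matrix_vector_smult)
  qed
  have q: "Q (\<sigma> *v (\<tau> *v p)) \<doteq> Q (\<tau> *v (\<sigma> *v p))" if p: "p \<in> M_Delta F" for p
  proof -
    obtain zp where zp: "(p $ Mid, zp) \<in> Delta F" using p by (auto simp: M_Delta_iff J_Delta_def)
    define \<beta> where "\<beta> = (v $ Mid, cross v v + z)"
    define y where "y = C (ax k) p"
    define y' where "y' = C (ax k) (\<sigma> *v p)"
    define c where "c = B p v * y + cross (\<tau> *v p - p) p"
    define c' where "c' = B (\<sigma> *v p) v * y' + cross (\<tau> *v (\<sigma> *v p) - \<sigma> *v p) (\<sigma> *v p)"
    define \<alpha> where "\<alpha> = (p $ Mid, zp)"
    define d where "d = cross p p - zp"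
    have \<beta>: "\<beta> \<in> Delta F" using v(3) by (simp add: \<beta>_def)
    have y': "y' - y * s \<in> J"
      using J_intros(3)[OF smallD(1)[OF sm[OF p], of "- k"], of "rho k"] v(2)
      by (simp add: y_def y'_def algebra_simps)
    have c': "c' - c * (cj s * s) \<in> J"
    proof -
      have "B (\<sigma> *v p - s *s p) v * y' + (cj s * B p v) * (y' - y * s) \<in> J"
        by (rule J_intros(2)[OF J_intros(4)[OF B_small[OF sm[OF p] vM]] J_intros(3)[OF y']])
      moreover have "cross (\<tau> *v (\<sigma> *v p) - \<sigma> *v p) (\<sigma> *v p) - cross (s *s (\<tau> *v p - p)) (s *s p) \<in> J"
      proof (rule cross_congr)
        fix i :: "'n theta" assume i: "i \<noteq> Mid"
        show "(\<sigma> *v p - s *s p) $ i \<in> J" by (rule smallD(1)[OF sm[OF p] i])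
        have "(\<tau> *v (\<sigma> *v p - s *s p)) $ i - (\<sigma> *v p - s *s p) $ i \<in> J"
          by (rule J_intros(6)[OF U_small[OF \<tau> sm[OF p] i] smallD(1)[OF sm[OF p] i]])
        then show "(\<tau> *v (\<sigma> *v p) - \<sigma> *v p - s *s (\<tau> *v p - p)) $ i \<in> J"
          by (simp add: matrix_vector_mult_diff_distrib matrix_vector_smult algebra_simps)
      qed
      ultimately have "B (\<sigma> *v p - s *s p) v * y' + (cj s * B p v) * (y' - y * s)
        + (cross (\<tau> *v (\<sigma> *v p) - \<sigma> *v p) (\<sigma> *v p) - cross (s *s (\<tau> *v p - p)) (s *s p)) \<in> J"
        by (rule J_intros(2))
      moreover have "c' - c * (cj s * s) = B (\<sigma> *v p - s *s p) v * y' + (cj s * B p v) * (y' - y * s)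
        + (cross (\<tau> *v (\<sigma> *v p) - \<sigma> *v p) (\<sigma> *v p) - cross (s *s (\<tau> *v p - p)) (s *s p))"
        unfolding c_def c'_def by (simp only: cross_lin B_lin) (simp add: algebra_simps)
      ultimately show ?thesis by simp
    qed
    have Q\<tau>: "Q (\<tau> *v p) = Q p \<otimes>\<^bsub>heis F\<^esub> (heis_act F \<beta> y \<otimes>\<^bsub>heis F\<^esub> tr0 c)"
      "Q (\<tau> *v (\<sigma> *v p)) = Q (\<sigma> *v p) \<otimes>\<^bsub>heis F\<^esub> heis_act F \<beta> y' \<otimes>\<^bsub>heis F\<^esub> tr0 c'"
      using Q_transv_ax[OF v(1,2), of z p] Q_transv_ax[OF v(1,2), of z "\<sigma> *v p"]
      by (simp_all only: \<tau>_def \<beta>_def y_def y'_def c_def c'_def heis.m_assoc heis_carrier UNIV_I)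
    \<comment> \<open>the same factor by which \<open>Q (\<tau> *v p)\<close> differs from \<open>Q p\<close>\<close>
    define \<alpha>' where "\<alpha>' = \<alpha> \<otimes>\<^bsub>heis F\<^esub> (heis_act F \<beta> y \<otimes>\<^bsub>heis F\<^esub> tr0 c)"
    have \<alpha>': "\<alpha>' \<in> Delta F" unfolding \<alpha>'_def
      by (intro Delta_mult Delta_act Delta_tr0 \<beta>) (simp add: \<alpha>_def zp)
    obtain f h where X: "heis_act F \<beta> y \<otimes>\<^bsub>heis F\<^esub> tr0 c = (f, h)" by (meson surj_pair)
    have f: "(\<tau> *v p) $ Mid = p $ Mid + f" "cross (\<tau> *v p) (\<tau> *v p) = cross p p + h - cj (p $ Mid) * mu F * f"
      using Q\<tau>(1) unfolding X by (simp_all add: form_Q_eq)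
    have \<alpha>'_eq: "\<alpha>' = ((\<tau> *v p) $ Mid, zp + h - cj (p $ Mid) * mu F * f)"
      unfolding \<alpha>'_def X f \<alpha>_def by simp
    have "Q (\<sigma> *v (\<tau> *v p)) \<doteq> heis_act F \<alpha>' s \<otimes>\<^bsub>heis F\<^esub> (0, d)"
      using scalar_Q[OF \<sigma> v(2) \<alpha>'[unfolded \<alpha>'_eq]] unfolding s_def[symmetric] \<alpha>'_eq[symmetric]
      by (simp add: f(2) d_def)
    also have "\<dots> = (heis_act F \<alpha> s \<otimes>\<^bsub>heis F\<^esub> (0, d)) \<otimes>\<^bsub>heis F\<^esub> heis_act F \<beta> (y * s) \<otimes>\<^bsub>heis F\<^esub> tr0 (c * (cj s * s))"
      unfolding \<alpha>'_def heis_act_mult heis_act_act tr0_act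
      by (cases "heis_act F \<alpha> s"; cases "heis_act F \<beta> (y * s)") (simp add: tr0_def algebra_simps)
    also have "\<dots> \<doteq> Q (\<tau> *v (\<sigma> *v p))"
      unfolding Q\<tau>(2)
    proof (rule eqv_sym, intro eqv_mult)
      show "Q (\<sigma> *v p) \<doteq> heis_act F \<alpha> s \<otimes>\<^bsub>heis F\<^esub> (0, d)"
        using scalar_Q[OF \<sigma> v(2) zp] by (simp only: s_def d_def \<alpha>_def)
      show "heis_act F \<beta> y' \<doteq> heis_act F \<beta> (y * s)" by (rule act_eqv[OF \<beta> y'])
      show "tr0 c' \<doteq> tr0 (c * (cj s * s))" by (rule eqv_tr0[OF c'])
      show 1: "fst (Q (\<sigma> *v p)) \<in> J_Delta F" using MU(1)[OF p] by (simp add: fst_Q M_Delta_iff)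
      show "fst (Q (\<sigma> *v p) \<otimes>\<^bsub>heis F\<^esub> heis_act F \<beta> y') \<in> J_Delta F"
        unfolding fst_heis using vM by (intro J_Delta_add 1 J_Delta_mult) (simp add: \<beta>_def M_Delta_iff)
    qed
    finally show ?thesis .
  qed
  have inv: "inv\<^bsub>U F\<^esub> \<sigma> \<in> carrier (U F)" "inv\<^bsub>U F\<^esub> \<tau> \<in> carrier (U F)" using U_inv(3) \<sigma>(1) \<tau> by blast+
  have "\<sigma> \<otimes>\<^bsub>U F\<^esub> \<tau> \<otimes>\<^bsub>U F\<^esub> inv\<^bsub>U F\<^esub> \<sigma> \<otimes>\<^bsub>U F\<^esub> inv\<^bsub>U F\<^esub> \<tau> \<in> carrier (U F)"
    by (intro monoid.m_closed[OF group.is_monoid[OF U_group]] \<sigma>(1) \<tau> inv)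
  moreover have "(\<forall>i. i \<noteq> Mid \<longrightarrow> ((\<sigma> ** \<tau> ** inv\<^bsub>U F\<^esub> \<sigma> ** inv\<^bsub>U F\<^esub> \<tau>) *v u - u) $ i \<in> J)
      \<and> Q ((\<sigma> ** \<tau> ** inv\<^bsub>U F\<^esub> \<sigma> ** inv\<^bsub>U F\<^esub> \<tau>) *v u) \<doteq> Q u" if u: "u \<in> M_Delta F" for u
  proof -
    define p where "p = inv\<^bsub>U F\<^esub> \<sigma> *v (inv\<^bsub>U F\<^esub> \<tau> *v u)"
    have p: "p \<in> M_Delta F" unfolding p_def by (intro U_M_Delta inv u)
    have "(\<sigma> ** \<tau> ** inv\<^bsub>U F\<^esub> \<sigma> ** inv\<^bsub>U F\<^esub> \<tau>) *v u = \<sigma> *v (\<tau> *v p)" "u = \<tau> *v (\<sigma> *v p)"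
      by (simp_all add: p_def matrix_vector_mul_assoc[symmetric] U_inv_apply[OF \<sigma>(1)] U_inv_apply[OF \<tau>])
    then show ?thesis using hb[OF p] q[OF p] by simp
  qed
  ultimately show ?thesis unfolding \<tau>_def[symmetric] by (simp add: U_cong_iff)
qed

lemma scalar_CU:
  fixes \<sigma> :: "('a, 'n::finite) tmat"
  assumes \<sigma>: "\<sigma> \<in> carrier (U F)" "scalar \<sigma>" "scalar (inv\<^bsub>U F\<^esub> \<sigma>)"
  shows "\<sigma> \<in> CU F (J, \<Omega>)"
proof -
  let ?P = "{\<tau> \<in> normalizer (U F) (U_cong F (J, \<Omega>)).
    \<sigma> \<otimes>\<^bsub>U F\<^esub> \<tau> \<otimes>\<^bsub>U F\<^esub> inv\<^bsub>U F\<^esub> \<sigma> \<otimes>\<^bsub>U F\<^esub> inv\<^bsub>U F\<^esub> \<tau> \<in> U_cong F (J, \<Omega>)} :: ('a, 'n) tmat set"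
  have gen: "transv (ax k) v z \<in> ?P" if "v $ (- k) = 0" "k \<noteq> Mid" "(v $ Mid, cross v v + z) \<in> Delta F" for k v z
    using scalar_commutator[OF \<sigma>(1,2) that] transv_NU[OF that] by (simp add: NU_def)
  have cc: "involution_invariant F UNIV" by (simp add: involution_invariant_def)
  have "EU F (UNIV, Delta F) \<subseteq> ?P"
    unfolding EU_eq[OF ideal_UNIV cc Delta_submodule subset_refl]
  proof (rule group.generate_subgroup_incl[OF U_group _ group.commutator_subgroup[OF U_group U_cong_subgroup \<sigma>(1)]], rule Un_least)
    show "{transv (ax i) (x *s ax j) 0 | i j x. i \<noteq> Mid \<and> j \<noteq> Mid \<and> i \<noteq> j \<and> i \<noteq> - j \<and> x \<in> UNIV} \<subseteq> ?P"
    proof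
      fix t :: "('a, 'n) tmat"
      assume "t \<in> {transv (ax i) (x *s ax j) 0 | i j x. i \<noteq> Mid \<and> j \<noteq> Mid \<and> i \<noteq> j \<and> i \<noteq> - j \<and> x \<in> UNIV}"
      then obtain i j x where t: "t = transv (ax i) (x *s ax j) 0" "i \<noteq> Mid" "j \<noteq> Mid" "i \<noteq> j" "i \<noteq> - j"
        by blast
      then have "(x *s ax j) $ (- i) = 0" "((x *s ax j) $ Mid, cross (x *s ax j) (x *s ax j) + 0) \<in> Delta F"
        using Q_ax[of j] Delta_zero by (auto simp: cross_lin form_Q_eq)
      then show "t \<in> ?P" unfolding t(1) by (intro gen t(2))
    qed
    show "{transv (ax i) (x *s ax Mid) z | i x z. i \<noteq> Mid \<and> (x, z) \<in> Delta F} \<subseteq> ?P"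
    proof
      fix t :: "('a, 'n) tmat"
      assume "t \<in> {transv (ax i) (x *s ax Mid) z | i x z. i \<noteq> Mid \<and> (x, z) \<in> Delta F}"
      then obtain i x z where t: "t = transv (ax i) (x *s ax Mid) z" "i \<noteq> Mid" "(x, z) \<in> Delta F"
        by blast
      show "t \<in> ?P" unfolding t(1) by (rule gen[OF _ t(2)]) (use t(2,3) in \<open>simp_all add: cross_lin cross_ax_left\<close>)
    qed
  qed
  moreover have "\<sigma> \<in> NU F (J, \<Omega>)"
    by (rule compatible_NU[OF \<sigma>(1) scalar_compatible[OF \<sigma>(1,2)] scalar_compatible[OF U_inv(3)[OF \<sigma>(1)] \<sigma>(3)]])
  ultimately show ?thesis unfolding CU_def by blast
qed

end

section \<open>The sandwich theorem\<close>

theorem (in hermitian_form_ring) subset_CU_upper_level: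
  assumes H: "subgroup H (U F :: ('a, 'n::finite) tmat monoid)"
  shows "H \<subseteq> CU F (upper_level F H)"
proof
  fix \<sigma> assume \<sigma>: "\<sigma> \<in> H"
  obtain J \<Omega> where JO: "upper_level F H = (J, \<Omega>)" by (meson surj_pair)
  interpret form_ideal F J \<Omega>
    by standard (use upper_level_odd_form_ideal[OF subgroup.subset[OF H]] JO in simp)
  have "J = ideal_generated (level_Y F H \<union> cj ` level_Y F H)" using JO by (simp add: upper_level_def Let_def)
  then have Y: "level_Y F H \<subseteq> J" using ideal_generated_base by blast
  have Z: "level_Z F H \<subseteq> \<Omega>" using level_Z_upper_level[of H] by (simp add: JO)
  have sc: "scalar \<tau>" if "\<tau> \<in> H" for \<tau>
    using near_level[OF J_ideal Y that] Z that unfolding scalar_def level_Z_eq by blast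
  show "\<sigma> \<in> CU F (upper_level F H)"
    unfolding JO using \<sigma> subgroup.subset[OF H] subgroup.m_inv_closed[OF H \<sigma>]
    by (intro scalar_CU sc) auto
qed

theorem theorem41:
  fixes F :: "'a::comm_ring_1 form_ring"
    and I :: "'a set" and \<Omega> :: "('a \<times> 'a) set"
    and H :: "('a, 3) tmat set"
  assumes "hermitian_form_ring F"
    and "odd_form_ideal F (I, \<Omega>)"
    and "subgroup H (U F)"
    and "EU F (I, \<Omega>) \<subseteq> normalizer (U F) H"
  shows "EU F (form_ideal_prod F (upper_level F H) (ideal_pow I 12)) \<subseteq> H
    \<and> H \<subseteq> CU F (upper_level F H)"
proof -
  interpret hermitian_form_ring F by (rule assms(1))
  interpret O: form_ideal F I \<Omega> by standard (rule assms(2))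
  have D: "\<Omega> \<subseteq> Delta F" using O.Om_Delta by blast
  \<comment> \<open>the elementary group of level \<open>(I, \<Omega>)\<close> contains that of the smallest level over \<open>I\<close>\<close>
  have E: "EU F (I, Omega_min F I) \<subseteq> (EU F (I, \<Omega>) :: ('a, 3) tmat set)"
    unfolding EU_eq[OF O.J_ideal O.J_cj Omega_min_submodule[OF O.J_ideal] Omega_min_Delta]
      EU_eq[OF O.J_ideal O.J_cj O.Om_submodule D]
    by (rule group.mono_generate[OF U_group]) (use O.Omega_min_Om in blast)
  interpret subnormal F I H
    by (rule subnormal.intro[OF assms(1)], rule subnormal_axioms.intro)
      (use assms(3,4) O.J_ideal O.J_cj E in auto)
  show ?thesis using EU_prod_subset subset_CU_upper_level[OF assms(3)] by blast
qed

end
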